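(* Let $r\in\mathbb{N}$ and $1\le p\le\infty$. There exists a constant $C>0$ such that for every $n\in\mathbb{N}$ and $f\in L^p(\Omega)$, $$\omega_\Omega^r(f,n^{-1})_p\le\frac{C}{n^r}\sum_{j=0}^n(j+1)^{r-1}E_j(f)_{L^p(\Omega)},$$ where $C$ is independent of $f$ and $n$.
   Context: Let $d\ge1$ be an integer; $\|\cdot\|$ is the Euclidean norm, $e_1,\dots,e_{d+1}$ the standard basis of $\mathbb{R}^{d+1}$, $\mathrm{dist}(\xi,E)=\inf_{\eta\in E}\|\xi-\eta\|$; points of $\mathbb{R}^{d+1}$ are written $(x,y)$ with $x\in\mathbb{R}^d$, $y\in\mathbb{R}$. **$C^2$-domain.** A bounded domain $\Omega_0\subset\mathbb{R}^{d+1}$ is $C^2$ if there exist $\delta>0$, $M>0$ and a finite cover of its boundary $\Gamma$ by connected open sets $U_1,\dots,U_J$ such that (i) for every $x\in\Omega_0$ with $\mathrm{dist}(x,\Gamma)<\delta$ there is $j$ with $x\in U_j$ and $\mathrm{dist}(x,\partial U_j)>\delta$; (ii) for each $j$ there is a Cartesian coordinate system $(\xi_{j,1},\dots,\xi_{j,d+1})$ in $U_j$ in which $\Omega_0\cap U_j$ is represented by $\xi_{j,d+1}\le f_j(\xi_{j,1},\dots,\xi_{j,d})$ with $f_j:\mathbb{R}^d\to\mathbb{R}$ of class $C^2$ and $\max_{i,k}\|\partial_i\partial_kf_j\|_\infty\le M$. Throughout, $\Omega$ is a fixed closure of an open, connected, bounded $C^2$-domain in $\mathbb{R}^{d+1}$,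 with boundary $\Gamma=\partial\Omega$. **Function spaces.** $L^p(\Omega)$, $0<p<\infty$, is with respect to Lebesgue measure; $L^\infty(\Omega)$ means $C(\Omega)$ with the uniform norm. $\Pi_n^{d+1}$ is the space of real polynomials on $\mathbb{R}^{d+1}$ of total degree $\le n$, and $E_n(f)_{L^p(\Omega)}=\inf\{\|f-Q\|_{L^p(\Omega)}:Q\in\Pi_n^{d+1}\}$. **Differences.** $\triangle_\xi^rf(\eta)=\sum_{j=0}^r(-1)^{r+j}\binom rjf(\eta+j\xi)$; $\triangle_\xi^r(f,\Omega,\eta)=\triangle_\xi^rf(\eta)$ if the segment $[\eta,\eta+r\xi]\subset\Omega$, and $0$ otherwise; $\widetilde\triangle_\xi^r(f,\Omega,\eta)=\triangle_\xi^r(f,\Omega,\eta-\frac r2\xi)$. **Domains of special type.** $G\subset\mathbb{R}^{d+1}$ is an upward $x_{d+1}$-domain with base size $b>0$ and parameter $L\ge1$ if $G=\xi+\{(x,y):x\in(-b,b)^d,\ g(x)-Lb<y\le g(x)\}$ with $\xi\in\mathbb{R}^{d+1}$, $g\in C^2(\mathbb{R}^d)$. For $\lambda\in(0,2]$ put $G(\lambda)=\xi+\{(x,y):x\in(-\lambda b,\lambda b)^d,\ g(x)-\lambda Lb<y\le g(x)\}$, $\partial'G(\lambda)=\xi+\{(x,g(x)):x\in(-\lambda b,\lambda b)^d\}$, $\partial'G=\partial'G(1)$, $\partial'G^*=\partial'G(2)$ and $G^*=\xi+\{(x,y):x\in(-2b,2b)^d,\ \min_{u\in[-2b,2b]^d}g(u)-4Lb<y\le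 g(x)\}$. It is always assumed that $L\ge4\sqrt d\max_{x\in[-2b,2b]^d}\|\nabla g(x)\|+1$. Upward $x_j$-domains ($1\le j\le d$) and their associated sets are the images of upward $x_{d+1}$-domains and their associated sets under the map $\sigma_j$ swapping the $j$-th and $(d+1)$-st coordinates; downward $x_j$-domains ($1\le j\le d+1$) and their associated sets are the images of those of upward $x_j$-domains under the map $\tau_j$ changing the sign of the $j$-th coordinate. All of these are called domains of special type. A domain of special type $G\subset\Omega$ is attached to $\Gamma$ if $\overline{G^*}\cap\Gamma=\overline{\partial'G^*}$ and $G^*=Q\cap\Omega$ for some open rectangular box $Q$ (sides parallel to the axes). There is a finite cover of $\Gamma$ by domains of special type $G_1,\dots,G_{m_0}\subset\Omega$ attached to $\Gamma$; such a cover is fixed. **Modulus of smoothness.** Let $\varphi_\Omega(e,\xi)=\max\{\sqrt{l_1l_2}:l_1,l_2\ge0,\ [\xi-l_1e,\xi+l_2e]\subset\Omega\}$ and $$\omega_{\Omega,\varphi}^r(f,t;e)_p=\sup_{|h|\le\min\{t,1\}}\big\|\widetilde\triangle^r_{h\varphi_\Omega(e,\cdot)e}(f,\Omega,\cdot)\big\|_{L^p(\Omega)},\qquad \omega_{\Omega,\varphi}^r(f,t)_p=\max_{1\le j\le d+1}\omega_{\Omega,\varphi}^r(f,t;e_j)_p .$$ Fix a parameter $A_0>1$. For an upward $x_{d+1}$-domain $G=\{(x,y):x\in(-b,b)^d,\ g(x)-Lb<y\le g(x)\}\subset\Omega$ with base size $b>0$, parameter $L\ge1$ and $g\in C^2(\mathbb{R}^d)$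 (that is, with $\xi=0$), let $\xi_j(u)=e_j+\partial_jg(u)e_{d+1}$, $1\le j\le d$, $G^t=\{\xi\in G:\mathrm{dist}(\xi,\partial'G)\ge A_0t^2\}$, $I_x(tb)=\{u\in(-b,b)^d:\|u-x\|\le tb\}$, and for $0<t\le1$ $$\widetilde\omega_G^r(f,t)_p=\sup_{0<s\le t,\ 1\le j\le d}\Big(\int_{G^t}\Big[\frac1{(tb)^d}\int_{I_x(tb)}|\triangle^r_{s\xi_j(u)}(f,\Omega,(x,y))|^p\,du\Big]dx\,dy\Big)^{1/p}$$ (with the $L^\infty$-norm replacing the $L^p$-norm if $p=\infty$); $\widetilde\omega_G^r(f,t)_p=\widetilde\omega_G^r(f,1)_p$ for $t>1$. For a general domain of special type $G\subset\Omega$, $\widetilde\omega^r_G(f,t)_p=\widetilde\omega^r_{T(G)}(f\circ T^{-1},t)_p$ (with $T(\Omega)$ in place of $\Omega$), where $T$ is a composition of a translation and reflections $\sigma_j,\tau_j$ taking $G$ to an upward $x_{d+1}$-domain with $\xi=0$. Finally $$\omega^r_\Omega(f,t)_p=\omega^r_{\Omega,\varphi}(f,t)_p+\sum_{j=1}^{m_0}\widetilde\omega^r_{G_j}(f,t)_p .$$ *)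

theory Defs
  imports "HOL-Analysis.Analysis"
begin

section \<open>Points, coordinates and smooth functions\<close>

text \<open>The space of dimension d + 1 is real^'d \<times> real with d = CARD('d); its norm is the Euclidean one
  and its Basis consists of the d + 1 standard unit vectors. Coordinates are indexed by 'd option,
  where None stands for the last coordinate.\<close>

type_synonym 'd point = "(real^'d) \<times> real"

definition partial_deriv :: "'d::finite \<Rightarrow> (real^'d \<Rightarrow> real) \<Rightarrow> real^'d \<Rightarrow> real" where
  "partial_deriv i g x = frechet_derivative g (at x) (axis i 1)"

definition grad :: "(real^'d::finite \<Rightarrow> real) \<Rightarrow> real^'d \<Rightarrow> real^'d" where
  "grad g x = (\<chi> i. partial_deriv i g x)"

definition C1_fun :: "(real^'d::finite \<Rightarrow> real) \<Rightarrow> bool" where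
  "C1_fun g \<longleftrightarrow> (\<forall>x. g differentiable (at x)) \<and> (\<forall>i. continuous_on UNIV (partial_deriv i g))"

definition C2_fun :: "(real^'d::finite \<Rightarrow> real) \<Rightarrow> bool" where
  "C2_fun g \<longleftrightarrow> C1_fun g \<and> (\<forall>i. C1_fun (partial_deriv i g))"

section \<open>Domains with twice continuously differentiable boundary\<close>

text \<open>The map z \<mapsto> R (z - a) gives the Cartesian coordinates attached to U. For an open set
  \<Omega>0 the inequality describing \<Omega>0 inside U has to be strict: with a non-strict one, \<Omega>0 \<inter> U would be
  both open and closed in the connected set U, and U would not meet the boundary of \<Omega>0. The
  non-strict inequality then describes closure \<Omega>0 inside U.\<close>

definition C2_domain :: "('d::finite) point set \<Rightarrow> bool" where
  "C2_domain \<Omega>0 \<longleftrightarrow>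
     open \<Omega>0 \<and> connected \<Omega>0 \<and> bounded \<Omega>0 \<and> \<Omega>0 \<noteq> {} \<and>
     (\<exists>\<delta>>0. \<exists>M>0. \<exists>\<U>.
        finite \<U> \<and> (\<forall>U\<in>\<U>. open U \<and> connected U) \<and> frontier \<Omega>0 \<subseteq> \<Union>\<U> \<and>
        (\<forall>z\<in>\<Omega>0. infdist z (frontier \<Omega>0) < \<delta> \<longrightarrow>
            (\<exists>U\<in>\<U>. z \<in> U \<and> infdist z (frontier U) > \<delta>)) \<and>
        (\<forall>U\<in>\<U>. \<exists>(R :: 'd point \<Rightarrow> 'd point) a f.
            orthogonal_transformation R \<and> C2_fun f \<and>
            (\<forall>i k x. \<bar>partial_deriv i (partial_deriv k f) x\<bar> \<le> M) \<and>
            \<Omega>0 \<inter> U = {z \<in> U. snd (R (z - a)) < f (fst (R (z - a)))}))"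

section \<open>Function spaces and best polynomial approximation\<close>

definition ennreal_powr :: "ennreal \<Rightarrow> real \<Rightarrow> ennreal" where
  "ennreal_powr x a = (if x = \<infinity> then \<infinity> else ennreal (enn2real x powr a))"

text \<open>For p = \<infinity> the norm is the uniform norm and the space consists of the continuous functions.\<close>

definition Lp_norm :: "ennreal \<Rightarrow> 'a::euclidean_space set \<Rightarrow> ('a \<Rightarrow> real) \<Rightarrow> ennreal" where
  "Lp_norm p A f =
     (if p = \<infinity> then (SUP z\<in>A. ennreal \<bar>f z\<bar>)
      else ennreal_powr (\<integral>\<^sup>+z\<in>A. ennreal (\<bar>f z\<bar> powr enn2real p) \<partial>lebesgue) (1 / enn2real p))"

definition Lp_space :: "ennreal \<Rightarrow> 'a::euclidean_space set \<Rightarrow> ('a \<Rightarrow> real) set" where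
  "Lp_space p A =
     (if p = \<infinity> then {f. continuous_on A f}
      else {f. f \<in> borel_measurable (lebesgue_on A) \<and> Lp_norm p A f < \<infinity>})"

definition exponents :: "nat \<Rightarrow> (('d::finite \<Rightarrow> nat) \<times> nat) set" where
  "exponents n = {(k, m). (\<Sum>i\<in>UNIV. k i) + m \<le> n}"

lemma finite_exponents: "finite (exponents n :: (('d::finite \<Rightarrow> nat) \<times> nat) set)"
proof -
  have le: "k i \<le> n" if "(\<Sum>i\<in>UNIV. k i) + m \<le> n" for k :: "'d \<Rightarrow> nat" and m i
    using member_le_sum[of i UNIV k] that by simp
  have "finite (PiE (UNIV :: 'd set) (\<lambda>_. {..n}))"
    by (intro finite_PiE) auto
  moreover have "(exponents n :: (('d \<Rightarrow> nat) \<times> nat) set) \<subseteq> PiE UNIV (\<lambda>_. {..n}) \<times> {..n}"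
    using le by (fastforce simp: exponents_def PiE_def Pi_def)
  ultimately show ?thesis
    by (meson finite_SigmaI finite_atMost finite_subset)
qed

definition poly_space :: "nat \<Rightarrow> (('d::finite) point \<Rightarrow> real) set" where
  "poly_space n =
     {Q. \<exists>c. \<forall>x y. Q (x, y) = (\<Sum>(k, m)\<in>exponents n. c k m * (\<Prod>i\<in>UNIV. (x $ i) ^ k i) * y ^ m)}"

definition best_approx ::
    "ennreal \<Rightarrow> ('d::finite) point set \<Rightarrow> nat \<Rightarrow> ('d point \<Rightarrow> real) \<Rightarrow> ennreal" where
  "best_approx p \<Omega> n f = (INF Q\<in>poly_space n. Lp_norm p \<Omega> (\<lambda>z. f z - Q z))"

section \<open>Finite differences\<close>

definition fdiff :: "nat \<Rightarrow> 'a::real_vector \<Rightarrow> ('a \<Rightarrow> real) \<Rightarrow> 'a \<Rightarrow> real" where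
  "fdiff r \<xi> f \<eta> = (\<Sum>j\<le>r. (-1) ^ (r + j) * real (r choose j) * f (\<eta> + real j *\<^sub>R \<xi>))"

definition diff_on :: "nat \<Rightarrow> 'a::real_vector \<Rightarrow> ('a \<Rightarrow> real) \<Rightarrow> 'a set \<Rightarrow> 'a \<Rightarrow> real" where
  "diff_on r \<xi> f \<Omega> \<eta> = (if closed_segment \<eta> (\<eta> + real r *\<^sub>R \<xi>) \<subseteq> \<Omega> then fdiff r \<xi> f \<eta> else 0)"

definition central_diff_on :: "nat \<Rightarrow> 'a::real_vector \<Rightarrow> ('a \<Rightarrow> real) \<Rightarrow> 'a set \<Rightarrow> 'a \<Rightarrow> real" where
  "central_diff_on r \<xi> f \<Omega> \<eta> = diff_on r \<xi> f \<Omega> (\<eta> - (real r / 2) *\<^sub>R \<xi>)"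

section \<open>Domains of special type\<close>

definition cube :: "real \<Rightarrow> (real^'d::finite) set" where
  "cube b = {x. \<forall>i. -b < x $ i \<and> x $ i < b}"

definition closed_cube :: "real \<Rightarrow> (real^'d::finite) set" where
  "closed_cube b = {x. \<forall>i. -b \<le> x $ i \<and> x $ i \<le> b}"

text \<open>A record of the following type holds the data (b, L, g) of an upward domain in the last
  coordinate with \<xi> = 0.\<close>

record ('d::finite) updom =
  base :: real
  param :: real
  graph :: "real^'d \<Rightarrow> real"

definition updom_ok :: "('d::finite) updom \<Rightarrow> bool" where
  "updom_ok H \<longleftrightarrow> base H > 0 \<and> param H \<ge> 1 \<and> C2_fun (graph H) \<and>
     param H \<ge> 4 * sqrt (real CARD('d)) * (SUP x\<in>closed_cube (2 * base H). norm (grad (graph H) x)) + 1"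

definition up_set :: "('d::finite) updom \<Rightarrow> 'd point set" where
  "up_set H = {(x, y). x \<in> cube (base H) \<and> graph H x - param H * base H < y \<and> y \<le> graph H x}"

text \<open>This is \<partial>'G(c), where c scales the base of the domain.\<close>

definition up_bdry :: "real \<Rightarrow> ('d::finite) updom \<Rightarrow> 'd point set" where
  "up_bdry c H = {(x, y). x \<in> cube (c * base H) \<and> y = graph H x}"

definition up_star :: "('d::finite) updom \<Rightarrow> 'd point set" where
  "up_star H = {(x, y). x \<in> cube (2 * base H) \<and>
     (INF u\<in>closed_cube (2 * base H). graph H u) - 4 * param H * base H < y \<and> y \<le> graph H x}"

fun swap_coord :: "'d option \<Rightarrow> ('d::finite) point \<Rightarrow> 'd point" where
  "swap_coord None z = z"
| "swap_coord (Some j) (x, y) = ((\<chi> i. if i = j then y else x $ i), x $ j)"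

fun neg_coord :: "'d option \<Rightarrow> ('d::finite) point \<Rightarrow> 'd point" where
  "neg_coord None (x, y) = (x, - y)"
| "neg_coord (Some j) (x, y) = ((\<chi> i. if i = j then - (x $ i) else x $ i), y)"

text \<open>A domain of special type is kept together with its data: the coordinate direction, whether it is
  a downward domain, the translation vector \<xi> and the data (b, L, g). The associated sets depend on
  g also outside the base of the domain, so the point set alone does not determine them.\<close>

record ('d::finite) special_domain =
  direction :: "'d option"
  downward :: bool
  offset :: "'d point"
  shape :: "'d updom"

definition place :: "('d::finite) special_domain \<Rightarrow> 'd point \<Rightarrow> 'd point" where
  "place G z = (let w = swap_coord (direction G) (offset G + z)
                in if downward G then neg_coord (direction G) w else w)"

definition sd_set :: "('d::finite) special_domain \<Rightarrow> 'd point set" where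
  "sd_set G = place G ` up_set (shape G)"

definition sd_bdry_star :: "('d::finite) special_domain \<Rightarrow> 'd point set" where
  "sd_bdry_star G = place G ` up_bdry 2 (shape G)"

definition sd_star :: "('d::finite) special_domain \<Rightarrow> 'd point set" where
  "sd_star G = place G ` up_star (shape G)"

definition attached :: "('d::finite) point set \<Rightarrow> 'd special_domain \<Rightarrow> bool" where
  "attached \<Omega> G \<longleftrightarrow>
     sd_set G \<subseteq> \<Omega> \<and>
     closure (sd_star G) \<inter> frontier \<Omega> = closure (sd_bdry_star G) \<and>
     (\<exists>a c. sd_star G = box a c \<inter> \<Omega>)"

inductive_set coord_maps :: "(('d::finite) point \<Rightarrow> 'd point) set" where
  translation: "(\<lambda>z. a + z) \<in> coord_maps"
| swap: "swap_coord j \<in> coord_maps"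
| neg: "neg_coord j \<in> coord_maps"
| comp: "S \<in> coord_maps \<Longrightarrow> T \<in> coord_maps \<Longrightarrow> S \<circ> T \<in> coord_maps"

definition normalizes ::
    "(('d::finite) point \<Rightarrow> 'd point) \<Rightarrow> 'd special_domain \<Rightarrow> 'd updom \<Rightarrow> bool" where
  "normalizes T G H \<longleftrightarrow> T \<in> coord_maps \<and> updom_ok H \<and> T ` sd_set G = up_set H"

section \<open>Moduli of smoothness\<close>

text \<open>The supremum is attained for \<xi> in a compact \<Omega>.\<close>

definition phi :: "('d::finite) point set \<Rightarrow> 'd point \<Rightarrow> 'd point \<Rightarrow> real" where
  "phi \<Omega> e \<xi> = Sup {sqrt (l1 * l2) | l1 l2.
     0 \<le> l1 \<and> 0 \<le> l2 \<and> closed_segment (\<xi> - l1 *\<^sub>R e) (\<xi> + l2 *\<^sub>R e) \<subseteq> \<Omega>}"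

definition omega_phi_dir :: "ennreal \<Rightarrow> ('d::finite) point set \<Rightarrow> nat \<Rightarrow>
    ('d point \<Rightarrow> real) \<Rightarrow> real \<Rightarrow> 'd point \<Rightarrow> ennreal" where
  "omega_phi_dir p \<Omega> r f t e =
     (SUP h\<in>{h. \<bar>h\<bar> \<le> min t 1}.
        Lp_norm p \<Omega> (\<lambda>z. central_diff_on r ((h * phi \<Omega> e z) *\<^sub>R e) f \<Omega> z))"

definition omega_phi :: "ennreal \<Rightarrow> ('d::finite) point set \<Rightarrow> nat \<Rightarrow>
    ('d point \<Rightarrow> real) \<Rightarrow> real \<Rightarrow> ennreal" where
  "omega_phi p \<Omega> r f t = Max (omega_phi_dir p \<Omega> r f t ` Basis)"

definition tangent :: "('d::finite) updom \<Rightarrow> 'd \<Rightarrow> real^'d \<Rightarrow> 'd point" where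
  "tangent H j u = (axis j 1, partial_deriv j (graph H) u)"

definition up_inner :: "real \<Rightarrow> ('d::finite) updom \<Rightarrow> real \<Rightarrow> 'd point set" where
  "up_inner A0 H t = {z \<in> up_set H. infdist z (up_bdry 1 H) \<ge> A0 * t\<^sup>2}"

definition up_window :: "('d::finite) updom \<Rightarrow> real \<Rightarrow> real^'d \<Rightarrow> (real^'d) set" where
  "up_window H t x = {u \<in> cube (base H). norm (u - x) \<le> t * base H}"

text \<open>The averaged norm of tangential differences with step s; it is the L^p norm in the
  variables (x, y, u), and the uniform norm if p = \<infinity>.\<close>

definition tang_norm :: "real \<Rightarrow> ennreal \<Rightarrow> ('d::finite) point set \<Rightarrow> 'd updom \<Rightarrow> nat \<Rightarrow>
    ('d point \<Rightarrow> real) \<Rightarrow> real \<Rightarrow> real \<Rightarrow> 'd \<Rightarrow> ennreal" where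
  "tang_norm A0 p \<Omega> H r f t s j =
     (if p = \<infinity> then
        (SUP z\<in>up_inner A0 H t. SUP u\<in>up_window H t (fst z).
           ennreal \<bar>diff_on r (s *\<^sub>R tangent H j u) f \<Omega> z\<bar>)
      else
        ennreal_powr
          (\<integral>\<^sup>+z\<in>up_inner A0 H t.
             ennreal (1 / (t * base H) ^ CARD('d)) *
             (\<integral>\<^sup>+u\<in>up_window H t (fst z).
                ennreal (\<bar>diff_on r (s *\<^sub>R tangent H j u) f \<Omega> z\<bar> powr enn2real p) \<partial>lebesgue)
           \<partial>lebesgue)
          (1 / enn2real p))"

definition omega_up :: "real \<Rightarrow> ennreal \<Rightarrow> ('d::finite) point set \<Rightarrow> 'd updom \<Rightarrow> nat \<Rightarrow>
    ('d point \<Rightarrow> real) \<Rightarrow> real \<Rightarrow> ennreal" where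
  "omega_up A0 p \<Omega> H r f t =
     (SUP (s, j)\<in>{0<..min t 1} \<times> UNIV. tang_norm A0 p \<Omega> H r f (min t 1) s j)"

text \<open>The modulus of a domain of special type that T takes to the upward domain with data H.\<close>

definition omega_special :: "real \<Rightarrow> ennreal \<Rightarrow> ('d::finite) point set \<Rightarrow>
    ('d point \<Rightarrow> 'd point) \<Rightarrow> 'd updom \<Rightarrow> nat \<Rightarrow> ('d point \<Rightarrow> real) \<Rightarrow> real \<Rightarrow> ennreal" where
  "omega_special A0 p \<Omega> T H r f t = omega_up A0 p (T ` \<Omega>) H r (f \<circ> inv T) t"

definition omega :: "real \<Rightarrow> ennreal \<Rightarrow> ('d::finite) point set \<Rightarrow> nat \<Rightarrow>
    (nat \<Rightarrow> 'd point \<Rightarrow> 'd point) \<Rightarrow> (nat \<Rightarrow> 'd updom) \<Rightarrow>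
    nat \<Rightarrow> ('d point \<Rightarrow> real) \<Rightarrow> real \<Rightarrow> ennreal" where
  "omega A0 p \<Omega> m0 T H r f t =
     omega_phi p \<Omega> r f t + (\<Sum>i<m0. omega_special A0 p \<Omega> (T i) (H i) r f t)"

end

theory Submission
  imports Defs "HOL-Complex_Analysis.Cauchy_Integral_Formula"
begin

text \<open>The value of a polynomial of degree k at a complex point of modulus at most A/k is bounded by a
weighted sum of its absolute values at O(k) real nodes of [-1, 1], the weights decaying with the
distance of the node from 0. An r-th difference is estimated through Cauchy's formula by values at
such complex points, after composing the polynomial with a quadratic curve that stays in \<open>\<Omega>\<close> for
real parameters: along a line, v \<open>\<mapsto>\<close> t + l (\<open>\<beta>\<close> v + v^2) / 4, pointing from t into the component of length
l that contains t; for the tangential differences, (s, v) \<open>\<mapsto>\<close> z + s \<open>\<xi>\<close> - M (s^2 + v^2) e, a paraboloid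
hanging below the boundary, which passes through z + s \<open>\<xi>\<close> at the complex point v = i s.
Integrating over t, or over z and u, turns the nodes into translations, so that the bounds hold in L^p.
This gives the Bernstein inequality: the difference of step 1/n of a polynomial Q of degree k \<open>\<le>\<close> n is
at most C (k/n)^r times the norm of Q. The theorem follows by telescoping f over near-best
approximants of dyadic degrees.\<close>

section \<open>Point evaluation of polynomials by node values\<close>

text \<open>The step of a difference shrinks near the boundary: at relative depth \<delta> the disc
  for Cauchy's estimate has radius of order l sqrt \<delta> / k. A curve with linear coefficient of
  order sqrt \<delta> pulls it back to |v| \<le> const / k, where the node bound is available, and
  the square term keeps the real curve inside. If this coefficient varied continuously with the
  point, every node would give a nonlinear change of variables in L^p; frozen on dyadic blocks it
  gives translations, at the price of an overlap that grows linearly in k |v|. Hence the cubic decay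
  of the node weights: one power pays for the overlap, two make the sum converge. Tangential
  differences use the slope at a nearby u and not at the point itself, an error of order s t; the
  distance A0 t^2 from the graph required in \<open>up_inner\<close> absorbs it after completing a
  square. Finally, the normalising maps and the data \<open>H\<close> are tied to the domain only by
  an equality of two sets, so the vertical direction has to be recovered from the shape of these
  sets before the larger set \<open>sd_star\<close>, which attachment puts into \<Omega>, can be
  used.\<close>

definition trig_poly :: "nat \<Rightarrow> (complex \<Rightarrow> complex) \<Rightarrow> bool" where
  "trig_poly L S \<longleftrightarrow>
     (\<exists>P. degree P \<le> 2 * L \<and> (\<forall>x. S x = exp (- (\<i> * of_nat L * x)) * poly P (exp (\<i> * x))))"

text \<open>Pulling out \<open>exp (- \<i> L x)\<close> moves the frequencies -L, ..., L to the
  exponents 0, ..., 2 L, so that degree bounds become those of ordinary polynomials; here the two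
  prefactors combine to the one for L + K.\<close>

lemma trig_poly_mult:
  assumes "trig_poly L S" "trig_poly K R"
  shows "trig_poly (L + K) (\<lambda>x. S x * R x)"
proof -
  obtain P where P: "degree P \<le> 2 * L" "\<And>x. S x = exp (- (\<i> * of_nat L * x)) * poly P (exp (\<i> * x))"
    using assms(1) unfolding trig_poly_def by blast
  obtain Q where Q: "degree Q \<le> 2 * K" "\<And>x. R x = exp (- (\<i> * of_nat K * x)) * poly Q (exp (\<i> * x))"
    using assms(2) unfolding trig_poly_def by blast
  have "degree (P * Q) \<le> 2 * (L + K)"
    using order_trans[OF degree_mult_le[of P Q] add_mono[OF P(1) Q(1)]] by (simp add: algebra_simps)
  moreover have "S x * R x = exp (- (\<i> * of_nat (L + K) * x)) * poly (P * Q) (exp (\<i> * x))" for x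
    unfolding P(2) Q(2) by (simp add: exp_add[symmetric] algebra_simps)
  ultimately show ?thesis unfolding trig_poly_def by blast
qed

lemma trig_poly_add:
  assumes "trig_poly L S" "trig_poly L R"
  shows "trig_poly L (\<lambda>x. S x + R x)"
proof -
  obtain P where P: "degree P \<le> 2 * L" "\<And>x. S x = exp (- (\<i> * of_nat L * x)) * poly P (exp (\<i> * x))"
    using assms(1) unfolding trig_poly_def by blast
  obtain Q where Q: "degree Q \<le> 2 * L" "\<And>x. R x = exp (- (\<i> * of_nat L * x)) * poly Q (exp (\<i> * x))"
    using assms(2) unfolding trig_poly_def by blast
  have "degree (P + Q) \<le> 2 * L"
    using P(1) Q(1) by (simp add: degree_add_le)
  moreover have "S x + R x = exp (- (\<i> * of_nat L * x)) * poly (P + Q) (exp (\<i> * x))" for x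
    unfolding P(2) Q(2) by (simp add: algebra_simps)
  ultimately show ?thesis unfolding trig_poly_def by blast
qed

text \<open>The constant sits at the middle exponent L, which the prefactor moves to frequency 0.
  Having it at every degree is what allows sums with a fixed L.\<close>

lemma trig_poly_const: "trig_poly L (\<lambda>x. c)"
proof -
  have "degree (monom c L) \<le> 2 * L"
    using degree_monom_le[of c L] by linarith
  moreover have "c = exp (- (\<i> * of_nat L * x)) * poly (monom c L) (exp (\<i> * x))" for x
    by (simp add: poly_monom exp_of_nat_mult[symmetric] exp_minus field_simps)
  ultimately show ?thesis unfolding trig_poly_def by blast
qed

lemma trig_poly_sin: "trig_poly 1 sin"
proof -
  define P :: "complex poly" where "P = [: - 1 / (2 * \<i>), 0, 1 / (2 * \<i>) :]"
  have "degree P \<le> 2 * 1" by (simp add: P_def)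
  moreover have "sin x = exp (- (\<i> * of_nat 1 * x)) * poly P (exp (\<i> * x))" for x
  proof -
    have 1: "exp (\<i> * x) * exp (- (\<i> * x)) = 1" by (simp add: exp_minus)
    have "exp (- (\<i> * x)) * poly P (exp (\<i> * x))
       = ((exp (\<i> * x) * exp (- (\<i> * x))) * exp (\<i> * x) - exp (- (\<i> * x))) / (2 * \<i>)"
      by (simp add: P_def field_simps)
    then show ?thesis unfolding 1 by (simp add: sin_exp_eq)
  qed
  ultimately show ?thesis unfolding trig_poly_def by blast
qed

text \<open>Horner's scheme: every further factor sin raises the trigonometric degree by
  one.\<close>

lemma trig_poly_poly_sin:
  assumes "degree q \<le> N"
  shows "trig_poly N (\<lambda>x. poly q (sin x))"
  using assms
proof (induction q arbitrary: N)
  case 0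
  then show ?case by (simp add: trig_poly_const)
next
  case (pCons a q)
  show ?case
  proof (cases "q = 0")
    case True
    then show ?thesis by (simp add: trig_poly_const)
  next
    case False
    then obtain K where K: "N = Suc K" "degree q \<le> K"
      using pCons.prems by (cases N) auto
    have "trig_poly (1 + K) (\<lambda>x. sin x * poly q (sin x))"
      using trig_poly_mult[OF trig_poly_sin pCons.IH[OF K(2)]] .
    then show ?thesis
      using trig_poly_add[OF trig_poly_const] by (simp add: K(1))
  qed
qed

section \<open>The Dirichlet kernel and interpolation at equispaced points\<close>

definition dirichlet :: "nat \<Rightarrow> complex \<Rightarrow> complex" where
  "dirichlet L x = (\<Sum>l\<le>2 * L. exp (\<i> * (of_nat l - of_nat L) * x)) / of_nat (2 * L + 1)"

lemma dirichlet_0: "dirichlet L 0 = 1"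
  by (simp add: dirichlet_def of_nat_Suc[symmetric] del: of_nat_Suc)

lemma trig_poly_dirichlet: "trig_poly L (\<lambda>x. dirichlet L (\<omega> - x))"
proof -
  \<comment> \<open>In the variable x the frequency l - L occurs with the opposite sign, so the
    shift by L gives the exponent 2 L - l.\<close>
  define P :: "complex poly" where
    "P = (\<Sum>l\<le>2 * L. monom (exp (\<i> * (of_nat l - of_nat L) * \<omega>) / of_nat (2 * L + 1)) (2 * L - l))"
  have "degree P \<le> 2 * L"
    unfolding P_def by (intro degree_sum_le) (auto intro: order_trans[OF degree_monom_le])
  moreover have "dirichlet L (\<omega> - x) = exp (- (\<i> * of_nat L * x)) * poly P (exp (\<i> * x))" for x
  proof -
    have "exp (\<i> * (of_nat l - of_nat L) * (\<omega> - x)) / of_nat (2 * L + 1)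
        = exp (- (\<i> * of_nat L * x)) *
          (exp (\<i> * (of_nat l - of_nat L) * \<omega>) / of_nat (2 * L + 1) * exp (\<i> * x) ^ (2 * L - l))"
      if "l \<le> 2 * L" for l
    proof -
      have "exp (\<i> * x) ^ (2 * L - l) = exp (\<i> * (2 * of_nat L - of_nat l) * x)"
        using that by (simp add: exp_of_nat_mult[symmetric] of_nat_diff algebra_simps)
      moreover have "exp (\<i> * (of_nat l - of_nat L) * (\<omega> - x))
         = exp (- (\<i> * of_nat L * x)) * (exp (\<i> * (of_nat l - of_nat L) * \<omega>) * exp (\<i> * (2 * of_nat L - of_nat l) * x))"
        unfolding exp_add[symmetric] by (simp add: algebra_simps)
      ultimately show ?thesis by simp
    qed
    then show ?thesis
      unfolding dirichlet_def P_def poly_sum poly_monom sum_divide_distrib sum_distrib_left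
      by (intro sum.cong) auto
  qed
  ultimately show ?thesis unfolding trig_poly_def by blast
qed

text \<open>The 2 L + 1 equispaced points are centred: index L is the point 0, and all of them lie
  between -\<pi> and \<pi>.\<close>

definition grid :: "nat \<Rightarrow> nat \<Rightarrow> real" where
  "grid L j = 2 * pi * (real j - real L) / real (2 * L + 1)"

text \<open>For m \<noteq> l this is a geometric sum whose ratio w is a (2 L + 1)-th root of unity;
  w \<noteq> 1 because 0 < |m - l| < 2 L + 1.\<close>

lemma grid_orthogonality:
  assumes "m \<le> 2 * L" "l \<le> 2 * L"
  shows "(\<Sum>j\<le>2 * L. exp (\<i> * (of_nat m - of_nat l) * of_real (grid L j)))
       = (if m = l then of_nat (2 * L + 1) else 0)"
proof (cases "m = l")
  case False
  define d where "d = real m - real l"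
  define w where "w = exp (\<i> * of_real (d * 2 * pi / real (2 * L + 1)))"
  have w1: "w \<noteq> 1"
  proof
    assume "w = 1"
    then obtain n :: int where "d * 2 * pi / real (2 * L + 1) = of_int (2 * n) * pi"
      unfolding w_def exp_eq_1 by auto
    then have "(2 * pi) * d = (2 * pi) * (of_int n * real (2 * L + 1))"
      by (simp add: field_simps)
    then have "d = of_int n * real (2 * L + 1)"
      by simp
    then have "(int m - int l) = n * int (2 * L + 1)"
    proof -
      have "real_of_int (int m - int l) = real_of_int (n * int (2 * L + 1))"
        using \<open>d = of_int n * real (2 * L + 1)\<close> unfolding d_def by simp
      then show ?thesis by (simp only: of_int_eq_iff)
    qed
    moreover have "\<bar>int m - int l\<bar> < int (2 * L + 1)" using assms by auto
    moreover have "n \<noteq> 0" using calculation False by auto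
    ultimately show False
      by (smt (verit, ccfv_SIG) mult_le_cancel_right1 mult_minus_left)
  qed
  have wM: "w ^ (2 * L + 1) = 1"
  proof -
    have "w ^ (2 * L + 1) = exp (of_nat (2 * L + 1) * (\<i> * of_real (d * 2 * pi / real (2 * L + 1))))"
      unfolding w_def exp_of_nat_mult ..
    also have "of_nat (2 * L + 1) * (\<i> * of_real (d * 2 * pi / real (2 * L + 1))) = \<i> * of_real (d * 2 * pi)"
    proof -
      have "real (2*L+1) * (d * 2 * pi / real (2 * L + 1)) = d * 2 * pi" by simp
      then have "of_real (real (2*L+1)) * of_real (d * 2 * pi / real (2 * L + 1)) = (of_real (d * 2 * pi)::complex)"
        by (metis of_real_mult)
      then show ?thesis by (simp only: of_real_of_nat_eq mult.left_commute)
    qed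
    also have "exp (\<i> * of_real (d * 2 * pi)) = 1"
      unfolding exp_eq_1 d_def
      by (auto intro!: exI[of _ "int m - int l"])
    finally show ?thesis .
  qed
  have "exp (\<i> * (of_nat m - of_nat l) * of_real (grid L j))
      = exp (\<i> * of_real (- (d * 2 * pi * real L / real (2 * L + 1)))) * w ^ j" for j
  proof -
    have "d * (2 * pi * (real j - real L) / M) = - (d * 2 * pi * real L / M) + real j * (d * 2 * pi / M)" for M :: real
      by (simp add: algebra_simps diff_divide_distrib)
    then have "d * grid L j = - (d * 2 * pi * real L / real (2 * L + 1)) + real j * (d * 2 * pi / real (2 * L + 1))"
      unfolding grid_def .
    then have "complex_of_real d * of_real (grid L j)
        = of_real (- (d * 2 * pi * real L / real (2 * L + 1))) + of_nat j * of_real (d * 2 * pi / real (2 * L + 1))"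
      by (metis of_real_add of_real_mult of_real_of_nat_eq)
    then have "\<i> * (of_nat m - of_nat l) * of_real (grid L j)
        = \<i> * of_real (- (d * 2 * pi * real L / real (2 * L + 1))) + of_nat j * (\<i> * of_real (d * 2 * pi / real (2 * L + 1)))"
      unfolding d_def by (simp only: of_real_diff of_real_of_nat_eq mult.assoc distrib_left mult.left_commute[of \<i>])
    then show ?thesis
      unfolding w_def exp_of_nat_mult[symmetric] exp_add[symmetric] by simp
  qed
  then have "(\<Sum>j\<le>2 * L. exp (\<i> * (of_nat m - of_nat l) * of_real (grid L j)))
     = exp (\<i> * of_real (- (d * 2 * pi * real L / real (2 * L + 1)))) * (\<Sum>j<2*L+1. w ^ j)"
    by (simp add: sum_distrib_left lessThan_Suc_atMost)
  also have "(\<Sum>j<2*L+1. w ^ j) = 0"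
    unfolding geometric_sum[OF w1] wM by simp
  finally show ?thesis using False by simp
qed simp

text \<open>Insert the Fourier sum of S and the kernel and sum over the grid first: orthogonality
  leaves the terms with m = l. Only finite sums of exponentials occur, so \<omega> may be
  complex.\<close>

lemma trig_interpolation:
  assumes "trig_poly L S"
  shows "S \<omega> = (\<Sum>j\<le>2 * L. S (of_real (grid L j)) * dirichlet L (\<omega> - of_real (grid L j)))"
proof -
  obtain P where P: "degree P \<le> 2 * L" "\<And>x. S x = exp (- (\<i> * of_nat L * x)) * poly P (exp (\<i> * x))"
    using assms(1) unfolding trig_poly_def by blast
  define a where "a m = coeff P m" for m
  have S: "S x = (\<Sum>m\<le>2 * L. a m * exp (\<i> * (of_nat m - of_nat L) * x))" for x
  proof -
    have "poly P y = (\<Sum>m\<le>2 * L. a m * y ^ m)" for y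
      unfolding a_def poly_altdef
      by (rule sum.mono_neutral_left) (use P(1) le_degree in auto)
    then have "S x = (\<Sum>m\<le>2 * L. exp (- (\<i> * of_nat L * x)) * (a m * exp (\<i> * x) ^ m))"
      unfolding P(2) by (simp add: sum_distrib_left)
    also have "\<dots> = (\<Sum>m\<le>2 * L. a m * exp (\<i> * (of_nat m - of_nat L) * x))"
    proof (rule sum.cong[OF refl])
      fix m
      have "exp (- (\<i> * of_nat L * x)) * exp (\<i> * x) ^ m = exp (\<i> * (of_nat m - of_nat L) * x)"
        unfolding exp_of_nat_mult[symmetric] exp_add[symmetric] by (simp add: algebra_simps)
      then show "exp (- (\<i> * of_nat L * x)) * (a m * exp (\<i> * x) ^ m) = a m * exp (\<i> * (of_nat m - of_nat L) * x)"
        by (metis mult.left_commute)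
    qed
    finally show ?thesis .
  qed
  define M :: complex where "M = of_nat (2 * L + 1)"
  have M0: "M \<noteq> 0" unfolding M_def by (metis of_nat_eq_0_iff add_is_0 one_neq_zero)
  let ?t = "\<lambda>j. complex_of_real (grid L j)"
  have "(\<Sum>j\<le>2 * L. S (?t j) * dirichlet L (\<omega> - ?t j))
      = (\<Sum>j\<le>2 * L. \<Sum>m\<le>2 * L. \<Sum>l\<le>2 * L.
           a m * exp (\<i> * (of_nat l - of_nat L) * \<omega>) / M * exp (\<i> * (of_nat m - of_nat l) * ?t j))"
    unfolding dirichlet_def S M_def[symmetric] sum_divide_distrib sum_product
  proof (intro sum.cong refl)
    fix j m l
    have "exp (\<i> * (of_nat m - of_nat L) * ?t j) * exp (\<i> * (of_nat l - of_nat L) * (\<omega> - ?t j))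
        = exp (\<i> * (of_nat l - of_nat L) * \<omega>) * exp (\<i> * (of_nat m - of_nat l) * ?t j)"
      unfolding exp_add[symmetric] by (simp add: algebra_simps)
    then show "a m * exp (\<i> * (of_nat m - of_nat L) * ?t j) * (exp (\<i> * (of_nat l - of_nat L) * (\<omega> - ?t j)) / M)
      = a m * exp (\<i> * (of_nat l - of_nat L) * \<omega>) / M * exp (\<i> * (of_nat m - of_nat l) * ?t j)"
      by (simp add: field_simps)
  qed
  also have "\<dots> = (\<Sum>m\<le>2 * L. \<Sum>l\<le>2 * L. a m * exp (\<i> * (of_nat l - of_nat L) * \<omega>) / M *
                   (\<Sum>j\<le>2 * L. exp (\<i> * (of_nat m - of_nat l) * ?t j)))"
    unfolding sum_distrib_left
    by (subst sum.swap, rule sum.cong[OF refl], rule sum.swap)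
  also have "\<dots> = (\<Sum>m\<le>2 * L. \<Sum>l\<le>2 * L. if m = l then a m * exp (\<i> * (of_nat l - of_nat L) * \<omega>) else 0)"
  proof (intro sum.cong refl)
    fix m l assume "m \<in> {..2 * L}" "l \<in> {..2 * L}"
    then have "(\<Sum>j\<le>2 * L. exp (\<i> * (of_nat m - of_nat l) * ?t j)) = (if m = l then M else 0)"
      using grid_orthogonality[of m L l] unfolding M_def by simp
    then show "a m * exp (\<i> * (of_nat l - of_nat L) * \<omega>) / M * (\<Sum>j\<le>2 * L. exp (\<i> * (of_nat m - of_nat l) * ?t j))
      = (if m = l then a m * exp (\<i> * (of_nat l - of_nat L) * \<omega>) else 0)"
      using M0 by simp
  qed
  also have "\<dots> = S \<omega>"
    unfolding S by (intro sum.cong refl) (simp add: sum.delta)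
  finally show ?thesis by simp
qed

lemma norm_dirichlet_le: "norm (dirichlet L x) \<le> exp (real L * \<bar>Im x\<bar>)"
proof -
  have "norm (\<Sum>l\<le>2 * L. exp (\<i> * (of_nat l - of_nat L) * x)) \<le> (\<Sum>l\<le>2 * L. exp (real L * \<bar>Im x\<bar>))"
  proof (rule sum_norm_le)
    fix l assume l: "l \<in> {..2 * L}"
    have "norm (exp (\<i> * (of_nat l - of_nat L) * x)) = exp (- ((real l - real L) * Im x))"
      by (simp add: norm_exp_eq_Re)
    also have "- ((real l - real L) * Im x) \<le> \<bar>real l - real L\<bar> * \<bar>Im x\<bar>"
      by (metis abs_ge_minus_self abs_mult)
    also have "\<dots> \<le> real L * \<bar>Im x\<bar>"
      using l by (intro mult_right_mono) auto
    finally show "norm (exp (\<i> * (of_nat l - of_nat L) * x)) \<le> exp (real L * \<bar>Im x\<bar>)"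
      by simp
  qed
  also have "\<dots> = real (2 * L + 1) * exp (real L * \<bar>Im x\<bar>)" by simp
  finally show ?thesis
    unfolding dirichlet_def norm_divide norm_of_nat by (simp add: field_simps)
qed

text \<open>Multiplication by \<open>exp (\<i> * x) - 1\<close> telescopes the geometric sum to two
  end terms, of frequencies L + 1 and -L; the division by 2 L + 1 then yields decay away from the
  multiples of 2 \<pi>.\<close>

lemma norm_dirichlet_decay:
  "norm (dirichlet L x) * norm (exp (\<i> * x) - 1) \<le> 2 * exp (real (L + 1) * \<bar>Im x\<bar>) / real (2 * L + 1)"
proof -
  define e where "e l = exp (\<i> * (of_nat l - of_nat L) * x)" for l
  have e: "e l * exp (\<i> * x) = e (Suc l)" for l
    unfolding e_def exp_add[symmetric] by (simp add: algebra_simps)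
  have tel: "(\<Sum>l\<le>n. e l) * (exp (\<i> * x) - 1) = e (Suc n) - e 0" for n
    by (induction n) (auto simp: algebra_simps e)
  have n: "norm (e l) \<le> exp (real (L + 1) * \<bar>Im x\<bar>)" if "l \<le> 2 * L + 1" for l
  proof -
    have "norm (e l) = exp (- ((real l - real L) * Im x))"
      by (simp add: norm_exp_eq_Re e_def)
    also have "- ((real l - real L) * Im x) \<le> \<bar>real l - real L\<bar> * \<bar>Im x\<bar>"
      by (metis abs_ge_minus_self abs_mult)
    also have "\<dots> \<le> real (L + 1) * \<bar>Im x\<bar>"
      using that by (intro mult_right_mono) auto
    finally show ?thesis by simp
  qed
  have "norm (dirichlet L x * (exp (\<i> * x) - 1)) = norm (e (Suc (2 * L)) - e 0) / real (2 * L + 1)"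
    unfolding dirichlet_def e_def[symmetric] times_divide_eq_left tel norm_divide norm_of_nat ..
  also have "norm (e (Suc (2 * L)) - e 0) \<le> norm (e (Suc (2 * L))) + norm (e 0)"
    by (rule norm_triangle_ineq4)
  also have "\<dots> \<le> 2 * exp (real (L + 1) * \<bar>Im x\<bar>)"
    using n[of "Suc (2 * L)"] n[of 0] by linarith
  finally show ?thesis by (simp add: norm_mult divide_right_mono)
qed

section \<open>Estimates for the sine and its complex inverse\<close>

lemma abs_sin_ge:
  assumes "\<bar>x\<bar> \<le> pi / 2"
  shows "\<bar>x\<bar> / 2 \<le> \<bar>sin x\<bar>"
proof -
  have *: "y / 2 \<le> sin y" if "0 \<le> y" "y \<le> pi / 2" for y
  proof -
    \<comment> \<open>Sine is concave here, so up to \<pi> / 2 it lies above its chord 2 y / \<pi>;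
      the constant 1/2 follows from \<pi> < 4.\<close>
    have "convex_on {0..pi} (\<lambda>x. - sin x)"
      by (rule f''_ge0_imp_convex[where f' = "\<lambda>x. - cos x" and f'' = sin])
         (auto intro!: derivative_eq_intros sin_ge_zero)
    from convex_onD[OF this, of "2 * y / pi" 0 "pi / 2"] that
    have "2 * y / pi \<le> sin y" by simp
    moreover have "y / 2 \<le> 2 * y / pi"
      using that pi_less_4 by (simp add: field_simps) (metis less_eq_real_def mult.commute mult_right_mono)
    ultimately show ?thesis by linarith
  qed
  show ?thesis using *[of "\<bar>x\<bar>"] assms
    by (smt (verit) sin_minus)
qed

text \<open>\<open>Arcsin\<close> is 2-Lipschitz on the disc of radius 1/2: its derivative is 1 /
  cos (Arcsin z), and |cos (Arcsin z)|^2 = |1 - z^2| \<ge> 3/4 there.\<close>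

lemma ex_sin_eq:
  assumes "norm w \<le> 1 / 2"
  shows "\<exists>x. sin x = w \<and> norm x \<le> 2 * norm (w :: complex)"
proof -
  have re: "Im z = 0 \<Longrightarrow> \<bar>Re z\<bar> < 1" if "z \<in> cball (0::complex) (1/2)" for z
    using that abs_Re_le_cmod[of z] by simp
  have "norm (Arcsin w - Arcsin 0) \<le> 2 * norm (w - 0)"
  proof (rule field_differentiable_bound[where S = "cball 0 (1/2)" and f' = "\<lambda>z. inverse (cos (Arcsin z))"])
    fix z :: complex assume z: "z \<in> cball 0 (1/2)"
    show "(Arcsin has_field_derivative inverse (cos (Arcsin z))) (at z within cball 0 (1 / 2))"
      using has_field_derivative_Arcsin[of z] re[OF z] has_field_derivative_at_within by blast
    have "(norm z)^2 \<le> (1/2)^2" using z by (intro power_mono) auto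
    then have 1: "norm (z\<^sup>2) \<le> 1 / 4" by (simp add: norm_mult power2_eq_square)
    have "(cos (Arcsin z))\<^sup>2 = 1 - z\<^sup>2" by (simp add: cos_squared_eq)
    then have "(norm (cos (Arcsin z)))\<^sup>2 = norm (1 - z\<^sup>2)" by (metis norm_power)
    moreover have "norm (1 - z\<^sup>2) \<ge> 1 - norm (z\<^sup>2)"
      by (metis norm_one norm_triangle_ineq2)
    ultimately have "(norm (cos (Arcsin z)))\<^sup>2 \<ge> (1/2)\<^sup>2" using 1 by (simp add: power2_eq_square)
    then have "norm (cos (Arcsin z)) \<ge> 1 / 2"
      by (rule power2_le_imp_le) simp
    then have "inverse (norm (cos (Arcsin z))) \<le> inverse (1/2)"
      by (intro le_imp_inverse_le) auto
    then show "norm (inverse (cos (Arcsin z))) \<le> 2"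
      by (simp add: norm_inverse)
  qed (use assms in auto)
  moreover have "Arcsin 0 = 0" using Arcsin_sin[of 0] by simp
  ultimately show ?thesis by (intro exI[of _ "Arcsin w"]) simp
qed

text \<open>The two exponentials in the sine have moduli exp (- Im x) and exp (Im x), so |sin x|
  \<ge> sinh |Im x|, and sinh y \<ge> y.\<close>

lemma norm_sin_ge_abs_Im: "\<bar>Im x\<bar> \<le> norm (sin x)"
proof -
  define y where "y = \<bar>Im x\<bar>"
  have "norm (exp (\<i> * x)) = exp (- Im x)" "norm (exp (- (\<i> * x))) = exp (Im x)"
    by (simp_all add: norm_exp_eq_Re)
  then have "norm (exp (\<i> * x) - exp (- (\<i> * x))) \<ge> exp y - exp (- y)"
    unfolding y_def
    by (smt (verit) norm_minus_commute norm_triangle_ineq2)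
  then have "exp y - exp (- y) \<le> 2 * norm (sin x)"
    by (simp add: sin_exp_eq norm_divide norm_mult)
  moreover have "exp y - exp (- y) \<ge> 2 * y"
  proof -
    have "(\<lambda>u. exp u - exp (- u) - 2 * u) 0 \<le> (\<lambda>u. exp u - exp (- u) - 2 * u) y"
    proof (rule DERIV_nonneg_imp_nondecreasing[where f = "\<lambda>u. exp u - exp (- u) - 2 * u"])
      fix u :: real
      have "exp u + exp (- u) \<ge> 2"
        using exp_ge_add_one_self[of u] exp_ge_add_one_self[of "- u"] by linarith
      then show "\<exists>d. ((\<lambda>u. exp u - exp (- u) - 2 * u) has_real_derivative d) (at u) \<and> d \<ge> 0"
        by (intro exI[of _ "exp u + exp (- u) - 2"]) (auto intro!: derivative_eq_intros)
    qed (simp add: y_def)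
    then show ?thesis by simp
  qed
  ultimately show ?thesis unfolding y_def by linarith
qed

text \<open>All w have to be covered because the radius A / N is large for small N. If |w| > 1/2,
  the real part of \<open>Arcsin w\<close> is at most \<pi> < 8 |w| in modulus and the imaginary
  part at most |w|; this gives the 9.\<close>

lemma ex_sin_eq_norm_le: "\<exists>x. sin x = w \<and> norm x \<le> 9 * norm (w :: complex)"
proof (cases "norm w \<le> 1 / 2")
  case True
  then show ?thesis using ex_sin_eq[OF True] by (smt (verit) norm_ge_zero)
next
  case False
  have "\<bar>Re (Arcsin w)\<bar> \<le> pi" by (rule Re_Arcsin_bound)
  moreover have "\<bar>Im (Arcsin w)\<bar> \<le> norm w" using norm_sin_ge_abs_Im[of "Arcsin w"] by simp
  ultimately have "norm (Arcsin w) \<le> 9 * norm w"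
    using cmod_le[of "Arcsin w"] False pi_less_4 by linarith
  then show ?thesis by (intro exI[of _ "Arcsin w"]) simp
qed

section \<open>Nodes in [-1, 1] and the evaluation bound\<close>

definition node :: "nat \<Rightarrow> nat \<Rightarrow> real" where
  "node N j = sin (grid (3 * N) j)"

text \<open>The distance is counted in indices from the central index 3 N, whose node is 0. It
  reflects the size of the grid point and not of the node: grid points near \<pi> have small nodes
  but a large \<open>offcentre\<close>.\<close>

definition offcentre :: "nat \<Rightarrow> nat \<Rightarrow> real" where
  "offcentre N j = \<bar>real j - 3 * real N\<bar>"

lemma grid_bounds:
  assumes "N \<ge> 1" "j \<le> 6 * N"
  shows "\<bar>grid (3 * N) j\<bar> \<le> pi" "real N * \<bar>grid (3 * N) j\<bar> \<ge> offcentre N j / 2"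
    "real N * \<bar>grid (3 * N) j\<bar> \<le> 2 * offcentre N j"
proof -
  define d where "d = offcentre N j"
  have d: "d \<ge> 0" "d \<le> 3 * real N" using assms unfolding d_def offcentre_def by auto
  have g: "\<bar>grid (3 * N) j\<bar> = 2 * pi * d / (6 * real N + 1)"
    unfolding grid_def d_def offcentre_def by (simp add: abs_mult)
  have N: "real N \<ge> 1" using assms by simp
  show "\<bar>grid (3 * N) j\<bar> \<le> pi"
    unfolding g using d N mult_left_mono[of "2 * d" "6 * real N + 1" pi]
    by (simp add: divide_le_eq mult.assoc mult.left_commute[of _ pi])
  have "d * (real N * (2 * pi)) \<ge> d * ((6 * real N + 1) / 2)"
  proof (rule mult_left_mono[OF _ d(1)])
    have "real N * 3 \<le> real N * pi" using pi_gt3 by (intro mult_left_mono) auto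
    then have "2 * (real N * 3) \<le> real N * (2 * pi)" by (simp add: mult.commute)
    moreover have "(6 * real N + 1) / 2 \<le> 2 * (real N * 3)" using N by simp
    ultimately show "(6 * real N + 1) / 2 \<le> real N * (2 * pi)" by (rule order_trans[rotated])
  qed
  then show "real N * \<bar>grid (3 * N) j\<bar> \<ge> offcentre N j / 2"
    unfolding g d_def[symmetric] using N by (simp add: field_simps)
  have "d * (real N * (2 * pi)) \<le> d * (2 * (6 * real N + 1))"
  proof (rule mult_left_mono[OF _ d(1)])
    have "real N * pi \<le> real N * 4" using pi_less_4 by (intro mult_left_mono) auto
    then have "real N * (2 * pi) \<le> 2 * (real N * 4)" by (simp add: mult.commute)
    moreover have "2 * (real N * 4) \<le> 2 * (6 * real N + 1)" by simp
    ultimately show "real N * (2 * pi) \<le> 2 * (6 * real N + 1)" by (rule order_trans)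
  qed
  then show "real N * \<bar>grid (3 * N) j\<bar> \<le> 2 * offcentre N j"
    unfolding g d_def[symmetric] using N by (simp add: field_simps)
qed

lemma abs_node_le:
  assumes "N \<ge> 1" "j \<le> 6 * N"
  shows "\<bar>node N j\<bar> \<le> 2 * offcentre N j / real N"
proof -
  have "\<bar>node N j\<bar> \<le> \<bar>grid (3 * N) j\<bar>"
    unfolding node_def by (rule abs_sin_x_le_abs_x)
  with grid_bounds(3)[OF assms] assms show ?thesis by (simp add: field_simps) (meson mult_left_mono of_nat_0_le_iff order_trans)
qed

lemma norm_exp_minus_one_le: "norm (exp z - 1) \<le> norm z * exp (norm (z::complex))"
proof -
  have "norm (exp z - exp 0) \<le> exp (norm z) * norm (z - 0)"
  proof (rule field_differentiable_bound[where S = "cball 0 (norm z)" and f' = exp])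
    show "norm (exp x) \<le> exp (norm z)" if "x \<in> cball 0 (norm z)" for x :: complex
      using that complex_Re_le_cmod[of x] by (simp add: norm_exp_eq_Re)
  qed (auto intro!: derivative_eq_intros)
  then show ?thesis by (simp add: mult.commute)
qed

text \<open>As |Im \<omega>| \<le> B / N, all exponential growth is bounded by exp (4 B) for either
  degree. The decay is governed by |exp (\<i> (\<omega> - \<theta>)) - 1|; since \<omega> is within
  B / N of 0, the triangle inequality trades it for |exp (\<i> \<theta>) - 1| \<ge> |\<theta>| / 2,
  and N |\<theta>| is at least \<open>offcentre\<close> / 2.\<close>

lemma dirichlet_kernel_bound:
  assumes N: "N \<ge> 1" and B: "B \<ge> 0" and w: "norm \<omega> \<le> B / real N" and L: "L \<in> {N, 3 * N}"
    and j: "j \<le> 6 * N"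
  shows "norm (dirichlet L (\<omega> - of_real (grid (3 * N) j))) * (1 + offcentre N j) \<le> 5 * (2 + B) * exp (4 * B)"
proof -
  define \<theta> where "\<theta> = grid (3 * N) j"
  define D where "D = norm (dirichlet L (\<omega> - of_real \<theta>))"
  have LN: "real L \<le> 3 * real N" "real N \<le> real L" "real N \<ge> 1" using L N by auto
  have Im: "real N * \<bar>Im (\<omega> - of_real \<theta>)\<bar> \<le> B"
    using abs_Im_le_cmod[of \<omega>] w LN by (simp add: field_simps) (meson mult_left_mono of_nat_0_le_iff order_trans)
  have m3: "exp (real L * \<bar>Im (\<omega> - of_real \<theta>)\<bar>) \<le> exp (3 * B)"
    using Im mult_right_mono[OF LN(1), of "\<bar>Im (\<omega> - of_real \<theta>)\<bar>"] by simp
  have m4: "exp (real (L + 1) * \<bar>Im (\<omega> - of_real \<theta>)\<bar>) \<le> exp (4 * B)"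
  proof -
    have "real (L + 1) * \<bar>Im (\<omega> - of_real \<theta>)\<bar> \<le> (4 * real N) * \<bar>Im (\<omega> - of_real \<theta>)\<bar>"
      using LN by (intro mult_right_mono) auto
    then show ?thesis using Im by simp
  qed
  have D3: "D \<le> exp (3 * B)"
    unfolding D_def using norm_dirichlet_le m3 order_trans by blast
  have D34: "exp (3 * B) \<le> exp (4 * B)" using B by simp
  have dec: "D * norm (exp (\<i> * (\<omega> - of_real \<theta>)) - 1) \<le> 2 * exp (4 * B) / real N"
  proof -
    have "D * norm (exp (\<i> * (\<omega> - of_real \<theta>)) - 1) \<le> 2 * exp (real (L + 1) * \<bar>Im (\<omega> - of_real \<theta>)\<bar>) / real (2 * L + 1)"
      unfolding D_def by (rule norm_dirichlet_decay)
    also have "\<dots> \<le> 2 * exp (4 * B) / real N"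
      using m4 LN by (intro frac_le) auto
    finally show ?thesis .
  qed
  have "norm (exp (\<i> * of_real \<theta>) - 1) - norm (exp (\<i> * \<omega>) - 1) \<le> norm (exp (\<i> * \<omega>) - exp (\<i> * of_real \<theta>))"
    by (smt (verit) norm_minus_commute norm_triangle_ineq add_diff_cancel diff_add_cancel diff_diff_eq2)
  also have "exp (\<i> * \<omega>) - exp (\<i> * of_real \<theta>) = exp (\<i> * of_real \<theta>) * (exp (\<i> * (\<omega> - of_real \<theta>)) - 1)"
    by (simp add: algebra_simps exp_add[symmetric])
  also have "norm \<dots> = norm (exp (\<i> * (\<omega> - of_real \<theta>)) - 1)"
    by (simp add: norm_mult norm_exp_eq_Re)
  finally have a: "norm (exp (\<i> * of_real \<theta>) - 1) \<le> norm (exp (\<i> * (\<omega> - of_real \<theta>)) - 1) + norm (exp (\<i> * \<omega>) - 1)"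
    by linarith
  have th: "\<bar>\<theta>\<bar> / 2 \<le> norm (exp (\<i> * of_real \<theta>) - 1)"
    unfolding dist_exp_i_1 using abs_sin_ge[of "\<theta> / 2"] grid_bounds(1)[OF N j] \<theta>_def by (simp add: abs_if split: if_splits)
  have om: "norm (exp (\<i> * \<omega>) - 1) \<le> B / real N * exp B"
  proof -
    have "norm (exp (\<i> * \<omega>) - 1) \<le> norm \<omega> * exp (norm \<omega>)"
      using norm_exp_minus_one_le[of "\<i> * \<omega>"] by (simp add: norm_mult)
    also have "B / real N \<le> B" using LN B by (simp add: field_simps mult_le_cancel_left1)
    then have "norm \<omega> * exp (norm \<omega>) \<le> B / real N * exp B"
      using w B by (intro mult_mono) auto
    finally show ?thesis .
  qed
  have D0: "D \<ge> 0" unfolding D_def by simp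
  have "D * (\<bar>\<theta>\<bar> / 2) \<le> D * (norm (exp (\<i> * (\<omega> - of_real \<theta>)) - 1) + B / real N * exp B)"
  proof (rule mult_left_mono[OF _ D0])
    show "\<bar>\<theta>\<bar> / 2 \<le> norm (exp (\<i> * (\<omega> - of_real \<theta>)) - 1) + B / real N * exp B"
      using th a om by linarith
  qed
  also have "\<dots> \<le> 2 * exp (4 * B) / real N + exp (3 * B) * (B / real N * exp B)"
    unfolding distrib_left using dec D3 B by (intro add_mono mult_right_mono) auto
  also have "\<dots> = (2 + B) * exp (4 * B) / real N"
    using LN by (simp add: field_simps exp_add[symmetric])
  finally have "D * (real N * \<bar>\<theta>\<bar>) \<le> 2 * ((2 + B) * exp (4 * B))"
    using LN by (simp add: field_simps)
  then have "D * (offcentre N j / 2) \<le> 2 * ((2 + B) * exp (4 * B))"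
    using grid_bounds(2)[OF N j] D0 mult_left_mono \<theta>_def by (smt (verit))
  \<comment> \<open>The factor \<open>offcentre\<close> has cost four copies of (2 + B) exp (4 B);
    the summand 1 costs one more, hence the 5.\<close>
  moreover have "exp (3 * B) \<le> (2 + B) * exp (4 * B)"
    using D34 B by (smt (verit) exp_ge_zero mult_le_cancel_right1)
  ultimately show ?thesis
    using D3 unfolding D_def \<theta>_def by (simp add: algebra_simps)
qed

text \<open>With w = sin \<open>\<omega>\<close> the function x \<open>\<mapsto>\<close> q (sin x) D(\<open>\<omega>\<close> - x)^2, D the normalised Dirichlet kernel of
degree N, is a trigonometric polynomial of degree 3 N. Interpolating it at \<open>\<omega>\<close> brings a third kernel,
and each of the three decays like 1 / (1 + distance from the central node).\<close>

lemma kernel_bound: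
  assumes A: "A \<ge> 0"
  shows "\<exists>C>0. \<forall>N\<ge>1. \<forall>q w. degree q \<le> N \<longrightarrow> norm w \<le> A / real N \<longrightarrow>
    norm (poly q w) \<le> C * (\<Sum>j\<le>6 * N. norm (poly q (complex_of_real (node N j))) / (1 + offcentre N j) ^ 3)"
proof (intro exI conjI allI impI)
  \<comment> \<open>Inverting the sine turns |w| \<le> A / N into |\<omega>| \<le> 9 A / N, so each
    kernel is estimated with B = 9 A; three kernels give the cube.\<close>
  let ?C = "(5 * (2 + 9 * A) * exp (4 * (9 * A))) ^ 3"
  show "?C > 0" using A by simp
  fix N :: nat and q :: "complex poly" and w :: complex
  assume N: "1 \<le> N" and q: "degree q \<le> N" and w: "norm w \<le> A / real N"
  obtain \<omega> where \<omega>: "sin \<omega> = w" "norm \<omega> \<le> 9 * norm w" using ex_sin_eq_norm_le by blast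
  have \<omega>B: "norm \<omega> \<le> 9 * A / real N" using \<omega>(2) w(1) by simp
  define T where "T x = poly q (sin x) * (dirichlet N (\<omega> - x) * dirichlet N (\<omega> - x))" for x
  have "trig_poly (N + (N + N)) T"
    unfolding T_def by (intro trig_poly_mult trig_poly_poly_sin q trig_poly_dirichlet)
  then have T: "trig_poly (3 * N) T" by (simp add: numeral_3_eq_3 add.assoc)
  \<comment> \<open>The two auxiliary kernels equal 1 at x = \<omega>, so inserting them does not
    change the value to be estimated.\<close>
  have "poly q w = T \<omega>" unfolding T_def by (simp add: dirichlet_0 \<omega>(1))
  also have "\<dots> = (\<Sum>j\<le>6 * N. T (of_real (grid (3 * N) j)) * dirichlet (3 * N) (\<omega> - of_real (grid (3 * N) j)))"
    using trig_interpolation[OF T, of \<omega>] by simp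
  also have "norm \<dots> \<le> (\<Sum>j\<le>6 * N. ?C * (norm (poly q (complex_of_real (node N j))) / (1 + offcentre N j) ^ 3))"
  proof (rule sum_norm_le)
    fix j assume "j \<in> {..6 * N}"
    then have j: "j \<le> 6 * N" by simp
    define a where "a = norm (dirichlet N (\<omega> - of_real (grid (3 * N) j)))"
    define b where "b = norm (dirichlet (3 * N) (\<omega> - of_real (grid (3 * N) j)))"
    define o1 where "o1 = 1 + offcentre N j"
    define K where "K = 5 * (2 + 9 * A) * exp (4 * (9 * A))"
    have o1: "o1 > 0" unfolding o1_def offcentre_def by simp
    have ab: "a * o1 \<le> K" "b * o1 \<le> K" "a \<ge> 0" "b \<ge> 0"
      unfolding a_def b_def o1_def K_def
      by (rule dirichlet_kernel_bound[OF N _ \<omega>B _ j]; use A in simp)+ simp_all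
    have "(a * o1) * (a * o1) * (b * o1) \<le> K * K * K"
    proof -
      have "K \<ge> 0" using ab(1,3) o1 by (smt (verit) mult_nonneg_nonneg)
      then show ?thesis using ab o1 by (intro mult_mono) auto
    qed
    then have "a * a * b \<le> K ^ 3 / o1 ^ 3"
      using o1 by (simp add: field_simps power3_eq_cube)
    then have "norm (poly q (complex_of_real (node N j))) * (a * a * b) \<le> norm (poly q (complex_of_real (node N j))) * (K ^ 3 / o1 ^ 3)"
      by (rule mult_left_mono) simp
    moreover have "norm (T (of_real (grid (3 * N) j)) * dirichlet (3 * N) (\<omega> - of_real (grid (3 * N) j)))
       = norm (poly q (complex_of_real (node N j))) * (a * a * b)"
      unfolding T_def a_def b_def node_def norm_mult by (simp add: sin_of_real)
    ultimately show "norm (T (of_real (grid (3 * N) j)) * dirichlet (3 * N) (\<omega> - of_real (grid (3 * N) j)))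
       \<le> ?C * (norm (poly q (complex_of_real (node N j))) / (1 + offcentre N j) ^ 3)"
      unfolding K_def o1_def by (simp add: field_simps)
  qed
  finally show "norm (poly q w) \<le> ?C * (\<Sum>j\<le>6 * N. norm (poly q (complex_of_real (node N j))) / (1 + offcentre N j) ^ 3)"
    by (simp add: sum_distrib_left)
qed

text \<open>The induction runs on the sharper bound 2 - 1 / n, whose increments 1 / (n (n + 1))
  dominate the next inverse square.\<close>

lemma sum_inverse_squares_le: "(\<Sum>i<n. 1 / (1 + real i) ^ 2) \<le> 2"
proof -
  have "(\<Sum>i<Suc n. 1 / (1 + real i) ^ 2) \<le> 2 - 1 / real (Suc n)" for n
  proof (induction n)
    case (Suc n)
    have "1 / (1 + real (Suc n)) ^ 2 \<le> 1 / ((real n + 1) * (real n + 2))"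
      by (intro divide_left_mono) (auto simp: power2_eq_square intro!: mult_mono)
    also have "\<dots> = 1 / real (Suc n) - 1 / real (Suc (Suc n))"
      by (simp add: field_simps)
    finally show ?case using Suc.IH by simp
  qed simp
  then have "(\<Sum>i<Suc n. 1 / (1 + real i) ^ 2) \<le> 2" for n
    by (smt (verit) divide_nonneg_nonneg of_nat_0_le_iff)
  then show ?thesis by (cases n) auto
qed

lemma sum_offcentre_le: "(\<Sum>j\<le>6 * N. 1 / (1 + offcentre N j) ^ 2) \<le> 4"
proof -
  let ?f = "\<lambda>i. 1 / (1 + real i) ^ 2"
  have split: "{..6 * N} = {..<3 * N} \<union> {3 * N..6 * N}" by auto
  have "(\<Sum>j\<le>6 * N. 1 / (1 + offcentre N j) ^ 2)
      = (\<Sum>j<3 * N. 1 / (1 + offcentre N j) ^ 2) + (\<Sum>j\<in>{3 * N..6 * N}. 1 / (1 + offcentre N j) ^ 2)"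
    unfolding split by (rule sum.union_disjoint) auto
  also have "(\<Sum>j<3 * N. 1 / (1 + offcentre N j) ^ 2) \<le> (\<Sum>j<3 * N. ?f (3 * N - Suc j))"
    by (intro sum_mono divide_left_mono power_mono) (auto simp: offcentre_def of_nat_diff)
  also have "(\<Sum>j<3 * N. ?f (3 * N - Suc j)) = (\<Sum>j<3 * N. ?f j)"
    by (rule sum.nat_diff_reindex)
  also have "(\<Sum>j\<in>{3 * N..6 * N}. 1 / (1 + offcentre N j) ^ 2) = (\<Sum>i<3 * N + 1. ?f i)"
    by (rule sum.reindex_bij_witness[of _ "\<lambda>i. i + 3 * N" "\<lambda>j. j - 3 * N"])
       (auto simp: offcentre_def of_nat_diff)
  finally show ?thesis
    using sum_inverse_squares_le[of "3 * N"] sum_inverse_squares_le[of "3 * N + 1"] by linarith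
qed

section \<open>Finite differences of entire functions\<close>

definition cdiff :: "nat \<Rightarrow> complex \<Rightarrow> (complex \<Rightarrow> complex) \<Rightarrow> complex \<Rightarrow> complex" where
  "cdiff r s f w = (\<Sum>j\<le>r. (-1) ^ (r + j) * of_nat (r choose j) * f (w + of_nat j * s))"

text \<open>Pascal's rule splits each binomial coefficient; the two parts are the lower-order sums
  at shifted and at unshifted points.\<close>

lemma cdiff_Suc: "cdiff (Suc r) s f w = cdiff r s (\<lambda>x. f (x + s) - f x) w"
proof -
  let ?g = "\<lambda>j. f (w + of_nat j * s)"
  have "cdiff (Suc r) s f w
      = (-1) ^ Suc r * ?g 0 + (\<Sum>j\<le>r. (-1) ^ (Suc r + Suc j) * of_nat (Suc r choose Suc j) * ?g (Suc j))"
    unfolding cdiff_def by (subst sum.atMost_Suc_shift) simp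
  also have "(\<Sum>j\<le>r. (-1) ^ (Suc r + Suc j) * of_nat (Suc r choose Suc j) * ?g (Suc j))
     = (\<Sum>j\<le>r. (-1) ^ (r + j) * of_nat (r choose j) * ?g (Suc j))
       + (\<Sum>j\<le>r. (-1) ^ (r + j) * of_nat (r choose Suc j) * ?g (Suc j))"
    by (simp add: sum.distrib[symmetric] algebra_simps)
  also have "(\<Sum>j\<le>r. (-1) ^ (r + j) * of_nat (r choose Suc j) * ?g (Suc j))
     = (\<Sum>j<r. (-1) ^ (r + j) * of_nat (r choose Suc j) * ?g (Suc j))"
    by (simp add: lessThan_Suc_atMost[symmetric])
  also have "(-1) ^ Suc r * ?g 0 + ((\<Sum>j\<le>r. (-1) ^ (r + j) * of_nat (r choose j) * ?g (Suc j)) + \<dots>)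
     = (\<Sum>j\<le>r. (-1) ^ (r + j) * of_nat (r choose j) * ?g (Suc j))
       - (\<Sum>j\<le>r. (-1) ^ (r + j) * of_nat (r choose j) * ?g j)"
  proof -
    have "(\<Sum>j\<le>r. (-1) ^ (r + j) * of_nat (r choose j) * ?g j)
       = (-1) ^ r * ?g 0 + (\<Sum>j<r. (-1) ^ (r + Suc j) * of_nat (r choose Suc j) * ?g (Suc j))"
      by (simp add: lessThan_Suc_atMost[symmetric] sum.lessThan_Suc_shift del: sum.lessThan_Suc)
    then show ?thesis by (simp add: sum_negf)
  qed
  also have "\<dots> = cdiff r s (\<lambda>x. f (x + s) - f x) w"
    unfolding cdiff_def by (simp add: sum_subtractf[symmetric] algebra_simps)
  finally show ?thesis .
qed

text \<open>Each passage from f to x \<mapsto> f (x + s) - f x costs a margin \<epsilon> + |s| of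
  the radius and gains a factor |s| / \<epsilon>, by Cauchy's estimate for the derivative on discs
  of radius \<epsilon> centred on the segment from x to x + s.\<close>

lemma norm_cdiff_le_aux:
  assumes "f holomorphic_on UNIV" and "\<And>x. norm x \<le> R \<Longrightarrow> norm (f x) \<le> B"
    and "\<epsilon> > 0" and "norm w + real r * (\<epsilon> + norm s) \<le> R"
  shows "norm (cdiff r s f w) \<le> B * (norm s / \<epsilon>) ^ r"
  using assms
proof (induction r arbitrary: f B R)
  case 0
  then show ?case by (simp add: cdiff_def)
next
  case (Suc r)
  define g where "g x = f (x + s) - f x" for x
  have hol: "g holomorphic_on UNIV"
    unfolding g_def using Suc.prems(1)
    by (intro holomorphic_intros holomorphic_on_compose[of "\<lambda>x. x + s" UNIV f, unfolded o_def])
       (auto intro: holomorphic_on_subset)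
  have fd: "(f has_field_derivative deriv f z) (at z)" for z
    using Suc.prems(1) by (simp add: holomorphic_derivI)
  have R0: "0 \<le> R" using Suc.prems(3,4) by (smt (verit) mult_nonneg_nonneg norm_ge_zero of_nat_0_le_iff)
  have B0: "0 \<le> B" using Suc.prems(2)[of 0] R0 by (smt (verit) norm_ge_zero norm_zero)
  have gb: "norm (g x) \<le> B * (norm s / \<epsilon>)" if x: "norm x \<le> R - (\<epsilon> + norm s)" for x
  proof -
    have "norm (f (x + s) - f x) \<le> B / \<epsilon> * norm (x + s - x)"
    proof (rule field_differentiable_bound[where S = "closed_segment x (x + s)" and f' = "deriv f"])
      show "(f has_field_derivative deriv f z) (at z within closed_segment x (x + s))" for z
        using fd by (rule has_field_derivative_at_within)
      fix z assume z: "z \<in> closed_segment x (x + s)"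
      have "norm (z - x) \<le> norm s" using z segment_bound(1)[of z x "x + s"] by simp
      then have nz: "norm z \<le> R - \<epsilon>" using x norm_triangle_sub[of z x] by linarith
      have "norm ((deriv ^^ 1) f z) \<le> fact 1 * B / \<epsilon> ^ 1"
      proof (rule Cauchy_inequality)
        show "f holomorphic_on ball z \<epsilon>" using Suc.prems(1) holomorphic_on_subset by blast
        show "continuous_on (cball z \<epsilon>) f"
          using Suc.prems(1) holomorphic_on_imp_continuous_on continuous_on_subset by blast
        show "norm (f y) \<le> B" if "norm (z - y) = \<epsilon>" for y
          using Suc.prems(2)[of y] that nz norm_triangle_sub[of y z] by (simp add: norm_minus_commute)
      qed (use Suc.prems in auto)
      then show "norm (deriv f z) \<le> B / \<epsilon>" by simp
    qed auto
    then show ?thesis by (simp add: g_def field_simps)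
  qed
  have "norm (cdiff r s g w) \<le> B * (norm s / \<epsilon>) * (norm s / \<epsilon>) ^ r"
  proof (rule Suc.IH[OF hol, where R = "R - (\<epsilon> + norm s)"])
    show "norm w + real r * (\<epsilon> + norm s) \<le> R - (\<epsilon> + norm s)"
      using Suc.prems(4) by (simp add: algebra_simps)
  qed (use gb Suc.prems in auto)
  then show ?case
    unfolding cdiff_Suc g_def by (simp add: mult.assoc)
qed

lemma norm_cdiff_le:
  assumes "f holomorphic_on UNIV" and "\<And>x. norm x \<le> R \<Longrightarrow> norm (f x) \<le> B"
    and "r \<ge> 1" and "R > 0" and "4 * real r * norm s \<le> R" and "norm w \<le> R / 2"
  shows "norm (cdiff r s f w) \<le> B * (4 * real r * norm s / R) ^ r"
proof -
  \<comment> \<open>The radius R is divided up: one half for |w|, one quarter for r \<epsilon> and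
    one quarter for r |s|.\<close>
  define \<epsilon> where "\<epsilon> = R / (4 * real r)"
  have "norm (cdiff r s f w) \<le> B * (norm s / \<epsilon>) ^ r"
  proof (rule norm_cdiff_le_aux[OF assms(1,2)])
    show "\<epsilon> > 0" using assms by (simp add: \<epsilon>_def)
    have "real r * \<epsilon> = R / 4" using assms(3) by (simp add: \<epsilon>_def)
    moreover have "real r * norm s \<le> R / 4" using assms(5) by simp
    ultimately show "norm w + real r * (\<epsilon> + norm s) \<le> R"
      using assms(6) by (simp add: distrib_left)
  qed
  also have "norm s / \<epsilon> = 4 * real r * norm s / R"
    using assms(3,4) by (simp add: \<epsilon>_def field_simps)
  finally show ?thesis .
qed

section \<open>Convexity of powers\<close>

lemma convex_on_powr_nonneg:
  assumes "p \<ge> 1"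
  shows "convex_on {0..} (\<lambda>x::real. x powr p)"
proof (rule convex_onI)
  fix t x y :: real
  assume t: "0 < t" "t < 1" and xy: "x \<in> {0..}" "y \<in> {0..}"
  \<comment> \<open>If x or y is 0, convexity reduces to s^p \<le> s for 0 < s < 1.\<close>
  have small: "(s * z) powr p \<le> s * z powr p" if "0 < s" "s < 1" "0 \<le> z" for s z :: real
  proof -
    have "s powr p \<le> s powr 1" using that assms by (intro powr_mono') auto
    then show ?thesis using that by (simp add: powr_mult mult_right_mono)
  qed
  show "((1 - t) *\<^sub>R x + t *\<^sub>R y) powr p \<le> (1 - t) * x powr p + t * y powr p"
  proof (cases "x = 0 \<or> y = 0")
    case True
    then show ?thesis using small[of t y] small[of "1 - t" x] t xy assms by auto
  next
    case False
    then show ?thesis using convex_onD[OF powr_convex[OF assms], of t x y] t xy by auto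
  qed
qed auto

text \<open>Jensen's inequality for the weights divided by their sum; undoing this normalisation
  leaves the sum to the power p - 1.\<close>

lemma powr_sum_le:
  fixes w x :: "'i \<Rightarrow> real"
  assumes "finite I" "p \<ge> 1" "\<And>i. i \<in> I \<Longrightarrow> w i \<ge> 0" "\<And>i. i \<in> I \<Longrightarrow> x i \<ge> 0"
  shows "(\<Sum>i\<in>I. w i * x i) powr p \<le> (\<Sum>i\<in>I. w i) powr (p - 1) * (\<Sum>i\<in>I. w i * x i powr p)"
proof (cases "(\<Sum>i\<in>I. w i) = 0")
  case True
  then have "\<forall>i\<in>I. w i = 0" using assms by (simp add: sum_nonneg_eq_0_iff)
  then show ?thesis using assms by simp
next
  case False
  define W where "W = (\<Sum>i\<in>I. w i)"
  have W: "W > 0" using False assms unfolding W_def by (simp add: less_le sum_nonneg)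
  have ne: "I \<noteq> {}" using False by auto
  have "(\<Sum>i\<in>I. (w i / W) *\<^sub>R x i) powr p \<le> (\<Sum>i\<in>I. (w i / W) * x i powr p)"
    using W assms by (intro convex_on_sum[OF assms(1) ne convex_on_powr_nonneg])
      (auto simp: sum_divide_distrib[symmetric] W_def)
  moreover have "(\<Sum>i\<in>I. w i * x i) = W * (\<Sum>i\<in>I. (w i / W) *\<^sub>R x i)"
    using W by (simp add: sum_distrib_left)
  moreover have "(\<Sum>i\<in>I. (w i / W) *\<^sub>R x i) \<ge> 0"
    using W assms by (intro sum_nonneg) auto
  ultimately have "(\<Sum>i\<in>I. w i * x i) powr p \<le> W powr p * (\<Sum>i\<in>I. (w i / W) * x i powr p)"
    using W by (simp add: powr_mult mult_left_mono)
  also have "\<dots> = W powr (p - 1) * (\<Sum>i\<in>I. w i * x i powr p)"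
    using W by (simp add: sum_divide_distrib[symmetric] powr_diff)
  finally show ?thesis unfolding W_def .
qed

section \<open>Bernstein's inequality on an interval\<close>

text \<open>The principal square root has nonnegative real part, so the other root u has modulus at
  least \<beta> / 2; as the product of the roots is - \<kappa>, this bounds v.\<close>

lemma quadratic_root:
  fixes \<kappa> :: complex and \<beta> :: real
  assumes "\<beta> \<ge> 0"
  shows "\<exists>v. v\<^sup>2 + of_real \<beta> * v = \<kappa> \<and> norm v * \<beta> \<le> 2 * norm \<kappa> \<and> (\<beta> = 0 \<longrightarrow> (norm v)\<^sup>2 = norm \<kappa>)"
proof -
  define d where "d = csqrt ((of_real \<beta>)\<^sup>2 + 4 * \<kappa>)"
  have d2: "d\<^sup>2 = (of_real \<beta>)\<^sup>2 + 4 * \<kappa>" unfolding d_def by simp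
  define v u where "v = (d - of_real \<beta>) / 2" and "u = (- d - of_real \<beta>) / 2"
  have eq: "v\<^sup>2 + of_real \<beta> * v = \<kappa>"
    using d2 unfolding v_def by (simp add: power2_eq_square field_simps)
  have vu: "v * u = - \<kappa>"
    using d2 unfolding v_def u_def by (simp add: power2_eq_square field_simps)
  have "\<bar>Re u\<bar> \<ge> \<beta> / 2"
  proof -
    have "2 * Re u = - Re d - \<beta>" unfolding u_def by simp
    moreover have "Re d \<ge> 0" unfolding d_def by (rule Re_csqrt)
    ultimately show ?thesis using assms by linarith
  qed
  then have "\<beta> / 2 \<le> norm u" using abs_Re_le_cmod[of u] by linarith
  then have "norm v * (\<beta> / 2) \<le> norm v * norm u" by (rule mult_left_mono) simp
  also have "\<dots> = norm \<kappa>" by (metis norm_minus_cancel norm_mult vu)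
  finally have "norm v * \<beta> \<le> 2 * norm \<kappa>" by simp
  moreover have "\<beta> = 0 \<longrightarrow> (norm v)\<^sup>2 = norm \<kappa>"
    using eq by (metis add.right_neutral mult_zero_left norm_power of_real_0)
  ultimately show ?thesis using eq by blast
qed

text \<open>For relative depth \<open>\<delta>\<close> the scale is a power of 1/2 comparable with sqrt \<open>\<delta>\<close>, or 0 in the
boundary layer \<open>\<delta>\<close> < 1/k^2. It takes only O(log k) values, so that moving each point inwards
according to its depth is a translation on each of few blocks.\<close>

definition dyadic_level :: "real \<Rightarrow> nat" where
  "dyadic_level \<delta> = (LEAST i. (1 / 4) ^ i \<le> \<delta>)"

definition dyadic_scale :: "nat \<Rightarrow> real \<Rightarrow> real" where
  "dyadic_scale k \<delta> = (if \<delta> < 1 / (real k)\<^sup>2 then 0 else (1 / 2) ^ dyadic_level \<delta>)"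

lemma dyadic_level_bounds:
  assumes "0 < \<delta>" "\<delta> < 1"
  shows "(1 / 4) ^ dyadic_level \<delta> \<le> \<delta>" "\<delta> < 4 * (1 / 4) ^ dyadic_level \<delta>"
proof -
  obtain n where "(1 / 4) ^ n < \<delta>" using real_arch_pow_inv[of \<delta> "1 / 4"] assms by auto
  then show 1: "(1 / 4) ^ dyadic_level \<delta> \<le> \<delta>"
    unfolding dyadic_level_def using LeastI[of "\<lambda>i. (1 / 4) ^ i \<le> \<delta>" n] by simp
  obtain m where m: "dyadic_level \<delta> = Suc m" using 1 assms(2) by (cases "dyadic_level \<delta>") auto
  have "\<not> (1 / 4) ^ m \<le> \<delta>"
    using not_less_Least[of m "\<lambda>i. (1 / 4) ^ i \<le> \<delta>"] m unfolding dyadic_level_def by simp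
  then show "\<delta> < 4 * (1 / 4) ^ dyadic_level \<delta>" using m by simp
qed

lemma dyadic_scale_bounds:
  assumes "0 \<le> \<delta>" "\<delta> \<le> 1 / 2" "k \<ge> 1"
  shows "0 \<le> dyadic_scale k \<delta>" "dyadic_scale k \<delta> \<le> 1" "(dyadic_scale k \<delta>)\<^sup>2 \<le> \<delta>"
    "1 / (real k)\<^sup>2 \<le> \<delta> \<Longrightarrow> \<delta> < 4 * (dyadic_scale k \<delta>)\<^sup>2"
proof -
  have p: "((1 / 2) ^ i)\<^sup>2 = (1 / 4 :: real) ^ i" for i
    by (simp add: power2_eq_square power_mult_distrib[symmetric])
  have pos: "0 < \<delta>" if "1 / (real k)\<^sup>2 \<le> \<delta>"
    using less_le_trans[OF _ that] assms(3) by simp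
  show "0 \<le> dyadic_scale k \<delta>" "dyadic_scale k \<delta> \<le> 1"
    by (simp_all add: dyadic_scale_def power_le_one)
  show "(dyadic_scale k \<delta>)\<^sup>2 \<le> \<delta>"
    using dyadic_level_bounds(1)[of \<delta>] pos assms by (auto simp: dyadic_scale_def p)
  show "\<delta> < 4 * (dyadic_scale k \<delta>)\<^sup>2" if "1 / (real k)\<^sup>2 \<le> \<delta>"
    using dyadic_level_bounds(2)[of \<delta>] pos that assms by (auto simp: dyadic_scale_def p)
qed

text \<open>The divisor 4 keeps moved points inside the interval: with \<beta> the scale, \<delta> +
  (\<beta> v + v^2) / 4 \<ge> \<delta> - \<beta>^2 / 16 \<ge> 0 by completing the square, and for
  |v| \<le> 1 and \<delta> \<le> 1/2 the left side is at most 1.\<close>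

definition shift_by :: "nat \<Rightarrow> real \<Rightarrow> real \<Rightarrow> real" where
  "shift_by k \<delta> v = (dyadic_scale k \<delta> * v + v\<^sup>2) / 4"

lemma cdiff_zero_step: "r \<ge> 1 \<Longrightarrow> cdiff r 0 f w = 0"
proof (cases r)
  case (Suc m)
  then show ?thesis unfolding Suc cdiff_Suc by (simp add: cdiff_def)
qed simp

text \<open>Let \<phi> = l sqrt (\<delta> (1 - \<delta>)). Cauchy's estimate is applied on the disc
  of radius 4 r \<phi> / k around t; as |h| \<le> 1 / k, the steps fit into it and the quotient in
  the estimate is |h| k. Every point of the disc is reached by the quadratic curve at a complex v
  with |v| \<le> 64 r / k, and q along the curve has degree at most 2 k, so the node bound applies
  with N = 2 k and A = 128 r.\<close>

lemma bernstein_pointwise: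
  assumes r: "r \<ge> 1"
  shows "\<exists>C>0. \<forall>k\<ge>1. \<forall>q t \<sigma> l \<delta> h. degree q \<le> k \<longrightarrow> \<bar>\<sigma>\<bar> = 1 \<longrightarrow> l > 0 \<longrightarrow> 0 \<le> \<delta> \<longrightarrow> \<delta> \<le> 1 / 2 \<longrightarrow>
    \<bar>h\<bar> \<le> 1 / real k \<longrightarrow>
    norm (cdiff r (of_real (h * (l * sqrt (\<delta> * (1 - \<delta>))))) (poly q)
        (of_real (t - real r / 2 * (h * (l * sqrt (\<delta> * (1 - \<delta>)))))))
    \<le> C * (\<bar>h\<bar> * real k) ^ r * (\<Sum>j\<le>6 * (2 * k).
         norm (poly q (complex_of_real (t + \<sigma> * l * shift_by k \<delta> (node (2 * k) j)))) / (1 + offcentre (2 * k) j) ^ 3)"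
proof -
  obtain C where C: "C > 0" and ker: "\<And>N q w. N \<ge> 1 \<Longrightarrow> degree q \<le> N \<Longrightarrow> norm w \<le> (128 * real r) / real N \<Longrightarrow>
    norm (poly q w) \<le> C * (\<Sum>j\<le>6 * N. norm (poly q (complex_of_real (node N j))) / (1 + offcentre N j) ^ 3)"
    using kernel_bound[of "128 * real r"] by auto
  show ?thesis
  proof (intro exI[of _ C] conjI C allI impI)
    fix k :: nat and q :: "complex poly" and t \<sigma> l \<delta> h :: real
    assume k: "1 \<le> k" and q: "degree q \<le> k" and \<sigma>: "\<bar>\<sigma>\<bar> = 1" and l: "l > 0" and \<delta>: "0 \<le> \<delta>" "\<delta> \<le> 1 / 2"
      and h: "\<bar>h\<bar> \<le> 1 / real k"
    define \<phi> where "\<phi> = l * sqrt (\<delta> * (1 - \<delta>))"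
    define \<beta> where "\<beta> = dyadic_scale k \<delta>"
    define S where "S = (\<Sum>j\<le>6 * (2 * k).
         norm (poly q (complex_of_real (t + \<sigma> * l * shift_by k \<delta> (node (2 * k) j)))) / (1 + offcentre (2 * k) j) ^ 3)"
    define B where "B = C * S"
    have k0: "real k > 0" using k by simp
    have ss: "\<sigma> * \<sigma> = 1" using \<sigma> by (auto simp: abs_if split: if_splits)
    have \<phi>0: "\<phi> \<ge> 0" using l \<delta> unfolding \<phi>_def by simp
    have \<phi>le: "\<phi> \<le> l * sqrt \<delta>"
      unfolding \<phi>_def using l \<delta> by (intro mult_left_mono real_sqrt_le_mono) (auto simp: mult_left_le)
    have B0: "B \<ge> 0" unfolding B_def S_def using C
      by (intro mult_nonneg_nonneg sum_nonneg divide_nonneg_nonneg) (auto simp: offcentre_def)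
    define \<rho> where "\<rho> = 4 * real r * \<phi> / real k"
    define R where "R = pcompose q [: of_real t, of_real (\<sigma> * l * \<beta> / 4), of_real (\<sigma> * l / 4) :]"
    have degR: "degree R \<le> 2 * k"
    proof -
      have "degree [: complex_of_real t, of_real (\<sigma> * l * \<beta> / 4), of_real (\<sigma> * l / 4) :] \<le> 2"
        by simp
      then have "degree q * degree [: complex_of_real t, of_real (\<sigma> * l * \<beta> / 4), of_real (\<sigma> * l / 4) :] \<le> k * 2"
        using q by (intro mult_mono) auto
      then show ?thesis unfolding R_def degree_pcompose by simp
    qed
    have Rev: "poly R v = poly q (of_real t + of_real (\<sigma> * l / 4) * (v\<^sup>2 + of_real \<beta> * v))" for v
      unfolding R_def poly_pcompose
      by (rule arg_cong[of _ _ "poly q"]) (simp add: field_simps power2_eq_square)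
    have Rreal: "poly R (of_real v) = poly q (of_real (t + \<sigma> * l * shift_by k \<delta> v))" for v :: real
      unfolding Rev shift_by_def \<beta>_def[symmetric] by (rule arg_cong[of _ _ "poly q"]) (simp add: field_simps power2_eq_square)
    have bound: "norm (poly q (of_real t + \<eta>)) \<le> B" if \<eta>: "norm \<eta> \<le> \<rho>" for \<eta>
    proof -
      \<comment> \<open>This is \<eta> in the coordinate of the curve: \<sigma> l (v^2 + \<beta> v)
        / 4 = \<eta> amounts to v^2 + \<beta> v = \<kappa>, because \<sigma>^2 = 1.\<close>
      define \<kappa> where "\<kappa> = of_real (4 * \<sigma> / l) * \<eta>"
      have \<kappa>: "norm \<kappa> \<le> 16 * real r * sqrt \<delta> / real k"
      proof -
        have "norm \<kappa> = 4 / l * norm \<eta>" unfolding \<kappa>_def using \<sigma> l by (simp add: norm_mult norm_divide)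
        also have "\<dots> \<le> 4 / l * (4 * real r * (l * sqrt \<delta>) / real k)"
        proof (rule mult_left_mono)
          have "\<rho> \<le> 4 * real r * (l * sqrt \<delta>) / real k"
            unfolding \<rho>_def using \<phi>le k0 by (intro divide_right_mono mult_left_mono) auto
          then show "norm \<eta> \<le> 4 * real r * (l * sqrt \<delta>) / real k" using \<eta> by (rule order_trans[rotated])
        qed (use l in simp)
        also have "\<dots> = 16 * real r * sqrt \<delta> / real k" using l by simp
        finally show ?thesis .
      qed
      have \<beta>b: "0 \<le> \<beta>" "\<beta>\<^sup>2 \<le> \<delta>" "1 / (real k)\<^sup>2 \<le> \<delta> \<Longrightarrow> \<delta> < 4 * \<beta>\<^sup>2"
        unfolding \<beta>_def using dyadic_scale_bounds[OF \<delta> k] by auto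
      obtain v where v: "v\<^sup>2 + of_real \<beta> * v = \<kappa>" "norm v * \<beta> \<le> 2 * norm \<kappa>" "\<beta> = 0 \<longrightarrow> (norm v)\<^sup>2 = norm \<kappa>"
        using quadratic_root[OF \<beta>b(1)] by blast
      \<comment> \<open>Outside the boundary layer sqrt \<delta> \<le> 2 \<beta>, and the bound on
        |v| \<beta> can be divided by \<beta>. Inside it \<beta> = 0, so |v|^2 = |\<kappa>|, and
        sqrt \<delta> \<le> 1 / k supplies the second factor 1 / k.\<close>
      have vb: "norm v \<le> 64 * real r / real k"
      proof (cases "1 / (real k)\<^sup>2 \<le> \<delta>")
        case True
        have \<beta>pos: "\<beta> > 0"
        proof (rule ccontr)
          assume "\<not> \<beta> > 0"
          then have "\<beta> = 0" using \<beta>b(1) by simp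
          then show False using \<beta>b(3)[OF True] \<delta> by simp
        qed
        have "sqrt \<delta> \<le> sqrt (4 * \<beta>\<^sup>2)" using \<beta>b(3)[OF True] by simp
        also have "\<dots> = 2 * \<beta>" using \<beta>pos by (simp add: real_sqrt_mult)
        finally have "16 * real r * sqrt \<delta> / real k \<le> 16 * real r * (2 * \<beta>) / real k"
          using k0 by (intro divide_right_mono mult_left_mono) auto
        then have "norm v * \<beta> \<le> (64 * real r / real k) * \<beta>" using \<kappa> v(2) by simp
        then show ?thesis using \<beta>pos by (rule mult_right_le_imp_le)
      next
        case False
        then have "\<beta> = 0" unfolding \<beta>_def dyadic_scale_def by simp
        then have "(norm v)\<^sup>2 \<le> 16 * real r * sqrt \<delta> / real k" using v(3) \<kappa> by simp
        also have "sqrt \<delta> \<le> 1 / real k"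
          using False k0 \<delta> by (intro real_le_lsqrt) (auto simp: power_divide)
        then have "16 * real r * sqrt \<delta> / real k \<le> 16 * real r * (1 / real k) / real k"
          using k0 by (intro divide_right_mono mult_left_mono) auto
        also have "\<dots> = 16 * real r / (real k)\<^sup>2" by (simp add: power2_eq_square)
        also have "\<dots> \<le> (64 * real r)\<^sup>2 / (real k)\<^sup>2"
        proof (rule divide_right_mono)
          have "16 * real r * 1 \<le> 64 * real r * (64 * real r)" using r by (intro mult_mono) auto
          then show "16 * real r \<le> (64 * real r)\<^sup>2" by (simp add: power2_eq_square)
        qed simp
        also have "\<dots> = (64 * real r / real k)\<^sup>2" by (simp add: power_divide)
        finally show ?thesis by (rule power2_le_imp_le) simp
      qed
      have \<eta>eq: "of_real (\<sigma> * l / 4) * \<kappa> = \<eta>"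
      proof -
        have "(\<sigma> * l / 4) * (4 * \<sigma> / l) = 1" using l ss by (simp add: field_simps)
        then have "complex_of_real (\<sigma> * l / 4) * of_real (4 * \<sigma> / l) = 1"
          by (metis of_real_1 of_real_mult)
        then show ?thesis unfolding \<kappa>_def by (metis mult.assoc mult_1)
      qed
      have "norm (poly R v) \<le> C * (\<Sum>j\<le>6 * (2 * k). norm (poly R (complex_of_real (node (2 * k) j))) / (1 + offcentre (2 * k) j) ^ 3)"
        using vb k degR by (intro ker) auto
      then have "norm (poly R v) \<le> B" unfolding Rreal S_def[symmetric] B_def .
      then show ?thesis unfolding Rev v(1) \<eta>eq .
    qed
    have shift: "cdiff r (of_real (h * \<phi>)) (poly q) (of_real (t - real r / 2 * (h * \<phi>)))
        = cdiff r (of_real (h * \<phi>)) (\<lambda>x. poly q (of_real t + x)) (of_real (- (real r / 2 * (h * \<phi>))))"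
      unfolding cdiff_def by (simp add: algebra_simps)
    have "norm (cdiff r (of_real (h * \<phi>)) (poly q) (of_real (t - real r / 2 * (h * \<phi>)))) \<le> B * (\<bar>h\<bar> * real k) ^ r"
    \<comment> \<open>At an endpoint, where \<delta> = 0, the disc degenerates, but so does the
      step.\<close>
    proof (cases "\<phi> = 0")
      case True
      then show ?thesis using B0 by (simp add: cdiff_zero_step[OF r])
    next
      case False
      then have \<phi>pos: "\<phi> > 0" using \<phi>0 by simp
      have \<rho>pos: "\<rho> > 0" unfolding \<rho>_def using \<phi>pos k0 r by simp
      have nb: "norm (complex_of_real (h * \<phi>)) = \<bar>h\<bar> * \<phi>" using \<phi>pos by (simp add: norm_mult)
      have hk: "\<bar>h\<bar> * \<phi> \<le> \<phi> / real k" using mult_right_mono[OF h \<phi>0] by simp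
      have s4: "4 * real r * norm (complex_of_real (h * \<phi>)) \<le> \<rho>"
        unfolding nb \<rho>_def using mult_left_mono[OF hk, of "4 * real r"] by simp
      have "norm (cdiff r (of_real (h * \<phi>)) (\<lambda>x. poly q (of_real t + x)) (of_real (- (real r / 2 * (h * \<phi>)))))
         \<le> B * (4 * real r * norm (complex_of_real (h * \<phi>)) / \<rho>) ^ r"
      proof (rule norm_cdiff_le)
        show "norm (complex_of_real (- (real r / 2 * (h * \<phi>)))) \<le> \<rho> / 2"
        proof -
          have "0 \<le> real r * (\<bar>h\<bar> * \<phi>)" using \<phi>pos by simp
          then have "real r * (\<bar>h\<bar> * \<phi>) \<le> \<rho>" using s4 unfolding nb by linarith
          then show ?thesis using \<phi>pos by (simp add: norm_mult abs_mult)
        qed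
      qed (use bound r \<rho>pos s4 in \<open>auto intro!: holomorphic_intros\<close>)
      also have "4 * real r * norm (complex_of_real (h * \<phi>)) / \<rho> = \<bar>h\<bar> * real k"
        unfolding nb \<rho>_def using \<phi>pos k0 r by (simp add: field_simps)
      finally show ?thesis unfolding shift .
    qed
    moreover have "B * (\<bar>h\<bar> * real k) ^ r = C * (\<bar>h\<bar> * real k) ^ r * S"
      unfolding B_def S_def[symmetric] by (rule mult.commute[of "C * S", THEN trans]) (simp only: mult.left_commute mult.assoc mult.commute)
    ultimately show "norm (cdiff r (of_real (h * (l * sqrt (\<delta> * (1 - \<delta>))))) (poly q)
        (of_real (t - real r / 2 * (h * (l * sqrt (\<delta> * (1 - \<delta>)))))))
    \<le> C * (\<bar>h\<bar> * real k) ^ r * (\<Sum>j\<le>6 * (2 * k).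
         norm (poly q (complex_of_real (t + \<sigma> * l * shift_by k \<delta> (node (2 * k) j)))) / (1 + offcentre (2 * k) j) ^ 3)"
      unfolding \<phi>_def[symmetric] S_def[symmetric] by simp
  qed
qed

lemma shift_by_bounds:
  assumes "0 \<le> \<delta>" "\<delta> \<le> 1 / 2" "k \<ge> 1" "\<bar>v\<bar> \<le> 1"
  shows "0 \<le> \<delta> + shift_by k \<delta> v" "\<delta> + shift_by k \<delta> v \<le> 1"
proof -
  define \<beta> where "\<beta> = dyadic_scale k \<delta>"
  have \<beta>: "0 \<le> \<beta>" "\<beta> \<le> 1" "\<beta>\<^sup>2 \<le> \<delta>" unfolding \<beta>_def using dyadic_scale_bounds[OF assms(1-3)] by auto
  have "(v + \<beta> / 2)\<^sup>2 \<ge> 0" by simp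
  then have "\<beta> * v + v\<^sup>2 \<ge> - (\<beta>\<^sup>2) / 4" by (simp add: power2_eq_square algebra_simps)
  moreover define x where "x = \<beta> * v + v\<^sup>2"
  moreover have "0 \<le> \<beta>\<^sup>2" by simp
  ultimately have "0 \<le> \<delta> + x / 4" using \<beta>(3) by linarith
  then show "0 \<le> \<delta> + shift_by k \<delta> v" unfolding shift_by_def \<beta>_def[symmetric] x_def .
  have "\<beta> * v \<le> 1" using mult_mono[of \<beta> 1 "\<bar>v\<bar>" 1] \<beta> assms(4)
    by (smt (verit) mult_left_mono)
  moreover have "v\<^sup>2 \<le> 1" using assms(4) by (simp add: abs_square_le_1)
  ultimately show "\<delta> + shift_by k \<delta> v \<le> 1" unfolding shift_by_def \<beta>_def[symmetric] using assms by (simp add: field_simps)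
qed

section \<open>Moving a half interval inwards by dyadic blocks\<close>

lemma nn_integral_translate:
  fixes F :: "'a::euclidean_space \<Rightarrow> ennreal"
  assumes [measurable]: "F \<in> borel_measurable borel"
  shows "(\<integral>\<^sup>+x. F (x + c) \<partial>lborel) = (\<integral>\<^sup>+x. F x \<partial>lborel)"
proof -
  have "(\<integral>\<^sup>+x. F x \<partial>lborel) = (\<integral>\<^sup>+x. F x \<partial>distr lborel borel ((+) c))"
    by (simp add: lborel_distr_plus)
  also have "\<dots> = (\<integral>\<^sup>+x. F (c + x) \<partial>lborel)"
    by (subst nn_integral_distr) auto
  finally show ?thesis by (simp add: add.commute)
qed

lemma nn_integral_reflect:
  fixes F :: "real \<Rightarrow> ennreal"
  assumes "F \<in> borel_measurable borel"
  shows "(\<integral>\<^sup>+x. F (c - x) \<partial>lborel) = (\<integral>\<^sup>+x. F x \<partial>lborel)"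
  using nn_integral_real_affine[OF assms, of "-1" c] by simp

lemma card_le_of_diff_le_one:
  assumes "finite (J :: nat set)" "\<And>i j. i \<in> J \<Longrightarrow> j \<in> J \<Longrightarrow> i \<le> j \<Longrightarrow> j \<le> i + 1"
  shows "card J \<le> 2"
proof (cases "J = {}")
  case False
  define m where "m = Min J"
  have "m \<in> J" "\<And>j. j \<in> J \<Longrightarrow> m \<le> j" unfolding m_def using False assms(1) by auto
  then have "J \<subseteq> {m, m + 1}" using assms(2)[of m] by fastforce
  then show ?thesis using card_mono[of "{m, m + 1}" J] by simp
qed simp

text \<open>Between the extreme exponents m and M there are at most M - m + 1 \<le> 2^(M - m) = 2^M
  / 2^m of them.\<close>

lemma card_powers_of_two_le:
  assumes "\<alpha> > 0" "finite J" "\<And>i. i \<in> J \<Longrightarrow> \<alpha> < 2 ^ i \<and> 2 ^ i < \<gamma>" "0 \<le> \<gamma> / (\<alpha>::real)"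
  shows "real (card J) \<le> \<gamma> / \<alpha>"
proof (cases "J = {}")
  case False
  define m M where "m = Min J" and "M = Max J"
  have mM: "m \<in> J" "M \<in> J" "\<And>j. j \<in> J \<Longrightarrow> m \<le> j \<and> j \<le> M" "m \<le> M"
    unfolding m_def M_def using False assms(2) by auto
  then have "J \<subseteq> {m..M}" by auto
  then have "card J \<le> card {m..M}" by (intro card_mono) auto
  then have "card J \<le> Suc (M - m)" using mM(4) by simp
  also have "\<dots> \<le> 2 ^ (M - m)" using less_exp[of "M - m"] by linarith
  finally have "real (card J) \<le> 2 ^ (M - m)" by (metis of_nat_le_iff of_nat_numeral of_nat_power)
  also have "\<dots> = 2 ^ M / 2 ^ m" using mM(4) by (simp add: power_diff)
  also have "\<dots> \<le> \<gamma> / \<alpha>"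
    using assms(1) assms(3)[OF mM(1)] assms(3)[OF mM(2)] by (intro frac_le) (auto intro: order_trans[OF _ less_imp_le])
  finally show ?thesis .
qed (use assms in simp)

lemma finite_powers_less: "finite {i. (2::real) ^ i < c}"
proof -
  obtain n where n: "c < 2 ^ n" using real_arch_pow[of 2 c] by auto
  have "{i. (2::real) ^ i < c} \<subseteq> {..<n}"
  proof
    fix i assume "i \<in> {i. (2::real) ^ i < c}"
    then have "(2::real) ^ i < 2 ^ n" using n by (metis less_trans mem_Collect_eq)
    then show "i \<in> {..<n}" using power_less_imp_less_exp[of "2::real" i n] by simp
  qed
  then show ?thesis by (rule finite_subset) simp
qed

text \<open>After the move the blocks overlap at most 2 + k |v| times: while |v| is below the scale, each block
stays essentially in place; the remaining scales lie between 1/(2k) and |v|/2. The growth in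
k |v| is absorbed by the decay of the kernel.\<close>

lemma dyadic_overlap:
  assumes k: "k \<ge> 1" and v: "\<bar>v\<bar> \<le> 1" and I: "I = {i. (2::real) ^ i < 2 * real k}"
  shows "real (card {i \<in> I. (1 / 4) ^ i \<le> y - ((1 / 2) ^ i * v + v\<^sup>2) / 4 \<and> y - ((1 / 2) ^ i * v + v\<^sup>2) / 4 < 4 * (1 / 4) ^ i})
    \<le> 2 + real k * \<bar>v\<bar>"
proof -
  have finI: "finite I" unfolding I by (rule finite_powers_less)
  define S where "S = {i \<in> I. (1 / 4) ^ i \<le> y - ((1 / 2) ^ i * v + v\<^sup>2) / 4 \<and> y - ((1 / 2) ^ i * v + v\<^sup>2) / 4 < 4 * (1 / 4) ^ i}"
  define S1 where "S1 = {i \<in> S. \<bar>v\<bar> \<le> 2 * (1 / 2) ^ i}"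
  define S2 where "S2 = {i \<in> S. \<not> \<bar>v\<bar> \<le> 2 * (1 / 2) ^ i}"
  have fin: "finite S" "finite S1" "finite S2" using finI by (auto simp: S_def S1_def S2_def)
  have sq: "((1 / 2) ^ i)\<^sup>2 = (1 / 4 :: real) ^ i" for i
    by (simp add: power2_eq_square power_mult_distrib[symmetric])
  \<comment> \<open>While |v| \<le> 2 \<beta>, the terms \<beta> v and v^2 are at most 2 \<beta>^2
    and 4 \<beta>^2, so 2 y lies between \<beta>^2 and 11 \<beta>^2. Levels two or more apart differ
    by at least 16 in \<beta>^2 and cannot share a y.\<close>
  have b1: "(1 / 4) ^ i \<le> 2 * y \<and> y < 11 / 2 * (1 / 4) ^ i" if "i \<in> S1" for i
  proof -
    define \<beta> :: real where "\<beta> = (1 / 2) ^ i"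
    have \<beta>: "\<beta> > 0" "\<bar>v\<bar> \<le> 2 * \<beta>" "\<beta>\<^sup>2 \<le> y - (\<beta> * v + v\<^sup>2) / 4" "y - (\<beta> * v + v\<^sup>2) / 4 < 4 * \<beta>\<^sup>2"
      using that unfolding S1_def S_def \<beta>_def by (auto simp: sq)
    have "\<bar>\<beta> * v\<bar> \<le> \<beta> * (2 * \<beta>)" using \<beta> by (simp add: abs_mult)
    then have 1: "\<bar>\<beta> * v\<bar> \<le> 2 * \<beta>\<^sup>2" by (simp add: power2_eq_square)
    have "\<bar>v\<bar>\<^sup>2 \<le> (2 * \<beta>)\<^sup>2" using \<beta> by (intro power_mono) auto
    then have 2: "v\<^sup>2 \<le> 4 * \<beta>\<^sup>2" by (simp add: power_mult_distrib)
    have 3: "4 * y - \<beta> * v - v\<^sup>2 < 16 * \<beta>\<^sup>2" "4 * \<beta>\<^sup>2 \<le> 4 * y - \<beta> * v - v\<^sup>2"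
      using \<beta>(3,4) by (simp_all add: field_simps)
    have "0 \<le> v\<^sup>2" by simp
    then have "\<beta>\<^sup>2 \<le> 2 * y" "y < 11 / 2 * \<beta>\<^sup>2" using 1 2 3 by linarith+
    then show ?thesis unfolding \<beta>_def sq by simp
  qed
  have "card S1 \<le> 2"
  proof (rule card_le_of_diff_le_one[OF fin(2)])
    fix i j assume ij: "i \<in> S1" "j \<in> S1" "i \<le> j"
    show "j \<le> i + 1"
    proof (rule ccontr)
      assume "\<not> j \<le> i + 1"
      then obtain d where d: "j = i + 2 + d" using le_Suc_ex by (metis add.assoc not_less_eq_eq Suc_eq_plus1 add_2_eq_Suc')
      have "(1 / 4 :: real) ^ j = (1 / 4) ^ i * (1 / 16) * (1 / 4) ^ d" unfolding d by (simp add: power_add power2_eq_square)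
      also have "\<dots> \<le> (1 / 4) ^ i * (1 / 16) * 1" by (intro mult_left_mono) (auto simp: power_le_one)
      finally have "(1 / 4 :: real) ^ j \<le> (1 / 4) ^ i * (1 / 16)" by simp
      moreover have "0 < (1 / 4 :: real) ^ i" by simp
      ultimately show False using b1[OF ij(1)] b1[OF ij(2)] by linarith
    qed
  qed
  moreover have "real (card S2) \<le> real k * \<bar>v\<bar>"
  proof (cases "v = 0")
    case True
    then have "S2 = {}" by (auto simp: S2_def)
    then show ?thesis by simp
  next
    case False
    \<comment> \<open>For these levels 2 / |v| < 2^i < 2 k; the upper bound is the cut-off by the
      boundary layer.\<close>
    have "real (card S2) \<le> (2 * real k) / (2 / \<bar>v\<bar>)"
    proof (rule card_powers_of_two_le[OF _ fin(3)])
      fix i assume i: "i \<in> S2"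
      then have "2 * (1 / 2) ^ i < \<bar>v\<bar>" "(2::real) ^ i < 2 * real k" by (auto simp: S2_def S_def I)
      then show "2 / \<bar>v\<bar> < 2 ^ i \<and> (2::real) ^ i < 2 * real k"
        using False by (simp add: field_simps power_one_over)
    qed (use False in auto)
    then show ?thesis by simp
  qed
  moreover have "card S \<le> card S1 + card S2"
    using card_Un_le[of S1 S2] by (simp add: S1_def S2_def Collect_disj_eq[symmetric] conj_disj_distribL[symmetric])
  ultimately show ?thesis unfolding S_def[symmetric] by linarith
qed

text \<open>On the boundary layer and on each block of constant scale the move is a translation. W
  adds up the translated integrands of all of them, so its integral is that of F times the number of
  moved blocks over a point: 1 for the layer and at most 2 + k |v| for the blocks.\<close>

lemma half_interval_majorant:
  fixes F :: "real \<Rightarrow> ennreal"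
  assumes l: "l > 0" and k: "k \<ge> 1" and v: "\<bar>v\<bar> \<le> 1" and F[measurable]: "F \<in> borel_measurable borel"
  shows "\<exists>W\<in>borel_measurable borel.
    (\<forall>t\<in>{a..a + l / 2}. F (t + l * shift_by k ((t - a) / l) v) \<le> W t) \<and>
    (\<integral>\<^sup>+t. W t \<partial>lborel) \<le> ennreal (3 + real k * \<bar>v\<bar>) * (\<integral>\<^sup>+t\<in>{a..a + l}. F t \<partial>lborel)"
proof -
  \<comment> \<open>Exactly these levels can occur: 1 / k^2 \<le> \<delta> < 4 (1/4)^i forces 2^i <
    2 k.\<close>
  define I where "I = {i. (2::real) ^ i < 2 * real k}"
  have finI: "finite I" unfolding I_def by (rule finite_powers_less)
  define E where "E t = F t * indicator {a..a + l} t" for t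
  have E[measurable]: "E \<in> borel_measurable borel" unfolding E_def by measurable
  define c where "c i = ((1 / 2) ^ i * v + v\<^sup>2) / 4" for i
  define B where "B i = {t. (1 / 4) ^ i \<le> (t - a) / l \<and> (t - a) / l < 4 * (1 / 4) ^ i}" for i
  have B[measurable]: "B i \<in> sets borel" for i unfolding B_def by measurable
  define W where "W t = E (t + l * (v\<^sup>2 / 4)) + (\<Sum>i\<in>I. indicator (B i) t * E (t + l * c i))" for t
  show ?thesis
  proof (intro bexI[of _ W] conjI ballI)
    show "W \<in> borel_measurable borel" unfolding W_def by measurable
    fix t assume t: "t \<in> {a..a + l / 2}"
    define \<delta> where "\<delta> = (t - a) / l"
    have \<delta>: "0 \<le> \<delta>" "\<delta> \<le> 1 / 2" "t = a + l * \<delta>" using t l unfolding \<delta>_def by (auto simp: field_simps)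
    have "t + l * shift_by k \<delta> v = a + l * (\<delta> + shift_by k \<delta> v)" unfolding \<delta>(3) by (simp add: algebra_simps)
    moreover have "l * (\<delta> + shift_by k \<delta> v) \<in> {0..l}"
      using shift_by_bounds[OF \<delta>(1,2) k v] l by (auto simp: mult_left_le)
    ultimately have EF: "F (t + l * shift_by k \<delta> v) = E (t + l * shift_by k \<delta> v)" unfolding E_def by simp
    have "E (t + l * shift_by k \<delta> v) \<le> W t"
    proof (cases "\<delta> < 1 / (real k)\<^sup>2")
      case True
      then have "shift_by k \<delta> v = v\<^sup>2 / 4" unfolding shift_by_def dyadic_scale_def by simp
      then have "E (t + l * shift_by k \<delta> v) = E (t + l * (v\<^sup>2 / 4))" by (rule arg_cong)
      then show ?thesis unfolding W_def by (simp add: add_increasing2 del: times_divide_eq_right)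
    next
      case False
      define i where "i = dyadic_level \<delta>"
      have "0 < 1 / (real k)\<^sup>2" using k by simp
      then have d01: "0 < \<delta>" "\<delta> < 1" using False \<delta> by linarith+
      have lev: "(1 / 4) ^ i \<le> \<delta>" "\<delta> < 4 * (1 / 4) ^ i" using dyadic_level_bounds[OF d01] unfolding i_def by auto
      have sh: "shift_by k \<delta> v = c i" unfolding shift_by_def dyadic_scale_def c_def i_def using False by simp
      have "((1 / 2 :: real) ^ i)\<^sup>2 = (1 / 4) ^ i" by (simp add: power2_eq_square power_mult_distrib[symmetric])
      then have "(1 / real k)\<^sup>2 < (2 * (1 / 2) ^ i)\<^sup>2" using lev(2) False by (simp add: power_divide power_mult_distrib)
      then have "1 / real k < 2 * (1 / 2) ^ i" by (rule power2_less_imp_less) simp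
      then have "i \<in> I" unfolding I_def using k by (simp add: field_simps power_one_over)
      moreover have "t \<in> B i" using lev unfolding B_def \<delta>_def by simp
      ultimately have "E (t + l * c i) \<le> (\<Sum>i\<in>I. indicator (B i) t * E (t + l * c i))"
        using member_le_sum[of i I "\<lambda>i. indicator (B i) t * E (t + l * c i)"] finI by simp
      then show ?thesis unfolding sh W_def by (simp add: add_increasing)
    qed
    then show "F (t + l * shift_by k ((t - a) / l) v) \<le> W t" using EF unfolding \<delta>_def by simp
  next
    have "(\<integral>\<^sup>+t. W t \<partial>lborel) = (\<integral>\<^sup>+t. E (t + l * (v\<^sup>2 / 4)) \<partial>lborel)
        + (\<Sum>i\<in>I. \<integral>\<^sup>+t. indicator (B i) t * E (t + l * c i) \<partial>lborel)"
      unfolding W_def by (subst nn_integral_add) (auto intro!: nn_integral_sum)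
    also have "(\<integral>\<^sup>+t. E (t + l * (v\<^sup>2 / 4)) \<partial>lborel) = (\<integral>\<^sup>+t. E t \<partial>lborel)"
      by (rule nn_integral_translate) simp
    also have "(\<Sum>i\<in>I. \<integral>\<^sup>+t. indicator (B i) t * E (t + l * c i) \<partial>lborel)
       = (\<Sum>i\<in>I. \<integral>\<^sup>+y. indicator (B i) (y - l * c i) * E y \<partial>lborel)"
    proof (rule sum.cong[OF refl])
      fix i
      have "(\<integral>\<^sup>+y. indicator (B i) (y - l * c i) * E y \<partial>lborel)
          = (\<integral>\<^sup>+t. (\<lambda>y. indicator (B i) (y - l * c i) * E y) (t + l * c i) \<partial>lborel)"
        by (rule nn_integral_translate[symmetric]) measurable
      then show "(\<integral>\<^sup>+t. indicator (B i) t * E (t + l * c i) \<partial>lborel) = (\<integral>\<^sup>+y. indicator (B i) (y - l * c i) * E y \<partial>lborel)"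
        by simp
    qed
    also have "\<dots> = (\<integral>\<^sup>+y. (\<Sum>i\<in>I. indicator (B i) (y - l * c i) * E y) \<partial>lborel)"
      by (rule nn_integral_sum[symmetric]) measurable
    also have "\<dots> \<le> (\<integral>\<^sup>+y. ennreal (2 + real k * \<bar>v\<bar>) * E y \<partial>lborel)"
    proof (rule nn_integral_mono)
      fix y :: real
      have "(\<Sum>i\<in>I. indicator (B i) (y - l * c i) :: ennreal) = of_nat (card {i \<in> I. y - l * c i \<in> B i})"
        using finI by (simp add: indicator_def sum.If_cases Int_def)
      also have "{i \<in> I. y - l * c i \<in> B i} = {i \<in> I. (1 / 4) ^ i \<le> (y - a) / l - ((1 / 2) ^ i * v + v\<^sup>2) / 4 \<and>
           (y - a) / l - ((1 / 2) ^ i * v + v\<^sup>2) / 4 < 4 * (1 / 4) ^ i}"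
      proof -
        have "(y - l * c i - a) / l = (y - a) / l - ((1 / 2) ^ i * v + v\<^sup>2) / 4" for i
          using l unfolding c_def by (simp add: diff_divide_distrib)
        then show ?thesis unfolding B_def by simp
      qed
      also have "of_nat (card \<dots>) \<le> ennreal (2 + real k * \<bar>v\<bar>)"
        unfolding ennreal_of_nat_eq_real_of_nat
        by (rule ennreal_leI) (rule dyadic_overlap[OF k v I_def])
      finally show "(\<Sum>i\<in>I. indicator (B i) (y - l * c i) * E y) \<le> ennreal (2 + real k * \<bar>v\<bar>) * E y"
        unfolding sum_distrib_right[symmetric] by (rule mult_right_mono) simp
    qed
    also have "\<dots> = ennreal (2 + real k * \<bar>v\<bar>) * (\<integral>\<^sup>+y. E y \<partial>lborel)"
      by (rule nn_integral_cmult) simp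
    also have "(\<integral>\<^sup>+y. E y \<partial>lborel) + ennreal (2 + real k * \<bar>v\<bar>) * (\<integral>\<^sup>+y. E y \<partial>lborel)
       = ennreal (3 + real k * \<bar>v\<bar>) * (\<integral>\<^sup>+y. E y \<partial>lborel)"
    proof -
      have "ennreal (3 + real k * \<bar>v\<bar>) = 1 + ennreal (2 + real k * \<bar>v\<bar>)"
        by (subst ennreal_1[symmetric], subst ennreal_plus[symmetric]) auto
      then show ?thesis by (simp only: distrib_right mult_1)
    qed
    finally show "(\<integral>\<^sup>+t. W t \<partial>lborel) \<le> ennreal (3 + real k * \<bar>v\<bar>) * (\<integral>\<^sup>+t\<in>{a..a + l}. F t \<partial>lborel)"
      unfolding E_def by (simp add: add_left_mono)
  qed
qed

section \<open>Bernstein's inequality on [a, b] from the two half intervals\<close>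

definition rel_depth :: "real \<Rightarrow> real \<Rightarrow> real \<Rightarrow> real" where
  "rel_depth a b t = (if t - a \<le> b - t then (t - a) / (b - a) else (b - t) / (b - a))"

definition inward :: "real \<Rightarrow> real \<Rightarrow> real \<Rightarrow> real" where
  "inward a b t = (if t - a \<le> b - t then 1 else - 1)"

definition moved :: "real \<Rightarrow> real \<Rightarrow> nat \<Rightarrow> real \<Rightarrow> real \<Rightarrow> real" where
  "moved a b k v t = t + inward a b t * (b - a) * shift_by k (rel_depth a b t) v"

lemma rel_depth_bounds:
  assumes "a < b" "t \<in> {a..b}"
  shows "0 \<le> rel_depth a b t" "rel_depth a b t \<le> 1 / 2"
    "(b - a) * sqrt (rel_depth a b t * (1 - rel_depth a b t)) = sqrt ((t - a) * (b - t))"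
proof -
  define l where "l = b - a"
  have l: "l > 0" "b = a + l" using assms unfolding l_def by auto
  show "0 \<le> rel_depth a b t" "rel_depth a b t \<le> 1 / 2"
    using assms l unfolding rel_depth_def by (auto simp: field_simps)
  have "(t - a) * (b - t) = l\<^sup>2 * (rel_depth a b t * (1 - rel_depth a b t))"
    unfolding rel_depth_def using l by (simp add: power2_eq_square field_simps)
  then show "(b - a) * sqrt (rel_depth a b t * (1 - rel_depth a b t)) = sqrt ((t - a) * (b - t))"
    using l unfolding l_def[symmetric] by (simp add: real_sqrt_mult)
qed

lemma moved_in:
  assumes "a < b" "t \<in> {a..b}" "k \<ge> 1" "\<bar>v\<bar> \<le> 1"
  shows "moved a b k v t \<in> {a..b}"
proof -
  define s where "s = rel_depth a b t + shift_by k (rel_depth a b t) v"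
  have s: "0 \<le> s" "s \<le> 1"
    unfolding s_def using shift_by_bounds[OF rel_depth_bounds(1,2)[OF assms(1,2)] assms(3,4)] by auto
  have ls: "0 \<le> (b - a) * s" "(b - a) * s \<le> b - a" using s assms(1) by (auto simp: mult_left_le)
  have "moved a b k v t = (if t - a \<le> b - t then a + (b - a) * s else b - (b - a) * s)"
    unfolding moved_def s_def inward_def rel_depth_def using assms(1) by (simp add: distrib_left) (simp add: algebra_simps)
  then show ?thesis using ls by auto
qed

text \<open>Reflection at the midpoint carries the right half to the left one and reverses the
  inward direction; the two majorants are added, hence the factor 2.\<close>

lemma moved_majorant:
  fixes F :: "real \<Rightarrow> ennreal"
  assumes ab: "a < b" and k: "k \<ge> 1" and v: "\<bar>v\<bar> \<le> 1" and F[measurable]: "F \<in> borel_measurable borel"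
  shows "\<exists>W\<in>borel_measurable borel. (\<forall>t\<in>{a..b}. F (moved a b k v t) \<le> W t) \<and>
    (\<integral>\<^sup>+t. W t \<partial>lborel) \<le> ennreal (2 * (3 + real k * \<bar>v\<bar>)) * (\<integral>\<^sup>+t\<in>{a..b}. F t \<partial>lborel)"
proof -
  define l where "l = b - a"
  have l: "l > 0" "a + l = b" using ab unfolding l_def by auto
  obtain W1 where W1[measurable]: "W1 \<in> borel_measurable borel"
    and W1F: "\<And>t. t \<in> {a..a + l / 2} \<Longrightarrow> F (t + l * shift_by k ((t - a) / l) v) \<le> W1 t"
    and W1i: "(\<integral>\<^sup>+t. W1 t \<partial>lborel) \<le> ennreal (3 + real k * \<bar>v\<bar>) * (\<integral>\<^sup>+t\<in>{a..b}. F t \<partial>lborel)"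
    using half_interval_majorant[OF l(1) k v F, of a] unfolding l(2) by blast
  have G[measurable]: "(\<lambda>x. F (a + b - x)) \<in> borel_measurable borel" by measurable
  obtain W2 where W2[measurable]: "W2 \<in> borel_measurable borel"
    and W2F: "\<And>t. t \<in> {a..a + l / 2} \<Longrightarrow> F (a + b - (t + l * shift_by k ((t - a) / l) v)) \<le> W2 t"
    and W2i: "(\<integral>\<^sup>+t. W2 t \<partial>lborel) \<le> ennreal (3 + real k * \<bar>v\<bar>) * (\<integral>\<^sup>+t\<in>{a..b}. F (a + b - t) \<partial>lborel)"
    using half_interval_majorant[OF l(1) k v G, of a] unfolding l(2) by blast
  have refl: "(\<integral>\<^sup>+t\<in>{a..b}. F (a + b - t) \<partial>lborel) = (\<integral>\<^sup>+t\<in>{a..b}. F t \<partial>lborel)"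
  proof -
    have "(\<integral>\<^sup>+t\<in>{a..b}. F t \<partial>lborel) = (\<integral>\<^sup>+t. F (a + b - t) * indicator {a..b} (a + b - t) \<partial>lborel)"
      by (rule nn_integral_reflect[symmetric]) measurable
    also have "\<dots> = (\<integral>\<^sup>+t\<in>{a..b}. F (a + b - t) \<partial>lborel)"
      by (intro nn_integral_cong) (auto split: split_indicator)
    finally show ?thesis ..
  qed
  show ?thesis
  proof (intro bexI[of _ "\<lambda>t. W1 t + W2 (a + b - t)"] conjI ballI)
    fix t assume t: "t \<in> {a..b}"
    show "F (moved a b k v t) \<le> W1 t + W2 (a + b - t)"
    proof (cases "t - a \<le> b - t")
      case True
      then have "t \<in> {a..a + l / 2}" using t unfolding l_def by (auto simp: field_simps)
      from W1F[OF this] show ?thesis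
        unfolding moved_def inward_def rel_depth_def l_def using True by (simp add: add_increasing2)
    next
      case False
      then have "a + b - t \<in> {a..a + l / 2}" using t unfolding l_def by (auto simp: field_simps)
      from W2F[OF this] have "F (t - l * shift_by k ((b - t) / l) v) \<le> W2 (a + b - t)"
        by (simp add: algebra_simps)
      moreover have "moved a b k v t = t - l * shift_by k ((b - t) / l) v"
        unfolding moved_def inward_def rel_depth_def l_def using False by (simp add: algebra_simps)
      ultimately show ?thesis by (simp add: add_increasing)
    qed
  next
    have "(\<integral>\<^sup>+t. W1 t + W2 (a + b - t) \<partial>lborel) = (\<integral>\<^sup>+t. W1 t \<partial>lborel) + (\<integral>\<^sup>+t. W2 t \<partial>lborel)"
      by (subst nn_integral_add) (auto simp: nn_integral_reflect)
    also have "\<dots> \<le> ennreal (3 + real k * \<bar>v\<bar>) * (\<integral>\<^sup>+t\<in>{a..b}. F t \<partial>lborel)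
        + ennreal (3 + real k * \<bar>v\<bar>) * (\<integral>\<^sup>+t\<in>{a..b}. F t \<partial>lborel)"
      using W1i W2i unfolding refl by (rule add_mono)
    also have "\<dots> = ennreal (2 * (3 + real k * \<bar>v\<bar>)) * (\<integral>\<^sup>+t\<in>{a..b}. F t \<partial>lborel)"
    proof -
      have "ennreal (2 * (3 + real k * \<bar>v\<bar>)) = ennreal (3 + real k * \<bar>v\<bar>) + ennreal (3 + real k * \<bar>v\<bar>)"
        by (subst ennreal_plus[symmetric]) auto
      then show ?thesis by (simp add: distrib_right)
    qed
    finally show "(\<integral>\<^sup>+t. W1 t + W2 (a + b - t) \<partial>lborel) \<le> ennreal (2 * (3 + real k * \<bar>v\<bar>)) * (\<integral>\<^sup>+t\<in>{a..b}. F t \<partial>lborel)" .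
  qed measurable
qed

definition phi_diff :: "nat \<Rightarrow> real \<Rightarrow> real \<Rightarrow> real \<Rightarrow> (complex \<Rightarrow> complex) \<Rightarrow> real \<Rightarrow> complex" where
  "phi_diff r h a b f t = (let s = h * sqrt ((t - a) * (b - t))
     in cdiff r (of_real s) f (of_real (t - real r / 2 * s)))"

lemma borel_measurable_poly_of_real [measurable]:
  "(\<lambda>x::real. poly q (complex_of_real x)) \<in> borel_measurable borel"
  by (intro borel_measurable_continuous_onI continuous_intros)

lemma abs_node_le_one: "\<bar>node N j\<bar> \<le> 1"
  unfolding node_def by simp

text \<open>The overlap factor 3 + k |v_j| is at most 3 (1 + \<open>offcentre\<close>), since k
  |v_j| \<le> \<open>offcentre\<close> for the nodes with N = 2 k. It uses up one of the three
  powers of decay and leaves a sum of inverse squares.\<close>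

lemma bernstein_interval:
  assumes r: "r \<ge> 1"
  shows "\<exists>C>0. \<forall>k\<ge>1. \<forall>q a b h. degree q \<le> k \<longrightarrow> a < b \<longrightarrow> \<bar>h\<bar> \<le> 1 / real k \<longrightarrow>
    (\<forall>t\<in>{a..b}. \<forall>B. (\<forall>x\<in>{a..b}. norm (poly q (complex_of_real x)) \<le> B) \<longrightarrow>
       norm (phi_diff r h a b (poly q) t) \<le> C * (\<bar>h\<bar> * real k) ^ r * B) \<and>
    (\<forall>p\<ge>1. (\<integral>\<^sup>+t\<in>{a..b}. ennreal (norm (phi_diff r h a b (poly q) t) powr p) \<partial>lborel)
       \<le> ennreal ((C * (\<bar>h\<bar> * real k) ^ r) powr p) *
         (\<integral>\<^sup>+t\<in>{a..b}. ennreal (norm (poly q (complex_of_real t)) powr p) \<partial>lborel))"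
proof -
  obtain C where C: "C > 0" and pw: "\<And>k q t \<sigma> l \<delta> h. k \<ge> 1 \<Longrightarrow> degree q \<le> k \<Longrightarrow> \<bar>\<sigma>\<bar> = 1 \<Longrightarrow> l > 0 \<Longrightarrow> 0 \<le> \<delta> \<Longrightarrow> \<delta> \<le> 1 / 2 \<Longrightarrow>
    \<bar>h\<bar> \<le> 1 / real k \<Longrightarrow>
    norm (cdiff r (of_real (h * (l * sqrt (\<delta> * (1 - \<delta>))))) (poly q)
        (of_real (t - real r / 2 * (h * (l * sqrt (\<delta> * (1 - \<delta>)))))))
    \<le> C * (\<bar>h\<bar> * real k) ^ r * (\<Sum>j\<le>6 * (2 * k).
         norm (poly q (complex_of_real (t + \<sigma> * l * shift_by k \<delta> (node (2 * k) j)))) / (1 + offcentre (2 * k) j) ^ 3)"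
    using bernstein_pointwise[OF r] by blast
  show ?thesis
  \<comment> \<open>96 = 4 * 24: Jensen with total weight at most 4 contributes 4^(p - 1), and the
    overlap contributes 6 * 4 = 24 \<le> 24^p. One constant thus serves every p and the uniform
    norm.\<close>
  proof (intro exI[of _ "96 * C"] conjI allI impI ballI)
    show "96 * C > 0" using C by simp
  next
    fix k :: nat and q :: "complex poly" and a b h :: real
    assume k: "1 \<le> k" and q: "degree q \<le> k" and ab: "a < b" and h: "\<bar>h\<bar> \<le> 1 / real k"
    define X where "X = (\<bar>h\<bar> * real k) ^ r"
    define w where "w j = 1 / (1 + offcentre (2 * k) j) ^ 3" for j
    define v where "v j = node (2 * k) j" for j
    have X0: "X \<ge> 0" unfolding X_def by simp
    have o0: "offcentre (2 * k) j \<ge> 0" for j unfolding offcentre_def by simp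
    have w0: "w j \<ge> 0" for j unfolding w_def using o0[of j] by simp
    have wle: "w j \<le> 1 / (1 + offcentre (2 * k) j) ^ 2" for j
      unfolding w_def using o0[of j] by (intro divide_left_mono power_increasing) auto
    have sumw: "(\<Sum>j\<le>6 * (2 * k). w j) \<le> 4"
    proof (rule order_trans[OF _ sum_offcentre_le])
      show "(\<Sum>j\<le>6 * (2 * k). w j) \<le> (\<Sum>j\<le>6 * (2 * k). 1 / (1 + offcentre (2 * k) j) ^ 2)"
        by (rule sum_mono) (rule wle)
    qed
    have D: "norm (phi_diff r h a b (poly q) t) \<le> C * X * (\<Sum>j\<le>6 * (2 * k). w j * norm (poly q (complex_of_real (moved a b k (v j) t))))"
      if t: "t \<in> {a..b}" for t
      using pw[OF k q _ _ rel_depth_bounds(1,2)[OF ab t] h, of "inward a b t" "b - a" t] ab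
      unfolding rel_depth_bounds(3)[OF ab t] phi_diff_def Let_def X_def w_def v_def moved_def inward_def
      by (simp split: if_splits)
    { fix t B assume t: "t \<in> {a..b}" and B: "\<forall>x\<in>{a..b}. norm (poly q (complex_of_real x)) \<le> B"
      have B0: "B \<ge> 0" using B t norm_ge_zero order_trans by blast
      have "norm (phi_diff r h a b (poly q) t) \<le> C * X * (\<Sum>j\<le>6 * (2 * k). w j * B)"
        using B moved_in[OF ab t k abs_node_le_one] w0 C X0 unfolding v_def
        by (intro order_trans[OF D[OF t]] mult_left_mono sum_mono) (auto simp: v_def)
      also have "\<dots> = C * X * ((\<Sum>j\<le>6 * (2 * k). w j) * B)" by (simp add: sum_distrib_right)
      also have "\<dots> \<le> C * X * (96 * B)"
        using sumw B0 C X0 by (intro mult_left_mono mult_right_mono) auto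
      finally show "norm (phi_diff r h a b (poly q) t) \<le> 96 * C * (\<bar>h\<bar> * real k) ^ r * B"
        unfolding X_def by simp }
    fix p :: real assume p: "p \<ge> 1"
    define F where "F x = ennreal (norm (poly q (complex_of_real x)) powr p)" for x
    have F[measurable]: "F \<in> borel_measurable borel" unfolding F_def by measurable
    have "\<forall>j. \<exists>W. W \<in> borel_measurable borel \<and> (\<forall>t\<in>{a..b}. F (moved a b k (v j) t) \<le> W t) \<and>
      (\<integral>\<^sup>+t. W t \<partial>lborel) \<le> ennreal (2 * (3 + real k * \<bar>v j\<bar>)) * (\<integral>\<^sup>+t\<in>{a..b}. F t \<partial>lborel)"
      using moved_majorant[OF ab k abs_node_le_one F] unfolding v_def by blast
    then obtain W where W[measurable]: "\<And>j. W j \<in> borel_measurable borel"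
      and WF: "\<And>j t. t \<in> {a..b} \<Longrightarrow> F (moved a b k (v j) t) \<le> W j t"
      and Wi: "\<And>j. (\<integral>\<^sup>+t. W j t \<partial>lborel) \<le> ennreal (2 * (3 + real k * \<bar>v j\<bar>)) * (\<integral>\<^sup>+t\<in>{a..b}. F t \<partial>lborel)"
      by metis
    define c where "c = (C * X) powr p * 4 powr (p - 1)"
    have c0: "c \<ge> 0" unfolding c_def by simp
    have "(\<integral>\<^sup>+t\<in>{a..b}. ennreal (norm (phi_diff r h a b (poly q) t) powr p) \<partial>lborel)
       \<le> (\<integral>\<^sup>+t. (\<Sum>j\<le>6 * (2 * k). ennreal (c * w j) * W j t) \<partial>lborel)"
    proof (rule nn_integral_mono)
      fix t :: real
      show "ennreal (norm (phi_diff r h a b (poly q) t) powr p) * indicator {a..b} t \<le> (\<Sum>j\<le>6 * (2 * k). ennreal (c * w j) * W j t)"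
      proof (cases "t \<in> {a..b}")
        case True
        let ?x = "\<lambda>j. norm (poly q (complex_of_real (moved a b k (v j) t)))"
        have "norm (phi_diff r h a b (poly q) t) powr p \<le> (C * X * (\<Sum>j\<le>6 * (2 * k). w j * ?x j)) powr p"
          using D[OF True] p by (intro powr_mono2) auto
        also have "\<dots> = (C * X) powr p * (\<Sum>j\<le>6 * (2 * k). w j * ?x j) powr p"
          by (rule powr_mult)
        also have "\<dots> \<le> (C * X) powr p * ((\<Sum>j\<le>6 * (2 * k). w j) powr (p - 1) * (\<Sum>j\<le>6 * (2 * k). w j * ?x j powr p))"
          using w0 p by (intro mult_left_mono powr_sum_le) auto
        also have "\<dots> \<le> (C * X) powr p * (4 powr (p - 1) * (\<Sum>j\<le>6 * (2 * k). w j * ?x j powr p))"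
          using w0 p sumw by (intro mult_left_mono mult_right_mono powr_mono2 sum_nonneg) auto
        also have "\<dots> = (\<Sum>j\<le>6 * (2 * k). c * w j * ?x j powr p)"
          unfolding c_def by (simp add: sum_distrib_left mult.assoc)
        finally have "ennreal (norm (phi_diff r h a b (poly q) t) powr p) \<le> ennreal (\<Sum>j\<le>6 * (2 * k). c * w j * ?x j powr p)"
          by (rule ennreal_leI)
        also have "\<dots> = (\<Sum>j\<le>6 * (2 * k). ennreal (c * w j) * F (moved a b k (v j) t))"
          unfolding F_def using c0 w0 by (subst sum_ennreal[symmetric]) (auto simp: ennreal_mult')
        also have "\<dots> \<le> (\<Sum>j\<le>6 * (2 * k). ennreal (c * w j) * W j t)"
          using WF[OF True] by (intro sum_mono mult_left_mono) auto
        finally show ?thesis using True by simp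
      qed simp
    qed
    also have "\<dots> = (\<Sum>j\<le>6 * (2 * k). ennreal (c * w j) * (\<integral>\<^sup>+t. W j t \<partial>lborel))"
      by (subst nn_integral_sum) (auto simp: nn_integral_cmult)
    also have "\<dots> \<le> (\<Sum>j\<le>6 * (2 * k). ennreal (c * (6 * (1 / (1 + offcentre (2 * k) j) ^ 2))) * (\<integral>\<^sup>+t\<in>{a..b}. F t \<partial>lborel))"
    proof (rule sum_mono)
      fix j assume j: "j \<in> {..6 * (2 * k)}"
      have "real k * \<bar>v j\<bar> \<le> offcentre (2 * k) j"
        using abs_node_le[of "2 * k" j] k j unfolding v_def by (simp add: field_simps)
      then have "w j * (2 * (3 + real k * \<bar>v j\<bar>)) \<le> w j * (6 * (1 + offcentre (2 * k) j))"
        using w0[of j] o0[of j] by (intro mult_left_mono) auto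
      also have "\<dots> = 6 * (1 / (1 + offcentre (2 * k) j) ^ 2)"
      proof -
        have "1 / y ^ 3 * (6 * y) = 6 * (1 / y ^ 2)" if "y > 0" for y :: real
          using that by (simp add: field_simps power2_eq_square power3_eq_cube)
        from this[of "1 + offcentre (2 * k) j"] show ?thesis unfolding w_def using o0[of j] by linarith
      qed
      finally have "c * (w j * (2 * (3 + real k * \<bar>v j\<bar>))) \<le> c * (6 * (1 / (1 + offcentre (2 * k) j) ^ 2))"
        using c0 by (rule mult_left_mono)
      then have 1: "ennreal (c * w j) * ennreal (2 * (3 + real k * \<bar>v j\<bar>)) \<le> ennreal (c * (6 * (1 / (1 + offcentre (2 * k) j) ^ 2)))"
        using c0 w0 by (subst ennreal_mult[symmetric]) (auto intro!: ennreal_leI simp: mult.assoc)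
      have "ennreal (c * w j) * (\<integral>\<^sup>+t. W j t \<partial>lborel) \<le> ennreal (c * w j) * (ennreal (2 * (3 + real k * \<bar>v j\<bar>)) * (\<integral>\<^sup>+t\<in>{a..b}. F t \<partial>lborel))"
        by (rule mult_left_mono[OF Wi]) simp
      also have "\<dots> \<le> ennreal (c * (6 * (1 / (1 + offcentre (2 * k) j) ^ 2))) * (\<integral>\<^sup>+t\<in>{a..b}. F t \<partial>lborel)"
        unfolding mult.assoc[of "ennreal (c * w j)", symmetric] by (rule mult_right_mono[OF 1]) simp
      finally show "ennreal (c * w j) * (\<integral>\<^sup>+t. W j t \<partial>lborel)
        \<le> ennreal (c * (6 * (1 / (1 + offcentre (2 * k) j) ^ 2))) * (\<integral>\<^sup>+t\<in>{a..b}. F t \<partial>lborel)" .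
    qed
    also have "\<dots> = ennreal (\<Sum>j\<le>6 * (2 * k). c * (6 * (1 / (1 + offcentre (2 * k) j) ^ 2))) * (\<integral>\<^sup>+t\<in>{a..b}. F t \<partial>lborel)"
      unfolding sum_distrib_right[symmetric] using c0 by (subst sum_ennreal) auto
    also have "\<dots> \<le> ennreal ((96 * C * (\<bar>h\<bar> * real k) ^ r) powr p) * (\<integral>\<^sup>+t\<in>{a..b}. F t \<partial>lborel)"
    proof (intro mult_right_mono ennreal_leI)
      have "(\<Sum>j\<le>6 * (2 * k). c * (6 * (1 / (1 + offcentre (2 * k) j) ^ 2))) = c * 6 * (\<Sum>j\<le>6 * (2 * k). 1 / (1 + offcentre (2 * k) j) ^ 2)"
        by (simp add: sum_distrib_left)
      also have "\<dots> \<le> c * 6 * 4" using sum_offcentre_le[of "2 * k"] c0 by (intro mult_left_mono) auto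
      also have "\<dots> = (C * X) powr p * (24 * 4 powr (p - 1))" unfolding c_def by simp
      also have "\<dots> \<le> (C * X) powr p * (24 powr p * 4 powr p)"
      proof (intro mult_left_mono mult_mono)
        show "(24::real) \<le> 24 powr p" using powr_mono[of 1 p "24::real"] p by simp
        show "(4::real) powr (p - 1) \<le> 4 powr p" by (rule powr_mono) auto
      qed auto
      also have "\<dots> = (96 * C * (\<bar>h\<bar> * real k) ^ r) powr p"
      proof -
        have "(24::real) powr p * 4 powr p = 96 powr p" by (subst powr_mult[symmetric]) auto
        then have "(C * X) powr p * (24 powr p * 4 powr p) = (C * X * 96) powr p"
          using C X0 by (subst powr_mult) auto
        then show ?thesis unfolding X_def by (simp add: mult_ac)
      qed
      finally show "(\<Sum>j\<le>6 * (2 * k). c * (6 * (1 / (1 + offcentre (2 * k) j) ^ 2))) \<le> (96 * C * (\<bar>h\<bar> * real k) ^ r) powr p" .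
    qed simp
    finally show "(\<integral>\<^sup>+t\<in>{a..b}. ennreal (norm (phi_diff r h a b (poly q) t) powr p) \<partial>lborel)
       \<le> ennreal ((96 * C * (\<bar>h\<bar> * real k) ^ r) powr p) *
         (\<integral>\<^sup>+t\<in>{a..b}. ennreal (norm (poly q (complex_of_real t)) powr p) \<partial>lborel)"
      unfolding F_def .
  qed
qed

text \<open>Substitution by t \<mapsto> t + \<epsilon> sqrt ((t - a) (b - t)). The t whose segment
  of half-length \<theta> sqrt ((t - a) (b - t)) stays in [a, b] lie, endpoints apart, in an
  interval [A, B] on which this map has derivative at least 1/2. It is the reason why differences of
  variable step are bounded in L^p.\<close>

lemma phi_shift_interval:
  fixes F :: "real \<Rightarrow> ennreal"
  assumes ab: "a < b" and F[measurable]: "F \<in> borel_measurable borel" and \<theta>: "\<bar>\<epsilon>\<bar> \<le> \<theta>"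
  shows "(\<integral>\<^sup>+t\<in>{t\<in>{a..b}. \<theta> * sqrt ((t - a) * (b - t)) \<le> t - a \<and> \<theta> * sqrt ((t - a) * (b - t)) \<le> b - t}.
       F (t + \<epsilon> * sqrt ((t - a) * (b - t))) \<partial>lborel) \<le> 2 * (\<integral>\<^sup>+t\<in>{a..b}. F t \<partial>lborel)"
    (is "(\<integral>\<^sup>+t\<in>?J. _ \<partial>lborel) \<le> _")
proof (cases "\<theta> = 0")
  case True
  then have "\<epsilon> = 0" using \<theta> by simp
  have "(\<integral>\<^sup>+t\<in>?J. F (t + \<epsilon> * sqrt ((t - a) * (b - t))) \<partial>lborel) \<le> (\<integral>\<^sup>+t\<in>{a..b}. F t \<partial>lborel)"
    unfolding \<open>\<epsilon> = 0\<close> by (intro nn_integral_mono) (auto split: split_indicator)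
  also have "\<dots> \<le> 2 * (\<integral>\<^sup>+t\<in>{a..b}. F t \<partial>lborel)"
    by (metis add_increasing2 mult_2 order_refl zero_le)
  finally show ?thesis .
next
  case False
  then have \<theta>0: "\<theta> > 0" using \<theta> by linarith
  \<comment> \<open>A and B solve t - a = \<theta>^2 (b - t) and b - t = \<theta>^2 (t - a), the
    squared forms of the two conditions on t.\<close>
  define A B where "A = (a + \<theta>\<^sup>2 * b) / (1 + \<theta>\<^sup>2)" and "B = (b + \<theta>\<^sup>2 * a) / (1 + \<theta>\<^sup>2)"
  have th2: "1 + \<theta>\<^sup>2 > 0" by (simp add: add_pos_nonneg)
  have AB: "t \<ge> A \<longleftrightarrow> \<theta>\<^sup>2 * (b - t) \<le> t - a" "t \<le> B \<longleftrightarrow> \<theta>\<^sup>2 * (t - a) \<le> b - t" for t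
    unfolding A_def B_def using th2 by (auto simp: field_simps)
  have aA: "a < A" "B < b"
    unfolding A_def B_def using th2 \<theta>0 ab by (auto simp: field_simps)
  have J: "t \<in> {A..B}" if t: "t \<in> ?J" "t \<noteq> a" "t \<noteq> b" for t
  proof -
    have t': "a < t" "t < b" using t by auto
    have sq: "(\<theta> * sqrt ((t - a) * (b - t)))\<^sup>2 = \<theta>\<^sup>2 * ((t - a) * (b - t))"
      using t' by (simp add: power_mult_distrib)
    have "(\<theta> * sqrt ((t - a) * (b - t)))\<^sup>2 \<le> (t - a)\<^sup>2" "(\<theta> * sqrt ((t - a) * (b - t)))\<^sup>2 \<le> (b - t)\<^sup>2"
      using t t' \<theta>0 by (auto intro!: power_mono)
    then have "(t - a) * (\<theta>\<^sup>2 * (b - t)) \<le> (t - a) * (t - a)" "(b - t) * (\<theta>\<^sup>2 * (t - a)) \<le> (b - t) * (b - t)"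
      unfolding sq by (simp_all add: power2_eq_square mult_ac)
    then have "\<theta>\<^sup>2 * (b - t) \<le> t - a" "\<theta>\<^sup>2 * (t - a) \<le> b - t" using t' by (auto simp: mult_le_cancel_left_pos)
    then show ?thesis using AB by auto
  qed
  define g where "g t = t + \<epsilon> * sqrt ((t - a) * (b - t))" for t
  define g' where "g' t = 1 + \<epsilon> * ((a + b - 2 * t) / (2 * sqrt ((t - a) * (b - t))))" for t
  show ?thesis
  proof (cases "A < B")
    case True
    have in_ab: "a < t \<and> t < b" if "t \<in> {A..B}" for t using that aA by auto
    have der: "(g has_real_derivative g' t) (at t)" if t: "t \<in> {A..B}" for t
    proof -
      have pos: "(t - a) * (b - t) > 0" using in_ab[OF t] by simp
      have "((\<lambda>t. (t - a) * (b - t)) has_real_derivative a + b - 2 * t) (at t)"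
        by (auto intro!: derivative_eq_intros simp: algebra_simps)
      from DERIV_chain2[OF DERIV_real_sqrt[OF pos] this]
      have "((\<lambda>t. sqrt ((t - a) * (b - t))) has_real_derivative (a + b - 2 * t) / (2 * sqrt ((t - a) * (b - t)))) (at t)"
        by (simp add: field_simps)
      from DERIV_add[OF DERIV_ident DERIV_cmult[OF this, of \<epsilon>]] show ?thesis
        unfolding g_def g'_def .
    qed
    have cont: "continuous_on {A..B} g'"
      unfolding g'_def
    proof (intro continuous_intros ballI)
      fix x assume "x \<in> {A..B}"
      then have "a < x" "x < b" using in_ab by auto
      then show "2 * sqrt ((x - a) * (b - x)) \<noteq> 0" by simp
    qed
    \<comment> \<open>|a + b - 2 t| is at most the larger of t - a and b - t, and on [A, B] the
      larger times \<theta>^2 is at most the smaller.\<close>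
    have half: "\<bar>\<epsilon> * ((a + b - 2 * t) / (2 * sqrt ((t - a) * (b - t))))\<bar> \<le> 1 / 2" if t: "t \<in> {A..B}" for t
    proof -
      have t': "a < t" "t < b" using in_ab[OF t] by auto
      have s0: "sqrt ((t - a) * (b - t)) > 0" using t' by simp
      have c: "\<theta>\<^sup>2 * (b - t) \<le> t - a" "\<theta>\<^sup>2 * (t - a) \<le> b - t" using t AB by auto
      have "\<theta> * \<bar>a + b - 2 * t\<bar> \<le> sqrt ((t - a) * (b - t))"
      proof (rule real_le_rsqrt)
        have m: "\<bar>a + b - 2 * t\<bar> \<le> max (t - a) (b - t)" using t' by auto
        have "(\<theta> * \<bar>a + b - 2 * t\<bar>)\<^sup>2 \<le> (\<theta> * max (t - a) (b - t))\<^sup>2"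
          using m \<theta>0 by (intro power_mono mult_left_mono) auto
        also have "\<dots> = max (t - a) (b - t) * (\<theta>\<^sup>2 * max (t - a) (b - t))" by (simp add: power2_eq_square)
        also have "\<dots> \<le> (t - a) * (b - t)"
        proof (cases "t - a \<le> b - t")
          case True
          then show ?thesis using mult_left_mono[OF c(1), of "b - t"] t' by (simp add: max_def mult.commute)
        next
          case False
          then show ?thesis using mult_left_mono[OF c(2), of "t - a"] t' by (simp add: max_def mult.commute)
        qed
        finally show "(\<theta> * \<bar>a + b - 2 * t\<bar>)\<^sup>2 \<le> (t - a) * (b - t)" .
      qed
      moreover have "\<bar>\<epsilon>\<bar> * \<bar>a + b - 2 * t\<bar> \<le> \<theta> * \<bar>a + b - 2 * t\<bar>" using \<theta> by (rule mult_right_mono) simp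
      ultimately have "\<bar>\<epsilon>\<bar> * \<bar>a + b - 2 * t\<bar> \<le> sqrt ((t - a) * (b - t))" by linarith
      then have "(\<bar>\<epsilon>\<bar> * \<bar>a + b - 2 * t\<bar>) / (2 * sqrt ((t - a) * (b - t))) \<le> 1 / 2"
      proof -
        have "x / (2 * s) \<le> 1 / 2" if "x \<le> s" "s > 0" for x s :: real
          using that by (simp add: field_simps)
        then show ?thesis using \<open>\<bar>\<epsilon>\<bar> * \<bar>a + b - 2 * t\<bar> \<le> sqrt ((t - a) * (b - t))\<close> s0 by blast
      qed
      then show ?thesis using s0 by (simp add: abs_mult)
    qed
    have gin: "t \<in> {a..b}" if "t \<in> {g A..g B}" for t
    proof -
      have "\<bar>\<epsilon>\<bar> * sqrt ((x - a) * (b - x)) \<le> x - a" "\<bar>\<epsilon>\<bar> * sqrt ((x - a) * (b - x)) \<le> b - x" if x: "x \<in> {A..B}" for x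
      proof -
        have x': "a < x" "x < b" using in_ab[OF x] by auto
        have c: "\<theta>\<^sup>2 * (b - x) \<le> x - a" "\<theta>\<^sup>2 * (x - a) \<le> b - x" using x AB by auto
        have sq: "(\<theta> * sqrt ((x - a) * (b - x)))\<^sup>2 = \<theta>\<^sup>2 * ((x - a) * (b - x))"
          using x' by (simp add: power_mult_distrib)
        have q: "(\<theta> * sqrt ((x - a) * (b - x)))\<^sup>2 \<le> (x - a)\<^sup>2" "(\<theta> * sqrt ((x - a) * (b - x)))\<^sup>2 \<le> (b - x)\<^sup>2"
          unfolding sq using mult_left_mono[OF c(1), of "x - a"] mult_left_mono[OF c(2), of "b - x"] x'
          by (simp_all add: power2_eq_square mult_ac)
        have "\<theta> * sqrt ((x - a) * (b - x)) \<le> x - a" "\<theta> * sqrt ((x - a) * (b - x)) \<le> b - x"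
          using power2_le_imp_le[OF q(1)] power2_le_imp_le[OF q(2)] x' by auto
        moreover have "\<bar>\<epsilon>\<bar> * sqrt ((x - a) * (b - x)) \<le> \<theta> * sqrt ((x - a) * (b - x))"
          using \<theta> x' by (intro mult_right_mono) auto
        ultimately show "\<bar>\<epsilon>\<bar> * sqrt ((x - a) * (b - x)) \<le> x - a" "\<bar>\<epsilon>\<bar> * sqrt ((x - a) * (b - x)) \<le> b - x" by linarith+
      qed
      moreover have "\<bar>\<epsilon> * sqrt ((x - a) * (b - x))\<bar> = \<bar>\<epsilon>\<bar> * sqrt ((x - a) * (b - x))" if "x \<in> {A..B}" for x
        using in_ab[OF that] by (simp add: abs_mult)
      moreover have "A \<in> {A..B}" "B \<in> {A..B}" using True by auto
      ultimately have "\<bar>\<epsilon> * sqrt ((A - a) * (b - A))\<bar> \<le> A - a" "\<bar>\<epsilon> * sqrt ((B - a) * (b - B))\<bar> \<le> b - B"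
        by metis+
      then have "a \<le> g A" "g B \<le> b" unfolding g_def by linarith+
      then show ?thesis using that by auto
    qed
    have g'0: "g' t \<ge> 1 / 2" if "t \<in> {A..B}" for t
      using half[OF that] unfolding g'_def by linarith
    have "(\<integral>\<^sup>+t\<in>?J. F (t + \<epsilon> * sqrt ((t - a) * (b - t))) \<partial>lborel) \<le> (\<integral>\<^sup>+t. 2 * (F (g t) * ennreal (g' t) * indicator {A..B} t) \<partial>lborel)"
    proof (rule nn_integral_mono_AE)
      have "AE t in lborel. t \<noteq> a \<and> t \<noteq> b" using AE_lborel_singleton[of a] AE_lborel_singleton[of b] by eventually_elim simp
      then show "AE t in lborel. F (t + \<epsilon> * sqrt ((t - a) * (b - t))) * indicator ?J t \<le> 2 * (F (g t) * ennreal (g' t) * indicator {A..B} t)"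
      proof eventually_elim
        case (elim t)
        show ?case
        proof (cases "t \<in> ?J")
          case True
          then have t: "t \<in> {A..B}" using J elim by blast
          have "1 \<le> 2 * ennreal (g' t)"
          proof -
            have "ennreal 1 \<le> ennreal (2 * g' t)" using g'0[OF t] by (intro ennreal_leI) simp
            then show ?thesis by (simp add: ennreal_mult')
          qed
          then have "F (g t) * 1 \<le> F (g t) * (2 * ennreal (g' t))" by (rule mult_left_mono) simp
          then show ?thesis using True t unfolding g_def by (simp add: mult_ac)
        qed simp
      qed
    qed
    also have "\<dots> = 2 * (\<integral>\<^sup>+t. F (g t) * ennreal (g' t) * indicator {A..B} t \<partial>lborel)"
    proof (rule nn_integral_cmult)
      have [measurable]: "g \<in> borel_measurable borel" "g' \<in> borel_measurable borel"
        unfolding g_def g'_def by measurable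
      show "(\<lambda>t. F (g t) * ennreal (g' t) * indicator {A..B} t) \<in> borel_measurable lborel" by measurable
    qed
    also have "(\<integral>\<^sup>+t. F (g t) * ennreal (g' t) * indicator {A..B} t \<partial>lborel) = (\<integral>\<^sup>+t. F t * indicator {g A..g B} t \<partial>lborel)"
    proof (rule nn_integral_substitution_aux[symmetric, OF F _ der cont _ True])
      show "0 \<le> g' x" if "x \<in> {A..B}" for x using g'0[OF that] by simp
    qed auto
    also have "\<dots> \<le> (\<integral>\<^sup>+t\<in>{a..b}. F t \<partial>lborel)"
      using gin by (intro nn_integral_mono) (auto split: split_indicator)
    finally show ?thesis by (simp add: mult_left_mono)
  next
    case False
    \<comment> \<open>When A \<ge> B, the set of integration contains at most the points a, b and A,
      so it is null.\<close>
    have "(\<integral>\<^sup>+t\<in>?J. F (t + \<epsilon> * sqrt ((t - a) * (b - t))) \<partial>lborel) = (\<integral>\<^sup>+t. 0 \<partial>(lborel :: real measure))"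
    proof (rule nn_integral_cong_AE)
      have "AE t in lborel. t \<noteq> a \<and> t \<noteq> b \<and> t \<noteq> A"
        using AE_lborel_singleton[of a] AE_lborel_singleton[of b] AE_lborel_singleton[of A] by eventually_elim simp
      then show "AE t in lborel. F (t + \<epsilon> * sqrt ((t - a) * (b - t))) * indicator ?J t = 0"
      proof eventually_elim
        case (elim t)
        then have "t \<notin> ?J" using J[of t] False by force
        then have "indicator ?J t = (0::ennreal)" by (rule indicator_simps(2))
        then show ?case by (rule ssubst) (rule mult_zero_right)
      qed
    qed
    then show ?thesis by simp
  qed
qed

section \<open>Compact subsets of the line\<close>

definition line_phi :: "real set \<Rightarrow> real \<Rightarrow> real" where
  "line_phi K t = Sup {sqrt (l1 * l2) | l1 l2. 0 \<le> l1 \<and> 0 \<le> l2 \<and> {t - l1..t + l2} \<subseteq> K}"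

lemma component_interval:
  assumes "compact K" "C \<in> components K"
  obtains a b where "a \<le> b" "C = {a..b :: real}"
proof -
  have "connected C" "compact C" "C \<noteq> {}"
    using assms in_components_connected in_components_nonempty compact_components by blast+
  then show ?thesis using that connected_compact_interval_1[of C] by force
qed

lemma interval_in_component:
  assumes "{a..b} \<in> components K" "t \<in> {a..b}" "{c..d} \<subseteq> K" "t \<in> {c..d :: real}"
  shows "{c..d} \<subseteq> {a..b}"
  using components_maximal[OF assms(1) _ assms(3)] assms(2,4) by (metis IntI connected_Icc empty_iff)

text \<open>An interval around t inside K stays in the component of t, so l1 and l2 can be maximal
  simultaneously, namely t - a and b - t.\<close>

lemma line_phi_component:
  assumes C: "{a..b} \<in> components K" and t: "t \<in> {a..b}"
  shows "line_phi K t = sqrt ((t - a) * (b - t))"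
proof -
  have sub: "{a..b} \<subseteq> K" using C by (rule in_components_subset)
  have "{sqrt (l1 * l2) | l1 l2. 0 \<le> l1 \<and> 0 \<le> l2 \<and> {t - l1..t + l2} \<subseteq> K}
      = {sqrt (l1 * l2) | l1 l2. 0 \<le> l1 \<and> 0 \<le> l2 \<and> l1 \<le> t - a \<and> l2 \<le> b - t}"
  proof -
    have "{t - l1..t + l2} \<subseteq> K \<longleftrightarrow> l1 \<le> t - a \<and> l2 \<le> b - t" if l: "0 \<le> l1" "0 \<le> l2" for l1 l2
    proof
      assume "{t - l1..t + l2} \<subseteq> K"
      then have "{t - l1..t + l2} \<subseteq> {a..b}" by (rule interval_in_component[OF C t]) (use l in auto)
      then show "l1 \<le> t - a \<and> l2 \<le> b - t" using l by auto
    next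
      assume "l1 \<le> t - a \<and> l2 \<le> b - t"
      then have "{t - l1..t + l2} \<subseteq> {a..b}" by auto
      then show "{t - l1..t + l2} \<subseteq> K" using sub by blast
    qed
    then show ?thesis by blast
  qed
  moreover have "Sup {sqrt (l1 * l2) | l1 l2. 0 \<le> l1 \<and> 0 \<le> l2 \<and> l1 \<le> t - a \<and> l2 \<le> b - t} = sqrt ((t - a) * (b - t))"
  proof (rule cSup_eq_maximum)
    show "sqrt ((t - a) * (b - t)) \<in> {sqrt (l1 * l2) | l1 l2. 0 \<le> l1 \<and> 0 \<le> l2 \<and> l1 \<le> t - a \<and> l2 \<le> b - t}"
      using t by force
  qed (auto intro!: mult_mono)
  ultimately show ?thesis unfolding line_phi_def by simp
qed

text \<open>A compact set may have uncountably many one-point components; on these G vanishes. The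
  others have nonempty interior, so they are countably many, and the measures with densities F and G
  are countably additive over them.\<close>

lemma nn_integral_components_le:
  fixes F G :: "real \<Rightarrow> ennreal"
  assumes K: "compact K" and [measurable]: "F \<in> borel_measurable borel" "G \<in> borel_measurable borel"
    and le: "\<And>a b. a < b \<Longrightarrow> {a..b} \<in> components K \<Longrightarrow> (\<integral>\<^sup>+t\<in>{a..b}. G t \<partial>lborel) \<le> c * (\<integral>\<^sup>+t\<in>{a..b}. F t \<partial>lborel)"
    and zero: "\<And>t. {t} \<in> components K \<Longrightarrow> G t = 0"
  shows "(\<integral>\<^sup>+t\<in>K. G t \<partial>lborel) \<le> c * (\<integral>\<^sup>+t\<in>K. F t \<partial>lborel)"
proof -
  define \<C> where "\<C> = {C \<in> components K. interior C \<noteq> {}}"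
  have disj: "pairwise disjnt \<C>"
    unfolding \<C>_def using components_nonoverlap[of _ K] by (fastforce simp: pairwise_def disjnt_def)
  have cnt: "countable \<C>"
    by (rule countable_disjoint_nonempty_interior_subsets[OF disj]) (auto simp: \<C>_def)
  have disj': "disjoint_family_on (\<lambda>C. C) \<C>"
    using disj by (auto simp: disjoint_family_on_def pairwise_def disjnt_def)
  have form: "\<exists>a b. a < b \<and> C = {a..b}" if "C \<in> \<C>" for C
  proof -
    have "C \<in> components K" "interior C \<noteq> {}" using that unfolding \<C>_def by auto
    then obtain a b where ab: "a \<le> b" "C = {a..b}" using component_interval[OF K] by blast
    have "a \<noteq> b"
    proof
      assume "a = b"
      then have "C = {a}" using ab(2) by simp
      then show False using \<open>interior C \<noteq> {}\<close> by simp
    qed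
    then have "a < b" using ab(1) by simp
    then show ?thesis using ab(2) by blast
  qed
  have sets: "C \<in> sets borel" if "C \<in> \<C>" for C using form[OF that] by auto
  define U where "U = (\<Union>C\<in>\<C>. C)"
  have U[measurable]: "U \<in> sets borel" unfolding U_def by (rule sets.countable_UN'[OF cnt]) (use sets in auto)
  have UK: "U \<subseteq> K" unfolding U_def \<C>_def using in_components_subset by blast
  have G0: "G t = 0" if "t \<in> K" "t \<notin> U" for t
  proof -
    have "t \<in> \<Union> (components K)" by (metis Union_components that(1))
    then obtain C where C: "C \<in> components K" "t \<in> C" by blast
    obtain a b where ab: "a \<le> b" "C = {a..b}" using component_interval[OF K C(1)] .
    have "interior C = {}" using that(2) C unfolding U_def \<C>_def by auto
    then have "a = b" using ab by (simp add: interior_atLeastAtMost_real)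
    then have "C = {a}" using ab(2) by simp
    then have "C = {t}" using C(2) by simp
    then show ?thesis using zero C by simp
  qed
  have dens: "emeasure (density lborel H) U = (\<integral>\<^sup>+C. emeasure (density lborel H) C \<partial>count_space \<C>)" for H :: "real \<Rightarrow> ennreal"
    unfolding U_def using emeasure_UN_countable[of \<C> "\<lambda>C. C" "density lborel H", OF _ cnt disj'] sets by simp
  have "(\<integral>\<^sup>+t\<in>K. G t \<partial>lborel) = (\<integral>\<^sup>+t\<in>U. G t \<partial>lborel)"
    using G0 UK by (intro nn_integral_cong) (auto split: split_indicator)
  also have "\<dots> = emeasure (density lborel G) U" by (simp add: emeasure_density)
  also have "\<dots> = (\<integral>\<^sup>+C. emeasure (density lborel G) C \<partial>count_space \<C>)" by (rule dens)
  also have "\<dots> \<le> (\<integral>\<^sup>+C. c * emeasure (density lborel F) C \<partial>count_space \<C>)"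
  proof (rule nn_integral_mono)
    fix C assume "C \<in> space (count_space \<C>)"
    then have C: "C \<in> \<C>" by simp
    obtain a b where ab: "a < b" "C = {a..b}" using form[OF C] by blast
    then show "emeasure (density lborel G) C \<le> c * emeasure (density lborel F) C"
      using le[of a b] C unfolding \<C>_def by (simp add: emeasure_density)
  qed
  also have "\<dots> = c * emeasure (density lborel F) U"
    unfolding dens by (rule nn_integral_cmult) simp
  also have "emeasure (density lborel F) U = (\<integral>\<^sup>+t\<in>U. F t \<partial>lborel)" by (simp add: emeasure_density)
  also have "c * \<dots> \<le> c * (\<integral>\<^sup>+t\<in>K. F t \<partial>lborel)"
    using UK by (intro mult_left_mono nn_integral_mono) (auto split: split_indicator)
  finally show ?thesis .
qed

text \<open>Integration along lines in an arbitrary unit direction without a choice of coordinates: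
  after exchanging the integrals and translating, a point z is counted with the length of the set of
  t for which z - t e lies in the slab, which is 1.\<close>

lemma nn_integral_slab:
  fixes G :: "'a::euclidean_space \<Rightarrow> ennreal"
  assumes e: "norm e = 1" and [measurable]: "G \<in> borel_measurable borel"
  shows "(\<integral>\<^sup>+z. G z \<partial>lborel) = (\<integral>\<^sup>+z\<in>{z. 0 \<le> z \<bullet> e \<and> z \<bullet> e < 1}. (\<integral>\<^sup>+t. G (z + t *\<^sub>R e) \<partial>lborel) \<partial>lborel)"
proof -
  define S where "S = {z. 0 \<le> z \<bullet> e \<and> z \<bullet> e < 1}"
  have S[measurable]: "S \<in> sets borel" unfolding S_def by measurable
  have m1: "(\<lambda>(z, t). indicator S z * G (z + t *\<^sub>R e)) \<in> borel_measurable (lborel \<Otimes>\<^sub>M (lborel :: real measure))"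
    by measurable
  have m2: "(\<lambda>(z, t). indicator S (z - t *\<^sub>R e) * G z) \<in> borel_measurable (lborel \<Otimes>\<^sub>M (lborel :: real measure))"
    by measurable
  have "(\<integral>\<^sup>+z\<in>S. (\<integral>\<^sup>+t. G (z + t *\<^sub>R e) \<partial>lborel) \<partial>lborel) = (\<integral>\<^sup>+z. (\<integral>\<^sup>+t. indicator S z * G (z + t *\<^sub>R e) \<partial>lborel) \<partial>lborel)"
    by (simp add: nn_integral_cmult mult.commute)
  also have "\<dots> = (\<integral>\<^sup>+t. (\<integral>\<^sup>+z. indicator S z * G (z + t *\<^sub>R e) \<partial>lborel) \<partial>lborel)"
    using lborel_pair.Fubini'[OF m1] by simp
  also have "\<dots> = (\<integral>\<^sup>+t. (\<integral>\<^sup>+z. indicator S (z - t *\<^sub>R e) * G z \<partial>lborel) \<partial>lborel)"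
  proof (rule nn_integral_cong)
    fix t :: real
    have "(\<integral>\<^sup>+z. indicator S (z - t *\<^sub>R e) * G z \<partial>lborel) = (\<integral>\<^sup>+z. (\<lambda>z. indicator S (z - t *\<^sub>R e) * G z) (z + t *\<^sub>R e) \<partial>lborel)"
      by (rule nn_integral_translate[symmetric]) measurable
    then show "(\<integral>\<^sup>+z. indicator S z * G (z + t *\<^sub>R e) \<partial>lborel) = (\<integral>\<^sup>+z. indicator S (z - t *\<^sub>R e) * G z \<partial>lborel)"
      by simp
  qed
  also have "\<dots> = (\<integral>\<^sup>+z. (\<integral>\<^sup>+t. indicator S (z - t *\<^sub>R e) * G z \<partial>lborel) \<partial>lborel)"
    using lborel_pair.Fubini'[OF m2] by simp
  also have "\<dots> = (\<integral>\<^sup>+z. G z \<partial>lborel)"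
  proof (rule nn_integral_cong)
    fix z :: 'a
    have ee: "e \<bullet> e = 1" using e by (simp add: norm_eq_1)
    have "indicator S (z - t *\<^sub>R e) = (indicator {z \<bullet> e - 1<..z \<bullet> e} t :: ennreal)" for t
      unfolding S_def by (auto simp: indicator_def inner_diff_left ee)
    then have "(\<integral>\<^sup>+t. indicator S (z - t *\<^sub>R e) * G z \<partial>lborel) = (\<integral>\<^sup>+t. G z * indicator {z \<bullet> e - 1<..z \<bullet> e} t \<partial>lborel)"
      by (simp add: mult.commute)
    also have "\<dots> = G z" by (subst nn_integral_cmult_indicator) auto
    finally show "(\<integral>\<^sup>+t. indicator S (z - t *\<^sub>R e) * G z \<partial>lborel) = G z" .
  qed
  finally show ?thesis unfolding S_def by simp
qed

section \<open>The weight function of a compact set\<close>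

lemma closed_segment_line:
  fixes z e :: "'a::real_vector"
  assumes "c \<le> d"
  shows "closed_segment (z + c *\<^sub>R e) (z + d *\<^sub>R e) = (\<lambda>t. z + t *\<^sub>R e) ` {c..d}"
proof -
  have "closed_segment (z + c *\<^sub>R e) (z + d *\<^sub>R e) = (\<lambda>t. z + t *\<^sub>R e) ` closed_segment c d"
    unfolding closed_segment_image_interval image_image
    by (rule image_cong) (simp_all add: algebra_simps)
  then show ?thesis using assms by (simp add: closed_segment_eq_real_ivl)
qed

lemma mem_segment_through:
  assumes "0 \<le> l1" "0 \<le> l2"
  shows "z \<in> closed_segment (z - l1 *\<^sub>R e) (z + l2 *\<^sub>R e)"
proof -
  have "closed_segment (z + (- l1) *\<^sub>R e) (z + l2 *\<^sub>R e) = (\<lambda>t. z + t *\<^sub>R e) ` {- l1..l2}"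
    by (rule closed_segment_line) (use assms in simp)
  moreover have "z \<in> (\<lambda>t. z + t *\<^sub>R e) ` {- l1..l2}" using assms by (intro image_eqI[of _ _ 0]) auto
  ultimately show ?thesis by simp
qed

text \<open>For each parameter u the condition on the segment is closed, and the lengths are at most
  twice a bound for \<Omega>. Compactness yields both the attainment of the supremum in
  \<open>phi\<close> and its measurability.\<close>

lemma compact_segments:
  fixes \<Omega> :: "'a::euclidean_space set"
  assumes \<Omega>: "compact \<Omega>" and e: "norm e = 1"
  shows "compact {(z, l1, l2). 0 \<le> l1 \<and> 0 \<le> l2 \<and> closed_segment (z - l1 *\<^sub>R e) (z + l2 *\<^sub>R e) \<subseteq> \<Omega>}"
    (is "compact ?T")
proof -
  have seg: "closed_segment (z - l1 *\<^sub>R e) (z + l2 *\<^sub>R e) \<subseteq> \<Omega>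
      \<longleftrightarrow> (\<forall>u\<in>{0..1}. (1 - u) *\<^sub>R (z - l1 *\<^sub>R e) + u *\<^sub>R (z + l2 *\<^sub>R e) \<in> \<Omega>)" for z l1 l2
    unfolding closed_segment_image_interval by auto
  have "?T = {x. 0 \<le> fst (snd x)} \<inter> {x. 0 \<le> snd (snd x)} \<inter>
     (\<Inter>u\<in>{0..1}. (\<lambda>x. (1 - u) *\<^sub>R (fst x - fst (snd x) *\<^sub>R e) + u *\<^sub>R (fst x + snd (snd x) *\<^sub>R e)) -` \<Omega>)"
    unfolding seg by auto
  moreover have "closed \<dots>"
    by (intro closed_Int closed_INT ballI closed_Collect_le continuous_intros closed_vimage compact_imp_closed[OF \<Omega>])
  ultimately have "closed ?T" by simp
  moreover have "bounded ?T"
  proof -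
    obtain B where B: "\<And>x. x \<in> \<Omega> \<Longrightarrow> norm x \<le> B" using compact_imp_bounded[OF \<Omega>] unfolding bounded_iff by blast
    have "?T \<subseteq> cball 0 B \<times> cball 0 (2 * B) \<times> cball 0 (2 * B)"
    proof (rule subsetI)
      fix x assume "x \<in> ?T"
      then obtain z l1 l2 where x: "x = (z, l1, l2)" and l: "0 \<le> l1" "0 \<le> l2"
        and s: "closed_segment (z - l1 *\<^sub>R e) (z + l2 *\<^sub>R e) \<subseteq> \<Omega>" by auto
      have ends: "norm (z - l1 *\<^sub>R e) \<le> B" "norm (z + l2 *\<^sub>R e) \<le> B" using s B by auto
      have "z \<in> closed_segment (z - l1 *\<^sub>R e) (z + l2 *\<^sub>R e)" using l by (rule mem_segment_through)
      then have z: "norm z \<le> B" using s B by blast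
      have "l1 = norm (z - (z - l1 *\<^sub>R e))" "l2 = norm (z + l2 *\<^sub>R e - z)" using l e by simp_all
      then have "l1 \<le> 2 * B" "l2 \<le> 2 * B"
        using z ends norm_triangle_ineq4[of z "z - l1 *\<^sub>R e"] norm_triangle_ineq4[of "z + l2 *\<^sub>R e" z] by linarith+
      then show "x \<in> cball 0 B \<times> cball 0 (2 * B) \<times> cball 0 (2 * B)" unfolding x using z l by simp
    qed
    then show ?thesis by (rule bounded_subset[rotated]) (intro bounded_Times bounded_cball)
  qed
  ultimately show ?thesis by (simp add: compact_eq_bounded_closed)
qed

text \<open>The admissible pairs of lengths at z form a section of a compact set, so the continuous
  function sqrt (l1 l2) attains its maximum on them.\<close>

lemma phi_ge_iff:
  fixes \<Omega> :: "('d::finite) point set"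
  assumes \<Omega>: "compact \<Omega>" and e: "norm e = 1" and z: "z \<in> \<Omega>"
  shows "\<alpha> \<le> phi \<Omega> e z \<longleftrightarrow>
    (\<exists>l1 l2. 0 \<le> l1 \<and> 0 \<le> l2 \<and> closed_segment (z - l1 *\<^sub>R e) (z + l2 *\<^sub>R e) \<subseteq> \<Omega> \<and> \<alpha> \<le> sqrt (l1 * l2))"
proof -
  define T where "T = {(z, l1, l2). 0 \<le> l1 \<and> 0 \<le> l2 \<and> closed_segment (z - l1 *\<^sub>R e) (z + l2 *\<^sub>R e) \<subseteq> \<Omega>}"
  have "compact (T \<inter> ({z} \<times> UNIV))"
    unfolding T_def using compact_segments[OF \<Omega> e] by (intro compact_Int_closed closed_Times) auto
  then have "compact (snd ` (T \<inter> ({z} \<times> UNIV)))"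
    by (intro compact_continuous_image continuous_intros)
  moreover have "snd ` (T \<inter> ({z} \<times> UNIV)) = {(l1, l2). 0 \<le> l1 \<and> 0 \<le> l2 \<and> closed_segment (z - l1 *\<^sub>R e) (z + l2 *\<^sub>R e) \<subseteq> \<Omega>}"
  proof -
    have "snd ` (T \<inter> ({z} \<times> UNIV)) = {m. (z, m) \<in> T}"
    proof (intro set_eqI iffI)
      fix m assume "m \<in> {m. (z, m) \<in> T}"
      then show "m \<in> snd ` (T \<inter> ({z} \<times> UNIV))" by (intro image_eqI[of _ _ "(z, m)"]) auto
    qed auto
    then show ?thesis unfolding T_def by (simp add: case_prod_unfold)
  qed
  ultimately have cpt: "compact {(l1, l2). 0 \<le> l1 \<and> 0 \<le> l2 \<and> closed_segment (z - l1 *\<^sub>R e) (z + l2 *\<^sub>R e) \<subseteq> \<Omega>}" (is "compact ?L")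
    by simp
  have "(0, 0) \<in> ?L" using z by simp
  then have ne: "?L \<noteq> {}" by blast
  obtain m where m: "m \<in> ?L" "\<And>l. l \<in> ?L \<Longrightarrow> sqrt (fst l * snd l) \<le> sqrt (fst m * snd m)"
  proof -
    have "continuous_on ?L (\<lambda>l. sqrt (fst l * snd l))" by (intro continuous_intros)
    from continuous_attains_sup[OF cpt ne this] show ?thesis using that by blast
  qed
  have eq: "phi \<Omega> e z = sqrt (fst m * snd m)"
    unfolding phi_def
  proof (rule cSup_eq_maximum)
    show "sqrt (fst m * snd m) \<in> {sqrt (l1 * l2) |l1 l2. 0 \<le> l1 \<and> 0 \<le> l2 \<and> closed_segment (z - l1 *\<^sub>R e) (z + l2 *\<^sub>R e) \<subseteq> \<Omega>}"
    proof -
      obtain m1 m2 where "m = (m1, m2)" by (cases m)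
      then show ?thesis using m(1) by auto
    qed
  next
    fix x assume "x \<in> {sqrt (l1 * l2) |l1 l2. 0 \<le> l1 \<and> 0 \<le> l2 \<and> closed_segment (z - l1 *\<^sub>R e) (z + l2 *\<^sub>R e) \<subseteq> \<Omega>}"
    then obtain l1 l2 where "x = sqrt (l1 * l2)" "(l1, l2) \<in> ?L" by auto
    then show "x \<le> sqrt (fst m * snd m)" using m(2)[of "(l1, l2)"] by simp
  qed
  show ?thesis unfolding eq
  proof
    assume "\<alpha> \<le> sqrt (fst m * snd m)"
    then show "\<exists>l1 l2. 0 \<le> l1 \<and> 0 \<le> l2 \<and> closed_segment (z - l1 *\<^sub>R e) (z + l2 *\<^sub>R e) \<subseteq> \<Omega> \<and> \<alpha> \<le> sqrt (l1 * l2)"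
      using m(1) by (intro exI[of _ "fst m"] exI[of _ "snd m"]) (auto simp: case_prod_beta)
  next
    assume "\<exists>l1 l2. 0 \<le> l1 \<and> 0 \<le> l2 \<and> closed_segment (z - l1 *\<^sub>R e) (z + l2 *\<^sub>R e) \<subseteq> \<Omega> \<and> \<alpha> \<le> sqrt (l1 * l2)"
    then obtain l1 l2 where l: "(l1, l2) \<in> ?L" "\<alpha> \<le> sqrt (l1 * l2)" by auto
    show "\<alpha> \<le> sqrt (fst m * snd m)"
      using l(2) m(2)[OF l(1)] unfolding fst_conv snd_conv by (rule order_trans)
  qed
qed

text \<open>For \<alpha> > 0 the superlevel set is the projection of a compact set of triples and
  hence compact; for \<alpha> \<le> 0 it is the whole space.\<close>

lemma borel_measurable_phi:
  fixes \<Omega> :: "('d::finite) point set"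
  assumes \<Omega>: "compact \<Omega>" and e: "norm e = 1"
  shows "(\<lambda>z. indicator \<Omega> z * phi \<Omega> e z) \<in> borel_measurable borel"
proof (rule borel_measurableI_ge)
  fix \<alpha> :: real
  have [measurable]: "\<Omega> \<in> sets borel" using \<Omega> by (simp add: compact_imp_closed)
  have nn: "0 \<le> phi \<Omega> e z" if "z \<in> \<Omega>" for z
  proof -
    have "closed_segment (z - 0 *\<^sub>R e) (z + 0 *\<^sub>R e) \<subseteq> \<Omega>" using that by simp
    then show ?thesis using phi_ge_iff[OF \<Omega> e that, of 0] by (metis mult_zero_right order_refl real_sqrt_zero)
  qed
  show "{z \<in> space borel. \<alpha> \<le> indicator \<Omega> z * phi \<Omega> e z} \<in> sets borel"
  proof (cases "\<alpha> \<le> 0")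
    case True
    then have "{z \<in> space borel. \<alpha> \<le> indicator \<Omega> z * phi \<Omega> e z} = UNIV"
    proof -
      have "\<alpha> \<le> indicator \<Omega> z * phi \<Omega> e z" for z
        using nn[of z] True by (cases "z \<in> \<Omega>") auto
      then show ?thesis by simp
    qed
    then show ?thesis by simp
  next
    case False
    define T where "T = {(z, l1, l2). 0 \<le> l1 \<and> 0 \<le> l2 \<and> closed_segment (z - l1 *\<^sub>R e) (z + l2 *\<^sub>R e) \<subseteq> \<Omega>}"
    have T\<Omega>: "z \<in> \<Omega>" if "(z, l1, l2) \<in> T" for z l1 l2
      using that mem_segment_through[of l1 l2 z e] unfolding T_def by blast
    have "compact (T \<inter> {x. \<alpha> \<le> sqrt (fst (snd x) * snd (snd x))})"
      unfolding T_def by (intro compact_Int_closed compact_segments[OF \<Omega> e] closed_Collect_le continuous_intros)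
    then have "compact (fst ` (T \<inter> {x. \<alpha> \<le> sqrt (fst (snd x) * snd (snd x))}))"
      by (intro compact_continuous_image continuous_intros)
    moreover have "{z \<in> space borel. \<alpha> \<le> indicator \<Omega> z * phi \<Omega> e z} = fst ` (T \<inter> {x. \<alpha> \<le> sqrt (fst (snd x) * snd (snd x))})"
    proof (intro set_eqI iffI)
      fix z assume "z \<in> {z \<in> space borel. \<alpha> \<le> indicator \<Omega> z * phi \<Omega> e z}"
      then have "\<alpha> \<le> indicator \<Omega> z * phi \<Omega> e z" by simp
      then have "z \<in> \<Omega>" "\<alpha> \<le> phi \<Omega> e z" using False by (cases "z \<in> \<Omega>"; simp)+
      then obtain l1 l2 where "(z, l1, l2) \<in> T" "\<alpha> \<le> sqrt (l1 * l2)"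
        using phi_ge_iff[OF \<Omega> e] unfolding T_def by blast
      then show "z \<in> fst ` (T \<inter> {x. \<alpha> \<le> sqrt (fst (snd x) * snd (snd x))})"
        by (intro image_eqI[of _ _ "(z, l1, l2)"]) auto
    next
      fix z assume "z \<in> fst ` (T \<inter> {x. \<alpha> \<le> sqrt (fst (snd x) * snd (snd x))})"
      then obtain l1 l2 where l: "(z, l1, l2) \<in> T" "\<alpha> \<le> sqrt (l1 * l2)" by auto
      then have "z \<in> \<Omega>" by (rule_tac T\<Omega>)
      moreover have "\<alpha> \<le> phi \<Omega> e z"
        using phi_ge_iff[OF \<Omega> e \<open>z \<in> \<Omega>\<close>, of \<alpha>] l unfolding T_def by blast
      ultimately show "z \<in> {z \<in> space borel. \<alpha> \<le> indicator \<Omega> z * phi \<Omega> e z}" by simp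
    qed
    ultimately show ?thesis by (simp add: borel_compact)
  qed
qed

lemma phi_line:
  fixes \<Omega> :: "('d::finite) point set"
  shows "phi \<Omega> e (z + t *\<^sub>R e) = line_phi {t. z + t *\<^sub>R e \<in> \<Omega>} t"
proof -
  have "closed_segment (z + t *\<^sub>R e - l1 *\<^sub>R e) (z + t *\<^sub>R e + l2 *\<^sub>R e) \<subseteq> \<Omega> \<longleftrightarrow> {t - l1..t + l2} \<subseteq> {t. z + t *\<^sub>R e \<in> \<Omega>}"
    if "0 \<le> l1" "0 \<le> l2" for l1 l2
  proof -
    have "closed_segment (z + t *\<^sub>R e - l1 *\<^sub>R e) (z + t *\<^sub>R e + l2 *\<^sub>R e)
        = closed_segment (z + (t - l1) *\<^sub>R e) (z + (t + l2) *\<^sub>R e)"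
      by (simp add: algebra_simps)
    also have "\<dots> = (\<lambda>t. z + t *\<^sub>R e) ` {t - l1..t + l2}" by (rule closed_segment_line) (use that in simp)
    finally show ?thesis by auto
  qed
  then have "{sqrt (l1 * l2) | l1 l2. 0 \<le> l1 \<and> 0 \<le> l2 \<and> closed_segment (z + t *\<^sub>R e - l1 *\<^sub>R e) (z + t *\<^sub>R e + l2 *\<^sub>R e) \<subseteq> \<Omega>}
     = {sqrt (l1 * l2) | l1 l2. 0 \<le> l1 \<and> 0 \<le> l2 \<and> {t - l1..t + l2} \<subseteq> {t. z + t *\<^sub>R e \<in> \<Omega>}}"
    by blast
  then show ?thesis unfolding phi_def line_phi_def by simp
qed

lemma compact_line_section:
  fixes \<Omega> :: "'a::euclidean_space set"
  assumes "compact \<Omega>" "norm e = 1"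
  shows "compact {t. z + t *\<^sub>R e \<in> \<Omega>}"
proof -
  have "closed ((\<lambda>t. z + t *\<^sub>R e) -` \<Omega>)"
    by (intro closed_vimage compact_imp_closed assms continuous_intros)
  moreover have "bounded ((\<lambda>t. z + t *\<^sub>R e) -` \<Omega>)"
  proof -
    obtain B where B: "\<And>x. x \<in> \<Omega> \<Longrightarrow> norm x \<le> B" using compact_imp_bounded[OF assms(1)] unfolding bounded_iff by blast
    have "\<bar>t\<bar> \<le> B + norm z" if "z + t *\<^sub>R e \<in> \<Omega>" for t
      using B[OF that] norm_triangle_ineq4[of "z + t *\<^sub>R e" z] assms(2) by simp
    then show ?thesis unfolding bounded_iff by (intro exI[of _ "B + norm z"]) auto
  qed
  ultimately show ?thesis by (simp add: compact_eq_bounded_closed vimage_def)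
qed

section \<open>Differences with step proportional to the weight function\<close>

lemma fdiff_zero_step:
  assumes "r \<ge> 1"
  shows "fdiff r 0 f \<eta> = 0"
proof -
  have "(\<Sum>j\<le>r. (-1) ^ (r + j) * real (r choose j) * f \<eta>) = (-1) ^ r * (\<Sum>j\<le>r. (-1) ^ j * real (r choose j)) * f \<eta>"
    by (simp add: sum_distrib_left sum_distrib_right power_add mult.assoc)
  also have "(\<Sum>j\<le>r. (-1) ^ j * real (r choose j)) = 0"
    using choose_alternating_sum[of r, where 'a = real] assms by simp
  finally show ?thesis unfolding fdiff_def by simp
qed

lemma closed_segment_line_subset_iff:
  fixes z e :: "'a::real_vector"
  shows "closed_segment (z + c *\<^sub>R e) (z + d *\<^sub>R e) \<subseteq> \<Omega> \<longleftrightarrow> closed_segment c d \<subseteq> {t. z + t *\<^sub>R e \<in> \<Omega>}"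
proof -
  have "closed_segment (z + c *\<^sub>R e) (z + d *\<^sub>R e) = (\<lambda>t. z + t *\<^sub>R e) ` closed_segment c d"
    unfolding closed_segment_image_interval image_image
    by (rule image_cong) (simp_all add: algebra_simps)
  then show ?thesis by auto
qed

lemma central_diff_on_line:
  "central_diff_on r (s *\<^sub>R e) f \<Omega> (z + t *\<^sub>R e)
    = (if closed_segment (t - real r / 2 * s) (t + real r / 2 * s) \<subseteq> {t. z + t *\<^sub>R e \<in> \<Omega>}
       then \<Sum>j\<le>r. (-1) ^ (r + j) * real (r choose j) * f (z + (t - real r / 2 * s + real j * s) *\<^sub>R e) else 0)"
proof -
  have a: "z + t *\<^sub>R e - (real r / 2) *\<^sub>R s *\<^sub>R e = z + (t - real r / 2 * s) *\<^sub>R e"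
    by (simp add: algebra_simps)
  have b: "z + (t - real r / 2 * s) *\<^sub>R e + real r *\<^sub>R s *\<^sub>R e = z + (t + real r / 2 * s) *\<^sub>R e"
  proof -
    have "t - real r / 2 * s + real r * s = t + real r / 2 * s" by simp
    then have "(t - real r / 2 * s) *\<^sub>R e + (real r * s) *\<^sub>R e = (t + real r / 2 * s) *\<^sub>R e"
      by (metis scaleR_left_distrib)
    then show ?thesis by (simp add: add.assoc)
  qed
  have c: "z + (t - real r / 2 * s) *\<^sub>R e + real j *\<^sub>R s *\<^sub>R e = z + (t - real r / 2 * s + real j * s) *\<^sub>R e" for j
    by (simp add: algebra_simps)
  show ?thesis
    unfolding central_diff_on_def diff_on_def fdiff_def a c closed_segment_line_subset_iff
    by (simp add: mult.commute add.commute)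
qed

text \<open>The extension by 0 outside \<Omega> allows integrals and majorants over the whole
  space.\<close>

definition phi_difference :: "nat \<Rightarrow> real \<Rightarrow> ('d::finite) point \<Rightarrow> 'd point set \<Rightarrow> ('d point \<Rightarrow> real) \<Rightarrow> 'd point \<Rightarrow> real" where
  "phi_difference r h e \<Omega> f z = indicator \<Omega> z * central_diff_on r ((h * phi \<Omega> e z) *\<^sub>R e) f \<Omega> z"

lemma closed_symmetric_segments:
  fixes \<Omega> :: "'a::euclidean_space set"
  assumes "closed \<Omega>"
  shows "closed {(z, \<tau>). closed_segment (z - \<tau> *\<^sub>R e) (z + \<tau> *\<^sub>R e) \<subseteq> \<Omega>}"
proof -
  have "{(z, \<tau>). closed_segment (z - \<tau> *\<^sub>R e) (z + \<tau> *\<^sub>R e) \<subseteq> \<Omega>}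
     = (\<Inter>u\<in>{0..1}. (\<lambda>x. (1 - u) *\<^sub>R (fst x - snd x *\<^sub>R e) + u *\<^sub>R (fst x + snd x *\<^sub>R e)) -` \<Omega>)"
    unfolding closed_segment_image_interval by auto
  moreover have "closed \<dots>"
    by (intro closed_INT ballI closed_vimage continuous_intros assms)
  ultimately show ?thesis by simp
qed

definition weight_at :: "('d::finite) point set \<Rightarrow> 'd point \<Rightarrow> 'd point \<Rightarrow> real" where
  "weight_at \<Omega> e z = indicator \<Omega> z * phi \<Omega> e z"

text \<open>Positive weight is demanded because at weight 0 the step is 0 and the difference
  vanishes. On a line this discards all one-point components, as the summation over components
  requires.\<close>

definition active_set :: "nat \<Rightarrow> real \<Rightarrow> ('d::finite) point \<Rightarrow> 'd point set \<Rightarrow> 'd point set" where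
  "active_set r h e \<Omega> = {z \<in> \<Omega>. weight_at \<Omega> e z > 0 \<and>
     closed_segment (z - (real r / 2 * (h * weight_at \<Omega> e z)) *\<^sub>R e) (z + (real r / 2 * (h * weight_at \<Omega> e z)) *\<^sub>R e) \<subseteq> \<Omega>}"

lemma weight_at_measurable:
  assumes "compact \<Omega>" "norm e = 1"
  shows "weight_at \<Omega> e \<in> borel_measurable borel"
  using borel_measurable_phi[OF assms] unfolding weight_at_def[abs_def] .

lemma active_set_measurable:
  fixes \<Omega> :: "('d::finite) point set"
  assumes \<Omega>: "compact \<Omega>" and e: "norm e = 1"
  shows "active_set r h e \<Omega> \<in> sets borel"
proof -
  note weight_at_measurable[OF assms, measurable]
  define C where "C = {(z, \<tau>). closed_segment (z - \<tau> *\<^sub>R e) (z + \<tau> *\<^sub>R e) \<subseteq> \<Omega>}"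
  have C[measurable]: "C \<in> sets borel"
    unfolding C_def using closed_symmetric_segments compact_imp_closed[OF \<Omega>] by (rule_tac borel_closed) blast
  have [measurable]: "\<Omega> \<in> sets borel" using \<Omega> by (simp add: compact_imp_closed)
  have [measurable]: "(\<lambda>z. (z, real r / 2 * (h * weight_at \<Omega> e z))) \<in> borel \<rightarrow>\<^sub>M borel"
    by (intro borel_measurable_Pair) measurable
  have "{z \<in> space borel. (z, real r / 2 * (h * weight_at \<Omega> e z)) \<in> C} \<in> sets borel"
    by measurable
  moreover have "{z \<in> space borel. weight_at \<Omega> e z > 0} \<in> sets borel" by measurable
  ultimately have "\<Omega> \<inter> {z \<in> space borel. weight_at \<Omega> e z > 0} \<inter> {z \<in> space borel. (z, real r / 2 * (h * weight_at \<Omega> e z)) \<in> C} \<in> sets borel"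
    by measurable
  also have "\<Omega> \<inter> {z \<in> space borel. weight_at \<Omega> e z > 0} \<inter> {z \<in> space borel. (z, real r / 2 * (h * weight_at \<Omega> e z)) \<in> C} = active_set r h e \<Omega>"
    unfolding active_set_def C_def by auto
  finally show ?thesis .
qed

text \<open>All case distinctions of the difference are collected in the indicator of one Borel set,
  which makes measurability evident when f is Borel.\<close>

lemma phi_difference_eq:
  assumes r: "r \<ge> 1" and nn: "\<And>z. z \<in> \<Omega> \<Longrightarrow> 0 \<le> phi \<Omega> e z"
  shows "phi_difference r h e \<Omega> f z = indicator (active_set r h e \<Omega>) z *
    (\<Sum>j\<le>r. (-1) ^ (r + j) * real (r choose j) * f (z + ((real j - real r / 2) * (h * weight_at \<Omega> e z)) *\<^sub>R e))"
proof (cases "z \<in> \<Omega>")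
  case z: True
  define s where "s = h * weight_at \<Omega> e z"
  have s: "h * phi \<Omega> e z = s" unfolding s_def weight_at_def using z by simp
  have c: "z - (real r / 2) *\<^sub>R s *\<^sub>R e + real r *\<^sub>R s *\<^sub>R e = z + (real r / 2 * s) *\<^sub>R e"
    by (simp add: scaleR_left_distrib[symmetric] algebra_simps)
  have pt: "z - (real r / 2) *\<^sub>R s *\<^sub>R e + real j *\<^sub>R s *\<^sub>R e = z + ((real j - real r / 2) * s) *\<^sub>R e" for j
    by (simp add: algebra_simps)
  have eq: "phi_difference r h e \<Omega> f z = (if closed_segment (z - (real r / 2 * s) *\<^sub>R e) (z + (real r / 2 * s) *\<^sub>R e) \<subseteq> \<Omega>
     then fdiff r (s *\<^sub>R e) f (z - (real r / 2) *\<^sub>R s *\<^sub>R e) else 0)"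
    unfolding phi_difference_def s central_diff_on_def diff_on_def c using z by simp
  show ?thesis
  proof (cases "weight_at \<Omega> e z > 0")
    case True
    then have act: "z \<in> active_set r h e \<Omega> \<longleftrightarrow>
        closed_segment (z - (real r / 2 * s) *\<^sub>R e) (z + (real r / 2 * s) *\<^sub>R e) \<subseteq> \<Omega>"
      unfolding active_set_def s_def using z by blast
    show ?thesis unfolding eq fdiff_def pt s_def[symmetric] indicator_def act by simp
  next
    case False
    then have "weight_at \<Omega> e z = 0" using nn[OF z] z unfolding weight_at_def by simp
    then show ?thesis unfolding eq active_set_def s_def by (simp add: fdiff_zero_step[OF r])
  qed
next
  case False
  then show ?thesis by (simp add: phi_difference_def active_set_def)
qed

lemma phi_nonneg:
  fixes \<Omega> :: "('d::finite) point set"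
  assumes "compact \<Omega>" "norm e = 1" "z \<in> \<Omega>"
  shows "0 \<le> phi \<Omega> e z"
proof -
  have "closed_segment (z - 0 *\<^sub>R e) (z + 0 *\<^sub>R e) \<subseteq> \<Omega>" using assms by simp
  then show ?thesis using phi_ge_iff[OF assms, of 0] by (metis mult_zero_right order_refl real_sqrt_zero)
qed

lemma phi_difference_measurable:
  fixes \<Omega> :: "('d::finite) point set"
  assumes "compact \<Omega>" "norm e = 1" "r \<ge> 1" and f[measurable]: "f \<in> borel_measurable borel"
  shows "phi_difference r h e \<Omega> f \<in> borel_measurable borel"
proof -
  note weight_at_measurable[OF assms(1,2), measurable] active_set_measurable[OF assms(1,2), measurable]
  have "phi_difference r h e \<Omega> f = (\<lambda>z. indicator (active_set r h e \<Omega>) z *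
    (\<Sum>j\<le>r. (-1) ^ (r + j) * real (r choose j) * f (z + ((real j - real r / 2) * (h * weight_at \<Omega> e z)) *\<^sub>R e)))"
    by (intro ext phi_difference_eq assms phi_nonneg)
  also have "\<dots> \<in> borel_measurable borel" by measurable
  finally show ?thesis .
qed

lemma weight_at_line:
  assumes "z + t *\<^sub>R e \<in> \<Omega>"
  shows "weight_at \<Omega> e (z + t *\<^sub>R e) = line_phi {t. z + t *\<^sub>R e \<in> \<Omega>} t"
  using assms by (simp add: weight_at_def phi_line)

text \<open>The number d carries the sign of h, whence the absolute values.\<close>

lemma segment_in_component:
  fixes t :: real
  assumes C: "{a..b} \<in> components K" and t: "t \<in> {a..b}" and s: "closed_segment (t - d) (t + d) \<subseteq> K"
  shows "\<bar>d\<bar> \<le> t - a" "\<bar>d\<bar> \<le> b - t"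
proof -
  have eq: "closed_segment (t - d) (t + d) = {t - \<bar>d\<bar>..t + \<bar>d\<bar>}"
    unfolding closed_segment_eq_real_ivl by (simp add: abs_if)
  have "{t - \<bar>d\<bar>..t + \<bar>d\<bar>} \<subseteq> {a..b}"
    by (rule interval_in_component[OF C t]) (use s eq in auto)
  moreover have "t - \<bar>d\<bar> \<in> {t - \<bar>d\<bar>..t + \<bar>d\<bar>}" "t + \<bar>d\<bar> \<in> {t - \<bar>d\<bar>..t + \<bar>d\<bar>}" by auto
  ultimately have "t - \<bar>d\<bar> \<in> {a..b}" "t + \<bar>d\<bar> \<in> {a..b}" by blast+
  then show "\<bar>d\<bar> \<le> t - a" "\<bar>d\<bar> \<le> b - t" by auto
qed

text \<open>On a component of a line the weight is sqrt ((t - a) (b - t)), so the one-dimensional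
  substitution applies with \<theta> = r |h| / 2 and \<epsilon> = (j - r / 2) h. The components are
  summed up, and the slab formula puts the lines together.\<close>

lemma phi_shift_bounded:
  fixes \<Omega> :: "('d::finite) point set" and F :: "'d point \<Rightarrow> ennreal"
  assumes \<Omega>: "compact \<Omega>" and e: "norm e = 1" and F[measurable]: "F \<in> borel_measurable borel" and j: "j \<le> r"
  shows "(\<integral>\<^sup>+z\<in>active_set r h e \<Omega>. F (z + ((real j - real r / 2) * (h * weight_at \<Omega> e z)) *\<^sub>R e) \<partial>lborel)
    \<le> 2 * (\<integral>\<^sup>+z\<in>\<Omega>. F z \<partial>lborel)"
proof -
  note weight_at_measurable[OF \<Omega> e, measurable] active_set_measurable[OF \<Omega> e, measurable]
  have \<Omega>m[measurable]: "\<Omega> \<in> sets borel" using \<Omega> by (simp add: compact_imp_closed)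
  define W where "W z = F (z + ((real j - real r / 2) * (h * weight_at \<Omega> e z)) *\<^sub>R e) * indicator (active_set r h e \<Omega>) z" for z
  have W[measurable]: "W \<in> borel_measurable borel" unfolding W_def by measurable
  have line: "(\<integral>\<^sup>+t. W (z + t *\<^sub>R e) \<partial>lborel) \<le> 2 * (\<integral>\<^sup>+t. F (z + t *\<^sub>R e) * indicator \<Omega> (z + t *\<^sub>R e) \<partial>lborel)" for z
  proof -
    define K where "K = {t. z + t *\<^sub>R e \<in> \<Omega>}"
    have K: "compact K" unfolding K_def by (rule compact_line_section[OF \<Omega> e])
    have "(\<integral>\<^sup>+t\<in>K. W (z + t *\<^sub>R e) \<partial>lborel) \<le> 2 * (\<integral>\<^sup>+t\<in>K. F (z + t *\<^sub>R e) \<partial>lborel)"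
    proof (rule nn_integral_components_le[OF K])
      fix a b :: real assume ab: "a < b" and C: "{a..b} \<in> components K"
      have sub: "{a..b} \<subseteq> K" using C by (rule in_components_subset)
      define \<theta> where "\<theta> = \<bar>real r / 2 * h\<bar>"
      define \<epsilon> where "\<epsilon> = (real j - real r / 2) * h"
      have \<epsilon>\<theta>: "\<bar>\<epsilon>\<bar> \<le> \<theta>" unfolding \<epsilon>_def \<theta>_def abs_mult
      proof (rule mult_right_mono)
        have "real j \<le> real r" using j by simp
        then show "\<bar>real j - real r / 2\<bar> \<le> \<bar>real r / 2\<bar>" by linarith
      qed simp
      define J where "J = {t\<in>{a..b}. \<theta> * sqrt ((t - a) * (b - t)) \<le> t - a \<and> \<theta> * sqrt ((t - a) * (b - t)) \<le> b - t}"
      have "(\<integral>\<^sup>+t\<in>{a..b}. W (z + t *\<^sub>R e) \<partial>lborel)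
          \<le> (\<integral>\<^sup>+t\<in>J. F (z + (t + \<epsilon> * sqrt ((t - a) * (b - t))) *\<^sub>R e) \<partial>lborel)"
      proof (rule nn_integral_mono)
        fix t :: real
        show "W (z + t *\<^sub>R e) * indicator {a..b} t \<le> F (z + (t + \<epsilon> * sqrt ((t - a) * (b - t))) *\<^sub>R e) * indicator J t"
        proof (cases "t \<in> {a..b} \<and> z + t *\<^sub>R e \<in> active_set r h e \<Omega>")
          case True
          then have t: "t \<in> {a..b}" and act: "z + t *\<^sub>R e \<in> active_set r h e \<Omega>" by auto
          have wt: "weight_at \<Omega> e (z + t *\<^sub>R e) = sqrt ((t - a) * (b - t))"
          proof -
            have "z + t *\<^sub>R e \<in> \<Omega>" using t sub unfolding K_def by auto
            then have "weight_at \<Omega> e (z + t *\<^sub>R e) = line_phi K t" unfolding K_def by (rule weight_at_line)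
            then show ?thesis using line_phi_component[OF C t] by simp
          qed
          define d where "d = real r / 2 * (h * sqrt ((t - a) * (b - t)))"
          have "closed_segment (z + t *\<^sub>R e - d *\<^sub>R e) (z + t *\<^sub>R e + d *\<^sub>R e) \<subseteq> \<Omega>"
            using act unfolding active_set_def d_def wt[symmetric] by blast
          then have "closed_segment (z + (t - d) *\<^sub>R e) (z + (t + d) *\<^sub>R e) \<subseteq> \<Omega>"
            by (simp add: algebra_simps)
          then have "closed_segment (t - d) (t + d) \<subseteq> K" unfolding closed_segment_line_subset_iff K_def .
          from segment_in_component[OF C t this] have "\<bar>d\<bar> \<le> t - a" "\<bar>d\<bar> \<le> b - t" by auto
          moreover have "\<bar>d\<bar> = \<theta> * sqrt ((t - a) * (b - t))"
            unfolding d_def \<theta>_def using t by (simp add: abs_mult)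
          ultimately have "t \<in> J" unfolding J_def using t by simp
          moreover have "W (z + t *\<^sub>R e) \<le> F (z + (t + \<epsilon> * sqrt ((t - a) * (b - t))) *\<^sub>R e)"
            unfolding W_def wt \<epsilon>_def by (auto simp: indicator_def algebra_simps)
          ultimately show ?thesis using t by simp
        next
          case False
          then show ?thesis unfolding W_def by auto
        qed
      qed
      also have "\<dots> \<le> 2 * (\<integral>\<^sup>+t\<in>{a..b}. F (z + t *\<^sub>R e) \<partial>lborel)"
        unfolding J_def by (rule phi_shift_interval[OF ab _ \<epsilon>\<theta>, of "\<lambda>t. F (z + t *\<^sub>R e)"]) measurable
      finally show "(\<integral>\<^sup>+t\<in>{a..b}. W (z + t *\<^sub>R e) \<partial>lborel) \<le> 2 * (\<integral>\<^sup>+t\<in>{a..b}. F (z + t *\<^sub>R e) \<partial>lborel)" .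
    next
      fix t assume "{t} \<in> components K"
      then have C: "{t..t} \<in> components K" by simp
      then have "t \<in> K" using in_components_subset by fastforce
      then have "weight_at \<Omega> e (z + t *\<^sub>R e) = line_phi K t" unfolding K_def by (intro weight_at_line) simp
      also have "\<dots> = 0" using line_phi_component[OF C, of t] by simp
      finally show "W (z + t *\<^sub>R e) = 0" unfolding W_def active_set_def by simp
    qed measurable
    moreover have "(\<integral>\<^sup>+t\<in>K. W (z + t *\<^sub>R e) \<partial>lborel) = (\<integral>\<^sup>+t. W (z + t *\<^sub>R e) \<partial>lborel)"
      unfolding W_def K_def by (intro nn_integral_cong) (auto simp: indicator_def active_set_def)
    moreover have "(\<integral>\<^sup>+t\<in>K. F (z + t *\<^sub>R e) \<partial>lborel) = (\<integral>\<^sup>+t. F (z + t *\<^sub>R e) * indicator \<Omega> (z + t *\<^sub>R e) \<partial>lborel)"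
      unfolding K_def by (intro nn_integral_cong) (auto simp: indicator_def)
    ultimately show ?thesis by simp
  qed
  have "(\<integral>\<^sup>+z. W z \<partial>lborel) = (\<integral>\<^sup>+z\<in>{z. 0 \<le> z \<bullet> e \<and> z \<bullet> e < 1}. (\<integral>\<^sup>+t. W (z + t *\<^sub>R e) \<partial>lborel) \<partial>lborel)"
    by (rule nn_integral_slab[OF e]) simp
  also have "\<dots> \<le> (\<integral>\<^sup>+z. 2 * ((\<integral>\<^sup>+t. F (z + t *\<^sub>R e) * indicator \<Omega> (z + t *\<^sub>R e) \<partial>lborel) * indicator {z. 0 \<le> z \<bullet> e \<and> z \<bullet> e < 1} z) \<partial>lborel)"
    using line by (intro nn_integral_mono) (auto split: split_indicator)
  also have "\<dots> = 2 * (\<integral>\<^sup>+z\<in>{z. 0 \<le> z \<bullet> e \<and> z \<bullet> e < 1}. (\<integral>\<^sup>+t. F (z + t *\<^sub>R e) * indicator \<Omega> (z + t *\<^sub>R e) \<partial>lborel) \<partial>lborel)"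
    by (rule nn_integral_cmult) measurable
  also have "(\<integral>\<^sup>+z\<in>{z. 0 \<le> z \<bullet> e \<and> z \<bullet> e < 1}. (\<integral>\<^sup>+t. F (z + t *\<^sub>R e) * indicator \<Omega> (z + t *\<^sub>R e) \<partial>lborel) \<partial>lborel)
     = (\<integral>\<^sup>+z. F z * indicator \<Omega> z \<partial>lborel)"
    by (rule nn_integral_slab[OF e, symmetric]) measurable
  finally show ?thesis unfolding W_def .
qed

text \<open>On a component of a line Q is a polynomial of degree at most k, and its difference
  either equals \<open>phi_diff\<close> up to sign or is cut off to 0; in both cases the interval
  estimate dominates. The constant does not depend on the direction or on p.\<close>

lemma phi_bernstein:
  fixes \<Omega> :: "('d::finite) point set"
  assumes \<Omega>: "compact \<Omega>" and r: "r \<ge> 1"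
  shows "\<exists>C>0. \<forall>e k Q h. norm e = 1 \<longrightarrow> k \<ge> 1 \<longrightarrow> continuous_on UNIV Q \<longrightarrow>
      (\<forall>z. \<exists>q. degree q \<le> k \<and> (\<forall>t. poly q (complex_of_real t) = of_real (Q (z + t *\<^sub>R e)))) \<longrightarrow> \<bar>h\<bar> \<le> 1 / real k \<longrightarrow>
    (\<forall>z\<in>\<Omega>. \<forall>B. (\<forall>x\<in>\<Omega>. \<bar>Q x\<bar> \<le> B) \<longrightarrow> \<bar>phi_difference r h e \<Omega> Q z\<bar> \<le> C * (\<bar>h\<bar> * real k) ^ r * B) \<and>
    (\<forall>p\<ge>1. (\<integral>\<^sup>+z. ennreal (\<bar>phi_difference r h e \<Omega> Q z\<bar> powr p) \<partial>lborel)
       \<le> ennreal ((C * (\<bar>h\<bar> * real k) ^ r) powr p) * (\<integral>\<^sup>+z\<in>\<Omega>. ennreal (\<bar>Q z\<bar> powr p) \<partial>lborel))"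
proof -
  obtain C where C: "C > 0" and both: "\<forall>k\<ge>1. \<forall>q a b h. degree q \<le> k \<longrightarrow> a < b \<longrightarrow> \<bar>h\<bar> \<le> 1 / real k \<longrightarrow>
    (\<forall>t\<in>{a..b}. \<forall>B. (\<forall>x\<in>{a..b}. norm (poly q (complex_of_real x)) \<le> B) \<longrightarrow>
       norm (phi_diff r h a b (poly q) t) \<le> C * (\<bar>h\<bar> * real k) ^ r * B) \<and>
    (\<forall>p\<ge>1. (\<integral>\<^sup>+t\<in>{a..b}. ennreal (norm (phi_diff r h a b (poly q) t) powr p) \<partial>lborel)
       \<le> ennreal ((C * (\<bar>h\<bar> * real k) ^ r) powr p) *
         (\<integral>\<^sup>+t\<in>{a..b}. ennreal (norm (poly q (complex_of_real t)) powr p) \<partial>lborel))"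
    using bernstein_interval[OF r] by (elim exE conjE) (rule that)
  have sup: "norm (phi_diff r h a b (poly q) t) \<le> C * (\<bar>h\<bar> * real k) ^ r * B"
    if "k \<ge> 1" "degree q \<le> k" "a < b" "\<bar>h\<bar> \<le> 1 / real k" "t \<in> {a..b}"
      "\<And>x. x \<in> {a..b} \<Longrightarrow> norm (poly q (complex_of_real x)) \<le> B" for k q a b h t B
    using conjunct1[OF both[rule_format, OF that(1-4)]] that(5,6) by blast
  have int: "(\<integral>\<^sup>+t\<in>{a..b}. ennreal (norm (phi_diff r h a b (poly q) t) powr p) \<partial>lborel)
       \<le> ennreal ((C * (\<bar>h\<bar> * real k) ^ r) powr p) *
         (\<integral>\<^sup>+t\<in>{a..b}. ennreal (norm (poly q (complex_of_real t)) powr p) \<partial>lborel)"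
    if "k \<ge> 1" "degree q \<le> k" "a < b" "\<bar>h\<bar> \<le> 1 / real k" "p \<ge> 1" for k q a b h p
    using conjunct2[OF both[rule_format, OF that(1-4)]] that(5) by blast
  show ?thesis
  proof (intro exI[of _ C] conjI C allI impI ballI)
    fix e :: "'d point" and k Q h
    assume e: "norm e = 1" and k: "1 \<le> k" and Q: "continuous_on UNIV Q"
      and pol: "\<forall>z. \<exists>q. degree q \<le> k \<and> (\<forall>t. poly q (complex_of_real t) = of_real (Q (z + t *\<^sub>R e)))"
      and h: "\<bar>h\<bar> \<le> 1 / real k"
    note weight_at_measurable[OF \<Omega> e, measurable] active_set_measurable[OF \<Omega> e, measurable]
    have \<Omega>m[measurable]: "\<Omega> \<in> sets borel" using \<Omega> by (simp add: compact_imp_closed)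
    have Qm[measurable]: "Q \<in> borel_measurable borel" using Q by (rule borel_measurable_continuous_onI)
    have Dm[measurable]: "phi_difference r h e \<Omega> Q \<in> borel_measurable borel"
      by (rule phi_difference_measurable[OF \<Omega> e r Qm])
    define X where "X = C * (\<bar>h\<bar> * real k) ^ r"
    have X0: "X \<ge> 0" unfolding X_def using C by simp
    have nondeg: "\<bar>phi_difference r h e \<Omega> Q (z + t *\<^sub>R e)\<bar> \<le> norm (phi_diff r h a b (poly q) t)"
      if C: "{a..b} \<in> components {t. z + t *\<^sub>R e \<in> \<Omega>}" and t: "t \<in> {a..b}"
        and q: "\<And>t. poly q (complex_of_real t) = of_real (Q (z + t *\<^sub>R e))" for a b z t q
    proof -
      have "{a..b} \<subseteq> {t. z + t *\<^sub>R e \<in> \<Omega>}" using C by (rule in_components_subset)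
      then have zt: "z + t *\<^sub>R e \<in> \<Omega>" using t by auto
      define s where "s = h * sqrt ((t - a) * (b - t))"
      have ph: "phi \<Omega> e (z + t *\<^sub>R e) = sqrt ((t - a) * (b - t))"
        unfolding phi_line by (rule line_phi_component[OF C t])
      have "phi_diff r h a b (poly q) t
         = complex_of_real (\<Sum>j\<le>r. (-1) ^ (r + j) * real (r choose j) * Q (z + (t - real r / 2 * s + real j * s) *\<^sub>R e))"
      proof -
        have "complex_of_real (t - real r / 2 * s) + of_nat j * of_real s = of_real (t - real r / 2 * s + real j * s)" for j
          by simp
        then show ?thesis unfolding phi_diff_def Let_def cdiff_def s_def[symmetric] q by (simp only: q) simp
      qed
      then have "norm (phi_diff r h a b (poly q) t) = \<bar>\<Sum>j\<le>r. (-1) ^ (r + j) * real (r choose j) * Q (z + (t - real r / 2 * s + real j * s) *\<^sub>R e)\<bar>"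
        by (simp only: norm_of_real)
      moreover have "\<bar>phi_difference r h e \<Omega> Q (z + t *\<^sub>R e)\<bar> = \<bar>central_diff_on r (s *\<^sub>R e) Q \<Omega> (z + t *\<^sub>R e)\<bar>"
        unfolding phi_difference_def ph s_def using zt by simp
      ultimately show ?thesis unfolding central_diff_on_line by simp
    qed
    have deg: "phi_difference r h e \<Omega> Q (z + t *\<^sub>R e) = 0" if C: "{t} \<in> components {t. z + t *\<^sub>R e \<in> \<Omega>}" for z t
    proof -
      have "{t..t} \<in> components {t. z + t *\<^sub>R e \<in> \<Omega>}" using C by simp
      from line_phi_component[OF this, of t] have "phi \<Omega> e (z + t *\<^sub>R e) = 0" unfolding phi_line by simp
      then show ?thesis
        unfolding phi_difference_def central_diff_on_def diff_on_def by (simp add: fdiff_zero_step[OF r])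
    qed
    { fix z B assume z: "z \<in> \<Omega>" and B: "\<forall>x\<in>\<Omega>. \<bar>Q x\<bar> \<le> B"
      have B0: "B \<ge> 0" using B z abs_ge_zero order_trans by blast
      define K where "K = {t. z + t *\<^sub>R e \<in> \<Omega>}"
      have "0 \<in> \<Union> (components K)" using z unfolding K_def by simp
      then obtain Cc where Cc: "Cc \<in> components K" "0 \<in> Cc" by blast
      have K: "compact K" unfolding K_def by (rule compact_line_section[OF \<Omega> e])
      obtain a b where ab: "a \<le> b" "Cc = {a..b}" using component_interval[OF K Cc(1)] .
      obtain q where q: "degree q \<le> k" "\<And>t. poly q (complex_of_real t) = of_real (Q (z + t *\<^sub>R e))" using pol by blast
      show "\<bar>phi_difference r h e \<Omega> Q z\<bar> \<le> C * (\<bar>h\<bar> * real k) ^ r * B"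
      proof (cases "a = b")
        case True
        then have "{0} \<in> components K" using Cc ab by auto
        then have "phi_difference r h e \<Omega> Q (z + 0 *\<^sub>R e) = 0" unfolding K_def by (rule deg)
        then show ?thesis using X0 B0 unfolding X_def by simp
      next
        case False
        have t0: "0 \<in> {a..b}" using Cc ab by simp
        have C': "{a..b} \<in> components K" using Cc ab by simp
        have "\<bar>phi_difference r h e \<Omega> Q (z + 0 *\<^sub>R e)\<bar> \<le> norm (phi_diff r h a b (poly q) 0)"
          using nondeg[OF C'[unfolded K_def] t0 q(2)] .
        also have "\<dots> \<le> C * (\<bar>h\<bar> * real k) ^ r * B"
        proof (rule sup[OF k q(1) _ h t0])
          show "a < b" using False ab by simp
          fix x assume "x \<in> {a..b}"
          then have "z + x *\<^sub>R e \<in> \<Omega>" using in_components_subset[OF C'] unfolding K_def by auto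
          then show "norm (poly q (complex_of_real x)) \<le> B" using B unfolding q(2) by simp
        qed
        finally show ?thesis by simp
      qed }
    fix p :: real assume p: "p \<ge> 1"
    define c where "c = ennreal (X powr p)"
    have line: "(\<integral>\<^sup>+t. ennreal (\<bar>phi_difference r h e \<Omega> Q (z + t *\<^sub>R e)\<bar> powr p) \<partial>lborel)
       \<le> c * (\<integral>\<^sup>+t. ennreal (\<bar>Q (z + t *\<^sub>R e)\<bar> powr p) * indicator \<Omega> (z + t *\<^sub>R e) \<partial>lborel)" for z
    proof -
      define K where "K = {t. z + t *\<^sub>R e \<in> \<Omega>}"
      have K: "compact K" unfolding K_def by (rule compact_line_section[OF \<Omega> e])
      obtain q where q: "degree q \<le> k" "\<And>t. poly q (complex_of_real t) = of_real (Q (z + t *\<^sub>R e))" using pol by blast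
      have "(\<integral>\<^sup>+t\<in>K. ennreal (\<bar>phi_difference r h e \<Omega> Q (z + t *\<^sub>R e)\<bar> powr p) \<partial>lborel)
         \<le> c * (\<integral>\<^sup>+t\<in>K. ennreal (\<bar>Q (z + t *\<^sub>R e)\<bar> powr p) \<partial>lborel)"
      proof (rule nn_integral_components_le[OF K])
        fix a b :: real assume ab: "a < b" and C: "{a..b} \<in> components K"
        have "(\<integral>\<^sup>+t\<in>{a..b}. ennreal (\<bar>phi_difference r h e \<Omega> Q (z + t *\<^sub>R e)\<bar> powr p) \<partial>lborel)
           \<le> (\<integral>\<^sup>+t\<in>{a..b}. ennreal (norm (phi_diff r h a b (poly q) t) powr p) \<partial>lborel)"
        proof (rule nn_integral_mono)
          fix t
          show "ennreal (\<bar>phi_difference r h e \<Omega> Q (z + t *\<^sub>R e)\<bar> powr p) * indicator {a..b} t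
             \<le> ennreal (norm (phi_diff r h a b (poly q) t) powr p) * indicator {a..b} t"
          proof (cases "t \<in> {a..b}")
            case True
            have "\<bar>phi_difference r h e \<Omega> Q (z + t *\<^sub>R e)\<bar> powr p \<le> norm (phi_diff r h a b (poly q) t) powr p"
              using nondeg[OF C[unfolded K_def] True q(2)] p by (intro powr_mono2) auto
            then show ?thesis by (intro mult_right_mono ennreal_leI) auto
          qed simp
        qed
        also have "\<dots> \<le> c * (\<integral>\<^sup>+t\<in>{a..b}. ennreal (norm (poly q (complex_of_real t)) powr p) \<partial>lborel)"
          unfolding c_def X_def by (rule int[OF k q(1) ab h p])
        also have "(\<integral>\<^sup>+t\<in>{a..b}. ennreal (norm (poly q (complex_of_real t)) powr p) \<partial>lborel) = (\<integral>\<^sup>+t\<in>{a..b}. ennreal (\<bar>Q (z + t *\<^sub>R e)\<bar> powr p) \<partial>lborel)"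
          unfolding q(2) by simp
        finally show "(\<integral>\<^sup>+t\<in>{a..b}. ennreal (\<bar>phi_difference r h e \<Omega> Q (z + t *\<^sub>R e)\<bar> powr p) \<partial>lborel)
           \<le> c * (\<integral>\<^sup>+t\<in>{a..b}. ennreal (\<bar>Q (z + t *\<^sub>R e)\<bar> powr p) \<partial>lborel)" .
      next
        fix t assume "{t} \<in> components K"
        then show "ennreal (\<bar>phi_difference r h e \<Omega> Q (z + t *\<^sub>R e)\<bar> powr p) = 0"
          using deg p unfolding K_def by simp
      qed measurable
      moreover have "(\<integral>\<^sup>+t\<in>K. ennreal (\<bar>phi_difference r h e \<Omega> Q (z + t *\<^sub>R e)\<bar> powr p) \<partial>lborel)
          = (\<integral>\<^sup>+t. ennreal (\<bar>phi_difference r h e \<Omega> Q (z + t *\<^sub>R e)\<bar> powr p) \<partial>lborel)"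
        unfolding K_def by (intro nn_integral_cong) (auto simp: indicator_def phi_difference_def)
      moreover have "(\<integral>\<^sup>+t\<in>K. ennreal (\<bar>Q (z + t *\<^sub>R e)\<bar> powr p) \<partial>lborel)
          = (\<integral>\<^sup>+t. ennreal (\<bar>Q (z + t *\<^sub>R e)\<bar> powr p) * indicator \<Omega> (z + t *\<^sub>R e) \<partial>lborel)"
        unfolding K_def by (intro nn_integral_cong) (auto simp: indicator_def)
      ultimately show ?thesis by simp
    qed
    have "(\<integral>\<^sup>+z. ennreal (\<bar>phi_difference r h e \<Omega> Q z\<bar> powr p) \<partial>lborel)
       = (\<integral>\<^sup>+z\<in>{z. 0 \<le> z \<bullet> e \<and> z \<bullet> e < 1}. (\<integral>\<^sup>+t. ennreal (\<bar>phi_difference r h e \<Omega> Q (z + t *\<^sub>R e)\<bar> powr p) \<partial>lborel) \<partial>lborel)"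
      by (rule nn_integral_slab[OF e]) measurable
    also have "\<dots> \<le> (\<integral>\<^sup>+z. c * ((\<integral>\<^sup>+t. ennreal (\<bar>Q (z + t *\<^sub>R e)\<bar> powr p) * indicator \<Omega> (z + t *\<^sub>R e) \<partial>lborel) * indicator {z. 0 \<le> z \<bullet> e \<and> z \<bullet> e < 1} z) \<partial>lborel)"
      using line by (intro nn_integral_mono) (auto split: split_indicator)
    also have "\<dots> = c * (\<integral>\<^sup>+z\<in>{z. 0 \<le> z \<bullet> e \<and> z \<bullet> e < 1}. (\<integral>\<^sup>+t. ennreal (\<bar>Q (z + t *\<^sub>R e)\<bar> powr p) * indicator \<Omega> (z + t *\<^sub>R e) \<partial>lborel) \<partial>lborel)"
      by (rule nn_integral_cmult) measurable
    also have "(\<integral>\<^sup>+z\<in>{z. 0 \<le> z \<bullet> e \<and> z \<bullet> e < 1}. (\<integral>\<^sup>+t. ennreal (\<bar>Q (z + t *\<^sub>R e)\<bar> powr p) * indicator \<Omega> (z + t *\<^sub>R e) \<partial>lborel) \<partial>lborel)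
       = (\<integral>\<^sup>+z. ennreal (\<bar>Q z\<bar> powr p) * indicator \<Omega> z \<partial>lborel)"
      by (rule nn_integral_slab[OF e, symmetric]) measurable
    finally show "(\<integral>\<^sup>+z. ennreal (\<bar>phi_difference r h e \<Omega> Q z\<bar> powr p) \<partial>lborel)
       \<le> ennreal ((C * (\<bar>h\<bar> * real k) ^ r) powr p) * (\<integral>\<^sup>+z\<in>\<Omega>. ennreal (\<bar>Q z\<bar> powr p) \<partial>lborel)"
      unfolding c_def X_def .
  qed
qed

section \<open>Polynomials in several variables\<close>

lemma zero_in_poly_space: "(\<lambda>_. 0) \<in> poly_space n"
  unfolding poly_space_def by (auto intro!: exI[of _ "\<lambda>_ _. 0"])

lemma poly_space_mono:
  assumes "m \<le> n"
  shows "poly_space m \<subseteq> (poly_space n :: (('d::finite) point \<Rightarrow> real) set)"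
proof
  fix Q :: "'d point \<Rightarrow> real" assume "Q \<in> poly_space m"
  then obtain c where c: "\<And>x y. Q (x, y) = (\<Sum>(k, l)\<in>exponents m. c k l * (\<Prod>i\<in>UNIV. (x $ i) ^ k i) * y ^ l)"
    unfolding poly_space_def by auto
  have sub: "exponents m \<subseteq> (exponents n :: (('d \<Rightarrow> nat) \<times> nat) set)" using assms unfolding exponents_def by auto
  define c' where "c' k l = (if (k, l) \<in> exponents m then c k l else 0)" for k l
  have "Q (x, y) = (\<Sum>(k, l)\<in>exponents n. c' k l * (\<Prod>i\<in>UNIV. (x $ i) ^ k i) * y ^ l)" for x y
    unfolding c by (rule sum.mono_neutral_cong_left[OF finite_exponents sub]) (auto simp: c'_def)
  then show "Q \<in> poly_space n" unfolding poly_space_def by blast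
qed

lemma poly_space_diff:
  assumes "Q \<in> poly_space n" "R \<in> poly_space n"
  shows "(\<lambda>z. Q z - R z) \<in> poly_space n"
proof -
  obtain c where c: "\<And>x y. Q (x, y) = (\<Sum>(k, l)\<in>exponents n. c k l * (\<Prod>i\<in>UNIV. (x $ i) ^ k i) * y ^ l)"
    using assms(1) unfolding poly_space_def by auto
  obtain d where d: "\<And>x y. R (x, y) = (\<Sum>(k, l)\<in>exponents n. d k l * (\<Prod>i\<in>UNIV. (x $ i) ^ k i) * y ^ l)"
    using assms(2) unfolding poly_space_def by auto
  have "Q (x, y) - R (x, y) = (\<Sum>(k, l)\<in>exponents n. (c k l - d k l) * (\<Prod>i\<in>UNIV. (x $ i) ^ k i) * y ^ l)" for x y
    unfolding c d sum_subtractf[symmetric] by (intro sum.cong) (auto simp: algebra_simps)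
  then show ?thesis unfolding poly_space_def by (auto intro!: exI[of _ "\<lambda>k l. c k l - d k l"])
qed

lemma poly_space_0_const:
  assumes "Q \<in> poly_space 0"
  shows "\<exists>c. Q = (\<lambda>_. c)"
proof -
  obtain c where c: "\<And>x y. Q (x, y) = (\<Sum>(k, l)\<in>exponents 0. c k l * (\<Prod>i\<in>UNIV. (x $ i) ^ k i) * y ^ l)"
    using assms unfolding poly_space_def by auto
  have e0: "exponents 0 = {((\<lambda>_. 0), 0)}" unfolding exponents_def by auto
  have "Q (x, y) = c (\<lambda>_. 0) 0" for x y unfolding c e0 by simp
  then have "Q = (\<lambda>_. c (\<lambda>_. 0) 0)" by (intro ext) (metis surj_pair)
  then show ?thesis by blast
qed

lemma poly_space_continuous:
  assumes "Q \<in> poly_space n"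
  shows "continuous_on UNIV Q"
proof -
  obtain c where c: "\<And>x y. Q (x, y) = (\<Sum>(k, l)\<in>exponents n. c k l * (\<Prod>i\<in>UNIV. (x $ i) ^ k i) * y ^ l)"
    using assms unfolding poly_space_def by auto
  have eq: "Q = (\<lambda>z. \<Sum>kl\<in>exponents n. c (fst kl) (snd kl) * (\<Prod>i\<in>UNIV. (fst z $ i) ^ (fst kl) i) * snd z ^ snd kl)"
    by (rule ext) (auto simp: c case_prod_beta)
  show ?thesis by (subst eq) (intro continuous_intros)
qed

text \<open>Polynomials on a plane, through the one property that is used: P is the complexification of the
restriction of Q, and the restriction of P to a parametrised curve is a polynomial of one variable.\<close>

definition plane_poly :: "nat \<Rightarrow> ('a::real_vector \<Rightarrow> real) \<Rightarrow> bool" where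
  "plane_poly n Q \<longleftrightarrow> (\<forall>z a b. \<exists>P :: complex \<Rightarrow> complex \<Rightarrow> complex.
     (\<forall>s w :: real. P (of_real s) (of_real w) = of_real (Q (z + s *\<^sub>R a + w *\<^sub>R b))) \<and>
     (\<forall>\<alpha> \<beta> D. degree \<alpha> \<le> D \<longrightarrow> degree \<beta> \<le> D \<longrightarrow>
        (\<exists>q. degree q \<le> n * D \<and> (\<forall>x. P (poly \<alpha> x) (poly \<beta> x) = poly q x))))"

text \<open>P is obtained by allowing complex s and w in the coordinates of z + s a + w b. Along the
  curve each coordinate is a polynomial of degree at most D, so a monomial of total degree at most n
  has degree at most n D.\<close>

lemma plane_poly_of_poly_space:
  fixes Q :: "('d::finite) point \<Rightarrow> real"
  assumes "Q \<in> poly_space n"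
  shows "plane_poly n Q"
proof -
  obtain c where c: "\<And>x y. Q (x, y) = (\<Sum>(k, l)\<in>exponents n. c k l * (\<Prod>i\<in>UNIV. (x $ i) ^ k i) * y ^ l)"
    using assms unfolding poly_space_def by auto
  show ?thesis unfolding plane_poly_def
  proof (intro allI)
    fix z a b :: "'d point"
    obtain x y where z: "z = (x, y)" by (cases z)
    obtain ax ay where a: "a = (ax, ay)" by (cases a)
    obtain bx by' where b: "b = (bx, by')" by (cases b)
    define P :: "complex \<Rightarrow> complex \<Rightarrow> complex" where
      "P s w = (\<Sum>kl\<in>exponents n. of_real (c (fst kl) (snd kl)) *
         (\<Prod>i\<in>UNIV. (of_real (x $ i) + s * of_real (ax $ i) + w * of_real (bx $ i)) ^ (fst kl) i) *
         (of_real y + s * of_real ay + w * of_real by') ^ snd kl)" for s w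
    have "P (of_real s) (of_real w) = of_real (Q (z + s *\<^sub>R a + w *\<^sub>R b))" for s w :: real
      unfolding P_def z a b by (simp add: c case_prod_beta)
    moreover have "\<exists>q. degree q \<le> n * D \<and> (\<forall>x. P (poly \<alpha> x) (poly \<beta> x) = poly q x)"
      if D: "degree \<alpha> \<le> D" "degree \<beta> \<le> D" for \<alpha> \<beta> D
    proof -
      define L where "L u v w = [:complex_of_real u:] + smult (of_real v) \<alpha> + smult (of_real w) \<beta>" for u v w
      have L: "degree (L u v w) \<le> D" for u v w
        unfolding L_def using D by (intro degree_add_le) (auto intro: order_trans[OF degree_smult_le])
      have Lp: "poly (L u v w) t = of_real u + poly \<alpha> t * of_real v + poly \<beta> t * of_real w" for u v w t
        unfolding L_def by (simp add: mult.commute)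
      define q where "q = (\<Sum>kl\<in>exponents n. smult (of_real (c (fst kl) (snd kl)))
         ((\<Prod>i\<in>UNIV. L (x $ i) (ax $ i) (bx $ i) ^ (fst kl) i) * L y ay by' ^ snd kl))"
      have "degree q \<le> n * D" unfolding q_def
      proof (intro degree_sum_le finite_exponents)
        fix kl :: "('d \<Rightarrow> nat) \<times> nat" assume kl: "kl \<in> exponents n"
        have pw: "degree (L u v w ^ m) \<le> m * D" for u v w m
          using degree_power_le[of "L u v w" m] L[of u v w] by (metis mult.commute mult_le_mono1 order_trans)
        have "degree (\<Prod>i\<in>UNIV. L (x $ i) (ax $ i) (bx $ i) ^ (fst kl) i) \<le> (\<Sum>i\<in>UNIV. degree (L (x $ i) (ax $ i) (bx $ i) ^ (fst kl) i))"
          using degree_prod_sum_le[of UNIV "\<lambda>i. L (x $ i) (ax $ i) (bx $ i) ^ (fst kl) i"] by (simp add: o_def)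
        also have "\<dots> \<le> (\<Sum>i\<in>UNIV. (fst kl) i * D)" by (intro sum_mono pw)
        also have "\<dots> = (\<Sum>i\<in>UNIV. (fst kl) i) * D" by (simp add: sum_distrib_right)
        finally have 1: "degree (\<Prod>i\<in>UNIV. L (x $ i) (ax $ i) (bx $ i) ^ (fst kl) i) \<le> (\<Sum>i\<in>UNIV. (fst kl) i) * D" .
        have "degree ((\<Prod>i\<in>UNIV. L (x $ i) (ax $ i) (bx $ i) ^ (fst kl) i) * L y ay by' ^ snd kl)
           \<le> (\<Sum>i\<in>UNIV. (fst kl) i) * D + snd kl * D"
          by (rule order_trans[OF degree_mult_le add_mono[OF 1 pw]])
        also have "\<dots> = ((\<Sum>i\<in>UNIV. (fst kl) i) + snd kl) * D" by (simp add: add_mult_distrib)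
        also have "\<dots> \<le> n * D" using kl unfolding exponents_def by (intro mult_right_mono) auto
        finally show "degree (smult (of_real (c (fst kl) (snd kl)))
           ((\<Prod>i\<in>UNIV. L (x $ i) (ax $ i) (bx $ i) ^ (fst kl) i) * L y ay by' ^ snd kl)) \<le> n * D"
          using degree_smult_le order_trans by blast
      qed
      moreover have "P (poly \<alpha> t) (poly \<beta> t) = poly q t" for t
        unfolding P_def q_def poly_sum by (simp add: poly_prod Lp mult.assoc)
      ultimately show ?thesis by blast
    qed
    ultimately show "\<exists>P :: complex \<Rightarrow> complex \<Rightarrow> complex.
     (\<forall>s w :: real. P (of_real s) (of_real w) = of_real (Q (z + s *\<^sub>R a + w *\<^sub>R b))) \<and>
     (\<forall>\<alpha> \<beta> D. degree \<alpha> \<le> D \<longrightarrow> degree \<beta> \<le> D \<longrightarrow>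
        (\<exists>q. degree q \<le> n * D \<and> (\<forall>x. P (poly \<alpha> x) (poly \<beta> x) = poly q x)))"
      by blast
  qed
qed

text \<open>The line is a degenerate plane, with second direction 0, traversed with D = 1.\<close>

lemma plane_poly_line:
  assumes "plane_poly n Q"
  shows "\<exists>q. degree q \<le> n \<and> (\<forall>t. poly q (complex_of_real t) = of_real (Q (z + t *\<^sub>R e)))"
proof -
  obtain P where P: "\<And>s w :: real. P (of_real s) (of_real w) = complex_of_real (Q (z + s *\<^sub>R e + w *\<^sub>R 0))"
    "\<And>\<alpha> \<beta> D. degree \<alpha> \<le> D \<Longrightarrow> degree \<beta> \<le> D \<Longrightarrow> \<exists>q. degree q \<le> n * D \<and> (\<forall>x. P (poly \<alpha> x) (poly \<beta> x) = poly q x)"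
    using assms unfolding plane_poly_def by metis
  obtain q where q: "degree q \<le> n * 1" "\<And>x. P (poly [:0, 1:] x) (poly 0 x) = poly q x"
    using P(2)[of "[:0, 1:]" 1 0] by auto
  have "poly q (complex_of_real t) = of_real (Q (z + t *\<^sub>R e))" for t
    using q(2)[of "of_real t"] P(1)[of t 0] by simp
  then show ?thesis using q(1) by auto
qed

section \<open>Bounds by measurable majorants\<close>

text \<open>The norm of \<open>\<Phi>\<close> is at most N. A measurable majorant is asked for because \<open>\<Phi>\<close> itself is not known to be
Borel measurable when it is built from a Lebesgue measurable f.\<close>

definition bounded_by :: "ennreal \<Rightarrow> 'a measure \<Rightarrow> ('a \<Rightarrow> real) \<Rightarrow> real \<Rightarrow> bool" where
  "bounded_by p M \<Phi> N \<longleftrightarrow>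
     (if p = \<infinity> then \<forall>x\<in>space M. \<bar>\<Phi> x\<bar> \<le> N
      else \<exists>W\<in>borel_measurable M. (\<forall>x\<in>space M. ennreal (\<bar>\<Phi> x\<bar> powr enn2real p) \<le> W x) \<and>
             (\<integral>\<^sup>+x. W x \<partial>M) \<le> ennreal (N powr enn2real p))"

lemma enn2real_ge_one:
  assumes "1 \<le> p" "p \<noteq> \<infinity>"
  shows "1 \<le> enn2real p"
  using enn2real_mono[of 1 p] assms by (simp add: top.not_eq_extremum)

lemma bounded_by_mono:
  assumes "1 \<le> p" "bounded_by p M \<Phi> N" "0 \<le> N" "N \<le> N'" "\<And>x. x \<in> space M \<Longrightarrow> \<bar>\<Psi> x\<bar> \<le> \<bar>\<Phi> x\<bar>"
  shows "bounded_by p M \<Psi> N'"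
proof (cases "p = \<infinity>")
  case True
  then show ?thesis using assms unfolding bounded_by_def by force
next
  case False
  then obtain W where W: "W \<in> borel_measurable M" "\<And>x. x \<in> space M \<Longrightarrow> ennreal (\<bar>\<Phi> x\<bar> powr enn2real p) \<le> W x"
    "(\<integral>\<^sup>+x. W x \<partial>M) \<le> ennreal (N powr enn2real p)"
    using assms(2) unfolding bounded_by_def by auto
  have q: "enn2real p \<ge> 1" by (rule enn2real_ge_one[OF assms(1) False])
  have "ennreal (\<bar>\<Psi> x\<bar> powr enn2real p) \<le> W x" if "x \<in> space M" for x
    using assms(5)[OF that] q by (intro order_trans[OF _ W(2)[OF that]] ennreal_leI powr_mono2) auto
  moreover have "ennreal (N powr enn2real p) \<le> ennreal (N' powr enn2real p)"
    using assms(3,4) q by (intro ennreal_leI powr_mono2) auto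
  ultimately show ?thesis
    unfolding bounded_by_def if_not_P[OF False] using W(1) order_trans[OF W(3)] by blast
qed

text \<open>Minkowski's inequality for majorants. Jensen with the weights w i = N i / S, S the sum
  of the N i, gives the majorant with coefficients (w i)^(1 - q); its integral is at most the sum of
  the w i S^q, that is S^q.\<close>

lemma bounded_by_sum:
  assumes p: "1 \<le> p" and I: "finite I" "I \<noteq> {}"
    and N: "\<And>i. i \<in> I \<Longrightarrow> N i > 0" and b: "\<And>i. i \<in> I \<Longrightarrow> bounded_by p M (\<phi> i) (N i)"
    and \<Phi>: "\<And>x. x \<in> space M \<Longrightarrow> \<bar>\<Phi> x\<bar> \<le> (\<Sum>i\<in>I. \<bar>\<phi> i x\<bar>)"
  shows "bounded_by p M \<Phi> (\<Sum>i\<in>I. N i)"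
proof (cases "p = \<infinity>")
  case True
  then have "\<bar>\<phi> i x\<bar> \<le> N i" if "i \<in> I" "x \<in> space M" for i x
    using b[OF that(1)] that(2) unfolding bounded_by_def by simp
  then have "\<bar>\<Phi> x\<bar> \<le> (\<Sum>i\<in>I. N i)" if "x \<in> space M" for x
    using that by (intro order_trans[OF \<Phi>[OF that]] sum_mono)
  then show ?thesis unfolding bounded_by_def using True by simp
next
  case False
  define q where "q = enn2real p"
  have q: "q \<ge> 1" unfolding q_def by (rule enn2real_ge_one[OF p False])
  have "\<forall>i\<in>I. \<exists>W. W \<in> borel_measurable M \<and> (\<forall>x\<in>space M. ennreal (\<bar>\<phi> i x\<bar> powr q) \<le> W x) \<and>
             (\<integral>\<^sup>+x. W x \<partial>M) \<le> ennreal (N i powr q)"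
    using b False unfolding bounded_by_def q_def by auto
  then obtain W where W: "\<And>i. i \<in> I \<Longrightarrow> W i \<in> borel_measurable M"
    "\<And>i x. i \<in> I \<Longrightarrow> x \<in> space M \<Longrightarrow> ennreal (\<bar>\<phi> i x\<bar> powr q) \<le> W i x"
    "\<And>i. i \<in> I \<Longrightarrow> (\<integral>\<^sup>+x. W i x \<partial>M) \<le> ennreal (N i powr q)"
    by metis
  define S where "S = (\<Sum>i\<in>I. N i)"
  have S: "S > 0" unfolding S_def using I N by (intro sum_pos) auto
  define w where "w i = N i / S" for i
  have w: "w i > 0" if "i \<in> I" for i unfolding w_def using N[OF that] S by simp
  have w1: "(\<Sum>i\<in>I. w i) = 1" unfolding w_def using S by (simp add: sum_divide_distrib[symmetric] S_def)
  have "\<exists>V\<in>borel_measurable M. (\<forall>x\<in>space M. ennreal (\<bar>\<Phi> x\<bar> powr q) \<le> V x) \<and> (\<integral>\<^sup>+x. V x \<partial>M) \<le> ennreal (S powr q)"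
  proof (intro bexI[of _ "\<lambda>x. \<Sum>i\<in>I. ennreal (w i powr (1 - q)) * W i x"] conjI ballI)
    fix x assume x: "x \<in> space M"
    have "\<bar>\<Phi> x\<bar> powr q \<le> (\<Sum>i\<in>I. w i * (\<bar>\<phi> i x\<bar> / w i)) powr q"
    proof (rule powr_mono2)
      have "(\<Sum>i\<in>I. w i * (\<bar>\<phi> i x\<bar> / w i)) = (\<Sum>i\<in>I. \<bar>\<phi> i x\<bar>)"
        using w by (intro sum.cong) force+
      then show "\<bar>\<Phi> x\<bar> \<le> (\<Sum>i\<in>I. w i * (\<bar>\<phi> i x\<bar> / w i))" using \<Phi>[OF x] by simp
    qed (use q in auto)
    also have "\<dots> \<le> (\<Sum>i\<in>I. w i) powr (q - 1) * (\<Sum>i\<in>I. w i * (\<bar>\<phi> i x\<bar> / w i) powr q)"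
      using w by (intro powr_sum_le I q) (auto simp: less_imp_le)
    also have "\<dots> = (\<Sum>i\<in>I. w i powr (1 - q) * \<bar>\<phi> i x\<bar> powr q)"
      unfolding w1 using w by (simp, intro sum.cong refl) (simp add: powr_divide powr_diff less_imp_le)
    finally have "ennreal (\<bar>\<Phi> x\<bar> powr q) \<le> ennreal (\<Sum>i\<in>I. w i powr (1 - q) * \<bar>\<phi> i x\<bar> powr q)"
      by (rule ennreal_leI)
    also have "\<dots> = (\<Sum>i\<in>I. ennreal (w i powr (1 - q)) * ennreal (\<bar>\<phi> i x\<bar> powr q))"
      by (subst sum_ennreal[symmetric]) (auto simp: ennreal_mult')
    also have "\<dots> \<le> (\<Sum>i\<in>I. ennreal (w i powr (1 - q)) * W i x)"
      using W(2) x by (intro sum_mono mult_left_mono) auto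
    finally show "ennreal (\<bar>\<Phi> x\<bar> powr q) \<le> (\<Sum>i\<in>I. ennreal (w i powr (1 - q)) * W i x)" .
  next
    have "(\<integral>\<^sup>+x. (\<Sum>i\<in>I. ennreal (w i powr (1 - q)) * W i x) \<partial>M) = (\<Sum>i\<in>I. ennreal (w i powr (1 - q)) * (\<integral>\<^sup>+x. W i x \<partial>M))"
      using W(1) by (subst nn_integral_sum) (auto simp: nn_integral_cmult)
    also have "\<dots> \<le> (\<Sum>i\<in>I. ennreal (w i powr (1 - q)) * ennreal (N i powr q))"
      using W(3) by (intro sum_mono mult_left_mono) auto
    also have "\<dots> = ennreal (\<Sum>i\<in>I. w i powr (1 - q) * N i powr q)"
      by (subst sum_ennreal[symmetric]) (auto simp: ennreal_mult')
    also have "(\<Sum>i\<in>I. w i powr (1 - q) * N i powr q) = (\<Sum>i\<in>I. w i * S powr q)"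
    proof (rule sum.cong[OF refl])
      fix i assume i: "i \<in> I"
      have "N i = w i * S" unfolding w_def using S by simp
      then have "N i powr q = w i powr q * S powr q" by (simp add: powr_mult)
      moreover have "w i powr (1 - q) * w i powr q = w i" using w[OF i] by (simp add: powr_add[symmetric])
      ultimately show "w i powr (1 - q) * N i powr q = w i * S powr q" by (simp add: mult.assoc[symmetric])
    qed
    also have "\<dots> = S powr q" using w1 by (simp add: sum_distrib_right[symmetric])
    finally show "(\<integral>\<^sup>+x. (\<Sum>i\<in>I. ennreal (w i powr (1 - q)) * W i x) \<partial>M) \<le> ennreal (S powr q)" .
  next
    show "(\<lambda>x. \<Sum>i\<in>I. ennreal (w i powr (1 - q)) * W i x) \<in> borel_measurable M"
      using W(1) by measurable
  qed
  then show ?thesis unfolding bounded_by_def S_def q_def using False by simp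
qed

section \<open>Passing between L^p norms and majorants\<close>

lemma ennreal_powr_le_iff:
  assumes "q \<ge> 1" "N \<ge> 0"
  shows "ennreal_powr X (1 / q) \<le> ennreal N \<longleftrightarrow> X \<le> ennreal (N powr q)"
proof (cases "X = \<infinity>")
  case True
  then show ?thesis by (simp add: ennreal_powr_def top_unique)
next
  case False
  then obtain x where x: "X = ennreal x" "x \<ge> 0" by (cases X) auto
  have "x powr (1 / q) \<le> N \<longleftrightarrow> x \<le> N powr q"
  proof
    assume "x powr (1 / q) \<le> N"
    then have "(x powr (1 / q)) powr q \<le> N powr q" using assms by (intro powr_mono2) auto
    then show "x \<le> N powr q" using assms x by (simp add: powr_powr)
  next
    assume "x \<le> N powr q"
    then have "x powr (1 / q) \<le> (N powr q) powr (1 / q)" using assms x by (intro powr_mono2) auto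
    then show "x powr (1 / q) \<le> N" using assms by (simp add: powr_powr)
  qed
  then show ?thesis using x assms by (simp add: ennreal_powr_def)
qed

lemma Lp_norm_le_iff:
  assumes "1 \<le> p" "N \<ge> 0"
  shows "Lp_norm p A f \<le> ennreal N \<longleftrightarrow>
    (if p = \<infinity> then \<forall>z\<in>A. \<bar>f z\<bar> \<le> N
     else (\<integral>\<^sup>+z\<in>A. ennreal (\<bar>f z\<bar> powr enn2real p) \<partial>lebesgue) \<le> ennreal (N powr enn2real p))"
  using assms enn2real_ge_one[OF assms(1)]
  by (auto simp: Lp_norm_def SUP_le_iff ennreal_powr_le_iff)

lemma bounded_by_imp_Lp_norm_le:
  fixes A :: "'a::euclidean_space set"
  assumes "1 \<le> p" "N \<ge> 0" "bounded_by p lborel (\<lambda>z. indicator A z * f z) N"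
  shows "Lp_norm p A f \<le> ennreal N"
proof (cases "p = \<infinity>")
  case True
  then have b: "\<bar>indicator A z * f z\<bar> \<le> N" for z using assms(3) unfolding bounded_by_def by simp
  have "\<bar>f z\<bar> \<le> N" if "z \<in> A" for z using b[of z] that by simp
  then show ?thesis unfolding Lp_norm_le_iff[OF assms(1,2)] if_P[OF True] by blast
next
  case False
  then obtain W where W: "\<And>x. ennreal (\<bar>indicator A x * f x\<bar> powr enn2real p) \<le> W x"
    "(\<integral>\<^sup>+x. W x \<partial>lborel) \<le> ennreal (N powr enn2real p)"
    using assms unfolding bounded_by_def by auto
  have "(\<integral>\<^sup>+z\<in>A. ennreal (\<bar>f z\<bar> powr enn2real p) \<partial>lebesgue) = (\<integral>\<^sup>+z\<in>A. ennreal (\<bar>f z\<bar> powr enn2real p) \<partial>lborel)"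
    by (rule nn_integral_completion)
  also have "\<dots> \<le> (\<integral>\<^sup>+x. W x \<partial>lborel)"
  proof (rule nn_integral_mono)
    fix z show "ennreal (\<bar>f z\<bar> powr enn2real p) * indicator A z \<le> W z"
      using W(1)[of z] by (cases "z \<in> A") auto
  qed
  also note W(2)
  finally show ?thesis unfolding Lp_norm_le_iff[OF assms(1,2)] if_not_P[OF False] .
qed

text \<open>A Borel version of the integrand agrees with it outside a Borel null set; the value
  \<infinity> on that set makes the inequality hold at every point without changing the integral.
  Pointwise validity matters because the majorant is later evaluated along translates.\<close>

lemma Lp_borel_majorant:
  fixes A :: "'a::euclidean_space set"
  assumes p: "1 \<le> p" "p \<noteq> \<infinity>" and N: "N \<ge> 0" and A: "A \<in> sets borel"
    and f: "f \<in> borel_measurable (lebesgue_on A)" and le: "Lp_norm p A f \<le> ennreal N"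
  shows "\<exists>F\<in>borel_measurable borel. (\<forall>z\<in>A. ennreal (\<bar>f z\<bar> powr enn2real p) \<le> F z) \<and>
    (\<integral>\<^sup>+z\<in>A. F z \<partial>lborel) \<le> ennreal (N powr enn2real p)"
proof -
  define g where "g z = ennreal (\<bar>f z\<bar> powr enn2real p) * indicator A z" for z
  have A': "A \<in> sets lebesgue" using A by simp
  have "(\<lambda>z. ennreal (\<bar>f z\<bar> powr enn2real p)) \<in> borel_measurable (lebesgue_on A)" using f by measurable
  then have "g \<in> borel_measurable lebesgue"
    unfolding g_def using A' by (subst (asm) borel_measurable_restrict_space_iff_ennreal) auto
  then obtain g' where g': "g' \<in> borel_measurable lborel" "AE z in lborel. g z = g' z"
    using completion_ex_borel_measurable by blast
  then obtain Z where Z: "{z \<in> space lborel. \<not> g z = g' z} \<subseteq> Z" "emeasure lborel Z = 0" "Z \<in> sets lborel"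
    using AE_E by blast
  define F where "F z = g' z + \<infinity> * indicator Z z" for z
  have Fm: "F \<in> borel_measurable borel" unfolding F_def using g'(1) Z(3) by measurable
  have "g z = g' z" if "z \<notin> Z" for z using Z(1) that by auto
  then have gF: "g z \<le> F z" for z by (cases "z \<in> Z") (auto simp: F_def)
  have "ennreal (\<bar>f z\<bar> powr enn2real p) \<le> F z" if "z \<in> A" for z using gF[of z] that by (simp add: g_def)
  moreover have "(\<integral>\<^sup>+z\<in>A. F z \<partial>lborel) \<le> (\<integral>\<^sup>+z. F z \<partial>lborel)"
    by (intro nn_integral_mono) (auto split: split_indicator)
  moreover have "(\<integral>\<^sup>+z. F z \<partial>lborel) = (\<integral>\<^sup>+z. g z \<partial>lborel)"
  proof (rule nn_integral_cong_AE)
    have "AE z in lborel. z \<notin> Z" using Z(2,3) by (intro AE_not_in) auto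
    then show "AE z in lborel. F z = g z" using g'(2) by eventually_elim (simp add: F_def)
  qed
  moreover have "(\<integral>\<^sup>+z. g z \<partial>lborel) \<le> ennreal (N powr enn2real p)"
    using le p(2) unfolding Lp_norm_le_iff[OF p(1) N] g_def nn_integral_completion by simp
  ultimately show ?thesis using Fm by (intro bexI[of _ F]) (auto intro: order_trans)
qed

lemma Lp_norm_imp_bounded_by:
  fixes A :: "'a::euclidean_space set"
  assumes p: "1 \<le> p" and N: "N \<ge> 0" and A: "A \<in> sets borel"
    and f: "p \<noteq> \<infinity> \<Longrightarrow> f \<in> borel_measurable (lebesgue_on A)" and le: "Lp_norm p A f \<le> ennreal N"
  shows "bounded_by p lborel (\<lambda>z. indicator A z * f z) N"
proof (cases "p = \<infinity>")
  case True
  then show ?thesis using le N unfolding Lp_norm_le_iff[OF p N] bounded_by_def by (auto simp: indicator_def)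
next
  case False
  have q: "enn2real p \<ge> 1" by (rule enn2real_ge_one[OF p False])
  obtain F where F: "F \<in> borel_measurable borel" "\<And>z. z \<in> A \<Longrightarrow> ennreal (\<bar>f z\<bar> powr enn2real p) \<le> F z"
    "(\<integral>\<^sup>+z\<in>A. F z \<partial>lborel) \<le> ennreal (N powr enn2real p)"
    using Lp_borel_majorant[OF p False N A f[OF False] le] by blast
  have "ennreal (\<bar>indicator A z * f z\<bar> powr enn2real p) \<le> F z * indicator A z" for z
    using F(2)[of z] q by (cases "z \<in> A") auto
  moreover have "(\<lambda>z. F z * indicator A z) \<in> borel_measurable lborel" using F(1) A by measurable
  ultimately show ?thesis
    unfolding bounded_by_def if_not_P[OF False] using F(3) by (intro bexI[of _ "\<lambda>z. F z * indicator A z"]) auto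
qed

text \<open>The triangle inequality as the two-term case of \<open>bounded_by_sum\<close>, with the
  truth values as index set.\<close>

lemma Lp_norm_diff_le:
  fixes A :: "'a::euclidean_space set"
  assumes p: "1 \<le> p" and N: "N > 0" "N' > 0" and A: "A \<in> sets borel"
    and f: "p \<noteq> \<infinity> \<Longrightarrow> f \<in> borel_measurable (lebesgue_on A)" "p \<noteq> \<infinity> \<Longrightarrow> g \<in> borel_measurable (lebesgue_on A)"
    and le: "Lp_norm p A f \<le> ennreal N" "Lp_norm p A g \<le> ennreal N'"
  shows "Lp_norm p A (\<lambda>z. f z - g z) \<le> ennreal (N + N')"
proof -
  have "bounded_by p lborel (\<lambda>z. indicator A z * (f z - g z)) (\<Sum>i\<in>{False, True}. if i then N' else N)"
  proof (rule bounded_by_sum[OF p, where \<phi> = "\<lambda>i z. indicator A z * (if i then g z else f z)"])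
    fix i assume "i \<in> {False, True}"
    show "bounded_by p lborel (\<lambda>z. indicator A z * (if i then g z else f z)) (if i then N' else N)"
      using Lp_norm_imp_bounded_by[OF p _ A f(1) le(1)] Lp_norm_imp_bounded_by[OF p _ A f(2) le(2)] N by (cases i) auto
  qed (use N in \<open>auto simp: indicator_def\<close>)
  then show ?thesis using bounded_by_imp_Lp_norm_le[OF p, of "N + N'"] N by (simp add: add.commute)
qed

section \<open>Telescoping over dyadic degrees\<close>

text \<open>The degrees 0, 1, 2, 4, 8, ...; the start at 0 makes the telescoping sum end in a
  constant, which every difference annihilates.\<close>

definition dyadic_degree :: "nat \<Rightarrow> nat" where
  "dyadic_degree i = (case i of 0 \<Rightarrow> 0 | Suc m \<Rightarrow> 2 ^ m)"

text \<open>By monotonicity the term of degree 2^m can be spread over the degrees between the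
  preceding dyadic degree and 2^m: at least 2^m / 2 of them, each of weight at least (2^m / 2)^(r -
  1). The quotient of (2^(m + 1))^r and (2^m / 2)^r is the 4^r.\<close>

lemma dyadic_sum_le:
  fixes e :: "nat \<Rightarrow> real"
  assumes r: "r \<ge> 1" and e: "\<And>i j. i \<le> j \<Longrightarrow> e j \<le> e i" "\<And>j. e j \<ge> 0"
  shows "(\<Sum>i\<le>m. (2 ^ i) ^ r * e (dyadic_degree i)) \<le> 4 ^ r * (\<Sum>j\<le>dyadic_degree m. real (j + 1) ^ (r - 1) * e j)"
proof (induction m)
  case 0
  have "e 0 \<le> 4 ^ r * e 0" using e(2)[of 0] by (simp add: mult_le_cancel_right1 one_le_power)
  then show ?case by (simp add: dyadic_degree_def)
next
  case (Suc m)
  define a where "a = dyadic_degree m"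
  have a: "2 * a \<le> 2 ^ m" unfolding a_def dyadic_degree_def by (cases m) auto
  have split: "{..2 ^ m} = {..a} \<union> {a + 1..2 ^ m}" using a by auto
  have "(2 ^ m / 2) ^ r * e (2 ^ m) = (2 ^ m / 2) * ((2 ^ m / 2) ^ (r - 1) * e (2 ^ m))"
    using r by (cases r) auto
  also have "\<dots> \<le> real (card {a + 1..2 ^ m}) * ((2 ^ m / 2) ^ (r - 1) * e (2 ^ m))"
  proof (rule mult_right_mono)
    have "real a * 2 \<le> 2 ^ m" using a 
      using of_nat_mono[OF a, where 'a = real] by (simp add: mult.commute)
    moreover have "a \<le> 2 ^ m" using a by simp
    ultimately show "(2 ^ m / 2 :: real) \<le> real (card {a + 1..2 ^ m})" by (simp add: of_nat_diff)
  qed (use e in simp)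
  also have "\<dots> = (\<Sum>j\<in>{a + 1..2 ^ m}. (2 ^ m / 2) ^ (r - 1) * e (2 ^ m))" by simp
  also have "\<dots> \<le> (\<Sum>j\<in>{a + 1..2 ^ m}. real (j + 1) ^ (r - 1) * e j)"
  proof (rule sum_mono)
    fix j assume j: "j \<in> {a + 1..2 ^ m}"
    have "2 ^ m \<le> 2 * (j + 1)"
    proof (cases m)
      case (Suc i)
      then have "a = 2 ^ i" unfolding a_def dyadic_degree_def by simp
      then show ?thesis using j Suc by simp
    qed simp
    then have "(2 ^ m :: real) \<le> 2 * real (j + 1)" using of_nat_mono[of "2 ^ m" "2 * (j + 1)", where 'a = real] by simp
    then have "(2 ^ m / 2 :: real) \<le> real (j + 1)" by simp
    then show "(2 ^ m / 2) ^ (r - 1) * e (2 ^ m) \<le> real (j + 1) ^ (r - 1) * e j"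
      using j e by (intro mult_mono power_mono) auto
  qed
  finally have blk: "(2 ^ m / 2) ^ r * e (2 ^ m) \<le> (\<Sum>j\<in>{a + 1..2 ^ m}. real (j + 1) ^ (r - 1) * e j)" .
  have "(2 ^ Suc m) ^ r * e (2 ^ m) = 4 ^ r * ((2 ^ m / 2) ^ r * e (2 ^ m))"
  proof -
    have "(2 ^ Suc m :: real) ^ r = 4 ^ r * (2 ^ m / 2) ^ r"
      by (subst power_mult_distrib[symmetric]) simp
    then show ?thesis by simp
  qed
  also have "\<dots> \<le> 4 ^ r * (\<Sum>j\<in>{a + 1..2 ^ m}. real (j + 1) ^ (r - 1) * e j)"
    using blk by (rule mult_left_mono) simp
  finally have new: "(2 ^ Suc m) ^ r * e (2 ^ m) \<le> 4 ^ r * (\<Sum>j\<in>{a + 1..2 ^ m}. real (j + 1) ^ (r - 1) * e j)" .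
  have "(\<Sum>i\<le>Suc m. (2 ^ i) ^ r * e (dyadic_degree i)) = (\<Sum>i\<le>m. (2 ^ i) ^ r * e (dyadic_degree i)) + (2 ^ Suc m) ^ r * e (2 ^ m)"
    by (simp add: dyadic_degree_def)
  also have "\<dots> \<le> 4 ^ r * (\<Sum>j\<le>a. real (j + 1) ^ (r - 1) * e j) + 4 ^ r * (\<Sum>j\<in>{a + 1..2 ^ m}. real (j + 1) ^ (r - 1) * e j)"
    using Suc.IH new unfolding a_def by (rule add_mono)
  also have "\<dots> = 4 ^ r * (\<Sum>j\<in>{..2 ^ m}. real (j + 1) ^ (r - 1) * e j)"
    unfolding split by (subst sum.union_disjoint) (auto simp: distrib_left)
  finally show ?case by (simp add: dyadic_degree_def)
qed

text \<open>With 2^m \<le> n < 2^(m + 1), f is the sum of its error at degree 2^m, of the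
  differences of consecutive dyadic approximants, and of the constant Q 0. Boundedness of D handles
  the error and the Bernstein estimate the differences. D is kept abstract to serve both kinds of
  moduli.\<close>

lemma telescoping_bound:
  fixes D :: "(('d::finite) point \<Rightarrow> real) \<Rightarrow> 'x \<Rightarrow> real"
  assumes p: "1 \<le> p" and r: "r \<ge> 1" and n: "n \<ge> 1" and C: "C > 0" and \<Omega>: "\<Omega> \<in> sets borel"
    and add: "\<And>f g x. D (\<lambda>z. f z + g z) x = D f x + D g x"
    and const: "\<And>c x. D (\<lambda>_. c) x = 0"
    and bnd: "\<And>g N. N > 0 \<Longrightarrow> (p \<noteq> \<infinity> \<Longrightarrow> g \<in> borel_measurable (lebesgue_on \<Omega>)) \<Longrightarrow> Lp_norm p \<Omega> g \<le> ennreal N \<Longrightarrow> bounded_by p M (D g) (C * N)"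
    and bern: "\<And>Q k N. N > 0 \<Longrightarrow> 1 \<le> k \<Longrightarrow> k \<le> n \<Longrightarrow> Q \<in> poly_space k \<Longrightarrow> Lp_norm p \<Omega> Q \<le> ennreal N \<Longrightarrow>
       bounded_by p M (D Q) (C * (real k / real n) ^ r * N)"
    and f: "p \<noteq> \<infinity> \<Longrightarrow> f \<in> borel_measurable (lebesgue_on \<Omega>)"
    and e: "\<And>i j. i \<le> j \<Longrightarrow> e j \<le> e i" "\<And>j. e j > 0"
    and Q: "\<And>j. Q j \<in> poly_space j" "\<And>j. Lp_norm p \<Omega> (\<lambda>z. f z - Q j z) \<le> ennreal (e j)"
  shows "bounded_by p M (D f) (C * (2 * 4 ^ r) / real n ^ r * (\<Sum>j\<le>n. real (j + 1) ^ (r - 1) * e j))"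
proof -
  obtain m where m: "2 ^ m \<le> n" "n < 2 ^ Suc m"
  proof -
    define m where "m = (GREATEST i. 2 ^ i \<le> n)"
    have "\<forall>y. 2 ^ y \<le> n \<longrightarrow> y \<le> n" using less_exp by (meson le_less_trans less_imp_le order.trans)
    moreover have "2 ^ 0 \<le> n" using n by simp
    ultimately have "2 ^ m \<le> n" "\<And>y. 2 ^ y \<le> n \<Longrightarrow> y \<le> m"
      unfolding m_def using GreatestI_nat[of "\<lambda>i. 2 ^ i \<le> n" 0 n] Greatest_le_nat[of "\<lambda>i. 2 ^ i \<le> n" _ n] by blast+
    then show ?thesis using that[of m] by (metis Suc_n_not_le_n not_le)
  qed
  let ?a = dyadic_degree
  have Qm: "Q j \<in> borel_measurable (lebesgue_on \<Omega>)" for j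
  proof -
    have "Q j \<in> borel_measurable borel" using poly_space_continuous[OF Q(1)] by (rule borel_measurable_continuous_onI)
    then have "Q j \<in> borel_measurable lebesgue" by (simp add: measurable_completion)
    then show ?thesis by (rule measurable_restrict_space1)
  qed
  have D_sum: "D (\<lambda>z. \<Sum>i\<in>I. g i z) x = (\<Sum>i\<in>I. D (g i) x)" if "finite I" for g :: "nat \<Rightarrow> 'd point \<Rightarrow> real" and I x
    using that
  proof (induction I rule: finite_induct)
    case empty
    then show ?case using const[of 0 x] by simp
  next
    case (insert i I)
    have "D (\<lambda>z. \<Sum>i\<in>insert i I. g i z) x = D (\<lambda>z. g i z + (\<Sum>i\<in>I. g i z)) x" using insert.hyps by simp
    also have "\<dots> = D (g i) x + (\<Sum>i\<in>I. D (g i) x)" unfolding add using insert.IH by simp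
    finally show ?case using insert.hyps by simp
  qed
  define g where "g i = (if i = Suc m then (\<lambda>z. f z - Q (?a (Suc m)) z) else (\<lambda>z. Q (?a (Suc i)) z - Q (?a i) z))" for i
  \<comment> \<open>Consecutive approximants differ in norm by at most the sum of their errors,
    which is at most twice the error of the lower degree.\<close>
  define N where "N i = (if i = Suc m then C * e (?a (Suc m)) else C * (2 ^ i / real n) ^ r * (2 * e (?a i)))" for i
  have mono_a: "?a i \<le> ?a (Suc i)" for i unfolding dyadic_degree_def by (cases i) auto
  obtain c where c: "Q 0 = (\<lambda>_. c)" using poly_space_0_const[OF Q(1)[of 0]] by blast
  have f_eq: "f z = (\<Sum>i\<le>Suc m. g i z) + c" for z
  proof -
    have "(\<Sum>i\<le>k. Q (?a (Suc i)) z - Q (?a i) z) = Q (?a (Suc k)) z - Q (?a 0) z" for k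
      by (induction k) auto
    then have "(\<Sum>i\<le>m. g i z) = Q (?a (Suc m)) z - Q (?a 0) z" unfolding g_def by simp
    moreover have "Q (?a 0) z = c" using c by (simp add: dyadic_degree_def)
    ultimately show ?thesis unfolding g_def by simp
  qed
  have "f = (\<lambda>z. (\<Sum>i\<le>Suc m. g i z) + c)" using f_eq by (intro ext)
  then have Df: "D f x = (\<Sum>i\<le>Suc m. D (g i) x)" for x
    using add[of "\<lambda>z. \<Sum>i\<le>Suc m. g i z" "\<lambda>_. c" x] const[of c x] D_sum[of "{..Suc m}" g x] by simp
  have bd: "bounded_by p M (D f) (\<Sum>i\<le>Suc m. N i)"
  proof (rule bounded_by_sum[OF p, where \<phi> = "\<lambda>i. D (g i)"])
    fix i assume i: "i \<in> {..Suc m}"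
    show "N i > 0" unfolding N_def using C e(2) n by simp
    show "bounded_by p M (D (g i)) (N i)"
    proof (cases "i = Suc m")
      case True
      have "bounded_by p M (D (\<lambda>z. f z - Q (?a (Suc m)) z)) (C * e (?a (Suc m)))"
        by (rule bnd[OF e(2) _ Q(2)]) (intro borel_measurable_diff f Qm)
      then show ?thesis unfolding g_def N_def using True by simp
    next
      case False
      then have im: "i \<le> m" using i by simp
      have a: "?a (Suc i) = 2 ^ i" by (simp add: dyadic_degree_def)
      have "(2::nat) ^ i \<le> 2 ^ m" using im by (rule power_increasing) simp
      then have "2 ^ i \<le> n" using m(1) by (rule order_trans)
      then have k: "1 \<le> ?a (Suc i)" "?a (Suc i) \<le> n" unfolding a by auto
      have "Lp_norm p \<Omega> (\<lambda>z. (f z - Q (?a i) z) - (f z - Q (?a (Suc i)) z)) \<le> ennreal (e (?a i) + e (?a (Suc i)))"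
        by (intro Lp_norm_diff_le[OF p e(2) e(2) \<Omega> _ _ Q(2) Q(2)] borel_measurable_diff f Qm)
      also have "\<dots> \<le> ennreal (2 * e (?a i))" using e(1)[OF mono_a[of i]] by (intro ennreal_leI) simp
      finally have "Lp_norm p \<Omega> (\<lambda>z. Q (?a (Suc i)) z - Q (?a i) z) \<le> ennreal (2 * e (?a i))" by simp
      moreover have "(\<lambda>z. Q (?a (Suc i)) z - Q (?a i) z) \<in> poly_space (?a (Suc i))"
        using Q(1) poly_space_mono[OF mono_a] by (intro poly_space_diff) auto
      ultimately have "bounded_by p M (D (\<lambda>z. Q (?a (Suc i)) z - Q (?a i) z)) (C * (real (?a (Suc i)) / real n) ^ r * (2 * e (?a i)))"
        using e(2) k by (intro bern) auto
      then show ?thesis unfolding g_def N_def a using False by simp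
    qed
  next
    fix x
    show "\<bar>D f x\<bar> \<le> (\<Sum>i\<le>Suc m. \<bar>D (g i) x\<bar>)" unfolding Df by (rule sum_abs)
  qed auto
  have sumN: "(\<Sum>i\<le>Suc m. N i) \<le> C * (2 * 4 ^ r) / real n ^ r * (\<Sum>j\<le>n. real (j + 1) ^ (r - 1) * e j)"
  proof -
    have n0: "real n > 0" using n by simp
    have e0: "e j \<ge> 0" for j using e(2)[of j] by simp
    have "(\<Sum>i\<le>Suc m. N i) = (\<Sum>i\<le>m. C * (2 ^ i / real n) ^ r * (2 * e (?a i))) + C * e (?a (Suc m))"
      unfolding N_def by simp
    also have "\<dots> = C * 2 / real n ^ r * (\<Sum>i\<le>m. (2 ^ i) ^ r * e (?a i)) + C * e (?a (Suc m))"
      by (simp add: sum_distrib_left power_divide mult_ac)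
    \<comment> \<open>The error piece has no factor (k / n)^r, but n < 2^(m + 1) allows it to be
      absorbed as the summand of index m + 1.\<close>
    also have "C * e (?a (Suc m)) \<le> C * 2 / real n ^ r * ((2 ^ Suc m) ^ r * e (?a (Suc m)))"
    proof -
      have "real n \<le> 2 ^ Suc m" using of_nat_mono[OF less_imp_le[OF m(2)], where 'a = real] by simp
      then have "real n ^ r \<le> (2 ^ Suc m) ^ r" by (intro power_mono) auto
      moreover have "(0::real) \<le> (2 ^ Suc m) ^ r" by simp
      ultimately have "real n ^ r \<le> 2 * (2 ^ Suc m) ^ r" by linarith
      then have "1 \<le> 2 / real n ^ r * (2 ^ Suc m) ^ r" using n0 by (simp add: pos_le_divide_eq)
      then have "C * e (?a (Suc m)) * 1 \<le> C * e (?a (Suc m)) * (2 / real n ^ r * (2 ^ Suc m) ^ r)"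
        using C e0 by (intro mult_left_mono) auto
      then show ?thesis by (simp add: mult_ac)
    qed
    also have "C * 2 / real n ^ r * (\<Sum>i\<le>m. (2 ^ i) ^ r * e (?a i)) + C * 2 / real n ^ r * ((2 ^ Suc m) ^ r * e (?a (Suc m)))
        = C * 2 / real n ^ r * (\<Sum>i\<le>Suc m. (2 ^ i) ^ r * e (?a i))"
      by (simp add: distrib_left)
    also have "\<dots> \<le> C * 2 / real n ^ r * (4 ^ r * (\<Sum>j\<le>?a (Suc m). real (j + 1) ^ (r - 1) * e j))"
    proof (rule mult_left_mono)
      show "(\<Sum>i\<le>Suc m. (2 ^ i) ^ r * e (?a i)) \<le> 4 ^ r * (\<Sum>j\<le>?a (Suc m). real (j + 1) ^ (r - 1) * e j)"
        by (rule dyadic_sum_le[OF r]) (use e(1) e0 in auto)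
    qed (use C n0 in auto)
    also have "\<dots> \<le> C * 2 / real n ^ r * (4 ^ r * (\<Sum>j\<le>n. real (j + 1) ^ (r - 1) * e j))"
    proof (intro mult_left_mono sum_mono2)
      show "{..?a (Suc m)} \<subseteq> {..n}" using m(1) by (simp add: dyadic_degree_def)
    qed (use C n0 e0 in auto)
    finally show ?thesis by simp
  qed
  have "(\<Sum>i\<le>Suc m. N i) \<ge> 0" unfolding N_def using C e(2) n by (intro sum_nonneg) (simp add: less_imp_le)
  then show ?thesis by (rule bounded_by_mono[OF p bd _ sumN]) simp
qed

text \<open>The telescoping needs strictly positive bounds, so each degree gets an approximant with
  error at most E j + \<epsilon>, and \<epsilon> tends to 0 afterwards. \<Lambda> stands for the
  norm of the difference, known only through its upper bounds.\<close>

lemma inverse_from_bounds: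
  fixes D :: "(('d::finite) point \<Rightarrow> real) \<Rightarrow> 'x \<Rightarrow> real"
  assumes p: "1 \<le> p" and r: "r \<ge> 1" and n: "n \<ge> 1" and C: "C > 0" and \<Omega>: "compact \<Omega>"
    and add: "\<And>f g x. D (\<lambda>z. f z + g z) x = D f x + D g x"
    and const: "\<And>c x. D (\<lambda>_. c) x = 0"
    and bnd: "\<And>g N. N > 0 \<Longrightarrow> (p \<noteq> \<infinity> \<Longrightarrow> g \<in> borel_measurable (lebesgue_on \<Omega>)) \<Longrightarrow> Lp_norm p \<Omega> g \<le> ennreal N \<Longrightarrow> bounded_by p M (D g) (C * N)"
    and bern: "\<And>Q k N. N > 0 \<Longrightarrow> 1 \<le> k \<Longrightarrow> k \<le> n \<Longrightarrow> Q \<in> poly_space k \<Longrightarrow> Lp_norm p \<Omega> Q \<le> ennreal N \<Longrightarrow>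
       bounded_by p M (D Q) (C * (real k / real n) ^ r * N)"
    and L: "\<And>N. N > 0 \<Longrightarrow> bounded_by p M (D f) N \<Longrightarrow> \<Lambda> \<le> ennreal N"
    and f: "f \<in> Lp_space p \<Omega>"
  shows "\<Lambda> \<le> ennreal (C * (2 * 4 ^ r) / real n ^ r) * (\<Sum>j = 0..n. ennreal (real (j + 1) ^ (r - 1)) * best_approx p \<Omega> j f)"
proof -
  have fm: "f \<in> borel_measurable (lebesgue_on \<Omega>)" if "p \<noteq> \<infinity>" using f that unfolding Lp_space_def by simp
  have fin: "Lp_norm p \<Omega> f < \<infinity>"
  proof (cases "p = \<infinity>")
    case True
    then have "continuous_on \<Omega> f" using f unfolding Lp_space_def by simp
    then have "bounded (f ` \<Omega>)" using \<Omega> compact_continuous_image compact_imp_bounded by blast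
    then obtain B where B: "\<And>z. z \<in> \<Omega> \<Longrightarrow> \<bar>f z\<bar> \<le> B" unfolding bounded_iff by auto
    have "Lp_norm p \<Omega> f \<le> ennreal (max B 0)"
      unfolding Lp_norm_def using True B by (auto intro!: SUP_least ennreal_leI simp: max.coboundedI1)
    then show ?thesis using le_less_trans ennreal_less_top by (metis infinity_ennreal_def)
  next
    case False
    then show ?thesis using f unfolding Lp_space_def by simp
  qed
  define E where "E j = enn2real (best_approx p \<Omega> j f)" for j
  have bfin: "best_approx p \<Omega> j f < \<infinity>" for j
  proof -
    have "best_approx p \<Omega> j f \<le> Lp_norm p \<Omega> (\<lambda>z. f z - (\<lambda>_. 0) z)"
      unfolding best_approx_def by (rule INF_lower[OF zero_in_poly_space])
    then show ?thesis using fin by (simp add: le_less_trans)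
  qed
  have E: "best_approx p \<Omega> j f = ennreal (E j)" for j unfolding E_def using bfin[of j] by simp
  have Emono: "E j \<le> E i" if "i \<le> j" for i j
  proof -
    have "best_approx p \<Omega> j f \<le> best_approx p \<Omega> i f"
      unfolding best_approx_def by (rule INF_superset_mono[OF poly_space_mono[OF that]]) simp
    then show ?thesis unfolding E_def using bfin[of i] by (intro enn2real_mono) auto
  qed
  have E0: "E j \<ge> 0" for j unfolding E_def by simp
  define c where "c = C * (2 * 4 ^ r) / real n ^ r"
  have c: "c > 0" unfolding c_def using C n by simp
  define w where "w j = real (j + 1) ^ (r - 1)" for j
  have w0: "w j \<ge> 0" for j unfolding w_def by simp
  have eps: "\<Lambda> \<le> ennreal (c * (\<Sum>j\<le>n. w j * (E j + \<epsilon>)))" if \<epsilon>: "\<epsilon> > 0" for \<epsilon>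
  proof -
    have "\<exists>R. R \<in> poly_space j \<and> Lp_norm p \<Omega> (\<lambda>z. f z - R z) \<le> ennreal (E j + \<epsilon>)" for j
    proof -
      have "best_approx p \<Omega> j f < ennreal (E j + \<epsilon>)" unfolding E using E0[of j] \<epsilon> by (simp add: ennreal_less_iff)
      then show ?thesis unfolding best_approx_def INF_less_iff by (auto intro: less_imp_le)
    qed
    then obtain Q where Q: "\<And>j. Q j \<in> poly_space j" "\<And>j. Lp_norm p \<Omega> (\<lambda>z. f z - Q j z) \<le> ennreal (E j + \<epsilon>)"
      by metis
    have \<Omega>b: "\<Omega> \<in> sets borel" using \<Omega> by (rule borel_compact)
    have "bounded_by p M (D f) (C * (2 * 4 ^ r) / real n ^ r * (\<Sum>j\<le>n. real (j + 1) ^ (r - 1) * (E j + \<epsilon>)))"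
    proof -
      have e1: "E j + \<epsilon> \<le> E i + \<epsilon>" if "i \<le> j" for i j using Emono[OF that] by simp
      have e2: "E j + \<epsilon> > 0" for j using E0[of j] \<epsilon> by simp
      show ?thesis
        using telescoping_bound[where e = "\<lambda>j. E j + \<epsilon>" and D = D and Q = Q and f = f,
          OF p r n C \<Omega>b add const bnd bern fm e1 e2 Q] by blast
    qed
    moreover have "c * (\<Sum>j\<le>n. w j * (E j + \<epsilon>)) > 0"
    proof (rule mult_pos_pos[OF c], rule sum_pos)
      show "0 < w j * (E j + \<epsilon>)" for j unfolding w_def using E0[of j] \<epsilon> by (intro mult_pos_pos) auto
    qed auto
    ultimately show ?thesis unfolding c_def w_def by (rule L[rotated])
  qed
  have "\<Lambda> \<le> ennreal (c * (\<Sum>j\<le>n. w j * E j))"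
  proof (rule ennreal_le_epsilon)
    fix \<delta> :: real assume \<delta>: "\<delta> > 0"
    \<comment> \<open>B - 1 is the coefficient of \<epsilon> in the bound; with \<epsilon> =
      \<delta> / B the error is at most \<delta>.\<close>
    define B where "B = c * (\<Sum>j\<le>n. w j) + 1"
    have B: "B > 0" unfolding B_def using c w0 by (intro add_nonneg_pos mult_nonneg_nonneg sum_nonneg) auto
    have "\<Lambda> \<le> ennreal (c * (\<Sum>j\<le>n. w j * (E j + \<delta> / B)))" using eps[of "\<delta> / B"] \<delta> B by simp
    also have "c * (\<Sum>j\<le>n. w j * (E j + \<delta> / B)) = c * (\<Sum>j\<le>n. w j * E j) + (B - 1) * (\<delta> / B)"
      unfolding B_def by (simp add: distrib_left sum.distrib sum_distrib_right[symmetric] sum_divide_distrib[symmetric])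
    also have "(B - 1) * (\<delta> / B) \<le> \<delta>" using B \<delta> by (simp add: field_simps)
    finally have "\<Lambda> \<le> ennreal (c * (\<Sum>j\<le>n. w j * E j) + \<delta>)" by (simp add: ennreal_leI)
    also have "\<dots> = ennreal (c * (\<Sum>j\<le>n. w j * E j)) + ennreal \<delta>"
      using c w0 E0 \<delta> by (intro ennreal_plus mult_nonneg_nonneg sum_nonneg) auto
    finally show "\<Lambda> \<le> ennreal (c * (\<Sum>j\<le>n. w j * E j)) + ennreal \<delta>" .
  qed
  also have "\<dots> = ennreal c * (\<Sum>j\<le>n. ennreal (w j) * ennreal (E j))"
  proof -
    have "(\<Sum>j\<le>n. ennreal (w j) * ennreal (E j)) = ennreal (\<Sum>j\<le>n. w j * E j)"
      using w0 E0 by (subst sum_ennreal[symmetric]) (auto simp: ennreal_mult')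
    then show ?thesis using c by (simp add: ennreal_mult')
  qed
  finally show ?thesis unfolding c_def w_def E by (simp add: atLeast0AtMost)
qed

section \<open>Coordinate maps\<close>

lemma point_Basis_cases:
  fixes b :: "('d::finite) point"
  assumes "b \<in> Basis"
  obtains (vertical) "b = (0, 1)" | (horizontal) i where "b = (axis i 1, 0)"
  using assms unfolding Basis_prod_def Basis_vec_def by auto

lemma horizontal_in_Basis: "(axis i 1, 0) \<in> (Basis :: ('d::finite) point set)"
  unfolding Basis_prod_def Basis_vec_def by auto

lemma vertical_in_Basis: "(0, 1) \<in> (Basis :: ('d::finite) point set)"
  unfolding Basis_prod_def by auto

text \<open>The signed permutations of the coordinates: these are the linear parts of the maps in
  \<open>coord_maps\<close>.\<close>

definition signed_coordinates :: "(('d::finite) point \<Rightarrow> 'd point) \<Rightarrow> bool" where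
  "signed_coordinates U \<longleftrightarrow> orthogonal_transformation U \<and> (\<forall>b\<in>Basis. U b \<in> Basis \<or> - U b \<in> Basis)"

lemma signed_coordinates_comp:
  assumes "signed_coordinates U" "signed_coordinates V"
  shows "signed_coordinates (U \<circ> V)"
proof -
  have lin: "linear U" using assms(1) unfolding signed_coordinates_def by (simp add: orthogonal_transformation_linear)
  have "U (V b) \<in> Basis \<or> - U (V b) \<in> Basis" if "b \<in> Basis" for b
  proof -
    from that assms(2) consider "V b \<in> Basis" | "- V b \<in> Basis" unfolding signed_coordinates_def by blast
    then show ?thesis
    proof cases
      case 1
      then show ?thesis using assms(1) unfolding signed_coordinates_def by blast
    next
      case 2
      then have "U (- V b) \<in> Basis \<or> - U (- V b) \<in> Basis" using assms(1) unfolding signed_coordinates_def by blast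
      then show ?thesis using linear_neg[OF lin, of "V b"] by auto
    qed
  qed
  then show ?thesis using assms unfolding signed_coordinates_def
    by (auto intro: orthogonal_transformation_compose)
qed

lemma swap_coord_simp: "swap_coord (Some j) z = ((\<chi> i. if i = j then snd z else fst z $ i), fst z $ j)"
  using swap_coord.simps(2)[of j "fst z" "snd z"] by simp

lemma neg_coord_simp: "neg_coord (Some j) z = ((\<chi> i. if i = j then - (fst z $ i) else fst z $ i), snd z)"
  using neg_coord.simps(2)[of j "fst z" "snd z"] by simp

lemma neg_coord_None: "neg_coord None z = (fst z, - snd z)"
  by (cases z) simp

lemma swap_coord_None: "swap_coord None = id"
  by (rule ext) simp

lemma swap_coord_self_adjoint: "swap_coord j z \<bullet> w = z \<bullet> swap_coord j (w :: ('d::finite) point)"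
proof (cases j)
  case (Some i)
  have "(\<Sum>k\<in>UNIV. (if k = i then snd z else fst z $ k) * fst w $ k) = snd z * fst w $ i + (\<Sum>k\<in>UNIV - {i}. fst z $ k * fst w $ k)"
    by (subst sum.remove[of UNIV i]) (auto intro!: sum.cong)
  moreover have "(\<Sum>k\<in>UNIV. fst z $ k * (if k = i then snd w else fst w $ k)) = fst z $ i * snd w + (\<Sum>k\<in>UNIV - {i}. fst z $ k * fst w $ k)"
    by (subst sum.remove[of UNIV i]) (auto intro!: sum.cong)
  ultimately show ?thesis
    unfolding Some swap_coord_simp by (simp add: inner_prod_def inner_vec_def)
qed simp

lemma swap_coord_involution: "swap_coord j (swap_coord j z) = z"
  by (cases j; cases z) (auto simp: vec_eq_iff)

lemma swap_coord_Basis: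
  assumes "b \<in> Basis"
  shows "swap_coord j b \<in> (Basis :: ('d::finite) point set)"
proof (cases j)
  case None
  then show ?thesis using assms by simp
next
  case (Some i)
  from assms show ?thesis
  proof (cases rule: point_Basis_cases)
    case vertical
    have "swap_coord j b = (axis i 1, 0)" unfolding Some vertical by (simp add: vec_eq_iff axis_def)
    then show ?thesis by (simp add: horizontal_in_Basis)
  next
    case (horizontal k)
    have "swap_coord j b = (if k = i then (0, 1) else (axis k 1, 0))"
      unfolding Some horizontal by (auto simp: vec_eq_iff axis_def)
    then show ?thesis by (simp add: horizontal_in_Basis vertical_in_Basis)
  qed
qed

lemma signed_coordinates_swap: "signed_coordinates (swap_coord j :: ('d::finite) point \<Rightarrow> 'd point)"
proof -
  have lin: "linear (swap_coord j :: 'd point \<Rightarrow> 'd point)"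
  proof (cases j)
    case None
    then show ?thesis by (simp add: swap_coord_None linear_id)
  next
    case (Some i)
    show ?thesis unfolding Some
      by (rule linearI) (auto simp: swap_coord_simp vec_eq_iff)
  qed
  have "norm (swap_coord j z) = norm z" for z :: "'d point"
    by (simp add: norm_eq_sqrt_inner swap_coord_self_adjoint swap_coord_involution)
  then have "orthogonal_transformation (swap_coord j :: 'd point \<Rightarrow> 'd point)"
    using lin by (simp add: orthogonal_transformation)
  moreover have "swap_coord j b \<in> Basis" if "b \<in> Basis" for b :: "'d point"
    using that by (rule swap_coord_Basis)
  ultimately show ?thesis unfolding signed_coordinates_def by blast
qed

lemma signed_coordinates_neg: "signed_coordinates (neg_coord j :: ('d::finite) point \<Rightarrow> 'd point)"
proof -
  have lin: "linear (neg_coord j :: 'd point \<Rightarrow> 'd point)"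
    by (cases j; rule linearI) (auto simp: neg_coord_simp neg_coord_None vec_eq_iff)
  have "(if i = k then - (x $ k) else x $ k) * (if i = k then - (x $ k) else x $ k) = x $ k * x $ k" for x :: "real^'d" and i k
    by simp
  then have "neg_coord j z \<bullet> neg_coord j z = z \<bullet> z" for z :: "'d point"
    by (cases j) (auto simp: neg_coord_simp neg_coord_None inner_prod_def inner_vec_def intro!: sum.cong)
  then have "norm (neg_coord j z) = norm z" for z :: "'d point"
    by (simp add: norm_eq_sqrt_inner)
  then have "orthogonal_transformation (neg_coord j :: 'd point \<Rightarrow> 'd point)"
    using lin by (simp add: orthogonal_transformation)
  moreover have "neg_coord j b \<in> Basis \<or> - neg_coord j b \<in> Basis" if "b \<in> Basis" for b :: "'d point"
    using that
  proof (cases rule: point_Basis_cases)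
    case vertical
    have "neg_coord j b = b \<or> - neg_coord j b = b"
      unfolding vertical by (cases j) (auto simp: vec_eq_iff)
    then show ?thesis using that by metis
  next
    case (horizontal k)
    have "neg_coord j b = b \<or> - neg_coord j b = b"
      unfolding horizontal by (cases j) (auto simp: vec_eq_iff axis_def)
    then show ?thesis using that by metis
  qed
  ultimately show ?thesis unfolding signed_coordinates_def by blast
qed

lemma coord_map_affine:
  assumes "S \<in> coord_maps"
  shows "\<exists>a U. signed_coordinates U \<and> S = (\<lambda>z. a + U z)"
  using assms
proof induction
  case (translation a)
  have "signed_coordinates id" unfolding signed_coordinates_def by (simp add: id_def)
  then show ?case by (intro exI[of _ a] exI[of _ id]) (simp add: id_def)
next
  case (swap j)
  then show ?case using signed_coordinates_swap[of j] by (intro exI[of _ 0] exI[of _ "swap_coord j"]) auto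
next
  case (neg j)
  then show ?case using signed_coordinates_neg[of j] by (intro exI[of _ 0] exI[of _ "neg_coord j"]) auto
next
  case (comp S T)
  then obtain a U b V where S: "signed_coordinates U" "S = (\<lambda>z. a + U z)" and T: "signed_coordinates V" "T = (\<lambda>z. b + V z)" by blast
  have lin: "linear U" using S(1) unfolding signed_coordinates_def by (simp add: orthogonal_transformation_linear)
  have "S \<circ> T = (\<lambda>z. (a + U b) + (U \<circ> V) z)"
    unfolding S(2) T(2) by (rule ext) (simp add: linear_add[OF lin] add.assoc)
  then show ?case using signed_coordinates_comp[OF S(1) T(1)] by blast
qed

text \<open>The swap is a self-adjoint involution that permutes the basis, so the preimage of a box
  is a box with permuted side lengths.\<close>

lemma distr_lborel_swap: "distr lborel borel (swap_coord j :: ('d::finite) point \<Rightarrow> 'd point) = lborel"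
proof (rule lborel_eqI[symmetric])
  fix l u :: "'d point" assume lu: "\<And>b. b \<in> Basis \<Longrightarrow> l \<bullet> b \<le> u \<bullet> b"
  let ?U = "swap_coord j :: 'd point \<Rightarrow> 'd point"
  have lin: "linear ?U" and mem: "\<And>b. b \<in> Basis \<Longrightarrow> ?U b \<in> Basis \<or> - ?U b \<in> Basis"
    using signed_coordinates_swap[of j] unfolding signed_coordinates_def by (auto simp: orthogonal_transformation_linear)
  have m: "?U \<in> borel_measurable borel" using linear_continuous_on[OF linear_conv_bounded_linear[THEN iffD1, OF lin]] by (rule borel_measurable_continuous_onI)
  have B: "?U b \<in> Basis" if "b \<in> Basis" for b using that by (rule swap_coord_Basis)
  have bij: "bij_betw ?U Basis Basis"
    by (rule bij_betw_byWitness[where f' = ?U]) (use B in \<open>auto simp: swap_coord_involution\<close>)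
  have ub: "?U -` box l u = box (?U l) (?U u)"
  proof -
    have "(\<forall>b\<in>Basis. l \<bullet> b < ?U x \<bullet> b \<and> ?U x \<bullet> b < u \<bullet> b) \<longleftrightarrow> (\<forall>b\<in>Basis. ?U l \<bullet> b < x \<bullet> b \<and> x \<bullet> b < ?U u \<bullet> b)" for x
    proof -
      have "(\<forall>b\<in>Basis. l \<bullet> b < ?U x \<bullet> b \<and> ?U x \<bullet> b < u \<bullet> b) \<longleftrightarrow> (\<forall>b\<in>?U ` Basis. l \<bullet> b < ?U x \<bullet> b \<and> ?U x \<bullet> b < u \<bullet> b)"
        using bij by (simp add: bij_betw_def)
      also have "\<dots> \<longleftrightarrow> (\<forall>b\<in>Basis. ?U l \<bullet> b < x \<bullet> b \<and> x \<bullet> b < ?U u \<bullet> b)"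
        by (simp add: swap_coord_self_adjoint[symmetric] swap_coord_involution)
      finally show ?thesis .
    qed
    then show ?thesis by (auto simp: box_def)
  qed
  have "emeasure (distr lborel borel ?U) (box l u) = emeasure lborel (box (?U l) (?U u))"
    using m by (subst emeasure_distr) (auto simp: ub)
  also have "\<dots> = (\<Prod>b\<in>Basis. (?U u - ?U l) \<bullet> b)"
  proof (rule emeasure_lborel_box)
    show "?U l \<bullet> b \<le> ?U u \<bullet> b" if "b \<in> Basis" for b using lu[OF B[OF that]] by (simp add: swap_coord_self_adjoint)
  qed
  also have "(\<Prod>b\<in>Basis. (?U u - ?U l) \<bullet> b) = (\<Prod>b\<in>Basis. (u - l) \<bullet> ?U b)"
    by (simp add: inner_diff_left swap_coord_self_adjoint)
  also have "\<dots> = (\<Prod>b\<in>Basis. (u - l) \<bullet> b)" using prod.reindex_bij_betw[OF bij, of "\<lambda>b. (u - l) \<bullet> b"] by simp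
  finally show "emeasure (distr lborel borel ?U) (box l u) = (\<Prod>b\<in>Basis. (u - l) \<bullet> b)" .
qed simp

text \<open>In the standard basis the reflection is diagonal with entries 1 and -1, so the affine
  change of variables has Jacobian 1 in modulus.\<close>

lemma distr_lborel_neg: "distr lborel borel (neg_coord j :: ('d::finite) point \<Rightarrow> 'd point) = lborel"
proof -
  define e :: "'d point" where "e = (case j of None \<Rightarrow> (0, 1) | Some i \<Rightarrow> (axis i 1, 0))"
  have e: "e \<in> Basis" unfolding e_def using horizontal_in_Basis vertical_in_Basis by (cases j) auto
  define c where "c b = (if b = e then - 1 else 1 :: real)" for b
  have lin: "linear (neg_coord j :: 'd point \<Rightarrow> 'd point)"
    using signed_coordinates_neg[of j] unfolding signed_coordinates_def by (auto simp: orthogonal_transformation_linear)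
  have nb: "neg_coord j b = c b *\<^sub>R b" if "b \<in> Basis" for b :: "'d point"
    using that
    by (cases rule: point_Basis_cases; cases j) (auto simp: c_def e_def vec_eq_iff axis_def)
  have "neg_coord j z = 0 + (\<Sum>b\<in>Basis. (c b * (z \<bullet> b)) *\<^sub>R b)" for z :: "'d point"
  proof -
    have "neg_coord j z = neg_coord j (\<Sum>b\<in>Basis. (z \<bullet> b) *\<^sub>R b)" by (simp add: euclidean_representation)
    also have "\<dots> = (\<Sum>b\<in>Basis. (z \<bullet> b) *\<^sub>R neg_coord j b)"
      by (simp add: linear_sum[OF lin] linear_cmul[OF lin])
    also have "\<dots> = (\<Sum>b\<in>Basis. (c b * (z \<bullet> b)) *\<^sub>R b)"
      by (intro sum.cong) (auto simp: nb mult.commute)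
    finally show ?thesis by simp
  qed
  then have eq: "(neg_coord j :: 'd point \<Rightarrow> 'd point) = (\<lambda>z. 0 + (\<Sum>b\<in>Basis. (c b * (z \<bullet> b)) *\<^sub>R b))" by (intro ext)
  have c1: "\<bar>c b\<bar> = 1" for b unfolding c_def by simp
  have "lborel = density (distr lborel borel (neg_coord j :: 'd point \<Rightarrow> 'd point)) (\<lambda>_. (\<Prod>b\<in>(Basis :: 'd point set). \<bar>c b\<bar>))"
    unfolding eq by (rule lborel_affine_euclidean) (simp add: c_def)
  then show ?thesis by (simp add: c1 density_1)
qed

lemma coord_map_measurable:
  assumes "S \<in> coord_maps"
  shows "S \<in> borel_measurable borel"
proof -
  obtain a U where U: "signed_coordinates U" "S = (\<lambda>z. a + U z)" using coord_map_affine[OF assms] by blast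
  then have "linear U" unfolding signed_coordinates_def by (simp add: orthogonal_transformation_linear)
  then have "continuous_on UNIV S" unfolding U(2)
    by (intro continuous_intros linear_continuous_on) (simp add: linear_conv_bounded_linear)
  then show ?thesis by (rule borel_measurable_continuous_onI)
qed

lemma distr_lborel_coord_map:
  assumes "S \<in> coord_maps"
  shows "distr lborel borel S = lborel"
  using assms
proof induction
  case (translation a)
  then show ?case by (rule lborel_distr_plus)
next
  case (comp S T)
  have "distr lborel borel (S \<circ> T) = distr (distr lborel borel T) borel S"
    using coord_map_measurable[OF comp.hyps(1)] coord_map_measurable[OF comp.hyps(2)] by (simp add: distr_distr)
  then show ?case by (simp only: comp.IH)
qed (rule distr_lborel_swap distr_lborel_neg)+

lemma nn_integral_coord_map:
  assumes "S \<in> coord_maps" "F \<in> borel_measurable borel"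
  shows "(\<integral>\<^sup>+z. F (S z) \<partial>lborel) = (\<integral>\<^sup>+z. F z \<partial>lborel)"
proof -
  have "(\<integral>\<^sup>+z. F z \<partial>distr lborel borel S) = (\<integral>\<^sup>+z. F (S z) \<partial>lborel)"
    using coord_map_measurable[OF assms(1)] assms(2) by (intro nn_integral_distr) auto
  then show ?thesis unfolding distr_lborel_coord_map[OF assms(1)] by simp
qed

lemma place_coord_map: "place G \<in> coord_maps"
proof -
  have "swap_coord (direction G) \<circ> (\<lambda>z. offset G + z) \<in> coord_maps"
    by (intro coord_maps.comp coord_maps.swap coord_maps.translation)
  moreover from this have "neg_coord (direction G) \<circ> (swap_coord (direction G) \<circ> (\<lambda>z. offset G + z)) \<in> coord_maps"
    by (intro coord_maps.comp[OF coord_maps.neg])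
  moreover have "place G = (if downward G then neg_coord (direction G) \<circ> (swap_coord (direction G) \<circ> (\<lambda>z. offset G + z))
      else swap_coord (direction G) \<circ> (\<lambda>z. offset G + z))"
    by (rule ext) (simp add: place_def Let_def)
  ultimately show ?thesis by simp
qed

lemma coord_map_bij:
  assumes "S \<in> coord_maps"
  shows "bij S"
proof -
  obtain a U where U: "signed_coordinates U" "S = (\<lambda>z. a + U z)" using coord_map_affine[OF assms] by blast
  then have b: "inj U" "surj U"
    unfolding signed_coordinates_def by (simp_all add: orthogonal_transformation_inj orthogonal_transformation_surj)
  have "inj S" using b(1) unfolding U(2) by (simp add: inj_def)
  moreover have "surj S" unfolding surj_def
  proof
    fix y
    obtain x where "y - a = U x" using b(2) by (rule surjE)
    then show "\<exists>x. y = S x" unfolding U(2) by (intro exI[of _ x]) (simp add: algebra_simps)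
  qed
  ultimately show ?thesis by (simp add: bij_def)
qed

section \<open>The vertical direction of a domain of special type\<close>

text \<open>If S turned the vertical direction of K into a horizontal one, some line in that direction would
leave \<open>up_set H\<close> through its open lateral face, whereas vertical lines leave \<open>up_set K\<close> through
a point of the graph, which belongs to \<open>up_set K\<close>.\<close>

lemma vertical_preserved:
  fixes S :: "('d::finite) point \<Rightarrow> 'd point"
  assumes K: "base K > 0" "param K \<ge> 1" and H: "base H > 0" "param H \<ge> 1"
    and U: "signed_coordinates U" and S: "S = (\<lambda>z. a + U z)"
    and im: "S ` up_set K = up_set H"
  shows "U (0, 1) = (0, 1)"
proof -
  define w where "w = U (0, 1)"
  define \<mu> where "\<mu> = param K * base K"
  define \<nu> where "\<nu> = param H * base H"
  define c where "c = w \<bullet> a"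
  define g where "g = graph K"
  define h where "h = graph H"
  have \<mu>: "\<mu> > 0" and \<nu>: "\<nu> > 0" unfolding \<mu>_def \<nu>_def using K H by (auto intro: mult_pos_pos)
  have orth: "orthogonal_transformation U" using U unfolding signed_coordinates_def by blast
  then have lin: "linear U" by (rule orthogonal_transformation_linear)
  have inj: "inj U" using orth by (rule orthogonal_transformation_inj)
  have memK: "(x, y) \<in> up_set K \<longleftrightarrow> x \<in> cube (base K) \<and> g x - \<mu> < y \<and> y \<le> g x" for x y
    unfolding up_set_def g_def \<mu>_def by simp
  have memH: "(x, y) \<in> up_set H \<longleftrightarrow> x \<in> cube (base H) \<and> h x - \<nu> < y \<and> y \<le> h x" for x y
    unfolding up_set_def h_def \<nu>_def by simp
  have Smem: "S z \<in> up_set H \<longleftrightarrow> z \<in> up_set K" for z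
  proof
    assume "S z \<in> up_set H"
    then obtain z' where "z' \<in> up_set K" "S z = S z'" using im by blast
    then show "z \<in> up_set K" using inj unfolding S by (simp add: inj_eq)
  qed (use im in blast)
  have shift: "S (x, y) + \<tau> *\<^sub>R w = S (x, y + \<tau>)" for x y \<tau>
  proof -
    have "U (x, y + \<tau>) = U ((x, y) + \<tau> *\<^sub>R (0, 1))" by simp
    also have "\<dots> = U (x, y) + \<tau> *\<^sub>R w" unfolding w_def by (simp only: linear_add[OF lin] linear_cmul[OF lin])
    finally show ?thesis unfolding S by (simp add: add.assoc)
  qed
  have wS: "w \<bullet> S (x, y) = c + y" for x y
  proof -
    have "w \<bullet> U (x, y) = (0, 1) \<bullet> (x, y)" unfolding w_def using orth by (metis orthogonal_transformation_def)
    then show ?thesis unfolding S c_def by (simp add: inner_add_right)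
  qed
  have z0: "(0 :: real^'d) \<in> cube (base K)" "(0 :: real^'d) \<in> cube (base H)" using K H unfolding cube_def by auto
  have "w \<in> Basis \<or> - w \<in> Basis" using U vertical_in_Basis unfolding signed_coordinates_def w_def by blast
  then consider "w = (0, 1)" | "w = - (0, 1)" | i \<epsilon> where "w = (\<epsilon> *\<^sub>R axis i 1, 0)" "\<epsilon> = 1 \<or> \<epsilon> = - 1"
  proof (elim disjE)
    assume "w \<in> Basis"
    then show ?thesis
      by (cases rule: point_Basis_cases) (use that(1) that(3)[of 1] in auto)
  next
    assume "- w \<in> Basis"
    then show ?thesis
    proof (cases rule: point_Basis_cases)
      case vertical
      then have "w = - (0, 1)" by (metis minus_minus)
      then show ?thesis by (rule that(2))
    next
      case (horizontal i)
      then have "w = - (axis i 1, 0)" by (metis minus_minus)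
      then show ?thesis by (intro that(3)[of "- 1" i]) simp_all
    qed
  qed
  then show ?thesis
  proof cases
    case 1
    then show ?thesis unfolding w_def .
  next
    case 2
    \<comment> \<open>If the vertical were reversed, a graph point of K would have an image that can
      still move down in \<open>up_set H\<close>, whose lower face is open; in K this is a move
      above the graph.\<close>
    obtain x' y' where z': "S (0, g 0) = (x', y')" by (cases "S (0, g 0)")
    have "(0, g 0) \<in> up_set K" unfolding memK using z0 \<mu> by simp
    then have m: "(x', y') \<in> up_set H" using Smem z' by metis
    define \<delta> where "\<delta> = (y' - (h x' - \<nu>)) / 2"
    have \<delta>: "\<delta> > 0" "y' - \<delta> > h x' - \<nu>" using m unfolding memH \<delta>_def by (auto simp: field_simps)
    have "(x', y' - \<delta>) \<in> up_set H" using m \<delta> unfolding memH by auto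
    moreover have "(x', y' - \<delta>) = S (0, g 0 + \<delta>)"
      unfolding shift[symmetric] z' 2 by simp
    ultimately have "(0, g 0 + \<delta>) \<in> up_set K" using Smem by metis
    then show ?thesis unfolding memK using \<delta> by simp
  next
    case 3
    define b where "b = base H"
    have b: "b > 0" unfolding b_def using H by simp
    have \<epsilon>\<epsilon>: "\<epsilon> * \<epsilon> = 1" "\<bar>\<epsilon>\<bar> = 1" using 3(2) by auto
    have wi: "w \<bullet> (x, y) = \<epsilon> * x $ i" for x y
      unfolding 3(1) by (simp add: inner_axis' )
    \<comment> \<open>The image of a graph point has its base point in the open cube of H, so its
      coordinate along w stays strictly below b.\<close>
    have top: "c + g x < b" if "x \<in> cube (base K)" for x
    proof -
      have "(x, g x) \<in> up_set K" unfolding memK using that \<mu> by simp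
      then have m: "S (x, g x) \<in> up_set H" using Smem by metis
      obtain x' y' where z': "S (x, g x) = (x', y')" by (cases "S (x, g x)")
      have "x' \<in> cube b" using m unfolding z' memH b_def by simp
      then have "- b < x' $ i" "x' $ i < b" unfolding cube_def by auto
      then have "\<epsilon> * x' $ i < b" using 3(2) by auto
      then show ?thesis using wS[of x "g x"] wi[of x' y'] unfolding z' by simp
    qed
    \<comment> \<open>Going against w means going down in K, which is possible until depth \<mu>
      below the graph. By \<open>top\<close> this limit can be expressed by the coordinate along w
      alone.\<close>
    have retreat: "z' - \<tau> *\<^sub>R w \<in> up_set H" if z': "z' \<in> up_set H" and \<tau>: "0 \<le> \<tau>" "b - \<mu> < w \<bullet> z' - \<tau>" for z' \<tau>
    proof -
      obtain x y where xy: "z' = S (x, y)" "(x, y) \<in> up_set K" using z' im by (metis imageE surj_pair)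
      have "y \<le> g x" "x \<in> cube (base K)" using xy(2) unfolding memK by auto
      moreover have "b - \<mu> < c + y - \<tau>" using \<tau>(2) unfolding xy(1) wS .
      ultimately have "(x, y - \<tau>) \<in> up_set K" unfolding memK using top[of x] \<tau>(1) by simp
      then have "S (x, y - \<tau>) \<in> up_set H" using Smem by metis
      moreover have "S (x, y - \<tau>) = z' - \<tau> *\<^sub>R w" unfolding xy(1) using shift[of x y "- \<tau>"] by simp
      ultimately show ?thesis by simp
    qed
    \<comment> \<open>The point of the i-th axis at distance \<eta> from the lateral face towards
      which w points.\<close>
    define X where "X \<eta> = (\<epsilon> * (b - \<eta>)) *\<^sub>R (axis i 1 :: real^'d)" for \<eta>
    have Xcube: "X \<eta> \<in> cube b" if "0 < \<eta>" "\<eta> < b" for \<eta>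
      unfolding cube_def X_def using that 3(2) by (auto simp: axis_def)
    have wX: "w \<bullet> (X \<eta>, y) = b - \<eta>" for \<eta> y unfolding wi X_def using \<epsilon>\<epsilon> by (simp add: axis_def mult.assoc[symmetric])
    have Xshift: "(X \<eta>, y) - \<tau> *\<^sub>R w = (X (\<eta> + \<tau>), y)" for \<eta> \<tau> y
      unfolding X_def 3(1) by (simp add: algebra_simps)
    define \<eta>2 where "\<eta>2 = min \<mu> b / 2"
    have \<eta>2: "0 < \<eta>2" "\<eta>2 < \<mu>" "\<eta>2 < b" unfolding \<eta>2_def using \<mu> b by (auto simp: min_def field_simps)
    have step: "(X \<eta>2, y) \<in> up_set H" if "(X \<eta>1, y) \<in> up_set H" "0 < \<eta>1" "\<eta>1 \<le> \<eta>2" for \<eta>1 y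
    proof -
      have "(X \<eta>1, y) - (\<eta>2 - \<eta>1) *\<^sub>R w \<in> up_set H"
        using that \<eta>2 by (intro retreat) (auto simp: wX)
      then show ?thesis unfolding Xshift by simp
    qed
    \<comment> \<open>By \<open>step\<close> the vertical fibre of \<open>up_set H\<close> over X
      \<eta>1 is contained in the one over X \<eta>2; both are half-open intervals of the same
      length \<nu>, so they coincide.\<close>
    have const: "h (X \<eta>1) = h (X \<eta>2)" if \<eta>1: "0 < \<eta>1" "\<eta>1 \<le> \<eta>2" for \<eta>1
    proof -
      have c1: "X \<eta>1 \<in> cube (base H)" using Xcube[of \<eta>1] \<eta>1 \<eta>2 unfolding b_def by simp
      have "(X \<eta>1, h (X \<eta>1)) \<in> up_set H" unfolding memH using c1 \<nu> by simp
      from step[OF this \<eta>1] have le: "h (X \<eta>1) \<le> h (X \<eta>2)" unfolding memH by simp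
      show ?thesis
      proof (rule ccontr)
        assume "h (X \<eta>1) \<noteq> h (X \<eta>2)"
        then have lt: "h (X \<eta>1) < h (X \<eta>2)" using le by simp
        define y where "y = min (h (X \<eta>1)) (h (X \<eta>2) - \<nu>)"
        have "(X \<eta>1, y) \<in> up_set H" unfolding memH y_def using c1 \<nu> lt by auto
        from step[OF this \<eta>1] show False unfolding memH y_def by simp
      qed
    qed
    have "X \<eta>2 \<in> cube (base H)" using Xcube[of \<eta>2] \<eta>2 unfolding b_def by simp
    then have m2: "(X \<eta>2, h (X \<eta>2)) \<in> up_set H" unfolding memH using \<nu> by simp
    then obtain x y where xy: "(X \<eta>2, h (X \<eta>2)) = S (x, y)" "(x, y) \<in> up_set K" using im by (metis imageE surj_pair)
    have xc: "x \<in> cube (base K)" using xy(2) unfolding memK by simp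
    have y: "c + y = b - \<eta>2" using wS[of x y] wX[of \<eta>2 "h (X \<eta>2)"] unfolding xy(1) by simp
    \<comment> \<open>As h is constant along X, the graph point over X \<eta>2 may be pushed to
      distance \<eta>1 from the lateral face. In K this lifts a point to height b - c - \<eta>1,
      above g x for this choice.\<close>
    define \<eta>1 where "\<eta>1 = min \<eta>2 ((b - c - g x) / 2)"
    have \<eta>1: "0 < \<eta>1" "\<eta>1 \<le> \<eta>2" "2 * \<eta>1 \<le> b - c - g x" unfolding \<eta>1_def using \<eta>2 top[OF xc] by (auto simp: min_def field_simps)
    have "X \<eta>1 \<in> cube (base H)" using Xcube[of \<eta>1] \<eta>1 \<eta>2 unfolding b_def by simp
    then have "(X \<eta>1, h (X \<eta>2)) \<in> up_set H" unfolding memH const[OF \<eta>1(1,2), symmetric] using \<nu> by simp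
    moreover have "(X \<eta>1, h (X \<eta>2)) = S (x, y + (\<eta>2 - \<eta>1))"
      using Xshift[of \<eta>2 "h (X \<eta>2)" "\<eta>1 - \<eta>2"] shift[of x y "\<eta>2 - \<eta>1"] unfolding xy(1)[symmetric]
      by (simp add: algebra_simps)
    ultimately have "(x, y + (\<eta>2 - \<eta>1)) \<in> up_set K" using Smem by metis
    then have "y + (\<eta>2 - \<eta>1) \<le> g x" unfolding memK by simp
    then show ?thesis using y \<eta>1 by linarith
  qed
qed

section \<open>Parabolas under the graph\<close>

lemma frechet_derivative_eq_sum:
  fixes g :: "real^'d::finite \<Rightarrow> real"
  assumes "g differentiable (at x)"
  shows "frechet_derivative g (at x) d = (\<Sum>i\<in>UNIV. d $ i * partial_deriv i g x)"
proof -
  have lin: "linear (frechet_derivative g (at x))" by (rule linear_frechet_derivative[OF assms])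
  have "frechet_derivative g (at x) d = frechet_derivative g (at x) (\<Sum>i\<in>UNIV. d $ i *s axis i 1)"
    by (simp add: basis_expansion)
  also have "\<dots> = (\<Sum>i\<in>UNIV. d $ i * partial_deriv i g x)"
    by (simp add: linear_sum[OF lin] scalar_mult_eq_scaleR linear_cmul[OF lin] partial_deriv_def)
  finally show ?thesis .
qed

lemma C1_fun_partial_bounded:
  fixes g :: "real^'d::finite \<Rightarrow> real"
  assumes "C1_fun g" "compact S"
  shows "\<exists>P\<ge>0. \<forall>x\<in>S. \<forall>i. \<bar>partial_deriv i g x\<bar> \<le> P"
proof -
  have "\<forall>i. \<exists>B\<ge>0. \<forall>x\<in>S. \<bar>partial_deriv i g x\<bar> \<le> B"
  proof
    fix i
    have "continuous_on S (partial_deriv i g)" using assms(1) continuous_on_subset unfolding C1_fun_def by blast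
    then have "bounded (partial_deriv i g ` S)" using assms(2) compact_continuous_image compact_imp_bounded by blast
    then obtain B where "\<And>x. x \<in> S \<Longrightarrow> \<bar>partial_deriv i g x\<bar> \<le> B" unfolding bounded_iff by auto
    then show "\<exists>B\<ge>0. \<forall>x\<in>S. \<bar>partial_deriv i g x\<bar> \<le> B" by (intro exI[of _ "max B 0"]) (auto simp: max.coboundedI1)
  qed
  then obtain B where B: "\<And>i. B i \<ge> 0" "\<And>i x. x \<in> S \<Longrightarrow> \<bar>partial_deriv i g x\<bar> \<le> B i" by metis
  have "\<bar>partial_deriv i g x\<bar> \<le> (\<Sum>i\<in>UNIV. B i)" if "x \<in> S" for i x
    using B(2)[OF that, of i] member_le_sum[of i UNIV B] B(1) by force
  then show ?thesis using B(1) by (intro exI[of _ "\<Sum>i\<in>UNIV. B i"]) (auto intro: sum_nonneg)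
qed

lemma C1_fun_lipschitz:
  fixes g :: "real^'d::finite \<Rightarrow> real"
  assumes "C1_fun g" "compact S" "convex S"
  shows "\<exists>K\<ge>0. \<forall>x\<in>S. \<forall>y\<in>S. \<bar>g x - g y\<bar> \<le> K * norm (x - y)"
proof -
  obtain P where P: "P \<ge> 0" "\<And>x i. x \<in> S \<Longrightarrow> \<bar>partial_deriv i g x\<bar> \<le> P" using C1_fun_partial_bounded[OF assms(1,2)] by blast
  have diff: "g differentiable (at x)" for x using assms(1) unfolding C1_fun_def by blast
  have "norm (g x - g y) \<le> (\<Sum>i\<in>(UNIV :: 'd set). P) * norm (x - y)" if "x \<in> S" "y \<in> S" for x y
  proof (rule differentiable_bound[OF assms(3) _ _ that])
    fix z assume z: "z \<in> S"
    show "(g has_derivative frechet_derivative g (at z)) (at z within S)"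
      using diff[of z] frechet_derivative_works has_derivative_at_withinI by blast
    show "onorm (frechet_derivative g (at z)) \<le> (\<Sum>i\<in>(UNIV :: 'd set). P)"
    proof (rule onorm_le)
      fix d :: "real^'d"
      have "\<bar>frechet_derivative g (at z) d\<bar> \<le> (\<Sum>i\<in>UNIV. \<bar>d $ i * partial_deriv i g z\<bar>)"
        unfolding frechet_derivative_eq_sum[OF diff] by (rule sum_abs)
      also have "\<dots> \<le> (\<Sum>i\<in>(UNIV :: 'd set). P * norm d)"
        unfolding abs_mult
      proof (rule sum_mono)
        fix i :: 'd
        have "\<bar>d $ i\<bar> * \<bar>partial_deriv i g z\<bar> \<le> norm d * P"
          using component_le_norm_cart[of d i] P(2)[OF z, of i] by (intro mult_mono) auto
        then show "\<bar>d $ i\<bar> * \<bar>partial_deriv i g z\<bar> \<le> P * norm d" by (simp add: mult.commute)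
      qed
      finally show "norm (frechet_derivative g (at z) d) \<le> (\<Sum>i\<in>(UNIV :: 'd set). P) * norm d" by simp
    qed
  qed
  then show ?thesis using P(1) by (intro exI[of _ "\<Sum>i\<in>(UNIV :: 'd set). P"]) (auto intro: sum_nonneg)
qed

text \<open>The second partial derivatives are bounded on the compact convex set, so the first ones
  are Lipschitz there; a unit direction has components of modulus at most 1, so summing over the
  coordinates gives the constant.\<close>

lemma C2_fun_derivative_bounds:
  fixes g :: "real^'d::finite \<Rightarrow> real"
  assumes "C2_fun g" "compact S" "convex S"
  shows "\<exists>K\<ge>0. \<forall>x\<in>S. \<forall>y\<in>S. \<forall>d. norm d = 1 \<longrightarrow>
    \<bar>frechet_derivative g (at x) d\<bar> \<le> K \<and>
    \<bar>frechet_derivative g (at x) d - frechet_derivative g (at y) d\<bar> \<le> K * norm (x - y)"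
proof -
  have C1: "C1_fun g" "\<And>i. C1_fun (partial_deriv i g)" using assms(1) unfolding C2_fun_def by auto
  have diff: "g differentiable (at x)" for x using C1(1) unfolding C1_fun_def by blast
  obtain P where P: "P \<ge> 0" "\<And>x i. x \<in> S \<Longrightarrow> \<bar>partial_deriv i g x\<bar> \<le> P" using C1_fun_partial_bounded[OF C1(1) assms(2)] by blast
  have "\<forall>i. \<exists>L\<ge>0. \<forall>x\<in>S. \<forall>y\<in>S. \<bar>partial_deriv i g x - partial_deriv i g y\<bar> \<le> L * norm (x - y)"
    using C1_fun_lipschitz[OF C1(2) assms(2,3)] by blast
  then obtain L where L: "\<And>i. L i \<ge> 0" "\<And>i x y. x \<in> S \<Longrightarrow> y \<in> S \<Longrightarrow> \<bar>partial_deriv i g x - partial_deriv i g y\<bar> \<le> L i * norm (x - y)"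
    by metis
  define K where "K = (\<Sum>i\<in>(UNIV :: 'd set). P) + (\<Sum>i\<in>UNIV. L i)"
  have nn: "(\<Sum>i\<in>(UNIV :: 'd set). P) \<ge> 0" "(\<Sum>i\<in>UNIV. L i) \<ge> 0" using P(1) L(1) by (auto intro: sum_nonneg)
  have d1: "\<bar>d $ i\<bar> * c \<le> c" if "norm d = 1" "c \<ge> 0" for d :: "real^'d" and i and c :: real
    using mult_right_mono[OF component_le_norm_cart[of d i] that(2)] that(1) by simp
  have b1: "\<bar>frechet_derivative g (at x) d\<bar> \<le> K" if x: "x \<in> S" and d: "norm d = 1" for x d
  proof -
    have "\<bar>frechet_derivative g (at x) d\<bar> \<le> (\<Sum>i\<in>UNIV. \<bar>d $ i\<bar> * \<bar>partial_deriv i g x\<bar>)"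
      unfolding frechet_derivative_eq_sum[OF diff] abs_mult[symmetric] by (rule sum_abs)
    also have "\<dots> \<le> (\<Sum>i\<in>(UNIV :: 'd set). P)"
      using d1[OF d] P(2)[OF x] by (intro sum_mono) (meson abs_ge_zero order_trans)
    also have "\<dots> \<le> K" unfolding K_def using nn by linarith
    finally show ?thesis .
  qed
  have b2: "\<bar>frechet_derivative g (at x) d - frechet_derivative g (at y) d\<bar> \<le> K * norm (x - y)"
    if x: "x \<in> S" and y: "y \<in> S" and d: "norm d = 1" for x y d
  proof -
    have "frechet_derivative g (at x) d - frechet_derivative g (at y) d
        = (\<Sum>i\<in>UNIV. d $ i * (partial_deriv i g x - partial_deriv i g y))"
      unfolding frechet_derivative_eq_sum[OF diff] by (simp add: sum_subtractf right_diff_distrib)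
    also have "\<bar>\<dots>\<bar> \<le> (\<Sum>i\<in>UNIV. \<bar>d $ i\<bar> * \<bar>partial_deriv i g x - partial_deriv i g y\<bar>)"
      unfolding abs_mult[symmetric] by (rule sum_abs)
    also have "\<dots> \<le> (\<Sum>i\<in>UNIV. L i * norm (x - y))"
      using d1[OF d] L(2)[OF x y] by (intro sum_mono) (meson abs_ge_zero order_trans)
    also have "\<dots> = (\<Sum>i\<in>UNIV. L i) * norm (x - y)" by (simp add: sum_distrib_right)
    also have "\<dots> \<le> K * norm (x - y)" unfolding K_def using nn by (intro mult_right_mono) auto
    finally show ?thesis .
  qed
  show ?thesis using b1 b2 nn unfolding K_def by (intro exI[of _ K, unfolded K_def]) auto
qed

text \<open>Mean value theorem along the segment, then the Lipschitz bound at the intermediate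
  point; this gives the coefficient K where an integrated remainder would give K / 2.\<close>

lemma C2_fun_taylor_lower:
  fixes g :: "real^'d::finite \<Rightarrow> real"
  assumes g: "C2_fun g" and S: "convex S" and x: "x \<in> S" "x + s *\<^sub>R d \<in> S" and d: "norm d = 1" and K: "K \<ge> 0"
    and lip: "\<And>y. y \<in> S \<Longrightarrow> \<bar>frechet_derivative g (at y) d - frechet_derivative g (at x) d\<bar> \<le> K * norm (y - x)"
  shows "g (x + s *\<^sub>R d) \<ge> g x + s * frechet_derivative g (at x) d - K * s\<^sup>2"
proof -
  have diff: "g differentiable (at x)" for x using g unfolding C2_fun_def C1_fun_def by blast
  define v where "v = s *\<^sub>R d"
  have der: "((\<lambda>\<tau>. g (x + \<tau> *\<^sub>R v)) has_real_derivative s * frechet_derivative g (at (x + \<tau> *\<^sub>R v)) d) (at \<tau>)" for \<tau>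
  proof -
    have lin: "linear (frechet_derivative g (at (x + \<tau> *\<^sub>R v)))" by (rule linear_frechet_derivative[OF diff])
    have 1: "((\<lambda>\<tau>. x + \<tau> *\<^sub>R v) has_derivative (\<lambda>h. h *\<^sub>R v)) (at \<tau>)"
      by (auto intro!: derivative_eq_intros)
    have 2: "(g has_derivative frechet_derivative g (at (x + \<tau> *\<^sub>R v))) (at (x + \<tau> *\<^sub>R v))"
      using diff frechet_derivative_works by blast
    have "((\<lambda>\<tau>. g (x + \<tau> *\<^sub>R v)) has_derivative (\<lambda>h. frechet_derivative g (at (x + \<tau> *\<^sub>R v)) (h *\<^sub>R v))) (at \<tau>)"
      using diff_chain_at[OF 1 2] by (simp add: o_def)
    moreover have "(\<lambda>h. frechet_derivative g (at (x + \<tau> *\<^sub>R v)) (h *\<^sub>R v)) = (*) (s * frechet_derivative g (at (x + \<tau> *\<^sub>R v)) d)"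
    proof (rule ext)
      fix h :: real
      have "frechet_derivative g (at (x + \<tau> *\<^sub>R v)) (h *\<^sub>R v) = (h * s) *\<^sub>R frechet_derivative g (at (x + \<tau> *\<^sub>R v)) d"
        unfolding linear_cmul[OF lin, symmetric] by (simp add: v_def)
      then show "frechet_derivative g (at (x + \<tau> *\<^sub>R v)) (h *\<^sub>R v) = s * frechet_derivative g (at (x + \<tau> *\<^sub>R v)) d * h"
        by (simp add: mult_ac)
    qed
    ultimately show ?thesis by (simp add: has_field_derivative_def)
  qed
  obtain z where z: "0 < z" "z < 1" "g (x + 1 *\<^sub>R v) - g (x + 0 *\<^sub>R v) = (1 - 0) * (s * frechet_derivative g (at (x + z *\<^sub>R v)) d)"
    using MVT2[of 0 1 "\<lambda>\<tau>. g (x + \<tau> *\<^sub>R v)" "\<lambda>\<tau>. s * frechet_derivative g (at (x + \<tau> *\<^sub>R v)) d"] der by auto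
  have "(1 - z) *\<^sub>R x + z *\<^sub>R (x + v) \<in> S" using z x S unfolding v_def by (intro convexD) auto
  then have zS: "x + z *\<^sub>R v \<in> S" by (simp add: algebra_simps)
  have "\<bar>frechet_derivative g (at (x + z *\<^sub>R v)) d - frechet_derivative g (at x) d\<bar> \<le> K * norm (z *\<^sub>R v)"
    using lip[OF zS] by simp
  also have "\<dots> \<le> K * \<bar>s\<bar>" using z d K unfolding v_def by (intro mult_left_mono) (auto simp: abs_mult mult_left_le_one_le)
  finally have "\<bar>s\<bar> * \<bar>frechet_derivative g (at (x + z *\<^sub>R v)) d - frechet_derivative g (at x) d\<bar> \<le> \<bar>s\<bar> * (K * \<bar>s\<bar>)"
    by (rule mult_left_mono) simp
  then have "\<bar>s * frechet_derivative g (at (x + z *\<^sub>R v)) d - s * frechet_derivative g (at x) d\<bar> \<le> K * s\<^sup>2"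
    by (simp add: abs_mult[symmetric] right_diff_distrib power2_eq_square mult.left_commute)
  then show ?thesis using z(3) unfolding v_def by simp
qed

lemma closed_cube_eq_cbox: "closed_cube b = cbox (\<chi> i. - b) (\<chi> i. b)"
  unfolding closed_cube_def by (auto simp: mem_box_cart)

lemma open_cube: "open (cube b :: (real^'d::finite) set)"
proof -
  have "cube b = box (\<chi> i. - b) (\<chi> i. b :: real^'d)" unfolding cube_def by (auto simp: mem_box_cart)
  then show ?thesis using open_box by metis
qed

text \<open>Moving by s along the slope at u costs, against the graph at x, the curvature term B s^2
  and the change of slope B b' t |s| \<le> t^2 + (B b')^2 s^2, where b' is the base size of H. The
  t^2 is paid by the depth A0 t^2 of z, as A0 > 1, and the rest by M s^2. The estimate is carried
  out for the graph of K on its doubled cube, over which \<open>up_star K\<close> is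
  defined.\<close>

lemma parabola_inside:
  fixes S U :: "('d::finite) point \<Rightarrow> 'd point"
  assumes K: "updom_ok K" and H: "updom_ok H" and U: "signed_coordinates U" and S: "S = (\<lambda>z. a + U z)"
    and im: "S ` up_set K = up_set H"
  shows "\<exists>c>0. \<exists>M>0. \<forall>A0>1. \<forall>t z u j s v. 0 < t \<longrightarrow> z \<in> up_inner A0 H t \<longrightarrow> u \<in> up_window H t (fst z) \<longrightarrow>
    \<bar>s\<bar> \<le> c \<longrightarrow> \<bar>v\<bar> \<le> c \<longrightarrow> z + s *\<^sub>R tangent H j u - (M * (s\<^sup>2 + v\<^sup>2)) *\<^sub>R (0, 1) \<in> S ` up_star K"
proof -
  have Kb: "base K > 0" "param K \<ge> 1" "C2_fun (graph K)" and Hb: "base H > 0" "param H \<ge> 1" "C2_fun (graph H)"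
    using K H unfolding updom_ok_def by auto
  have Ue: "U (0, 1) = (0, 1)" by (rule vertical_preserved[OF Kb(1,2) Hb(1,2) U S im])
  define g where "g = graph K"
  define h where "h = graph H"
  have g2: "C2_fun g" and h2: "C2_fun h" unfolding g_def h_def by (rule Kb, rule Hb)
  have orth: "orthogonal_transformation U" using U unfolding signed_coordinates_def by blast
  have bijU: "bij U" using orth by (rule orthogonal_transformation_bij)
  define Ui where "Ui = inv U"
  have orthi: "orthogonal_transformation Ui" unfolding Ui_def by (rule orthogonal_transformation_inv[OF orth])
  then have lini: "linear Ui" by (rule orthogonal_transformation_linear)
  have UUi: "U (Ui z) = z" for z unfolding Ui_def using bijU by (simp add: bij_is_surj surj_f_inv_f)
  have UiU: "Ui (U z) = z" for z unfolding Ui_def using bijU by (simp add: bij_is_inj)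
  have Uie: "Ui (0, 1) = (0, 1)" using UiU[of "(0, 1)"] Ue by simp
  have snd_Ui: "snd (Ui z) = snd z" for z
  proof -
    have "Ui (0, 1) \<bullet> Ui z = (0, 1) \<bullet> z" using orthi unfolding orthogonal_transformation_def by blast
    then show ?thesis unfolding Uie by (simp add: inner_prod_def)
  qed
  define V where "V p = fst (Ui (p, 0))" for p
  have Ui_eq: "Ui (p, q) = (V p, q)" for p q
  proof -
    have "Ui (p, q) = Ui ((p, 0) + q *\<^sub>R (0, 1))" by simp
    also have "\<dots> = Ui (p, 0) + q *\<^sub>R (0, 1)" by (simp only: linear_add[OF lini] linear_cmul[OF lini] Uie)
    finally have "fst (Ui (p, q)) = V p" unfolding V_def by simp
    then show ?thesis using snd_Ui[of "(p, q)"] by (metis prod.collapse snd_conv)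
  qed
  have linV: "linear V"
  proof (rule linearI)
    fix p q :: "real^'d" and r :: real
    show "V (p + q) = V p + V q" unfolding V_def using linear_add[OF lini, of "(p, 0)" "(q, 0)"] by simp
    show "V (r *\<^sub>R p) = r *\<^sub>R V p" unfolding V_def using linear_cmul[OF lini, of r "(p, 0)"] by simp
  qed
  have normV: "norm (V p) = norm p" for p
  proof -
    have "norm (Ui (p, 0)) = norm (p, 0 :: real)" using orthi by (simp add: orthogonal_transformation)
    then show ?thesis unfolding Ui_eq by (simp add: norm_Pair)
  qed
  \<comment> \<open>The horizontal part of the inverse of S, which splits because S preserves the
    vertical direction.\<close>
  define L where "L x = V (x - fst a)" for x
  have SL: "S (L x, y - snd a) = (x, y)" for x y
  proof -
    have "(x, y) - a = (x - fst a, y - snd a)" by (metis fst_conv minus_prod_def snd_conv)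
    then have "(L x, y - snd a) = Ui ((x, y) - a)" unfolding L_def by (simp add: Ui_eq)
    then show ?thesis unfolding S by (simp add: UUi)
  qed
  have injS: "inj S" unfolding S using bijU by (simp add: bij_def inj_def)
  have mem: "(x, y) \<in> up_set H \<longleftrightarrow> (L x, y - snd a) \<in> up_set K" for x y
  proof -
    have "(x, y) \<in> up_set H \<longleftrightarrow> S (L x, y - snd a) \<in> S ` up_set K"
      unfolding im by (subst SL) (rule refl)
    then show ?thesis unfolding inj_image_mem_iff[OF injS] .
  qed
  have muK: "param K * base K > 0" and muH: "param H * base H > 0" using Kb Hb by (auto intro: mult_pos_pos)
  \<comment> \<open>Each graph point belongs to its set, so comparing the tops of corresponding
    vertical fibres bounds the two heights by each other.\<close>
  have hg: "L x \<in> cube (base K) \<and> h x = g (L x) + snd a" if x: "x \<in> cube (base H)" for x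
  proof -
    have "(x, h x) \<in> up_set H" unfolding up_set_def h_def using x muH by simp
    then have "(L x, h x - snd a) \<in> up_set K" by (rule mem[THEN iffD1])
    then have 1: "L x \<in> cube (base K)" "h x - snd a \<le> g (L x)" unfolding up_set_def g_def by auto
    have "(L x, (g (L x) + snd a) - snd a) \<in> up_set K" unfolding up_set_def g_def using 1(1) muK by simp
    then have "(x, g (L x) + snd a) \<in> up_set H" by (rule mem[THEN iffD2])
    then have "g (L x) + snd a \<le> h x" unfolding up_set_def h_def by simp
    then show ?thesis using 1 by simp
  qed
  have partial: "partial_deriv j h u = frechet_derivative g (at (L u)) (V (axis j 1))" if u: "u \<in> cube (base H)" for j u
  proof -
    have gd: "(g has_derivative frechet_derivative g (at (L u))) (at (L u))"
      using g2 frechet_derivative_works unfolding C2_fun_def C1_fun_def by blast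
    have bl: "bounded_linear V" using linV by (simp add: linear_conv_bounded_linear)
    have Ld: "(L has_derivative V) (at u)" unfolding L_def[abs_def]
      by (rule bounded_linear.has_derivative[OF bl]) (auto intro!: derivative_eq_intros)
    have "((\<lambda>x. g (L x) + snd a) has_derivative (\<lambda>v. frechet_derivative g (at (L u)) (V v))) (at u)"
      using diff_chain_at[OF Ld gd] by (auto intro!: derivative_eq_intros simp: o_def)
    \<comment> \<open>The two functions are compared only over the cube of H; it is open, so their
      derivatives agree there as well.\<close>
    then have "(h has_derivative (\<lambda>v. frechet_derivative g (at (L u)) (V v))) (at u)"
      by (rule has_derivative_transform_within_open[OF _ open_cube u]) (use hg in auto)
    then have "frechet_derivative h (at u) = (\<lambda>v. frechet_derivative g (at (L u)) (V v))"
      by (rule frechet_derivative_at[symmetric])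
    then show ?thesis unfolding partial_deriv_def by simp
  qed
  let ?Q = "closed_cube (2 * base K) :: (real^'d) set"
  have Q: "compact ?Q" "convex ?Q" unfolding closed_cube_eq_cbox by auto
  obtain B where B: "B \<ge> 0" "\<And>x y d. x \<in> ?Q \<Longrightarrow> y \<in> ?Q \<Longrightarrow> norm d = 1 \<Longrightarrow>
    \<bar>frechet_derivative g (at x) d\<bar> \<le> B \<and> \<bar>frechet_derivative g (at x) d - frechet_derivative g (at y) d\<bar> \<le> B * norm (x - y)"
    using C2_fun_derivative_bounds[OF g2 Q] by blast
  define b' where "b' = base H"
  define M where "M = B + (B * b')\<^sup>2 + 1"
  have M: "M > 0" unfolding M_def using B(1) by (simp add: add_nonneg_pos)
  \<comment> \<open>c \<le> \<open>base K\<close> keeps x + s d in the doubled cube, and the second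
    bound limits the additional descent to \<open>param K * base K\<close>, so that the total stays
    within the four such units allowed in \<open>up_star\<close>.\<close>
  define c where "c = min (min (base K) 1) (param K * base K / (B + 2 * M))"
  have BM: "B + 2 * M > 0" using B(1) M by simp
  have c: "c > 0" "c \<le> base K" "c \<le> 1" "c * (B + 2 * M) \<le> param K * base K"
  proof -
    show "c > 0" unfolding c_def using Kb muK BM by simp
    show "c \<le> base K" "c \<le> 1" unfolding c_def by auto
    have "c \<le> param K * base K / (B + 2 * M)" unfolding c_def by simp
    then show "c * (B + 2 * M) \<le> param K * base K" using BM by (simp add: pos_le_divide_eq)
  qed
  have gbdd: "bdd_below (g ` ?Q)"
  proof -
    have "continuous_on ?Q g" using g2 unfolding C2_fun_def C1_fun_def
      by (meson continuous_at_imp_continuous_on differentiable_imp_continuous_within)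
    then show ?thesis using Q(1) by (meson bounded_imp_bdd_below compact_continuous_image compact_imp_bounded)
  qed
  show ?thesis
  proof (rule exI[of _ c], intro conjI c(1) exI[of _ M] M allI impI)
    fix A0 t :: real and z :: "'d point" and u j s v
    assume A0: "1 < A0" and t: "0 < t" and z: "z \<in> up_inner A0 H t" and u: "u \<in> up_window H t (fst z)"
      and s: "\<bar>s\<bar> \<le> c" and v: "\<bar>v\<bar> \<le> c"
    obtain x' y' where z': "z = (x', y')" by (cases z)
    have zH: "(x', y') \<in> up_set H" and dep: "infdist (x', y') (up_bdry 1 H) \<ge> A0 * t\<^sup>2" using z unfolding up_inner_def z' by auto
    have x'c: "x' \<in> cube (base H)" and y'h: "y' \<le> h x'" using zH unfolding up_set_def h_def by auto
    have uc: "u \<in> cube (base H)" and ux: "norm (u - x') \<le> t * b'" using u unfolding up_window_def z' b'_def by auto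
    define x where "x = L x'"
    define u0 where "u0 = L u"
    define d where "d = V (axis j 1)"
    have d: "norm d = 1" unfolding d_def normV by simp
    have xc: "x \<in> cube (base K)" and hx: "h x' = g x + snd a" using hg[OF x'c] unfolding x_def by auto
    have u0c: "u0 \<in> cube (base K)" using hg[OF uc] unfolding u0_def by auto
    have cube_sub: "cube (base K) \<subseteq> ?Q"
    proof
      fix w :: "real^'d" assume "w \<in> cube (base K)"
      then have "- base K < w $ i" "w $ i < base K" for i unfolding cube_def by auto
      then have "- (2 * base K) \<le> w $ i" "w $ i \<le> 2 * base K" for i using Kb(1) by (smt (verit))+
      then show "w \<in> ?Q" unfolding closed_cube_def by simp
    qed
    have xu: "norm (x - u0) \<le> t * b'"
    proof -
      have "x - u0 = V (x' - u)" unfolding x_def u0_def L_def linear_diff[OF linV, symmetric] by simp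
      then show ?thesis using ux normV by (simp add: norm_minus_commute)
    qed
    have "t\<^sup>2 \<le> A0 * t\<^sup>2" using mult_right_mono[of 1 A0 "t\<^sup>2"] A0 by simp
    also have "\<dots> \<le> infdist (x', y') (up_bdry 1 H)" by (rule dep)
    also have "\<dots> \<le> dist (x', y') (x', h x')"
      by (rule infdist_le) (use x'c in \<open>simp add: up_bdry_def h_def\<close>)
    also have "\<dots> = h x' - y'" using y'h by (simp add: dist_Pair_Pair dist_real_def)
    finally have depth: "y' - snd a \<le> g x - t\<^sup>2" unfolding hx by simp
    have "(x, y' - snd a) \<in> up_set K" unfolding x_def by (rule mem[THEN iffD1, OF zH])
    then have low: "y' - snd a > g x - param K * base K" unfolding up_set_def g_def by simp
    have dj: "frechet_derivative g (at u0) d = partial_deriv j h u" using partial[OF uc] unfolding u0_def d_def by simp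
    define D where "D = frechet_derivative g (at u0) d"
    have xs: "x + s *\<^sub>R d \<in> cube (2 * base K)"
    proof -
      have "\<bar>s * d $ i\<bar> \<le> base K" for i
      proof -
        have "\<bar>s\<bar> * \<bar>d $ i\<bar> \<le> c * 1" using component_le_norm_cart[of d i] d s c(1) by (intro mult_mono) auto
        then show ?thesis using c(2) by (simp add: abs_mult)
      qed
      moreover have "- base K < x $ i" "x $ i < base K" for i using xc unfolding cube_def by auto
      ultimately have "- (2 * base K) < x $ i + s * d $ i" "x $ i + s * d $ i < 2 * base K" for i
        by (smt (verit))+
      then show ?thesis unfolding cube_def by simp
    qed
    then have xsQ: "x + s *\<^sub>R d \<in> ?Q" unfolding cube_def closed_cube_def by (auto simp: less_imp_le)
    have xQ: "x \<in> ?Q" and uQ: "u0 \<in> ?Q" using xc u0c cube_sub by auto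
    have taylor: "g (x + s *\<^sub>R d) \<ge> g x + s * frechet_derivative g (at x) d - B * s\<^sup>2"
      by (rule C2_fun_taylor_lower[OF g2 Q(2) xQ xsQ d B(1)]) (use B(2) xQ d in blast)
    have "\<bar>frechet_derivative g (at x) d - D\<bar> \<le> B * (t * b')"
      using B(2)[OF xQ uQ d] mult_left_mono[OF xu B(1)] unfolding D_def by linarith
    then have "\<bar>s\<bar> * \<bar>frechet_derivative g (at x) d - D\<bar> \<le> \<bar>s\<bar> * (B * (t * b'))" by (rule mult_left_mono) simp
    then have "\<bar>s * frechet_derivative g (at x) d - s * D\<bar> \<le> t * (B * b' * \<bar>s\<bar>)"
      by (simp add: abs_mult[symmetric] right_diff_distrib mult_ac)
    moreover have "t * (B * b' * \<bar>s\<bar>) \<le> t\<^sup>2 + (B * b')\<^sup>2 * s\<^sup>2"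
    proof -
      have "0 \<le> (t - B * b' * \<bar>s\<bar>)\<^sup>2" by simp
      then have "2 * (t * (B * b' * \<bar>s\<bar>)) \<le> t\<^sup>2 + (B * b' * \<bar>s\<bar>)\<^sup>2" by (simp add: power2_eq_square algebra_simps)
      moreover have "(B * b' * \<bar>s\<bar>)\<^sup>2 = (B * b')\<^sup>2 * s\<^sup>2" by (simp add: power_mult_distrib)
      moreover have "0 \<le> t * (B * b' * \<bar>s\<bar>)" using t B(1) Hb(1) unfolding b'_def by simp
      ultimately show ?thesis by linarith
    qed
    ultimately have tan: "s * frechet_derivative g (at x) d \<ge> s * D - t\<^sup>2 - (B * b')\<^sup>2 * s\<^sup>2" by linarith
    have Msv: "M * (s\<^sup>2 + v\<^sup>2) \<ge> B * s\<^sup>2 + (B * b')\<^sup>2 * s\<^sup>2"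
    proof -
      have "M * (s\<^sup>2 + v\<^sup>2) = B * s\<^sup>2 + (B * b')\<^sup>2 * s\<^sup>2 + s\<^sup>2 + M * v\<^sup>2" unfolding M_def by (simp add: algebra_simps)
      moreover have "0 \<le> s\<^sup>2" "0 \<le> M * v\<^sup>2" using M by auto
      ultimately show ?thesis by linarith
    qed
    define Y where "Y = y' - snd a + s * D - M * (s\<^sup>2 + v\<^sup>2)"
    have up: "Y \<le> g (x + s *\<^sub>R d)" unfolding Y_def using depth taylor tan Msv by linarith
    have lowY: "(INF w\<in>?Q. g w) - 4 * param K * base K < Y"
    proof -
      have "(INF w\<in>?Q. g w) \<le> g x" by (rule cINF_lower[OF gbdd xQ])
      moreover have "\<bar>s * D\<bar> \<le> c * B" unfolding abs_mult D_def using B(2)[OF uQ uQ d] s c(1) by (intro mult_mono) auto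
      moreover have "M * (s\<^sup>2 + v\<^sup>2) \<le> M * (2 * c)"
      proof (rule mult_left_mono)
        have "s\<^sup>2 \<le> c\<^sup>2" "v\<^sup>2 \<le> c\<^sup>2" using s v c(1) by (auto intro: abs_le_square_iff[THEN iffD1])
        moreover have "c\<^sup>2 \<le> c" using c(1,3) by (simp add: power2_eq_square mult_left_le)
        ultimately show "s\<^sup>2 + v\<^sup>2 \<le> 2 * c" by linarith
      qed (use M in simp)
      moreover have "c * (B + 2 * M) = c * B + M * (2 * c)" by (simp add: algebra_simps)
      moreover have "4 * param K * base K = 4 * (param K * base K)" by simp
      ultimately show ?thesis unfolding Y_def using low c(4) muK by linarith
    qed
    have "(x + s *\<^sub>R d, Y) \<in> up_star K" unfolding up_star_def g_def[symmetric] using xs up lowY by simp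
    moreover have "z + s *\<^sub>R tangent H j u - (M * (s\<^sup>2 + v\<^sup>2)) *\<^sub>R (0, 1) = S (x + s *\<^sub>R d, Y)"
    proof -
      have "x + s *\<^sub>R d = L (x' + s *\<^sub>R axis j 1)"
        unfolding x_def d_def L_def by (simp add: linear_cmul[OF linV, symmetric] linear_add[OF linV, symmetric] algebra_simps)
      moreover have "Y = (y' + s * D - M * (s\<^sup>2 + v\<^sup>2)) - snd a" unfolding Y_def by simp
      ultimately have "S (x + s *\<^sub>R d, Y) = (x' + s *\<^sub>R axis j 1, y' + s * D - M * (s\<^sup>2 + v\<^sup>2))" using SL by simp
      then show ?thesis unfolding z' tangent_def D_def dj h_def[symmetric] by simp
    qed
    ultimately show "z + s *\<^sub>R tangent H j u - (M * (s\<^sup>2 + v\<^sup>2)) *\<^sub>R (0, 1) \<in> S ` up_star K" by (rule image_eqI[rotated])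
  qed
qed

section \<open>Tangential differences\<close>

lemma coord_map_inv_affine:
  assumes "T \<in> coord_maps"
  shows "\<exists>c L. linear L \<and> inv T = (\<lambda>z. c + L z)"
proof -
  obtain a U where U: "signed_coordinates U" "T = (\<lambda>z. a + U z)" using coord_map_affine[OF assms] by blast
  have orth: "orthogonal_transformation U" using U(1) unfolding signed_coordinates_def by blast
  have bijT: "bij T" by (rule coord_map_bij[OF assms])
  have lin: "linear (inv U)" using orthogonal_transformation_inv[OF orth] by (rule orthogonal_transformation_linear)
  have UU: "U (inv U z) = z" for z using orthogonal_transformation_surj[OF orth] by (rule surj_f_inv_f)
  have "inv T z = - inv U a + inv U z" for z
  proof -
    have "T (inv U (z - a)) = z" unfolding U(2) UU by simp
    then have "inv T z = inv U (z - a)" using bijT by (metis bij_inv_eq_iff)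
    then show ?thesis by (simp add: linear_diff[OF lin])
  qed
  then have "inv T = (\<lambda>z. - inv U a + inv U z)" by (rule ext)
  then show ?thesis using lin by blast
qed

lemma coord_map_inv_measurable:
  assumes "T \<in> coord_maps"
  shows "inv T \<in> borel_measurable borel"
proof -
  obtain c L where L: "linear L" "inv T = (\<lambda>z. c + L z)" using coord_map_inv_affine[OF assms] by blast
  have "continuous_on UNIV (\<lambda>z. c + L z)"
    using L(1) by (intro continuous_intros linear_continuous_on) (simp add: linear_conv_bounded_linear)
  then show ?thesis unfolding L(2) by (rule borel_measurable_continuous_onI)
qed

lemma plane_poly_coord_map:
  assumes "T \<in> coord_maps" "plane_poly n Q"
  shows "plane_poly n (Q \<circ> inv T)"
proof -
  obtain c L where L: "linear L" "inv T = (\<lambda>z. c + L z)" using coord_map_inv_affine[OF assms(1)] by blast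
  have "(Q \<circ> inv T) (z + s *\<^sub>R a + w *\<^sub>R b) = Q ((c + L z) + s *\<^sub>R L a + w *\<^sub>R L b)" for z a b s w
    unfolding L(2) by (simp add: linear_add[OF L(1)] linear_cmul[OF L(1)] add.assoc)
  then show ?thesis using assms(2) unfolding plane_poly_def by metis
qed

text \<open>Since w^2 + (\<i> w)^2 = 0, the complex point z + \<sigma> \<xi> lies on the paraboloid
  at the parameters w and \<i> w, where w = \<sigma> / c. The node bound is used in the first
  parameter with the second frozen at \<i> w, then for each real node in the second one; both
  restrictions have degree at most 2 k. Cauchy's estimate in \<sigma> finishes.\<close>

lemma tangential_pointwise:
  fixes c M :: real
  assumes r: "r \<ge> 1" and c: "c > 0"
  shows "\<exists>C>0. \<forall>k\<ge>1. \<forall>Q z \<xi> e s. plane_poly k Q \<longrightarrow> 0 < s \<longrightarrow> s \<le> 1 / real k \<longrightarrow>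
    \<bar>fdiff r (s *\<^sub>R \<xi>) Q (z :: 'a::real_vector)\<bar> \<le> C * (s * real k) ^ r *
      (\<Sum>i\<le>6 * (2 * k). \<Sum>l\<le>6 * (2 * k).
         \<bar>Q (z + (c * node (2 * k) i) *\<^sub>R \<xi> - (M * ((c * node (2 * k) i)\<^sup>2 + (c * node (2 * k) l)\<^sup>2)) *\<^sub>R e)\<bar>
           / ((1 + offcentre (2 * k) i) ^ 3 * (1 + offcentre (2 * k) l) ^ 3))"
proof -
  \<comment> \<open>On Cauchy's disc |\<sigma>| \<le> 4 r / k, so |w| \<le> 4 r / (c k), which is A
    / N for N = 2 k.\<close>
  define A where "A = 8 * real r / c"
  have A: "A \<ge> 0" unfolding A_def using c by simp
  obtain C where C: "C > 0" and ker0: "\<forall>N\<ge>1. \<forall>q w. degree q \<le> N \<longrightarrow> norm w \<le> A / real N \<longrightarrow>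
    norm (poly q w) \<le> C * (\<Sum>j\<le>6 * N. norm (poly q (complex_of_real (node N j))) / (1 + offcentre N j) ^ 3)"
    using kernel_bound[OF A] by blast
  show ?thesis
  proof (rule exI[of _ "C * C"], intro conjI allI impI)
    show "C * C > 0" using C by simp
    fix k :: nat and Q :: "'a \<Rightarrow> real" and z \<xi> e :: 'a and s :: real
    assume k: "1 \<le> k" and Q: "plane_poly k Q" and s: "0 < s" "s \<le> 1 / real k"
    define N where "N = 2 * k"
    have N: "N \<ge> 1" "real N = 2 * real k" unfolding N_def using k by auto
    have k0: "real k > 0" using k by simp
    define v where "v i = node N i" for i
    define \<kappa> where "\<kappa> i = 1 / (1 + offcentre N i) ^ 3" for i
    have \<kappa>0: "\<kappa> i \<ge> 0" for i unfolding \<kappa>_def offcentre_def by simp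
    have ker: "norm (poly q w) \<le> C * (\<Sum>j\<le>6 * N. \<kappa> j * norm (poly q (complex_of_real (v j))))"
      if "degree q \<le> N" "norm w \<le> A / real N" for q w
      using ker0[rule_format, OF N(1) that] unfolding \<kappa>_def v_def by simp
    obtain P where P: "\<And>s w :: real. P (of_real s) (of_real w) = complex_of_real (Q (z + s *\<^sub>R \<xi> + w *\<^sub>R e))"
      and Pd: "\<And>\<alpha> \<beta> D. degree \<alpha> \<le> D \<Longrightarrow> degree \<beta> \<le> D \<Longrightarrow> \<exists>q. degree q \<le> k * D \<and> (\<forall>x. P (poly \<alpha> x) (poly \<beta> x) = poly q x)"
      using Q unfolding plane_poly_def by metis
    define m where "m = complex_of_real (M * c\<^sup>2)"
    define W where "W i l = \<bar>Q (z + (c * v i) *\<^sub>R \<xi> - (M * ((c * v i)\<^sup>2 + (c * v l)\<^sup>2)) *\<^sub>R e)\<bar>" for i l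
    define B where "B = C * C * (\<Sum>i\<le>6 * N. \<Sum>l\<le>6 * N. \<kappa> i * \<kappa> l * W i l)"
    obtain h where h: "\<And>x. P x 0 = poly h x"
      using Pd[of "[:0, 1:]" 1 0] by auto
    have bound: "norm (poly h \<sigma>) \<le> B" if \<sigma>: "norm \<sigma> \<le> 4 * real r / real k" for \<sigma>
    proof -
      define w where "w = \<sigma> / of_real c"
      have w: "norm w \<le> A / real N"
      proof -
        have "norm w = norm \<sigma> / c" unfolding w_def using c by (simp add: norm_divide)
        also have "\<dots> \<le> (4 * real r / real k) / c" using \<sigma> c by (intro divide_right_mono) auto
        also have "\<dots> = A / real N" unfolding A_def N(2) using c k0 by (simp add: field_simps)
        finally show ?thesis .
      qed
      have cw: "of_real c * w = \<sigma>" unfolding w_def using c by simp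
      have i2: "(\<i> * w)\<^sup>2 = - (w\<^sup>2)" by (simp add: power_mult_distrib)
      obtain R1 where R1: "degree R1 \<le> N" "\<And>x. P (of_real c * x) (- m * (x\<^sup>2 + (\<i> * w)\<^sup>2)) = poly R1 x"
      proof -
        obtain q where "degree q \<le> k * 2" "\<And>x. P (poly [:0, of_real c:] x) (poly [:- m * (\<i> * w)\<^sup>2, 0, - m:] x) = poly q x"
        proof -
          have "degree [:0, complex_of_real c:] \<le> 2" "degree [:- m * (\<i> * w)\<^sup>2, 0, - m:] \<le> 2" by simp_all
          from Pd[OF this] show ?thesis using that by blast
        qed
        moreover have "poly [:0, of_real c:] x = of_real c * x" "poly [:- m * (\<i> * w)\<^sup>2, 0, - m:] x = - m * (x\<^sup>2 + (\<i> * w)\<^sup>2)" for x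
          by (simp_all add: algebra_simps power2_eq_square)
        ultimately show ?thesis using that[of q] unfolding N_def by (simp add: mult.commute)
      qed
      have "poly h \<sigma> = P (of_real c * w) (- m * (w\<^sup>2 + (\<i> * w)\<^sup>2))" unfolding h[symmetric] cw i2 by simp
      then have 1: "norm (poly h \<sigma>) \<le> C * (\<Sum>i\<le>6 * N. \<kappa> i * norm (poly R1 (of_real (v i))))"
        unfolding R1(2) using ker[OF R1(1) w] by simp
      have 2: "norm (poly R1 (of_real (v i))) \<le> C * (\<Sum>l\<le>6 * N. \<kappa> l * W i l)" for i
      proof -
        obtain R2 where R2: "degree R2 \<le> N" "\<And>x. P (of_real (c * v i)) (- m * ((of_real (v i))\<^sup>2 + x\<^sup>2)) = poly R2 x"
        proof -
          obtain q where "degree q \<le> k * 2" "\<And>x. P (poly [:of_real (c * v i):] x) (poly [:- m * (of_real (v i))\<^sup>2, 0, - m:] x) = poly q x"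
          proof -
            have "degree [:complex_of_real (c * v i):] \<le> 2" "degree [:- m * (of_real (v i))\<^sup>2, 0, - m:] \<le> 2" by simp_all
            from Pd[OF this] show ?thesis using that by blast
          qed
          moreover have "poly [:of_real (c * v i):] x = of_real (c * v i)" "poly [:- m * (of_real (v i))\<^sup>2, 0, - m:] x = - m * ((of_real (v i))\<^sup>2 + x\<^sup>2)" for x :: complex
            by (simp_all add: algebra_simps power2_eq_square)
          ultimately show ?thesis using that[of q] unfolding N_def by (simp add: mult.commute)
        qed
        have "poly R1 (of_real (v i)) = poly R2 (\<i> * w)" unfolding R1(2)[symmetric] R2(2)[symmetric] by simp
        moreover have "norm (\<i> * w) \<le> A / real N" using w by (simp add: norm_mult)
        moreover have "norm (poly R2 (of_real (v l))) = W i l" for l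
        proof -
          have "- m * ((of_real (v i))\<^sup>2 + (of_real (v l))\<^sup>2) = complex_of_real (- (M * ((c * v i)\<^sup>2 + (c * v l)\<^sup>2)))"
            unfolding m_def by (simp add: algebra_simps power_mult_distrib)
          then have "poly R2 (of_real (v l)) = of_real (Q (z + (c * v i) *\<^sub>R \<xi> + (- (M * ((c * v i)\<^sup>2 + (c * v l)\<^sup>2))) *\<^sub>R e))"
            unfolding R2(2)[symmetric] P[symmetric] by simp
          then show ?thesis unfolding W_def by (simp add: norm_of_real)
        qed
        ultimately show ?thesis using ker[OF R2(1), of "\<i> * w"] by simp
      qed
      have "norm (poly h \<sigma>) \<le> C * (\<Sum>i\<le>6 * N. \<kappa> i * (C * (\<Sum>l\<le>6 * N. \<kappa> l * W i l)))"
        using 1 2 C \<kappa>0 by (intro order_trans[OF 1] mult_left_mono sum_mono) auto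
      also have "\<dots> = B" unfolding B_def by (simp add: sum_distrib_left mult_ac)
      finally show ?thesis .
    qed
    have ph: "poly h (of_real x) = of_real (Q (z + x *\<^sub>R \<xi>))" for x :: real
      using P[of x 0] unfolding h[symmetric] by simp
    have "norm (cdiff r (of_real s) (poly h) 0) \<le> B * (4 * real r * norm (complex_of_real s) / (4 * real r / real k)) ^ r"
    proof (rule norm_cdiff_le)
      show "4 * real r * norm (complex_of_real s) \<le> 4 * real r / real k"
        using s mult_left_mono[OF s(2), of "4 * real r"] by simp
    qed (use bound r k0 in \<open>auto intro!: holomorphic_intros\<close>)
    also have "4 * real r * norm (complex_of_real s) / (4 * real r / real k) = s * real k"
      using r s k0 by (simp add: field_simps)
    also have "norm (cdiff r (of_real s) (poly h) 0) = \<bar>fdiff r (s *\<^sub>R \<xi>) Q z\<bar>"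
    proof -
      have "0 + of_nat j * complex_of_real s = of_real (real j * s)" for j by simp
      then have "cdiff r (of_real s) (poly h) 0 = complex_of_real (fdiff r (s *\<^sub>R \<xi>) Q z)"
        unfolding cdiff_def fdiff_def by (simp only: ph) simp
      then show ?thesis by (simp only: norm_of_real)
    qed
    finally have "\<bar>fdiff r (s *\<^sub>R \<xi>) Q z\<bar> \<le> (s * real k) ^ r * B" by (simp add: mult.commute)
    moreover have "(s * real k) ^ r * B = C * C * (s * real k) ^ r * (\<Sum>i\<le>6 * N. \<Sum>l\<le>6 * N. \<kappa> i * \<kappa> l * W i l)"
      unfolding B_def by simp
    moreover have "\<kappa> i * \<kappa> l * W i l = W i l / ((1 + offcentre N i) ^ 3 * (1 + offcentre N l) ^ 3)" for i l
      unfolding \<kappa>_def by simp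
    ultimately show "\<bar>fdiff r (s *\<^sub>R \<xi>) Q z\<bar> \<le> C * C * (s * real k) ^ r *
      (\<Sum>i\<le>6 * (2 * k). \<Sum>l\<le>6 * (2 * k).
         \<bar>Q (z + (c * node (2 * k) i) *\<^sub>R \<xi> - (M * ((c * node (2 * k) i)\<^sup>2 + (c * node (2 * k) l)\<^sup>2)) *\<^sub>R e)\<bar>
           / ((1 + offcentre (2 * k) i) ^ 3 * (1 + offcentre (2 * k) l) ^ 3))"
      unfolding W_def v_def N_def by simp
  qed
qed

text \<open>The average over the window puts 1 / R^d under the integral; pulled inside the p-th
  power it becomes R^(- d / p), and the averaged norm turns into an L^p norm over the pairs (z,
  u).\<close>

definition window_scale :: "ennreal \<Rightarrow> nat \<Rightarrow> real \<Rightarrow> real" where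
  "window_scale p d R = (if p = \<infinity> then 1 else (R ^ d) powr (- 1 / enn2real p))"

lemma window_measurable:
  fixes F :: "('d::finite) point \<Rightarrow> ennreal" and \<tau> :: "real^'d \<Rightarrow> 'd point"
  assumes F: "F \<in> borel_measurable borel" and \<tau>: "\<tau> \<in> borel_measurable borel"
  shows "(\<lambda>x. F (fst x + \<tau> (snd x)) * indicator {x. norm (snd x - fst (fst x) + v) \<le> R} x) \<in> borel_measurable borel"
proof -
  have f: "(fst :: 'd point \<times> (real^'d) \<Rightarrow> 'd point) \<in> borel_measurable borel"
    and s: "(snd :: 'd point \<times> (real^'d) \<Rightarrow> real^'d) \<in> borel_measurable borel"
    by (intro borel_measurable_continuous_onI continuous_intros)+
  have "(\<lambda>x. fst x + \<tau> (snd x)) \<in> borel_measurable borel"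
    by (intro borel_measurable_add f measurable_compose[OF s \<tau>])
  then have "(\<lambda>x. F (fst x + \<tau> (snd x))) \<in> borel_measurable borel"
    by (rule measurable_compose[OF _ F])
  moreover have "{x :: 'd point \<times> (real^'d). norm (snd x - fst (fst x) + v) \<le> R} \<in> sets borel"
    by (intro borel_closed closed_Collect_le continuous_intros)
  ultimately show ?thesis by measurable
qed

text \<open>The translation \<tau> u varies with u only vertically. For fixed u it can therefore be
  undone in z, and the window becomes a ball of radius R around \<open>fst z - \<sigma>\<close>,
  whose volume does not depend on z.\<close>

lemma window_integral:
  fixes F :: "('d::finite) point \<Rightarrow> ennreal" and \<tau> :: "real^'d \<Rightarrow> 'd point"
  assumes F[measurable]: "F \<in> borel_measurable borel" and \<tau>[measurable]: "\<tau> \<in> borel_measurable borel"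
    and \<sigma>: "\<And>u. fst (\<tau> u) = \<sigma>" and R: "R \<ge> 0"
  shows "(\<integral>\<^sup>+x. F (fst x + \<tau> (snd x)) * indicator {x. norm (snd x - fst (fst x)) \<le> R} x \<partial>lborel)
    = ennreal (unit_ball_vol (real CARD('d)) * R ^ CARD('d)) * (\<integral>\<^sup>+z. F z \<partial>lborel)"
proof -
  have m1: "(\<lambda>(z, u). F (z + \<tau> u) * indicator {x. norm (snd x - fst (fst x)) \<le> R} (z, u)) \<in> borel_measurable (lborel \<Otimes>\<^sub>M lborel)"
    using window_measurable[OF F \<tau>, of 0 R] unfolding lborel_prod by (simp add: case_prod_unfold)
  have m2: "(\<lambda>(z, u). F z * indicator {x. norm (snd x - fst (fst x) + \<sigma>) \<le> R} (z, u)) \<in> borel_measurable (lborel \<Otimes>\<^sub>M lborel)"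
    using window_measurable[OF F, of "\<lambda>_. 0" \<sigma> R] unfolding lborel_prod by (simp add: case_prod_unfold)
  have "(\<integral>\<^sup>+x. F (fst x + \<tau> (snd x)) * indicator {x. norm (snd x - fst (fst x)) \<le> R} x \<partial>(lborel :: ('d point \<times> (real^'d)) measure))
      = (\<integral>\<^sup>+x. (\<lambda>(z, u). F (z + \<tau> u) * indicator {x. norm (snd x - fst (fst x)) \<le> R} (z, u)) x \<partial>(lborel \<Otimes>\<^sub>M lborel))"
    by (simp add: lborel_prod case_prod_beta)
  also have "\<dots> = (\<integral>\<^sup>+z. \<integral>\<^sup>+u. F (z + \<tau> u) * indicator {x. norm (snd x - fst (fst x)) \<le> R} (z, u) \<partial>lborel \<partial>lborel)"
    using lborel.nn_integral_fst[OF m1] by simp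
  also have "\<dots> = (\<integral>\<^sup>+u. \<integral>\<^sup>+z. F (z + \<tau> u) * indicator {x. norm (snd x - fst (fst x)) \<le> R} (z, u) \<partial>lborel \<partial>lborel)"
    using lborel_pair.Fubini'[OF m1] by simp
  also have "\<dots> = (\<integral>\<^sup>+u. \<integral>\<^sup>+z. F z * indicator {x. norm (snd x - fst (fst x) + \<sigma>) \<le> R} (z, u) \<partial>lborel \<partial>lborel)"
  proof (rule nn_integral_cong)
    fix u :: "real^'d"
    have "(\<integral>\<^sup>+z. F z * indicator {x. norm (snd x - fst (fst x) + \<sigma>) \<le> R} (z, u) \<partial>lborel)
      = (\<integral>\<^sup>+z. (\<lambda>z. F z * indicator {x. norm (snd x - fst (fst x) + \<sigma>) \<le> R} (z, u)) (z + \<tau> u) \<partial>lborel)"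
    proof (rule nn_integral_translate[symmetric])
      have [measurable]: "{z :: 'd point. norm (u - fst z + \<sigma>) \<le> R} \<in> sets borel"
        by (intro borel_closed closed_Collect_le continuous_intros)
      have "indicator {x. norm (snd x - fst (fst x) + \<sigma>) \<le> R} (z, u)
          = (indicator {z. norm (u - fst z + \<sigma>) \<le> R} z :: ennreal)" for z :: "'d point"
        by (simp add: indicator_def)
      then show "(\<lambda>z. F z * indicator {x. norm (snd x - fst (fst x) + \<sigma>) \<le> R} (z, u)) \<in> borel_measurable borel"
        by simp
    qed
    also have "\<dots> = (\<integral>\<^sup>+z. F (z + \<tau> u) * indicator {x. norm (snd x - fst (fst x)) \<le> R} (z, u) \<partial>lborel)"
      by (simp add: indicator_def \<sigma>)
    finally show "(\<integral>\<^sup>+z. F (z + \<tau> u) * indicator {x. norm (snd x - fst (fst x)) \<le> R} (z, u) \<partial>lborel)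
      = (\<integral>\<^sup>+z. F z * indicator {x. norm (snd x - fst (fst x) + \<sigma>) \<le> R} (z, u) \<partial>lborel)" ..
  qed
  also have "\<dots> = (\<integral>\<^sup>+z. \<integral>\<^sup>+u. F z * indicator {x. norm (snd x - fst (fst x) + \<sigma>) \<le> R} (z, u) \<partial>lborel \<partial>lborel)"
    using lborel_pair.Fubini'[OF m2] by simp
  also have "\<dots> = (\<integral>\<^sup>+z. F z * ennreal (unit_ball_vol (real CARD('d)) * R ^ CARD('d)) \<partial>lborel)"
  proof (rule nn_integral_cong)
    fix z :: "'d point"
    have "indicator {x. norm (snd x - fst (fst x) + \<sigma>) \<le> R} (z, u) = (indicator (cball (fst z - \<sigma>) R) u :: ennreal)" for u
      by (simp add: indicator_def dist_norm norm_minus_commute algebra_simps)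
    then have "(\<integral>\<^sup>+u. F z * indicator {x. norm (snd x - fst (fst x) + \<sigma>) \<le> R} (z, u) \<partial>lborel) = F z * emeasure lborel (cball (fst z - \<sigma>) R)"
      by (simp add: nn_integral_cmult_indicator)
    then show "(\<integral>\<^sup>+u. F z * indicator {x. norm (snd x - fst (fst x) + \<sigma>) \<le> R} (z, u) \<partial>lborel) = F z * ennreal (unit_ball_vol (real CARD('d)) * R ^ CARD('d))"
      using R by (simp add: emeasure_cball)
  qed
  also have "\<dots> = ennreal (unit_ball_vol (real CARD('d)) * R ^ CARD('d)) * (\<integral>\<^sup>+z. F z \<partial>lborel)"
    by (subst mult.commute) (rule nn_integral_cmult, simp)
  finally show ?thesis .
qed

text \<open>Common to both applications: for general f the translates come from the binomial
  expansion, for polynomials from the nodes on the paraboloid. \<open>max 1\<close> makes one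
  formula valid for finite p and for the uniform norm.\<close>

lemma tangential_bounded_by:
  fixes \<Omega> :: "('d::finite) point set" and f :: "'d point \<Rightarrow> real" and E :: "'d point \<times> (real^'d) \<Rightarrow> real"
    and a :: "'i \<Rightarrow> real" and \<tau> :: "'i \<Rightarrow> real^'d \<Rightarrow> 'd point"
  assumes p: "1 \<le> p" and T: "T \<in> coord_maps" and \<Omega>: "compact \<Omega>" and R: "R > 0" and N: "N > 0"
    and f: "p \<noteq> \<infinity> \<Longrightarrow> f \<in> borel_measurable (lebesgue_on \<Omega>)" and le: "Lp_norm p \<Omega> f \<le> ennreal N"
    and I: "finite I" and a: "\<And>i. i \<in> I \<Longrightarrow> a i \<ge> 0" and \<tau>: "\<And>i. \<tau> i \<in> borel_measurable borel"
    and \<sigma>: "\<And>i u. fst (\<tau> i u) = \<sigma> i"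
    and E0: "\<And>z u. \<not> act z u \<Longrightarrow> E (z, u) = 0"
    and E: "\<And>z u. act z u \<Longrightarrow> \<bar>E (z, u)\<bar> \<le> (\<Sum>i\<in>I. a i * \<bar>f (inv T (z + \<tau> i u))\<bar>)"
    and act: "\<And>z u i. act z u \<Longrightarrow> i \<in> I \<Longrightarrow> z + \<tau> i u \<in> T ` \<Omega>" "\<And>z u. act z u \<Longrightarrow> norm (u - fst z) \<le> R"
  shows "bounded_by p lborel (\<lambda>x. window_scale p CARD('d) R * E x) ((\<Sum>i\<in>I. a i) * max 1 (unit_ball_vol (real CARD('d))) * N)"
proof -
  define \<omega> where "\<omega> = unit_ball_vol (real CARD('d))"
  define A where "A = (\<Sum>i\<in>I. a i)"
  have A0: "A \<ge> 0" unfolding A_def using a by (rule sum_nonneg)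
  have \<omega>0: "\<omega> \<ge> 0" unfolding \<omega>_def by simp
  have bijT: "bij T" by (rule coord_map_bij[OF T])
  have inT: "inv T w \<in> \<Omega>" if "w \<in> T ` \<Omega>" for w using that bijT by (auto simp: bij_is_inj)
  show ?thesis
  proof (cases "p = \<infinity>")
    case True
    have fN: "\<bar>f z\<bar> \<le> N" if "z \<in> \<Omega>" for z using le N that unfolding Lp_norm_le_iff[OF p less_imp_le[OF N]] if_P[OF True] by blast
    have "\<bar>E (z, u)\<bar> \<le> A * max 1 \<omega> * N" for z u
    proof (cases "act z u")
      case True
      have "\<bar>E (z, u)\<bar> \<le> (\<Sum>i\<in>I. a i * N)"
        by (rule order_trans[OF E[OF True]]) (intro sum_mono mult_left_mono a fN inT act(1)[OF True])
      also have "\<dots> = A * 1 * N" unfolding A_def by (simp add: sum_distrib_right)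
      also have "\<dots> \<le> A * max 1 \<omega> * N" using A0 N by (intro mult_right_mono mult_left_mono) auto
      finally show ?thesis .
    next
      case False
      then show ?thesis using E0 A0 N by simp
    qed
    then show ?thesis unfolding bounded_by_def if_P[OF True] window_scale_def A_def \<omega>_def by auto
  next
    case False
    define q where "q = enn2real p"
    have q: "q \<ge> 1" unfolding q_def by (rule enn2real_ge_one[OF p False])
    have \<Omega>b[measurable]: "\<Omega> \<in> sets borel" using \<Omega> by (rule borel_compact)
    obtain F where F[measurable]: "F \<in> borel_measurable borel" and Ff: "\<And>z. z \<in> \<Omega> \<Longrightarrow> ennreal (\<bar>f z\<bar> powr q) \<le> F z"
      and Fi: "(\<integral>\<^sup>+z\<in>\<Omega>. F z \<partial>lborel) \<le> ennreal (N powr q)"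
      using Lp_borel_majorant[OF p False less_imp_le[OF N] \<Omega>b f[OF False] le] unfolding q_def by blast
    note coord_map_inv_measurable[OF T, measurable]
    define F1 where "F1 w = F (inv T w) * indicator \<Omega> (inv T w)" for w
    have F1[measurable]: "F1 \<in> borel_measurable borel" unfolding F1_def by measurable
    have F1i: "(\<integral>\<^sup>+w. F1 w \<partial>lborel) \<le> ennreal (N powr q)"
    proof -
      have "(\<integral>\<^sup>+w. F1 w \<partial>lborel) = (\<integral>\<^sup>+z. F1 (T z) \<partial>lborel)" by (rule nn_integral_coord_map[OF T F1, symmetric])
      also have "\<dots> = (\<integral>\<^sup>+z\<in>\<Omega>. F z \<partial>lborel)" unfolding F1_def using bijT by (simp add: bij_is_inj)
      finally show ?thesis using Fi by simp
    qed
    define RC where "RC = R ^ CARD('d)"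
    have RC: "RC > 0" unfolding RC_def using R by simp
    define ws where "ws = window_scale p CARD('d) R"
    have ws: "ws \<ge> 0" "ws powr q = 1 / RC"
    proof -
      have e: "ws = RC powr (- 1 / q)" unfolding ws_def window_scale_def if_not_P[OF False] RC_def q_def ..
      show "ws \<ge> 0" unfolding e by simp
      have "ws powr q = RC powr (- 1)" unfolding e using q by (simp add: powr_powr)
      also have "\<dots> = 1 / RC" using RC by (simp add: powr_minus_divide)
      finally show "ws powr q = 1 / RC" .
    qed
    define Z where "Z = {x :: 'd point \<times> (real^'d). norm (snd x - fst (fst x)) \<le> R}"
    have Z[measurable]: "Z \<in> sets borel"
      unfolding Z_def by (intro borel_closed closed_Collect_le continuous_intros)
    define b where "b i = A powr (q - 1) * a i / RC" for i
    have b0: "b i \<ge> 0" if "i \<in> I" for i unfolding b_def using a[OF that] RC by simp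
    define W where "W x = (\<Sum>i\<in>I. ennreal (b i) * (F1 (fst x + \<tau> i (snd x)) * indicator Z x))" for x
    note \<tau>[measurable]
    have term_m: "(\<lambda>x. F1 (fst x + \<tau> i (snd x)) * indicator Z x) \<in> borel_measurable borel" for i
      using window_measurable[OF F1 \<tau>, where v = 0 and R = R] unfolding Z_def by simp
    have Wm: "W \<in> borel_measurable lborel" unfolding W_def using term_m by simp
    have "ennreal (\<bar>ws * E x\<bar> powr q) \<le> W x" for x
    proof -
      obtain z u where x: "x = (z, u)" by (cases x)
      show ?thesis
      proof (cases "act z u")
        case True
        define y where "y i = \<bar>f (inv T (z + \<tau> i u))\<bar>" for i
        have "\<bar>ws * E x\<bar> powr q \<le> (ws * (\<Sum>i\<in>I. a i * y i)) powr q"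
          using E[OF True] ws(1) q unfolding x abs_mult y_def by (intro powr_mono2 mult_mono) auto
        also have "\<dots> = 1 / RC * (\<Sum>i\<in>I. a i * y i) powr q" by (simp add: powr_mult ws(2))
        also have "\<dots> \<le> 1 / RC * (A powr (q - 1) * (\<Sum>i\<in>I. a i * y i powr q))"
          unfolding A_def using RC a by (intro mult_left_mono powr_sum_le I q) (auto simp: y_def)
        also have "\<dots> = (\<Sum>i\<in>I. b i * y i powr q)" unfolding b_def by (simp add: sum_distrib_left mult_ac)
        finally have "ennreal (\<bar>ws * E x\<bar> powr q) \<le> ennreal (\<Sum>i\<in>I. b i * y i powr q)" by (rule ennreal_leI)
        also have "\<dots> = (\<Sum>i\<in>I. ennreal (b i) * ennreal (y i powr q))"
          using b0 by (subst sum_ennreal[symmetric]) (auto simp: ennreal_mult)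
        also have "\<dots> \<le> W x" unfolding W_def
        proof (intro sum_mono mult_left_mono)
          fix i assume i: "i \<in> I"
          have "inv T (z + \<tau> i u) \<in> \<Omega>" by (rule inT[OF act(1)[OF True i]])
          moreover have "x \<in> Z" unfolding Z_def x using act(2)[OF True] by simp
          ultimately show "ennreal (y i powr q) \<le> F1 (fst x + \<tau> i (snd x)) * indicator Z x"
            unfolding y_def F1_def x using Ff by simp
        qed simp
        finally show ?thesis .
      next
        case False
        then show ?thesis unfolding x using E0 q by simp
      qed
    qed
    moreover have "(\<integral>\<^sup>+x. W x \<partial>lborel) \<le> ennreal ((A * max 1 \<omega> * N) powr q)"
    proof -
      have "(\<integral>\<^sup>+x. W x \<partial>lborel) = (\<Sum>i\<in>I. ennreal (b i) * (\<integral>\<^sup>+x. F1 (fst x + \<tau> i (snd x)) * indicator Z x \<partial>lborel))"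
        unfolding W_def using term_m by (subst nn_integral_sum) (auto simp: nn_integral_cmult)
      also have "\<dots> = (\<Sum>i\<in>I. ennreal (b i) * (ennreal (\<omega> * RC) * (\<integral>\<^sup>+w. F1 w \<partial>lborel)))"
        unfolding Z_def \<omega>_def RC_def using R by (simp add: window_integral[OF F1 \<tau> \<sigma>])
      also have "\<dots> \<le> (\<Sum>i\<in>I. ennreal (b i) * (ennreal (\<omega> * RC) * ennreal (N powr q)))"
        using F1i by (intro sum_mono mult_left_mono) auto
      also have "\<dots> = ennreal (\<Sum>i\<in>I. b i * (\<omega> * RC * N powr q))"
        using b0 \<omega>0 RC by (subst sum_ennreal[symmetric]) (auto simp: ennreal_mult)
      also have "(\<Sum>i\<in>I. b i * (\<omega> * RC * N powr q)) = A powr (q - 1) * A * (\<omega> * N powr q)"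
        unfolding b_def A_def using RC by (simp add: sum_distrib_left sum_distrib_right mult_ac)
      also have "\<dots> = A powr q * (\<omega> * N powr q)"
      proof (cases "A = 0")
        case False
        then have "A powr (q - 1) * A = A powr q" using A0 by (simp add: powr_diff)
        then show ?thesis by simp
      qed (use q in simp)
      also have "\<dots> \<le> A powr q * (max 1 \<omega> powr q * N powr q)"
      proof (intro mult_left_mono mult_right_mono)
        have "\<omega> \<le> max 1 \<omega> powr 1" by simp
        also have "\<dots> \<le> max 1 \<omega> powr q" using q by (intro powr_mono) auto
        finally show "\<omega> \<le> max 1 \<omega> powr q" .
      qed auto
      also have "\<dots> = (A * max 1 \<omega> * N) powr q" using A0 N by (simp add: powr_mult)
      finally show ?thesis by (simp add: ennreal_leI)
    qed
    ultimately show ?thesis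
      unfolding bounded_by_def if_not_P[OF False] ws_def A_def \<omega>_def q_def using Wm by blast
  qed
qed

section \<open>The inverse inequality\<close>

lemma fdiff_add: "fdiff r \<xi> (\<lambda>z. f z + g z) \<eta> = fdiff r \<xi> f \<eta> + fdiff r \<xi> g \<eta>"
  unfolding fdiff_def by (simp add: sum.distrib distrib_left)

lemma fdiff_const:
  assumes "r \<ge> 1"
  shows "fdiff r \<xi> (\<lambda>_. c) \<eta> = 0"
proof -
  have "fdiff r \<xi> (\<lambda>_. c) \<eta> = fdiff r 0 (\<lambda>_. c) \<eta>" unfolding fdiff_def by simp
  then show ?thesis using fdiff_zero_step[OF assms, of "\<lambda>_. c" \<eta>] by simp
qed

lemma diff_on_add: "diff_on r \<xi> (\<lambda>z. f z + g z) \<Omega> \<eta> = diff_on r \<xi> f \<Omega> \<eta> + diff_on r \<xi> g \<Omega> \<eta>"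
  unfolding diff_on_def by (simp add: fdiff_add)

lemma diff_on_const: "r \<ge> 1 \<Longrightarrow> diff_on r \<xi> (\<lambda>_. c) \<Omega> \<eta> = 0"
  unfolding diff_on_def by (simp add: fdiff_const)

lemma abs_fdiff_le: "\<bar>fdiff r \<xi> f \<eta>\<bar> \<le> (\<Sum>j\<le>r. real (r choose j) * \<bar>f (\<eta> + real j *\<^sub>R \<xi>)\<bar>)"
proof -
  have "\<bar>fdiff r \<xi> f \<eta>\<bar> \<le> (\<Sum>j\<le>r. \<bar>(-1) ^ (r + j) * real (r choose j) * f (\<eta> + real j *\<^sub>R \<xi>)\<bar>)"
    unfolding fdiff_def by (rule sum_abs)
  then show ?thesis by (simp add: abs_mult)
qed

lemma sum_choose_real: "(\<Sum>j\<le>r. real (r choose j)) = 2 ^ r"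
  using choose_row_sum[of r] by (metis of_nat_numeral of_nat_power of_nat_sum)

text \<open>The binomial coefficients add up to 2^r, and the substitution with variable step costs
  one further factor 2.\<close>

lemma phi_difference_bounded_by:
  fixes \<Omega> :: "('d::finite) point set"
  assumes p: "1 \<le> p" and r: "r \<ge> 1" and \<Omega>: "compact \<Omega>" and e: "norm e = 1" and N: "N > 0"
    and f: "p \<noteq> \<infinity> \<Longrightarrow> f \<in> borel_measurable (lebesgue_on \<Omega>)" and le: "Lp_norm p \<Omega> f \<le> ennreal N"
  shows "bounded_by p lborel (phi_difference r h e \<Omega> f) (2 ^ (r + 1) * N)"
proof -
  have eq: "phi_difference r h e \<Omega> f z = indicator (active_set r h e \<Omega>) z *
    (\<Sum>j\<le>r. (-1) ^ (r + j) * real (r choose j) * f (z + ((real j - real r / 2) * (h * weight_at \<Omega> e z)) *\<^sub>R e))" for z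
    by (intro phi_difference_eq r phi_nonneg \<Omega> e)
  define y where "y j z = z + ((real j - real r / 2) * (h * weight_at \<Omega> e z)) *\<^sub>R e" for j z
  have absle: "\<bar>phi_difference r h e \<Omega> f z\<bar> \<le> (\<Sum>j\<le>r. real (r choose j) * \<bar>f (y j z)\<bar>)" for z
  proof (cases "z \<in> active_set r h e \<Omega>")
    case True
    then have "\<bar>phi_difference r h e \<Omega> f z\<bar> \<le> (\<Sum>j\<le>r. \<bar>(-1) ^ (r + j) * real (r choose j) * f (y j z)\<bar>)"
      unfolding eq y_def by (simp add: sum_abs)
    then show ?thesis by (simp add: abs_mult)
  next
    case False
    then show ?thesis unfolding eq by (simp add: sum_nonneg)
  qed
  have mem: "y j z \<in> \<Omega>" if z: "z \<in> active_set r h e \<Omega>" and j: "j \<le> r" for j z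
  proof -
    define d where "d = real r / 2 * (h * weight_at \<Omega> e z)"
    define c where "c = (real j - real r / 2) * (h * weight_at \<Omega> e z)"
    have sub: "closed_segment (z + (- d) *\<^sub>R e) (z + d *\<^sub>R e) \<subseteq> \<Omega>" using z unfolding active_set_def d_def by simp
    have "\<bar>real j - real r / 2\<bar> \<le> real r / 2"
    proof -
      have "real j \<le> real r" using j by simp
      then show ?thesis by linarith
    qed
    then have "\<bar>c\<bar> \<le> \<bar>d\<bar>" unfolding c_def d_def abs_mult by (intro mult_right_mono) auto
    then have "c \<in> closed_segment (- d) d" by (auto simp: closed_segment_eq_real_ivl abs_if split: if_splits)
    then show ?thesis using sub unfolding closed_segment_line_subset_iff y_def c_def by blast
  qed
  show ?thesis
  proof (cases "p = \<infinity>")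
    case True
    have fN: "\<bar>f z\<bar> \<le> N" if "z \<in> \<Omega>" for z using le that unfolding Lp_norm_le_iff[OF p less_imp_le[OF N]] if_P[OF True] by blast
    have "\<bar>phi_difference r h e \<Omega> f z\<bar> \<le> 2 ^ (r + 1) * N" for z
    proof (cases "z \<in> active_set r h e \<Omega>")
      case True
      have "\<bar>phi_difference r h e \<Omega> f z\<bar> \<le> (\<Sum>j\<le>r. real (r choose j) * N)"
      proof (rule order_trans[OF absle], rule sum_mono, rule mult_left_mono)
        fix j assume "j \<in> {..r}"
        then show "\<bar>f (y j z)\<bar> \<le> N" using fN[OF mem[OF True]] by simp
      qed simp
      also have "\<dots> = 2 ^ r * N" by (simp add: sum_distrib_right[symmetric] sum_choose_real)
      also have "\<dots> \<le> 2 ^ (r + 1) * N" using N by simp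
      finally show ?thesis .
    next
      case False
      then show ?thesis unfolding eq using N by simp
    qed
    then show ?thesis unfolding bounded_by_def if_P[OF True] by simp
  next
    case False
    define q where "q = enn2real p"
    have q: "q \<ge> 1" unfolding q_def by (rule enn2real_ge_one[OF p False])
    have \<Omega>b[measurable]: "\<Omega> \<in> sets borel" using \<Omega> by (rule borel_compact)
    obtain F where F[measurable]: "F \<in> borel_measurable borel" and Ff: "\<And>z. z \<in> \<Omega> \<Longrightarrow> ennreal (\<bar>f z\<bar> powr q) \<le> F z"
      and Fi: "(\<integral>\<^sup>+z\<in>\<Omega>. F z \<partial>lborel) \<le> ennreal (N powr q)"
      using Lp_borel_majorant[OF p False less_imp_le[OF N] \<Omega>b f[OF False] le] unfolding q_def by blast
    note weight_at_measurable[OF \<Omega> e, measurable] active_set_measurable[OF \<Omega> e, measurable]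
    define c where "c j = (2 ^ r) powr (q - 1) * real (r choose j)" for j
    have c0: "c j \<ge> 0" for j unfolding c_def by simp
    define W where "W z = (\<Sum>j\<le>r. ennreal (c j) * (F (y j z) * indicator (active_set r h e \<Omega>) z))" for z
    have ym[measurable]: "y j \<in> borel_measurable borel" for j unfolding y_def[abs_def] by measurable
    have Wm: "W \<in> borel_measurable lborel" unfolding W_def by measurable
    have "ennreal (\<bar>phi_difference r h e \<Omega> f z\<bar> powr q) \<le> W z" for z
    proof (cases "z \<in> active_set r h e \<Omega>")
      case True
      have "\<bar>phi_difference r h e \<Omega> f z\<bar> powr q \<le> (\<Sum>j\<le>r. real (r choose j) * \<bar>f (y j z)\<bar>) powr q"
        using absle q by (intro powr_mono2) auto
      also have "\<dots> \<le> (\<Sum>j\<le>r. real (r choose j)) powr (q - 1) * (\<Sum>j\<le>r. real (r choose j) * \<bar>f (y j z)\<bar> powr q)"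
        by (rule powr_sum_le) (use q in auto)
      also have "\<dots> = (\<Sum>j\<le>r. c j * \<bar>f (y j z)\<bar> powr q)"
        unfolding sum_choose_real c_def by (simp add: sum_distrib_left mult.assoc)
      finally have "ennreal (\<bar>phi_difference r h e \<Omega> f z\<bar> powr q) \<le> ennreal (\<Sum>j\<le>r. c j * \<bar>f (y j z)\<bar> powr q)"
        by (rule ennreal_leI)
      also have "\<dots> = (\<Sum>j\<le>r. ennreal (c j) * ennreal (\<bar>f (y j z)\<bar> powr q))"
        using c0 by (subst sum_ennreal[symmetric]) (auto simp: ennreal_mult)
      also have "\<dots> \<le> W z"
        unfolding W_def using True mem[OF True] Ff by (intro sum_mono mult_left_mono) auto
      finally show ?thesis .
    next
      case False
      then show ?thesis unfolding eq using q by simp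
    qed
    moreover have "(\<integral>\<^sup>+z. W z \<partial>lborel) \<le> ennreal ((2 ^ (r + 1) * N) powr q)"
    proof -
      have "(\<integral>\<^sup>+z. W z \<partial>lborel) = (\<Sum>j\<le>r. ennreal (c j) * (\<integral>\<^sup>+z\<in>active_set r h e \<Omega>. F (y j z) \<partial>lborel))"
        unfolding W_def by (subst nn_integral_sum) (auto simp: nn_integral_cmult)
      also have "\<dots> \<le> (\<Sum>j\<le>r. ennreal (c j) * (2 * ennreal (N powr q)))"
      proof (intro sum_mono mult_left_mono)
        fix j assume "j \<in> {..r}"
        then have "(\<integral>\<^sup>+z\<in>active_set r h e \<Omega>. F (y j z) \<partial>lborel) \<le> 2 * (\<integral>\<^sup>+z\<in>\<Omega>. F z \<partial>lborel)"
          unfolding y_def by (intro phi_shift_bounded \<Omega> e F) simp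
        also have "\<dots> \<le> 2 * ennreal (N powr q)" using Fi by (rule mult_left_mono) simp
        finally show "(\<integral>\<^sup>+z\<in>active_set r h e \<Omega>. F (y j z) \<partial>lborel) \<le> 2 * ennreal (N powr q)" .
      qed simp
      also have "\<dots> = ennreal (\<Sum>j\<le>r. c j * (2 * N powr q))"
        using c0 by (subst sum_ennreal[symmetric]) (auto simp: ennreal_mult)
      also have "(\<Sum>j\<le>r. c j * (2 * N powr q)) = (2 ^ r) powr (q - 1) * (\<Sum>j\<le>r. real (r choose j)) * (2 * N powr q)"
        unfolding c_def by (simp add: sum_distrib_left sum_distrib_right mult.assoc)
      also have "\<dots> = (2 ^ r) powr q * (2 * N powr q)"
      proof -
        have "(2 ^ r :: real) powr (q - 1) * 2 ^ r = (2 ^ r) powr q" by (simp add: powr_diff)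
        then show ?thesis unfolding sum_choose_real by simp
      qed
      also have "\<dots> \<le> (2 ^ r) powr q * (2 powr q * N powr q)"
        using powr_mono[of 1 q "2 :: real"] q by (intro mult_left_mono mult_right_mono) auto
      also have "\<dots> = (2 ^ (r + 1) * N) powr q"
      proof -
        have "(2 ^ r * (2 * N)) powr q = (2 ^ r) powr q * (2 powr q * N powr q)" by (simp only: powr_mult)
        then show ?thesis by (simp add: mult_ac)
      qed
      finally show ?thesis by (simp add: ennreal_leI)
    qed
    ultimately show ?thesis unfolding bounded_by_def if_not_P[OF False] q_def using Wm by blast
  qed
qed

text \<open>The abstract inequality is applied for each fixed h and direction; |h| \<le> 1 / n turns
  the Bernstein factor |h| k into k / n, uniformly in both.\<close>

lemma inverse_phi:
  fixes \<Omega> :: "('d::finite) point set"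
  assumes p: "1 \<le> p" and r: "r \<ge> 1" and \<Omega>: "compact \<Omega>"
  shows "\<exists>C>0. \<forall>n\<ge>1. \<forall>f\<in>Lp_space p \<Omega>. omega_phi p \<Omega> r f (1 / real n)
    \<le> ennreal (C / real n ^ r) * (\<Sum>j = 0..n. ennreal (real (j + 1) ^ (r - 1)) * best_approx p \<Omega> j f)"
proof -
  obtain C0 where C0: "C0 > 0" and bern: "\<forall>e k Q h. norm e = 1 \<longrightarrow> k \<ge> 1 \<longrightarrow> continuous_on UNIV Q \<longrightarrow>
      (\<forall>z. \<exists>q. degree q \<le> k \<and> (\<forall>t. poly q (complex_of_real t) = of_real (Q (z + t *\<^sub>R e)))) \<longrightarrow> \<bar>h\<bar> \<le> 1 / real k \<longrightarrow>
    (\<forall>z\<in>\<Omega>. \<forall>B. (\<forall>x\<in>\<Omega>. \<bar>Q x\<bar> \<le> B) \<longrightarrow> \<bar>phi_difference r h e \<Omega> Q z\<bar> \<le> C0 * (\<bar>h\<bar> * real k) ^ r * B) \<and>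
    (\<forall>p\<ge>1. (\<integral>\<^sup>+z. ennreal (\<bar>phi_difference r h e \<Omega> Q z\<bar> powr p) \<partial>lborel)
       \<le> ennreal ((C0 * (\<bar>h\<bar> * real k) ^ r) powr p) * (\<integral>\<^sup>+z\<in>\<Omega>. ennreal (\<bar>Q z\<bar> powr p) \<partial>lborel))"
    using phi_bernstein[OF \<Omega> r] by (elim exE conjE) (rule that)
  define C where "C = max C0 (2 ^ (r + 1))"
  have C: "C > 0" "C0 \<le> C" "2 ^ (r + 1) \<le> C" unfolding C_def using C0 by auto
  have dir: "omega_phi_dir p \<Omega> r f (1 / real n) e
     \<le> ennreal (C * (2 * 4 ^ r) / real n ^ r) * (\<Sum>j = 0..n. ennreal (real (j + 1) ^ (r - 1)) * best_approx p \<Omega> j f)"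
    if n: "n \<ge> 1" and f: "f \<in> Lp_space p \<Omega>" and e: "norm e = 1" for n f and e :: "'d point"
    unfolding omega_phi_dir_def
  proof (rule SUP_least)
    fix h assume "h \<in> {h. \<bar>h\<bar> \<le> min (1 / real n) 1}"
    then have h: "\<bar>h\<bar> \<le> 1 / real n" by simp
    show "Lp_norm p \<Omega> (\<lambda>z. central_diff_on r ((h * phi \<Omega> e z) *\<^sub>R e) f \<Omega> z)
       \<le> ennreal (C * (2 * 4 ^ r) / real n ^ r) * (\<Sum>j = 0..n. ennreal (real (j + 1) ^ (r - 1)) * best_approx p \<Omega> j f)"
    proof (rule inverse_from_bounds[where D = "phi_difference r h e \<Omega>", OF p r n C(1) \<Omega>])
      fix f g :: "'d point \<Rightarrow> real" and x
      show "phi_difference r h e \<Omega> (\<lambda>z. f z + g z) x = phi_difference r h e \<Omega> f x + phi_difference r h e \<Omega> g x"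
        unfolding phi_difference_def central_diff_on_def by (simp add: diff_on_add distrib_left)
    next
      fix c :: real and x
      show "phi_difference r h e \<Omega> (\<lambda>_. c) x = 0"
        unfolding phi_difference_def central_diff_on_def by (simp add: diff_on_const[OF r])
    next
      fix g :: "'d point \<Rightarrow> real" and N :: real
      assume "N > 0" "p \<noteq> \<infinity> \<Longrightarrow> g \<in> borel_measurable (lebesgue_on \<Omega>)" "Lp_norm p \<Omega> g \<le> ennreal N"
      then have "bounded_by p lborel (phi_difference r h e \<Omega> g) (2 ^ (r + 1) * N)"
        by (intro phi_difference_bounded_by p r \<Omega> e)
      then show "bounded_by p lborel (phi_difference r h e \<Omega> g) (C * N)"
        by (rule bounded_by_mono[OF p]) (use \<open>N > 0\<close> C in \<open>auto intro: mult_right_mono\<close>)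
    next
      fix Q :: "'d point \<Rightarrow> real" and k N
      assume N: "0 < N" and k: "1 \<le> k" "k \<le> n" and Q: "Q \<in> poly_space k" and le: "Lp_norm p \<Omega> Q \<le> ennreal N"
      have hk: "\<bar>h\<bar> \<le> 1 / real k"
      proof -
        have "1 / real n \<le> 1 / real k" using k by (intro divide_left_mono) auto
        then show ?thesis using h by simp
      qed
      have "\<bar>h\<bar> * real k \<le> 1 / real n * real k" using h by (rule mult_right_mono) simp
      then have X: "(\<bar>h\<bar> * real k) ^ r \<le> (real k / real n) ^ r" by (intro power_mono) auto
      have lines: "\<forall>z. \<exists>q. degree q \<le> k \<and> (\<forall>t. poly q (complex_of_real t) = of_real (Q (z + t *\<^sub>R e)))"
        using plane_poly_line[OF plane_poly_of_poly_space[OF Q]] by blast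
      note bQ = bern[rule_format, OF e k(1) poly_space_continuous[OF Q] lines[rule_format] hk]
      have Qm: "Q \<in> borel_measurable borel" using poly_space_continuous[OF Q] by (rule borel_measurable_continuous_onI)
      have "bounded_by p lborel (phi_difference r h e \<Omega> Q) (C0 * (\<bar>h\<bar> * real k) ^ r * N)"
      proof (cases "p = \<infinity>")
        case True
        have "\<forall>x\<in>\<Omega>. \<bar>Q x\<bar> \<le> N" using le unfolding Lp_norm_le_iff[OF p less_imp_le[OF N]] if_P[OF True] .
        then have "\<bar>phi_difference r h e \<Omega> Q z\<bar> \<le> C0 * (\<bar>h\<bar> * real k) ^ r * N" if "z \<in> \<Omega>" for z
          using conjunct1[OF bQ] that by blast
        moreover have "\<bar>phi_difference r h e \<Omega> Q z\<bar> \<le> C0 * (\<bar>h\<bar> * real k) ^ r * N" if "z \<notin> \<Omega>" for z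
          using that C0 N by (simp add: phi_difference_def)
        ultimately show ?thesis unfolding bounded_by_def if_P[OF True] by blast
      next
        case False
        define q where "q = enn2real p"
        have q: "q \<ge> 1" unfolding q_def by (rule enn2real_ge_one[OF p False])
        have "(\<integral>\<^sup>+z\<in>\<Omega>. ennreal (\<bar>Q z\<bar> powr q) \<partial>lborel) \<le> ennreal (N powr q)"
          using le unfolding Lp_norm_le_iff[OF p less_imp_le[OF N]] if_not_P[OF False] q_def nn_integral_completion .
        then have "(\<integral>\<^sup>+z. ennreal (\<bar>phi_difference r h e \<Omega> Q z\<bar> powr q) \<partial>lborel)
            \<le> ennreal ((C0 * (\<bar>h\<bar> * real k) ^ r) powr q) * ennreal (N powr q)"
          using conjunct2[OF bQ, rule_format, OF q] by (meson mult_left_mono order_trans zero_le)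
        also have "\<dots> = ennreal ((C0 * (\<bar>h\<bar> * real k) ^ r * N) powr q)"
          by (simp add: ennreal_mult[symmetric] powr_mult)
        finally have I: "(\<integral>\<^sup>+z. ennreal (\<bar>phi_difference r h e \<Omega> Q z\<bar> powr q) \<partial>lborel) \<le> ennreal ((C0 * (\<bar>h\<bar> * real k) ^ r * N) powr q)" .
        have Dm: "phi_difference r h e \<Omega> Q \<in> borel_measurable borel" by (rule phi_difference_measurable[OF \<Omega> e r Qm])
        have "(\<lambda>z. ennreal (\<bar>phi_difference r h e \<Omega> Q z\<bar> powr q)) \<in> borel_measurable lborel" using Dm by measurable
        then show ?thesis unfolding bounded_by_def if_not_P[OF False] q_def[symmetric]
          by (intro bexI[of _ "\<lambda>z. ennreal (\<bar>phi_difference r h e \<Omega> Q z\<bar> powr q)"] conjI ballI order_refl I)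
      qed
      then show "bounded_by p lborel (phi_difference r h e \<Omega> Q) (C * (real k / real n) ^ r * N)"
      proof (rule bounded_by_mono[OF p])
        show "0 \<le> C0 * (\<bar>h\<bar> * real k) ^ r * N" using C0 N by simp
        show "C0 * (\<bar>h\<bar> * real k) ^ r * N \<le> C * (real k / real n) ^ r * N"
          using X C C0 N by (intro mult_right_mono mult_mono) auto
      qed simp
    next
      fix N :: real assume N: "N > 0" and b: "bounded_by p lborel (phi_difference r h e \<Omega> f) N"
      show "Lp_norm p \<Omega> (\<lambda>z. central_diff_on r ((h * phi \<Omega> e z) *\<^sub>R e) f \<Omega> z) \<le> ennreal N"
        by (rule bounded_by_imp_Lp_norm_le[OF p less_imp_le[OF N]]) (use b in \<open>simp add: phi_difference_def[abs_def]\<close>)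
    qed (rule f)
  qed
  show ?thesis
  proof (intro exI[of _ "C * (2 * 4 ^ r)"] conjI allI impI ballI)
    show "C * (2 * 4 ^ r) > 0" using C by simp
    fix n :: nat and f assume n: "1 \<le> n" and f: "f \<in> Lp_space p \<Omega>"
    show "omega_phi p \<Omega> r f (1 / real n) \<le> ennreal (C * (2 * 4 ^ r) / real n ^ r) * (\<Sum>j = 0..n. ennreal (real (j + 1) ^ (r - 1)) * best_approx p \<Omega> j f)"
      unfolding omega_phi_def
    proof (rule Max.boundedI)
      fix a assume "a \<in> omega_phi_dir p \<Omega> r f (1 / real n) ` Basis"
      then show "a \<le> ennreal (C * (2 * 4 ^ r) / real n ^ r) * (\<Sum>j = 0..n. ennreal (real (j + 1) ^ (r - 1)) * best_approx p \<Omega> j f)"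
        using dir[OF n f] by auto
    qed auto
  qed
qed

section \<open>The tangential modulus\<close>

definition tangential_difference :: "real \<Rightarrow> ('d::finite) point set \<Rightarrow> 'd updom \<Rightarrow> nat \<Rightarrow> real \<Rightarrow> real \<Rightarrow> 'd \<Rightarrow>
    ('d point \<Rightarrow> real) \<Rightarrow> 'd point \<times> (real^'d) \<Rightarrow> real" where
  "tangential_difference A0 \<Omega> H r t s j f x =
     (if fst x \<in> up_inner A0 H t \<and> snd x \<in> up_window H t (fst (fst x))
      then diff_on r (s *\<^sub>R tangent H j (snd x)) f \<Omega> (fst x) else 0)"

text \<open>The integrands of \<open>tang_norm\<close> need not be known to be measurable:
  monotonicity compares them with the majorant W, and Tonelli's theorem is used for W only.\<close>

lemma tang_norm_le:
  fixes \<Omega> :: "('d::finite) point set"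
  assumes p: "1 \<le> p" and N: "N > 0" and R: "t * base H > 0"
    and b: "bounded_by p lborel (\<lambda>x. window_scale p CARD('d) (t * base H) * tangential_difference A0 \<Omega> H r t s j f x) N"
  shows "tang_norm A0 p \<Omega> H r f t s j \<le> ennreal N"
proof (cases "p = \<infinity>")
  case True
  have le: "\<bar>tangential_difference A0 \<Omega> H r t s j f (z, u)\<bar> \<le> N" for z u
    using b[unfolded bounded_by_def if_P[OF True], THEN bspec, of "(z, u)"] unfolding window_scale_def if_P[OF True] by simp
  have "\<bar>diff_on r (s *\<^sub>R tangent H j u) f \<Omega> z\<bar> \<le> N" if "z \<in> up_inner A0 H t" "u \<in> up_window H t (fst z)" for z u
    using le[of z u] that unfolding tangential_difference_def by simp
  then show ?thesis unfolding tang_norm_def if_P[OF True] by (intro SUP_least ennreal_leI) blast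
next
  case False
  define q where "q = enn2real p"
  have q: "q \<ge> 1" unfolding q_def by (rule enn2real_ge_one[OF p False])
  define RC where "RC = (t * base H) ^ CARD('d)"
  have RC: "RC > 0" unfolding RC_def using R by (rule zero_less_power)
  define ws where "ws = window_scale p CARD('d) (t * base H)"
  have ws: "ws \<ge> 0" "ws powr q = 1 / RC"
  proof -
    have e: "ws = RC powr (- 1 / q)" unfolding ws_def window_scale_def if_not_P[OF False] RC_def q_def ..
    show "ws \<ge> 0" unfolding e by simp
    have "ws powr q = RC powr (- 1)" unfolding e using q by (simp add: powr_powr)
    also have "\<dots> = 1 / RC" using RC by (simp add: powr_minus_divide)
    finally show "ws powr q = 1 / RC" .
  qed
  obtain W where W: "W \<in> borel_measurable lborel"
    "\<And>x. ennreal (\<bar>ws * tangential_difference A0 \<Omega> H r t s j f x\<bar> powr q) \<le> W x"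
    "(\<integral>\<^sup>+x. W x \<partial>lborel) \<le> ennreal (N powr q)"
    using b unfolding bounded_by_def if_not_P[OF False] ws_def q_def by auto
  have Wm[measurable]: "W \<in> borel_measurable (lborel \<Otimes>\<^sub>M lborel)" using W(1) unfolding lborel_prod .
  define X where "X = (\<integral>\<^sup>+z\<in>up_inner A0 H t. ennreal (1 / RC) *
             (\<integral>\<^sup>+u\<in>up_window H t (fst z). ennreal (\<bar>diff_on r (s *\<^sub>R tangent H j u) f \<Omega> z\<bar> powr q) \<partial>lebesgue) \<partial>lebesgue)"
  have "X \<le> (\<integral>\<^sup>+z. (\<integral>\<^sup>+u. W (z, u) \<partial>lborel) \<partial>lborel)"
    unfolding X_def nn_integral_completion
  proof (rule nn_integral_mono)
    fix z :: "'d point"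
    show "ennreal (1 / RC) * (\<integral>\<^sup>+u\<in>up_window H t (fst z). ennreal (\<bar>diff_on r (s *\<^sub>R tangent H j u) f \<Omega> z\<bar> powr q) \<partial>lborel) * indicator (up_inner A0 H t) z
      \<le> (\<integral>\<^sup>+u. W (z, u) \<partial>lborel)"
    proof (cases "z \<in> up_inner A0 H t")
      case True
      have "(\<integral>\<^sup>+u\<in>up_window H t (fst z). ennreal (\<bar>diff_on r (s *\<^sub>R tangent H j u) f \<Omega> z\<bar> powr q) \<partial>lborel)
         \<le> (\<integral>\<^sup>+u. ennreal RC * W (z, u) \<partial>lborel)"
      proof (rule nn_integral_mono)
        fix u :: "real^'d"
        show "ennreal (\<bar>diff_on r (s *\<^sub>R tangent H j u) f \<Omega> z\<bar> powr q) * indicator (up_window H t (fst z)) u \<le> ennreal RC * W (z, u)"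
        proof (cases "u \<in> up_window H t (fst z)")
          case u: True
          have "\<bar>ws * tangential_difference A0 \<Omega> H r t s j f (z, u)\<bar> powr q = 1 / RC * \<bar>diff_on r (s *\<^sub>R tangent H j u) f \<Omega> z\<bar> powr q"
            unfolding tangential_difference_def using True u ws by (simp add: abs_mult powr_mult)
          then have "ennreal (1 / RC * \<bar>diff_on r (s *\<^sub>R tangent H j u) f \<Omega> z\<bar> powr q) \<le> W (z, u)" using W(2)[of "(z, u)"] by simp
          then have "ennreal RC * ennreal (1 / RC * \<bar>diff_on r (s *\<^sub>R tangent H j u) f \<Omega> z\<bar> powr q) \<le> ennreal RC * W (z, u)"
            by (rule mult_left_mono) simp
          moreover have "ennreal RC * ennreal (1 / RC * \<bar>diff_on r (s *\<^sub>R tangent H j u) f \<Omega> z\<bar> powr q)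
              = ennreal (\<bar>diff_on r (s *\<^sub>R tangent H j u) f \<Omega> z\<bar> powr q)"
            using RC by (simp add: ennreal_mult[symmetric])
          ultimately show ?thesis using u by simp
        qed simp
      qed
      also have "\<dots> = ennreal RC * (\<integral>\<^sup>+u. W (z, u) \<partial>lborel)"
        by (rule nn_integral_cmult) measurable
      finally have "ennreal (1 / RC) * (\<integral>\<^sup>+u\<in>up_window H t (fst z). ennreal (\<bar>diff_on r (s *\<^sub>R tangent H j u) f \<Omega> z\<bar> powr q) \<partial>lborel)
        \<le> ennreal (1 / RC) * (ennreal RC * (\<integral>\<^sup>+u. W (z, u) \<partial>lborel))"
        by (rule mult_left_mono) simp
      also have "\<dots> = (\<integral>\<^sup>+u. W (z, u) \<partial>lborel)"
        using RC by (simp add: mult.assoc[symmetric] ennreal_mult[symmetric])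
      finally show ?thesis using True by simp
    qed simp
  qed
  also have "\<dots> = (\<integral>\<^sup>+x. W x \<partial>(lborel \<Otimes>\<^sub>M lborel))"
    by (rule lborel.nn_integral_fst) simp
  also have "\<dots> \<le> ennreal (N powr q)" unfolding lborel_prod by (rule W(3))
  finally have "X \<le> ennreal (N powr q)" .
  then have "ennreal_powr X (1 / q) \<le> ennreal N" unfolding ennreal_powr_le_iff[OF q less_imp_le[OF N]] .
  then show ?thesis unfolding tang_norm_def if_not_P[OF False] X_def RC_def q_def .
qed

text \<open>The map \<open>T \<circ> place G\<close> takes the model set of the shape of G onto that
  of H, which brings the paraboloid into play; attachment gives \<open>sd_star G\<close> \<subseteq>
  \<Omega>, so all node points lie in the image of \<Omega>, where the norm of Q is
  controlled.\<close>

lemma inverse_special: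
  fixes \<Omega> :: "('d::finite) point set"
  assumes p: "1 \<le> p" and r: "r \<ge> 1" and \<Omega>: "compact \<Omega>" and A0: "A0 > 1"
    and K: "updom_ok (shape G)" and att: "attached \<Omega> G" and nor: "normalizes T G H"
  shows "\<exists>C>0. \<forall>n\<ge>1. \<forall>f\<in>Lp_space p \<Omega>. omega_special A0 p \<Omega> T H r f (1 / real n)
    \<le> ennreal (C / real n ^ r) * (\<Sum>j = 0..n. ennreal (real (j + 1) ^ (r - 1)) * best_approx p \<Omega> j f)"
proof -
  have T: "T \<in> coord_maps" and H: "updom_ok H" and TG: "T ` sd_set G = up_set H" using nor unfolding normalizes_def by auto
  have Hb: "base H > 0" and H2: "C2_fun (graph H)" using H unfolding updom_ok_def by auto
  define S where "S = T \<circ> place G"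
  have "S \<in> coord_maps" unfolding S_def by (rule coord_maps.comp[OF T place_coord_map])
  then obtain a U where U: "signed_coordinates U" "S = (\<lambda>z. a + U z)" using coord_map_affine by blast
  have im: "S ` up_set (shape G) = up_set H" unfolding S_def image_comp[symmetric] sd_set_def[symmetric] by (rule TG)
  obtain c M where c: "c > 0" and M: "M > 0" and par: "\<forall>A0>1. \<forall>t z u j s v. 0 < t \<longrightarrow> z \<in> up_inner A0 H t \<longrightarrow> u \<in> up_window H t (fst z) \<longrightarrow>
    \<bar>s\<bar> \<le> c \<longrightarrow> \<bar>v\<bar> \<le> c \<longrightarrow> z + s *\<^sub>R tangent H j u - (M * (s\<^sup>2 + v\<^sup>2)) *\<^sub>R (0, 1) \<in> S ` up_star (shape G)"
    using parabola_inside[OF K H U im] by (elim exE conjE) (rule that)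
  have star: "S ` up_star (shape G) \<subseteq> T ` \<Omega>"
  proof -
    have "sd_star G \<subseteq> \<Omega>" using att unfolding attached_def by blast
    then show ?thesis unfolding S_def sd_star_def image_comp[symmetric] by (rule image_mono)
  qed
  obtain C0 where C0: "C0 > 0" and pw: "\<forall>k\<ge>1. \<forall>Q z \<xi> e s. plane_poly k Q \<longrightarrow> 0 < s \<longrightarrow> s \<le> 1 / real k \<longrightarrow>
    \<bar>fdiff r (s *\<^sub>R \<xi>) Q (z :: 'd point)\<bar> \<le> C0 * (s * real k) ^ r *
      (\<Sum>i\<le>6 * (2 * k). \<Sum>l\<le>6 * (2 * k).
         \<bar>Q (z + (c * node (2 * k) i) *\<^sub>R \<xi> - (M * ((c * node (2 * k) i)\<^sup>2 + (c * node (2 * k) l)\<^sup>2)) *\<^sub>R e)\<bar>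
           / ((1 + offcentre (2 * k) i) ^ 3 * (1 + offcentre (2 * k) l) ^ 3))"
    using tangential_pointwise[OF r c, of M] by (elim exE conjE) (rule that)
  define \<omega> where "\<omega> = max 1 (unit_ball_vol (real CARD('d)))"
  have \<omega>: "\<omega> \<ge> 1" unfolding \<omega>_def by simp
  \<comment> \<open>The first entry comes from boundedness, with binomial sum 2^r; the second from
    the Bernstein estimate, with two sums of node weights of at most 4 each.\<close>
  define C where "C = max (2 ^ r * \<omega>) (16 * C0 * \<omega>)"
  have C: "C > 0" "2 ^ r * \<omega> \<le> C" "16 * C0 * \<omega> \<le> C"
  proof -
    show "2 ^ r * \<omega> \<le> C" "16 * C0 * \<omega> \<le> C" unfolding C_def by auto
    have "0 < 2 ^ r * \<omega>" using \<omega> by simp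
    then show "C > 0" using \<open>2 ^ r * \<omega> \<le> C\<close> by linarith
  qed
  have tm: "tangent H j \<in> borel_measurable borel" for j
  proof -
    have "continuous_on UNIV (partial_deriv j (graph H))" using H2 unfolding C2_fun_def C1_fun_def by blast
    then have "continuous_on UNIV (tangent H j)" unfolding tangent_def[abs_def] by (intro continuous_intros)
    then show ?thesis by (rule borel_measurable_continuous_onI)
  qed
  have main: "tang_norm A0 p (T ` \<Omega>) H r (f \<circ> inv T) (1 / real n) s j
      \<le> ennreal (C * (2 * 4 ^ r) / real n ^ r) * (\<Sum>j = 0..n. ennreal (real (j + 1) ^ (r - 1)) * best_approx p \<Omega> j f)"
    if n: "n \<ge> 1" and f: "f \<in> Lp_space p \<Omega>" and s: "0 < s" "s \<le> 1 / real n" for n f s j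
  proof -
    define t where "t = 1 / real n"
    have t: "t > 0" unfolding t_def using n by simp
    define R where "R = t * base H"
    have R: "R > 0" unfolding R_def using t Hb by simp
    define D where "D f x = window_scale p CARD('d) R * tangential_difference A0 (T ` \<Omega>) H r t s j (f \<circ> inv T) x" for f :: "'d point \<Rightarrow> real" and x
    have win: "norm (u - fst z) \<le> R" if "u \<in> up_window H t (fst z)" for u and z :: "'d point"
      using that unfolding up_window_def R_def by simp
    show ?thesis
    proof (rule inverse_from_bounds[where D = D and M = lborel, OF p r n C(1) \<Omega>])
      fix f g :: "'d point \<Rightarrow> real" and x
      have "diff_on r \<xi> ((\<lambda>z. f z + g z) \<circ> inv T) (T ` \<Omega>) \<eta> = diff_on r \<xi> (f \<circ> inv T) (T ` \<Omega>) \<eta> + diff_on r \<xi> (g \<circ> inv T) (T ` \<Omega>) \<eta>" for \<xi> \<eta>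
        using diff_on_add[of r \<xi> "f \<circ> inv T" "g \<circ> inv T"] by (simp add: comp_def)
      then show "D (\<lambda>z. f z + g z) x = D f x + D g x"
        unfolding D_def tangential_difference_def by (simp add: distrib_left del: o_apply)
    next
      fix c :: real and x
      have eq: "(\<lambda>_. c) \<circ> inv T = (\<lambda>_. c)" by auto
      show "D (\<lambda>_. c) x = 0"
        unfolding D_def tangential_difference_def eq diff_on_const[OF r] by simp
    next
      fix g :: "'d point \<Rightarrow> real" and N :: real
      assume N: "N > 0" and g: "p \<noteq> \<infinity> \<Longrightarrow> g \<in> borel_measurable (lebesgue_on \<Omega>)" and le: "Lp_norm p \<Omega> g \<le> ennreal N"
      define act where "act z u \<longleftrightarrow> z \<in> up_inner A0 H t \<and> u \<in> up_window H t (fst z) \<and>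
        closed_segment z (z + real r *\<^sub>R s *\<^sub>R tangent H j u) \<subseteq> T ` \<Omega>" for z u
      have "bounded_by p lborel (D g) ((\<Sum>i\<le>r. real (r choose i)) * max 1 (unit_ball_vol (real CARD('d))) * N)"
        unfolding D_def
      proof (rule tangential_bounded_by[OF p T \<Omega> R N g le, where \<tau> = "\<lambda>i u. (real i * s) *\<^sub>R tangent H j u"
            and act = act and \<sigma> = "\<lambda>i. (real i * s) *\<^sub>R axis j 1"])
        fix z u assume "\<not> act z u"
        then show "tangential_difference A0 (T ` \<Omega>) H r t s j (g \<circ> inv T) (z, u) = 0"
          unfolding act_def tangential_difference_def diff_on_def by auto
      next
        fix z u assume act: "act z u"
        then have "tangential_difference A0 (T ` \<Omega>) H r t s j (g \<circ> inv T) (z, u) = fdiff r (s *\<^sub>R tangent H j u) (g \<circ> inv T) z"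
          unfolding act_def tangential_difference_def diff_on_def by simp
        then show "\<bar>tangential_difference A0 (T ` \<Omega>) H r t s j (g \<circ> inv T) (z, u)\<bar>
            \<le> (\<Sum>i\<le>r. real (r choose i) * \<bar>g (inv T (z + (real i * s) *\<^sub>R tangent H j u))\<bar>)"
          using abs_fdiff_le[of r "s *\<^sub>R tangent H j u" "g \<circ> inv T" z] by simp
      next
        fix z u i assume act: "act z u" and i: "i \<in> {..r}"
        have "z + (real i * s) *\<^sub>R tangent H j u \<in> closed_segment z (z + real r *\<^sub>R s *\<^sub>R tangent H j u)"
        proof -
          have "closed_segment (z + 0 *\<^sub>R tangent H j u) (z + (real r * s) *\<^sub>R tangent H j u) = (\<lambda>x. z + x *\<^sub>R tangent H j u) ` {0..real r * s}"
            by (rule closed_segment_line) (use s in simp)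
          moreover have "real i * s \<in> {0..real r * s}" using i s by (auto intro: mult_right_mono)
          ultimately show ?thesis by auto
        qed
        then show "z + (real i * s) *\<^sub>R tangent H j u \<in> T ` \<Omega>" using act unfolding act_def by blast
      next
        fix z u assume "act z u"
        then show "norm (u - fst z) \<le> R" unfolding act_def using win by blast
      next
        show "(\<lambda>u. (real i * s) *\<^sub>R tangent H j u) \<in> borel_measurable borel" for i using tm by measurable
      qed (auto simp: tangent_def)
      then show "bounded_by p lborel (D g) (C * N)"
        by (rule bounded_by_mono[OF p]) (use N C \<omega> in \<open>auto simp: sum_choose_real \<omega>_def intro: mult_right_mono\<close>)
    next
      fix Q :: "'d point \<Rightarrow> real" and k N
      assume N: "0 < N" and k: "1 \<le> k" "k \<le> n" and Q: "Q \<in> poly_space k" and le: "Lp_norm p \<Omega> Q \<le> ennreal N"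
      have sk: "s \<le> 1 / real k"
      proof -
        have "1 / real n \<le> 1 / real k" using k by (intro divide_left_mono) auto
        then show ?thesis using s by simp
      qed
      have "s * real k \<le> 1 / real n * real k" using s by (intro mult_right_mono) auto
      then have X: "(s * real k) ^ r \<le> (real k / real n) ^ r" using s by (intro power_mono) auto
      define X where "X = (s * real k) ^ r"
      have X0: "X \<ge> 0" unfolding X_def using s by simp
      define v where "v i = c * node (2 * k) i" for i
      have vc: "\<bar>v i\<bar> \<le> c" for i unfolding v_def abs_mult using abs_node_le_one[of "2 * k" i] c by (simp add: mult_left_le)
      define \<kappa> where "\<kappa> i = 1 / (1 + offcentre (2 * k) i) ^ 3" for i
      have o0: "offcentre (2 * k) i \<ge> 0" for i unfolding offcentre_def by simp
      have \<kappa>0: "\<kappa> i \<ge> 0" for i unfolding \<kappa>_def using o0[of i] by simp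
      have sum\<kappa>: "(\<Sum>i\<le>6 * (2 * k). \<kappa> i) \<le> 4"
      proof (rule order_trans[OF _ sum_offcentre_le])
        show "(\<Sum>i\<le>6 * (2 * k). \<kappa> i) \<le> (\<Sum>i\<le>6 * (2 * k). 1 / (1 + offcentre (2 * k) i) ^ 2)"
          unfolding \<kappa>_def using o0 by (intro sum_mono divide_left_mono power_increasing mult_pos_pos zero_less_power add_pos_nonneg) auto
      qed
      define J where "J = {..6 * (2 * k)} \<times> {..6 * (2 * k)}"
      define w where "w il = C0 * X * (\<kappa> (fst il) * \<kappa> (snd il))" for il
      have w0: "w il \<ge> 0" for il unfolding w_def using C0 X0 \<kappa>0 by simp
      define \<tau> where "\<tau> il u = v (fst il) *\<^sub>R tangent H j u - (M * ((v (fst il))\<^sup>2 + (v (snd il))\<^sup>2)) *\<^sub>R (0, 1)" for il u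
      \<comment> \<open>For polynomials the segment condition is dropped: the node points lie in the
        image of \<Omega> even when the segment does not, and cutting off only decreases the modulus
        of the difference.\<close>
      define act where "act z u \<longleftrightarrow> z \<in> up_inner A0 H t \<and> u \<in> up_window H t (fst z)" for z u
      have pQ: "plane_poly k (Q \<circ> inv T)" by (rule plane_poly_coord_map[OF T plane_poly_of_poly_space[OF Q]])
      have Qm: "Q \<in> borel_measurable (lebesgue_on \<Omega>)"
      proof -
        have "Q \<in> borel_measurable borel" using poly_space_continuous[OF Q] by (rule borel_measurable_continuous_onI)
        then have "Q \<in> borel_measurable lebesgue" by (simp add: measurable_completion)
        then show ?thesis by (rule measurable_restrict_space1)
      qed
      have "bounded_by p lborel (D Q) ((\<Sum>il\<in>J. w il) * max 1 (unit_ball_vol (real CARD('d))) * N)"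
        unfolding D_def
      proof (rule tangential_bounded_by[OF p T \<Omega> R N Qm le, where \<tau> = \<tau> and act = act and \<sigma> = "\<lambda>il. v (fst il) *\<^sub>R axis j 1"])
        show "finite J" unfolding J_def by simp
        show "0 \<le> w il" for il by (rule w0)
        show "\<tau> il \<in> borel_measurable borel" for il unfolding \<tau>_def[abs_def] using tm by measurable
        show "fst (\<tau> il u) = v (fst il) *\<^sub>R axis j 1" for il u unfolding \<tau>_def tangent_def by simp
      next
        fix z u assume "\<not> act z u"
        then show "tangential_difference A0 (T ` \<Omega>) H r t s j (Q \<circ> inv T) (z, u) = 0"
          unfolding act_def tangential_difference_def by auto
      next
        fix z u assume act: "act z u"
        have "\<bar>tangential_difference A0 (T ` \<Omega>) H r t s j (Q \<circ> inv T) (z, u)\<bar> \<le> \<bar>fdiff r (s *\<^sub>R tangent H j u) (Q \<circ> inv T) z\<bar>"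
          unfolding tangential_difference_def diff_on_def by simp
        also have "\<dots> \<le> C0 * X * (\<Sum>i\<le>6 * (2 * k). \<Sum>l\<le>6 * (2 * k). \<kappa> i * \<kappa> l * \<bar>Q (inv T (z + \<tau> (i, l) u))\<bar>)"
          using pw[rule_format, OF k(1) pQ s(1) sk, of "tangent H j u" z "(0, 1)"]
          unfolding X_def \<tau>_def v_def \<kappa>_def by (simp add: add_diff_eq)
        also have "\<dots> = (\<Sum>il\<in>J. w il * \<bar>Q (inv T (z + \<tau> il u))\<bar>)"
          unfolding J_def w_def sum.cartesian_product by (simp add: sum_distrib_left case_prod_beta mult.assoc)
        finally show "\<bar>tangential_difference A0 (T ` \<Omega>) H r t s j (Q \<circ> inv T) (z, u)\<bar> \<le> (\<Sum>il\<in>J. w il * \<bar>Q (inv T (z + \<tau> il u))\<bar>)" .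
      next
        fix z u il assume act: "act z u"
        have "z + v (fst il) *\<^sub>R tangent H j u - (M * ((v (fst il))\<^sup>2 + (v (snd il))\<^sup>2)) *\<^sub>R (0, 1) \<in> S ` up_star (shape G)"
          using par[rule_format, OF A0 t _ _ vc vc] act unfolding act_def by blast
        then show "z + \<tau> il u \<in> T ` \<Omega>" using star unfolding \<tau>_def by (auto simp: add_diff_eq)
      next
        fix z u assume "act z u"
        then show "norm (u - fst z) \<le> R" unfolding act_def using win by blast
      qed
      then show "bounded_by p lborel (D Q) (C * (real k / real n) ^ r * N)"
      proof (rule bounded_by_mono[OF p])
        have "(\<Sum>il\<in>J. w il) = C0 * X * ((\<Sum>i\<le>6 * (2 * k). \<kappa> i) * (\<Sum>l\<le>6 * (2 * k). \<kappa> l))"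
          unfolding J_def w_def sum_product sum.cartesian_product by (simp add: sum_distrib_left case_prod_beta)
        also have "\<dots> \<le> C0 * X * (4 * 4)"
          using sum\<kappa> \<kappa>0 C0 X0 by (intro mult_left_mono mult_mono sum_nonneg) auto
        finally have "(\<Sum>il\<in>J. w il) * \<omega> * N \<le> C0 * X * (4 * 4) * \<omega> * N" using \<omega> N by (intro mult_right_mono) auto
        also have "\<dots> = 16 * C0 * \<omega> * X * N" by simp
        also have "\<dots> \<le> C * (real k / real n) ^ r * N"
          using C X X0 N unfolding X_def by (intro mult_right_mono mult_mono) auto
        finally show "(\<Sum>il\<in>J. w il) * max 1 (unit_ball_vol (real CARD('d))) * N \<le> C * (real k / real n) ^ r * N" unfolding \<omega>_def .
        show "0 \<le> (\<Sum>il\<in>J. w il) * max 1 (unit_ball_vol (real CARD('d))) * N"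
          using w0 N by (intro mult_nonneg_nonneg sum_nonneg) auto
      qed simp
    next
      fix N :: real assume N: "N > 0" and b: "bounded_by p lborel (D f) N"
      show "tang_norm A0 p (T ` \<Omega>) H r (f \<circ> inv T) (1 / real n) s j \<le> ennreal N"
        unfolding t_def[symmetric] by (rule tang_norm_le[OF p N R[unfolded R_def] b[unfolded D_def R_def]])
    qed (rule f)
  qed
  show ?thesis
  proof (intro exI[of _ "C * (2 * 4 ^ r)"] conjI allI impI ballI)
    show "C * (2 * 4 ^ r) > 0" using C by simp
    fix n :: nat and f assume n: "1 \<le> n" and f: "f \<in> Lp_space p \<Omega>"
    have n1: "min (1 / real n) 1 = 1 / real n" using n by (simp add: min_def)
    show "omega_special A0 p \<Omega> T H r f (1 / real n) \<le> ennreal (C * (2 * 4 ^ r) / real n ^ r) * (\<Sum>j = 0..n. ennreal (real (j + 1) ^ (r - 1)) * best_approx p \<Omega> j f)"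
      unfolding omega_special_def omega_up_def n1
    proof (rule SUP_least)
      fix sj :: "real \<times> 'd" assume "sj \<in> {0<..1 / real n} \<times> UNIV"
      then have "0 < fst sj" "fst sj \<le> 1 / real n" by auto
      from main[OF n f this, of "snd sj"]
      show "(case sj of (s, j) \<Rightarrow> tang_norm A0 p (T ` \<Omega>) H r (f \<circ> inv T) (1 / real n) s j)
          \<le> ennreal (C * (2 * 4 ^ r) / real n ^ r) * (\<Sum>j = 0..n. ennreal (real (j + 1) ^ (r - 1)) * best_approx p \<Omega> j f)"
        by (simp only: case_prod_beta)
    qed
  qed
qed

theorem theorem1p10:
  fixes \<Omega>0 \<Omega> :: "('d::finite) point set"
    and G :: "nat \<Rightarrow> 'd special_domain"
    and T :: "nat \<Rightarrow> 'd point \<Rightarrow> 'd point"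
    and H :: "nat \<Rightarrow> 'd updom"
    and m0 r :: nat and p :: ennreal and A0 :: real
  assumes "C2_domain \<Omega>0" and "\<Omega> = closure \<Omega>0"
    and "\<And>i. i < m0 \<Longrightarrow> updom_ok (shape (G i))"
    and "\<And>i. i < m0 \<Longrightarrow> attached \<Omega> (G i)"
    and "frontier \<Omega> \<subseteq> (\<Union>i<m0. sd_set (G i))"
    and "\<And>i. i < m0 \<Longrightarrow> normalizes (T i) (G i) (H i)"
    and "A0 > 1" and "r \<ge> 1" and "1 \<le> p"
  shows "\<exists>C::real. C > 0 \<and>
    (\<forall>n::nat. n \<ge> 1 \<longrightarrow> (\<forall>f \<in> Lp_space p \<Omega>.
       omega A0 p \<Omega> m0 T H r f (1 / real n)
         \<le> ennreal (C / real n ^ r) *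
             (\<Sum>j = 0..n. ennreal (real (j + 1) ^ (r - 1)) * best_approx p \<Omega> j f)))"
proof -
  have \<Omega>: "compact \<Omega>"
    using assms(1,2) unfolding C2_domain_def by (auto simp: compact_closure)
  define \<Sigma> where "\<Sigma> n f = (\<Sum>j = 0..n. ennreal (real (j + 1) ^ (r - 1)) * best_approx p \<Omega> j f)" for n f
  obtain C0 where C0: "C0 > 0" and phi: "\<And>n f. n \<ge> 1 \<Longrightarrow> f \<in> Lp_space p \<Omega> \<Longrightarrow> omega_phi p \<Omega> r f (1 / real n) \<le> ennreal (C0 / real n ^ r) * \<Sigma> n f"
    using inverse_phi[OF assms(9,8) \<Omega>] unfolding \<Sigma>_def by blast
  \<comment> \<open>Keeping i < m0 inside the existential allows a constant to be chosen for every
    index at once.\<close>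
  have "\<exists>C. i < m0 \<longrightarrow> C > 0 \<and> (\<forall>n\<ge>1. \<forall>f\<in>Lp_space p \<Omega>. omega_special A0 p \<Omega> (T i) (H i) r f (1 / real n) \<le> ennreal (C / real n ^ r) * \<Sigma> n f)" for i
    using inverse_special[OF assms(9,8) \<Omega> assms(7) assms(3,4,6)] unfolding \<Sigma>_def by blast
  then obtain C where C: "\<And>i. i < m0 \<Longrightarrow> C i > 0"
    "\<And>i n f. i < m0 \<Longrightarrow> n \<ge> 1 \<Longrightarrow> f \<in> Lp_space p \<Omega> \<Longrightarrow> omega_special A0 p \<Omega> (T i) (H i) r f (1 / real n) \<le> ennreal (C i / real n ^ r) * \<Sigma> n f"
    by metis
  have Cs: "(\<Sum>i<m0. C i) \<ge> 0" using C(1) by (intro sum_nonneg) (simp add: less_imp_le)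
  show ?thesis
  proof (intro exI[of _ "C0 + (\<Sum>i<m0. C i)"] conjI allI impI ballI)
    show "C0 + (\<Sum>i<m0. C i) > 0" using C0 Cs by simp
    fix n :: nat and f assume n: "1 \<le> n" and f: "f \<in> Lp_space p \<Omega>"
    have "omega A0 p \<Omega> m0 T H r f (1 / real n) \<le> ennreal (C0 / real n ^ r) * \<Sigma> n f + (\<Sum>i<m0. ennreal (C i / real n ^ r) * \<Sigma> n f)"
      unfolding omega_def using phi[OF n f] C(2)[OF _ n f] by (intro add_mono sum_mono) auto
    also have "\<dots> = (ennreal (C0 / real n ^ r) + ennreal (\<Sum>i<m0. C i / real n ^ r)) * \<Sigma> n f"
    proof -
      have "(\<Sum>i<m0. ennreal (C i / real n ^ r)) = ennreal (\<Sum>i<m0. C i / real n ^ r)"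
        using C(1) by (intro sum_ennreal) (simp add: less_imp_le)
      then show ?thesis by (simp add: distrib_right sum_distrib_right[symmetric])
    qed
    also have "ennreal (C0 / real n ^ r) + ennreal (\<Sum>i<m0. C i / real n ^ r) = ennreal ((C0 + (\<Sum>i<m0. C i)) / real n ^ r)"
      using C0 Cs by (subst ennreal_plus[symmetric]) (auto simp: add_divide_distrib sum_divide_distrib[symmetric])
    finally show "omega A0 p \<Omega> m0 T H r f (1 / real n)
         \<le> ennreal ((C0 + (\<Sum>i<m0. C i)) / real n ^ r) *
             (\<Sum>j = 0..n. ennreal (real (j + 1) ^ (r - 1)) * best_approx p \<Omega> j f)"
      unfolding \<Sigma>_def .
  qed
qed

end
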